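(* (i) For every infinitely renormalizable analytic unimodal map $g\in\mathbf U^\omega\cap\mathcal S_{\mathbf P}^\infty$ with critical exponent $\alpha$ and for every real number $r>0$, there exists $K_1=K_1(g,r)\in\mathbb N$ such that for every $k\ge K_1$ we have $\mathcal R^k(g)\in\mathbf A^\alpha(\mathbf\Phi_r)$. (ii) For every pair of real numbers $r>0$, $\alpha\in(1,+\infty)$ and for every $f\in\mathbf A^\alpha\cap\mathcal S_{\mathbf P}^\infty$ and $\phi\in\mathbf\Phi_r$, there exists $K_2=K_2(f,\phi)\in\mathbb N$ such that for all $k\ge K_2$ we have $$\|\mathcal F_f^k(\phi)-\mathrm{id}\|_r\le C\lambda^k,$$ for some constants $C>0$, $\lambda\in(0,1)$ that depend only on $\alpha$.
   Context: **Unimodal maps.** Let $\alpha>1$. A smooth map $f\colon[-1,1]\to[-1,1]$ is unimodal with critical exponent $\alpha$ if there is a point $c=c_f\in(-1,1)$ such that $f'>0$ on $[-1,c)$, $f'<0$ on $(c,1]$, and near $c$ one can write $f(x)=\psi(-|\phi(x)|^\alpha)$ with $\phi(c)=0$ and $\phi,\psi$ local orientation preserving diffeomorphisms near $c$ and $0$ respectively. It is analytic if $f$ is analytic on $[-1,c_f)$ and $(c_f,1]$ and $\phi,\psi$ can be chosen analytic. $\mathbf U$ (resp. $\mathbf U^\omega$) is the space of all unimodal (resp. analytic unimodal) maps. **Renormalization.** A unimodal map $f$ is renormalizable if there are an integer $m\ge2$ and a closed interval $J=[a,b]$ with $c_f\in(a,b)$, $f^m(J)\subset J$, and $J,f(J),\dots,f^{m-1}(J)$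 having pairwise disjoint interiors; the smallest such $m$ is the renormalization period. For $p\ne q$ let $A_{p,q}(z)=\frac{(z-p)+(z-q)}{q-p}$ (so $A_{p,q}(q)=1$, $A_{p,q}(p)=-1$). If $f$ is renormalizable with period $m$ and $J=[a,b]$ is the maximal closed interval such that $c_f\in(a,b)$, $f^m(J)\subset J$, and $J,f(J),\dots,f^{m-1}(J)$ have pairwise disjoint interiors, put $(p,q)=(a,b)$ if $(f^m)'(a)>0$ and $(p,q)=(b,a)$ otherwise; the renormalization of $f$ is $\mathcal R(f)=A_{p,q}\circ f^m\circ A_{p,q}^{-1}$, again unimodal with the same critical exponent. $\mathcal S_{\mathbf P}^\infty$ (resp. $\mathcal S_{\mathbf P}^1$) denotes the set of infinitely renormalizable (resp. renormalizable) unimodal maps, with no restriction on combinatorics. **Function spaces.** $N_r(K)$ is the open $r$-neighborhood of $K$ in $\mathbb C$. For a Jordan domain $\Omega$, $\mathcal B(\Omega)$ is the Banach space, with sup-norm, of analytic maps $\Omega\to\mathbb C$ extending continuously to $\overline\Omega$; if $\Omega$ is symmetric with respect to $\mathbb R$, $\mathcal B^{\mathbb R}(\Omega)$ is the real Banach space of real-symmetric elements ($f(\bar z)=\overline{f(z)}$). $\|\cdot\|_r$ denotes the norm of $\mathcal B(N_r([-1,1]))$. For $r>0$, $\tilde{\mathbf B}_r$ is the set of $\psi\in\mathcal B^{\mathbb R}(N_r([-1,0]))$ univalent in some neighborhood of $[-1,0]$ with $\psi(-1)=-1$, $-1<\psi(0)\le1$, and $\mathbf B_r=\{\psi\in\tilde{\mathbf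 B}_r:\psi(0)<1\}$. With $[j_\alpha(\psi)](x)=\psi(-|x|^\alpha)$, put $\mathbf A^\alpha=\bigcup_{r>0}j_\alpha(\mathbf B_r)$ and $\tilde{\mathbf A}^\alpha=\bigcup_{r>0}j_\alpha(\tilde{\mathbf B}_r)$. $\mathbf\Phi_r$ is the set of $\phi\in\mathcal B^{\mathbb R}(N_r([-1,1]))$ univalent in some neighborhood of $[-1,1]$ with $\phi(-1)=-1$, $\phi(1)=1$. For $\phi\in\mathbf\Phi_r$, $\mathbf A^\alpha(\phi)$ is the set of $g\in\mathbf U^\omega$ of the form $g=\phi^{-1}\circ f\circ\phi$ (on $[-1,1]$) with $f\in\mathbf A^\alpha$, and $\mathbf A^\alpha(\mathbf\Phi_r)=\bigcup_{\phi\in\mathbf\Phi_r}\mathbf A^\alpha(\phi)$. **The skew product.** If $f\in\mathbf A^\alpha$ is renormalizable with affine rescaling $A_{p,q}$ (i.e. $\mathcal R(f)=A_{p,q}\circ f^m\circ A_{p,q}^{-1}$, where $m$ is the renormalization period of $f$ and $p,q$ are the endpoints of the maximal interval $J=[a,b]$ in the definition of $\mathcal R(f)$, with $(p,q)=(a,b)$ if $(f^m)'(a)>0$ and $(p,q)=(b,a)$ otherwise) and $\phi\in\mathbf\Phi_r$, put $$\mathcal F_f(\phi)=A_{p,q}\circ\phi\circ A^{-1}_{\phi^{-1}(p),\phi^{-1}(q)}\in\mathbf\Phi_r ,$$ so that $\mathcal R(\phi^{-1}\circ f\circ\phi)=[\mathcal F_f(\phi)]^{-1}\circ\mathcal R(f)\circ\mathcal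 F_f(\phi)$. Define $\tilde{\mathcal R}\colon(\mathcal S^1_{\mathbf P}\cap\mathbf A^\alpha)\times\mathbf\Phi_r\to\tilde{\mathbf A}^\alpha\times\mathbf\Phi_r$ by $\tilde{\mathcal R}(f,\phi)=(\mathcal R(f),\mathcal F_f(\phi))$. For $f\in\mathcal S_{\mathbf P}^\infty\cap\mathbf A^\alpha$ and $n\in\mathbb N$, $\mathcal F_f^n(\phi)$ denotes the map $\phi_n\in\mathbf\Phi_r$ with $\tilde{\mathcal R}^n(f,\phi)=(\mathcal R^n(f),\phi_n)$. *)

theory Defs
  imports "HOL-Analysis.Analysis"
begin

text \<open>
  Maps of \<open>[-1,1]\<close> are represented by total functions \<open>real \<Rightarrow> real\<close>, and elements of
  \<open>\<B>(\<Omega>)\<close> by total functions \<open>complex \<Rightarrow> complex\<close>. Every notion below depends only on the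
  values on \<open>[-1,1]\<close>, respectively on the closure of \<open>\<Omega>\<close>.
\<close>

section \<open>Unimodal maps\<close>

definition smooth_on :: "(real \<Rightarrow> real) \<Rightarrow> real set \<Rightarrow> bool" where
  "smooth_on f S \<longleftrightarrow>
     (\<exists>D :: nat \<Rightarrow> real \<Rightarrow> real. (\<forall>x\<in>S. D 0 x = f x) \<and>
        (\<forall>n. \<forall>x\<in>S. (D n has_real_derivative D (Suc n) x) (at x within S)))"

definition C1_on :: "(real \<Rightarrow> real) \<Rightarrow> real set \<Rightarrow> bool" where
  "C1_on f S \<longleftrightarrow>
     (\<exists>f'. continuous_on S f' \<and> (\<forall>x\<in>S. (f has_real_derivative f' x) (at x within S)))"

definition real_analytic_on :: "(real \<Rightarrow> real) \<Rightarrow> real set \<Rightarrow> bool" where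
  "real_analytic_on f S \<longleftrightarrow>
     (\<forall>x\<in>S. \<exists>a :: nat \<Rightarrow> real. \<exists>e>0. \<forall>y\<in>S. \<bar>y - x\<bar> < e \<longrightarrow> (\<lambda>n. a n * (y - x) ^ n) sums f y)"

definition real_analytic_near :: "(real \<Rightarrow> real) \<Rightarrow> real \<Rightarrow> bool" where
  "real_analytic_near f x \<longleftrightarrow> (\<exists>e>0. real_analytic_on f {x - e<..<x + e})"

text \<open>Local orientation preserving diffeomorphism near a point.\<close>

definition local_diffeo :: "(real \<Rightarrow> real) \<Rightarrow> real \<Rightarrow> bool" where
  "local_diffeo h x \<longleftrightarrow>
     (\<exists>e>0. let U = {x - e<..<x + e} in
        strict_mono_on U h \<and> open (h ` U) \<and> smooth_on h U \<and> smooth_on (inv_into U h) (h ` U))"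

definition turning_point :: "(real \<Rightarrow> real) \<Rightarrow> real \<Rightarrow> bool" where
  "turning_point f c \<longleftrightarrow> -1 < c \<and> c < 1 \<and>
     (\<forall>x\<in>{-1..<c}. \<exists>D>0. (f has_real_derivative D) (at x within {-1..1})) \<and>
     (\<forall>x\<in>{c<..1}. \<exists>D<0. (f has_real_derivative D) (at x within {-1..1}))"

definition crit :: "(real \<Rightarrow> real) \<Rightarrow> real" where
  "crit f = (THE c. turning_point f c)"

definition normal_form ::
    "real \<Rightarrow> (real \<Rightarrow> real) \<Rightarrow> real \<Rightarrow> (real \<Rightarrow> real) \<Rightarrow> (real \<Rightarrow> real) \<Rightarrow> bool" where
  "normal_form \<alpha> f c \<phi> \<psi> \<longleftrightarrow>
     \<phi> c = 0 \<and> local_diffeo \<phi> c \<and> local_diffeo \<psi> 0 \<and>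
     (\<forall>\<^sub>F x in nhds c. f x = \<psi> (- (\<bar>\<phi> x\<bar> powr \<alpha>)))"

text \<open>
  When \<open>\<alpha>\<close> is not an even integer, the normal form prevents \<open>f\<close> from being \<open>C\<^sup>\<infinity>\<close> at the critical
  point. A smooth unimodal map is therefore taken to be \<open>C\<^sup>1\<close> on \<open>[-1,1]\<close> and \<open>C\<^sup>\<infinity>\<close> off the
  critical point, with \<open>C\<^sup>\<infinity>\<close> diffeomorphisms in the normal form; for even \<open>\<alpha>\<close> this amounts to
  \<open>f\<close> being \<open>C\<^sup>\<infinity>\<close>.
\<close>

definition unimodal :: "real \<Rightarrow> (real \<Rightarrow> real) set" where
  "unimodal \<alpha> = {f. f ` {-1..1} \<subseteq> {-1..1} \<and> C1_on f {-1..1} \<and>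
     (\<exists>c. turning_point f c \<and> smooth_on f {-1..<c} \<and> smooth_on f {c<..1} \<and>
          (\<exists>\<phi> \<psi>. normal_form \<alpha> f c \<phi> \<psi>))}"

definition analytic_unimodal :: "real \<Rightarrow> (real \<Rightarrow> real) set" where
  "analytic_unimodal \<alpha> = {f \<in> unimodal \<alpha>.
     real_analytic_on f {-1..<crit f} \<and> real_analytic_on f {crit f<..1} \<and>
     (\<exists>\<phi> \<psi>. normal_form \<alpha> f (crit f) \<phi> \<psi> \<and>
            real_analytic_near \<phi> (crit f) \<and> real_analytic_near \<psi> 0)}"

section \<open>Renormalization\<close>

definition renorm_interval :: "(real \<Rightarrow> real) \<Rightarrow> nat \<Rightarrow> real \<Rightarrow> real \<Rightarrow> bool" where
  "renorm_interval f m a b \<longleftrightarrow>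
     -1 \<le> a \<and> b \<le> 1 \<and> crit f \<in> {a<..<b} \<and> (f ^^ m) ` {a..b} \<subseteq> {a..b} \<and>
     (\<forall>i<m. \<forall>j<m. i \<noteq> j \<longrightarrow> interior ((f ^^ i) ` {a..b}) \<inter> interior ((f ^^ j) ` {a..b}) = {})"

definition renormalizable :: "(real \<Rightarrow> real) \<Rightarrow> bool" where
  "renormalizable f \<longleftrightarrow> (\<exists>m\<ge>2. \<exists>a b. renorm_interval f m a b)"

definition renorm_period :: "(real \<Rightarrow> real) \<Rightarrow> nat" where
  "renorm_period f = (LEAST m. m \<ge> 2 \<and> (\<exists>a b. renorm_interval f m a b))"

definition max_renorm_interval :: "(real \<Rightarrow> real) \<Rightarrow> real \<times> real" where
  "max_renorm_interval f = (THE (a, b). renorm_interval f (renorm_period f) a b \<and>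
     (\<forall>a' b'. renorm_interval f (renorm_period f) a' b' \<longrightarrow> {a'..b'} \<subseteq> {a..b}))"

text \<open>The pair \<open>(p, q)\<close>; the derivative is one-sided if \<open>a = -1\<close>.\<close>

definition rescaling_points :: "(real \<Rightarrow> real) \<Rightarrow> real \<times> real" where
  "rescaling_points f = (let (a, b) = max_renorm_interval f in
     if \<exists>D>0. ((f ^^ renorm_period f) has_real_derivative D) (at a within {-1..1})
     then (a, b) else (b, a))"

definition aff :: "'a::field \<Rightarrow> 'a \<Rightarrow> 'a \<Rightarrow> 'a" where
  "aff p q z = ((z - p) + (z - q)) / (q - p)"

definition renorm :: "(real \<Rightarrow> real) \<Rightarrow> real \<Rightarrow> real" where
  "renorm f = (let (p, q) = rescaling_points f in
     aff p q \<circ> (f ^^ renorm_period f) \<circ> inv (aff p q))"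

definition renormalizable_maps :: "real \<Rightarrow> (real \<Rightarrow> real) set" where
  "renormalizable_maps \<alpha> = {f \<in> unimodal \<alpha>. renormalizable f}"

definition inf_renormalizable_maps :: "real \<Rightarrow> (real \<Rightarrow> real) set" where
  "inf_renormalizable_maps \<alpha> = {f. \<forall>n. (renorm ^^ n) f \<in> renormalizable_maps \<alpha>}"

section \<open>Function spaces\<close>

definition nbhd :: "real \<Rightarrow> real set \<Rightarrow> complex set" where
  "nbhd r K = (\<Union>x\<in>K. ball (complex_of_real x) r)"

text \<open>An element of \<open>\<B>(\<Omega>)\<close> is identified with its continuous extension to the closure.\<close>

definition BR :: "complex set \<Rightarrow> (complex \<Rightarrow> complex) set" where
  "BR \<Omega> = {f. f holomorphic_on \<Omega> \<and> continuous_on (closure \<Omega>) f \<and> (\<forall>z\<in>\<Omega>. f (cnj z) = cnj (f z))}"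

definition sup_norm :: "complex set \<Rightarrow> (complex \<Rightarrow> complex) \<Rightarrow> real" where
  "sup_norm \<Omega> f = (SUP z\<in>\<Omega>. cmod (f z))"

definition univalent_near :: "complex set \<Rightarrow> real set \<Rightarrow> (complex \<Rightarrow> complex) \<Rightarrow> bool" where
  "univalent_near \<Omega> K f \<longleftrightarrow>
     (\<exists>U. open U \<and> complex_of_real ` K \<subseteq> U \<and> U \<subseteq> \<Omega> \<and> f holomorphic_on U \<and> inj_on f U)"

text \<open>By real symmetry \<open>\<psi> 0\<close> is real, so that \<open>Re (\<psi> 0)\<close> is \<open>\<psi> 0\<close>.\<close>

definition Btilde :: "real \<Rightarrow> (complex \<Rightarrow> complex) set" where
  "Btilde r = {\<psi> \<in> BR (nbhd r {-1..0}). univalent_near (nbhd r {-1..0}) {-1..0} \<psi> \<and>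
     \<psi> (-1) = -1 \<and> -1 < Re (\<psi> 0) \<and> Re (\<psi> 0) \<le> 1}"

definition B_univ :: "real \<Rightarrow> (complex \<Rightarrow> complex) set" where
  "B_univ r = {\<psi> \<in> Btilde r. Re (\<psi> 0) < 1}"

definition Phi :: "real \<Rightarrow> (complex \<Rightarrow> complex) set" where
  "Phi r = {\<phi> \<in> BR (nbhd r {-1..1}). univalent_near (nbhd r {-1..1}) {-1..1} \<phi> \<and>
     \<phi> (-1) = -1 \<and> \<phi> 1 = 1}"

text \<open>The restriction of a real-symmetric map to the real line, as a real function.\<close>

definition real_trace :: "(complex \<Rightarrow> complex) \<Rightarrow> real \<Rightarrow> real" where
  "real_trace \<phi> x = Re (\<phi> (complex_of_real x))"

definition j_map :: "real \<Rightarrow> (complex \<Rightarrow> complex) \<Rightarrow> real \<Rightarrow> real" where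
  "j_map \<alpha> \<psi> x = real_trace \<psi> (- (\<bar>x\<bar> powr \<alpha>))"

definition A_unimodal :: "real \<Rightarrow> (real \<Rightarrow> real) set" where
  "A_unimodal \<alpha> = {f. \<exists>r>0. \<exists>\<psi>\<in>B_univ r. \<forall>x\<in>{-1..1}. f x = j_map \<alpha> \<psi> x}"

text \<open>For \<open>\<phi> \<in> Phi r\<close>, the inverse of the increasing bijection \<open>\<phi>\<close> of \<open>[-1,1]\<close>.\<close>

definition real_inv :: "(complex \<Rightarrow> complex) \<Rightarrow> real \<Rightarrow> real" where
  "real_inv \<phi> = inv_into {-1..1} (real_trace \<phi>)"

definition A_conj :: "real \<Rightarrow> (complex \<Rightarrow> complex) \<Rightarrow> (real \<Rightarrow> real) set" where
  "A_conj \<alpha> \<phi> = {g \<in> analytic_unimodal \<alpha>.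
     \<exists>f\<in>A_unimodal \<alpha>. \<forall>x\<in>{-1..1}. g x = (real_inv \<phi> \<circ> f \<circ> real_trace \<phi>) x}"

definition A_Phi :: "real \<Rightarrow> real \<Rightarrow> (real \<Rightarrow> real) set" where
  "A_Phi \<alpha> r = (\<Union>\<phi>\<in>Phi r. A_conj \<alpha> \<phi>)"

section \<open>The skew product\<close>

definition Fmap :: "(real \<Rightarrow> real) \<Rightarrow> (complex \<Rightarrow> complex) \<Rightarrow> complex \<Rightarrow> complex" where
  "Fmap f \<phi> = (let (p, q) = rescaling_points f in
     aff (complex_of_real p) (complex_of_real q) \<circ> \<phi> \<circ>
     inv (aff (complex_of_real (real_inv \<phi> p)) (complex_of_real (real_inv \<phi> q))))"

definition Rtilde ::
    "(real \<Rightarrow> real) \<times> (complex \<Rightarrow> complex) \<Rightarrow> (real \<Rightarrow> real) \<times> (complex \<Rightarrow> complex)" where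
  "Rtilde = (\<lambda>(f, \<phi>). (renorm f, Fmap f \<phi>))"

definition Fiter :: "nat \<Rightarrow> (real \<Rightarrow> real) \<Rightarrow> (complex \<Rightarrow> complex) \<Rightarrow> complex \<Rightarrow> complex" where
  "Fiter n f \<phi> = snd ((Rtilde ^^ n) (f, \<phi>))"

end

theory Submission
 imports Defs "HOL-Complex_Analysis.Complex_Analysis"
begin

text \<open>
 Write \<open>J\<^sub>k\<close> for the level-\<open>k\<close> renormalization interval around the critical point. Everything follows from
 geometric decay \<open>\<bar>J\<^sub>k\<bar> \<le> A \<lambda>\<^sup>k\<close> with \<open>\<lambda>\<close> depending on \<open>\<alpha>\<close> only.

 The decay is a form of the real bounds. Pull an interval \<open>T\<close> around the shortest of the intervals \<open>f\<^sup>i(J\<^sub>k)\<close> back to the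
 critical value; the pullbacks have bounded multiplicity, hence bounded total length. Off the critical point
 \<open>f'(x) f'(y) (x-y)\<^sup>2 \<le> (1 + C (x-y)\<^sup>2) (f(x)-f(y))\<^sup>2\<close>, a weakening of negative Schwarzian derivative (the case \<open>C = 0\<close>)
 that survives composition and controls cross ratios. So the critical-value interval of level \<open>k\<close> has definite space
 inside that of level \<open>k-2\<close>. The first application gives some decay and makes the constant \<open>C\<close> of \<open>\<R>\<^sup>nf\<close> tend to \<open>0\<close>; applied again to a deep renormalization, it yields the universal rate \<open>6/7\<close> per two
 levels for the critical-value interval.

 For (ii), \<open>\<F>\<^sup>k\<^sub>f(\<phi>)\<close> is \<open>\<phi>\<close> on an interval of length comparable to \<open>\<bar>J\<^sub>k\<bar>\<close>, affinely rescaled, so its distance from the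
 identity is \<open>O(\<bar>J\<^sub>k\<bar>)\<close>. For (i), write \<open>g(x) = \<psi>(-\<bar>\<phi>(x)\<bar>\<^sup>\<alpha>)\<close> near the critical point. Once \<open>J\<^sub>k\<close> is small compared
 with the domain of \<open>\<phi>\<close>, the rescaled restriction of \<open>\<phi>\<close> to \<open>J\<^sub>k\<close> lies in \<open>\<Phi>\<^sub>r\<close>, and it conjugates \<open>\<R>\<^sup>k g\<close> to an element of
 \<open>A\<^sup>\<alpha>\<close>, as the remaining iterates of \<open>g\<close> are analytic diffeomorphisms near the orbit.
\<close>

section \<open>Cyclic intervals of unimodal maps\<close>

text \<open>The rate must depend on \<alpha> only, while the distortion constant, the distance of
  the intervals from -1 and 1, and with them the first decay rate depend on f. A deep
  renormalization removes both defects: its constant \<open>C\<close> is at most ln 2 / 28, where 28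
  bounds the sum of the squared lengths of a chain of pull-backs, and at its deep levels every
  interval is shorter than the distance to the boundary, so that the shortest one has room for a
  collar of its own width. The margin of the critical-value interval is then at least 1 / (2 (1 +
  2)) = 1/6 of its length, whence 6/7. Two levels are taken at a time because each period at least
  doubles: a coarse interval contains four fine ones, while a pull-back meets at most three and so
  cannot cover it. Lengths at the critical point are controlled by 1/\<alpha>-th powers of lengths
  at the critical value. As \<open>K2\<close> may depend on f and \<phi>, half of the exponent is
  given up to absorb the remaining constants. For general \<alpha> the map is not C^3 at its
  critical point; the two-point inequality involves first derivatives only and holds for the power
  map with \<open>C = 0\<close>.\<close>

definition ovl :: "real set \<Rightarrow> real set \<Rightarrow> bool" where
 "ovl S T \<longleftrightarrow> (\<exists>x y. x < y \<and> {x..y} \<subseteq> S \<inter> T)"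

definition peak :: "(real \<Rightarrow> real) \<Rightarrow> real \<Rightarrow> real \<Rightarrow> real \<Rightarrow> bool" where
 "peak g a c b \<longleftrightarrow> (\<forall>x y. a \<le> x \<longrightarrow> x < y \<longrightarrow> y \<le> c \<longrightarrow> g x < g y) \<and>
         (\<forall>x y. c \<le> x \<longrightarrow> x < y \<longrightarrow> y \<le> b \<longrightarrow> g y < g x)"

definition valley :: "(real \<Rightarrow> real) \<Rightarrow> real \<Rightarrow> real \<Rightarrow> real \<Rightarrow> bool" where
 "valley g a c b \<longleftrightarrow> (\<forall>x y. a \<le> x \<longrightarrow> x < y \<longrightarrow> y \<le> c \<longrightarrow> g y < g x) \<and>
          (\<forall>x y. c \<le> x \<longrightarrow> x < y \<longrightarrow> y \<le> b \<longrightarrow> g x < g y)"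

text \<open>The valley alternative makes the class invariant under conjugation by x -> -x, so that
  later arguments may fix the side of \<open>c\<close> on which an image lies.\<close>

definition unim :: "(real \<Rightarrow> real) \<Rightarrow> real \<Rightarrow> bool" where
 "unim f c \<longleftrightarrow> continuous_on {-1..1} f \<and> f ` {-1..1} \<subseteq> {-1..1} \<and> -1 < c \<and> c < 1 \<and>
  (peak f (-1) c 1 \<or> valley f (-1) c 1)"

definition cyc :: "(real \<Rightarrow> real) \<Rightarrow> real \<Rightarrow> nat \<Rightarrow> real \<Rightarrow> real \<Rightarrow> bool" where
 "cyc f c m a b \<longleftrightarrow> -1 \<le> a \<and> a < c \<and> c < b \<and> b \<le> 1 \<and> (f ^^ m) ` {a..b} \<subseteq> {a..b} \<and>
  (\<forall>s. 0 < s \<longrightarrow> s < m \<longrightarrow> \<not> ovl ((f ^^ s) ` {a..b}) {a..b})"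

lemma ovl_mono: "ovl S T ==> S \<subseteq> S' ==> T \<subseteq> T' ==> ovl S' T'"
 unfolding ovl_def by blast

lemma ovl_Icc: "ovl {a..b} {c..d} \<longleftrightarrow> max a c < min b d"
proof
 assume "ovl {a..b} {c..d}"
 then obtain x y where xy: "x < y" "{x..y} \<subseteq> {a..b} \<inter> {c..d}" by (auto simp: ovl_def)
 then have "x \<in> {a..b} \<inter> {c..d}" "y \<in> {a..b} \<inter> {c..d}" by (auto simp del: Int_iff intro!: subsetD[OF xy(2)])
 then show "max a c < min b d" using xy(1) by auto
next
 assume "max a c < min b d"
 then show "ovl {a..b} {c..d}" unfolding ovl_def
  by (intro exI[of _ "max a c"] exI[of _ "min b d"]) auto
qed

lemma image_contains_Icc:
 fixes f :: "real \<Rightarrow> real"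
 assumes "continuous_on {x..y} f" "x \<le> y"
 shows "{min (f x) (f y)..max (f x) (f y)} \<subseteq> f ` {x..y}"
proof -
 have "connected (f ` {x..y})" using assms(1) by (intro connected_continuous_image) auto
 moreover have "f x \<in> f ` {x..y}" "f y \<in> f ` {x..y}" using assms(2) by auto
 ultimately show ?thesis
  by (smt (verit, ccfv_threshold) connected_contains_Icc min_def max_def)
qed

lemma unim_maps: "unim f c ==> x \<in> {-1..1} ==> f x \<in> {-1..1}"
 unfolding unim_def by blast

lemma unim_cont: "unim f c ==> continuous_on {-1..1} f"
 unfolding unim_def by blast

lemma unim_c: "unim f c ==> -1 < c" "unim f c ==> c < 1"
 unfolding unim_def by blast+

lemma unim_pow_maps: "unim f c ==> x \<in> {-1..1} ==> (f ^^ n) x \<in> {-1..1}"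
proof (induction n)
 case (Suc n) then show ?case using unim_maps[of f c "(f ^^ n) x"] by simp
qed simp

lemma unim_pow_image: "unim f c ==> S \<subseteq> {-1..1} ==> (f ^^ n) ` S \<subseteq> {-1..1}"
 using unim_pow_maps by blast

lemma unim_pow_cont: "unim f c ==> continuous_on {-1..1} (f ^^ n)"
proof (induction n)
 case (Suc n)
 have "continuous_on {-1..1} (f \<circ> (f ^^ n))"
  using Suc unim_pow_image[OF Suc.prems, of "{-1..1}" n] unim_cont[OF Suc.prems]
  by (intro continuous_on_compose) (auto intro: continuous_on_subset)
 then show ?case by simp
qed (simp add: continuous_on_id)

lemma unim_pow_cont_on: "unim f c ==> -1 \<le> a ==> b \<le> 1 ==> continuous_on {a..b} (f ^^ n)"
 by (rule continuous_on_subset[OF unim_pow_cont]) auto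

lemma unim_inj:
 assumes "unim f c" "-1 \<le> x" "x < y" "y \<le> 1" "y \<le> c \<or> c \<le> x"
 shows "f x \<noteq> f y"
 using assms unfolding unim_def peak_def valley_def by (metis less_irrefl)

text \<open>A common nondegenerate interval contains a nondegenerate piece on one side of
  \<open>c\<close>, where f is injective. This is why disjointness is measured by
  \<open>ovl\<close>: overlaps pass to images.\<close>

lemma ovl_image:
 assumes u: "unim f c" and S: "S \<subseteq> {-1..1}" and o: "ovl S T"
 shows "ovl (f ` S) (f ` T)"
proof -
 obtain x y where xy: "x < y" "{x..y} \<subseteq> S \<inter> T" using o by (auto simp: ovl_def)
 obtain x' y' where x': "x \<le> x'" "x' < y'" "y' \<le> y" "y' \<le> c \<or> c \<le> x'"
 proof (cases "x < c")
  case True then show ?thesis using that[of x "min y c"] xy(1) by auto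
 next
  case False then show ?thesis using that[of x y] xy(1) by auto
 qed
 have sub: "{x'..y'} \<subseteq> S \<inter> T" using x' xy(2) by auto
 then have in1: "{x'..y'} \<subseteq> {-1..1}" using S by blast
 then have "-1 \<le> x'" "y' \<le> 1" using x'(2) by auto
 then have ne: "f x' \<noteq> f y'" using unim_inj[OF u] x' by auto
 have "{min (f x') (f y')..max (f x') (f y')} \<subseteq> f ` {x'..y'}"
  using unim_cont[OF u] in1 x' by (intro image_contains_Icc) (auto intro: continuous_on_subset)
 also have "\<dots> \<subseteq> f ` S \<inter> f ` T" using sub by blast
 finally show ?thesis using ne unfolding ovl_def
  by (intro exI[of _ "min (f x') (f y')"] exI[of _ "max (f x') (f y')"]) auto
qed

lemma ovl_pow:
 assumes u: "unim f c" and S: "S \<subseteq> {-1..1}" and o: "ovl S T"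
 shows "ovl ((f ^^ n) ` S) ((f ^^ n) ` T)"
proof (induction n)
 case (Suc n)
 have "ovl (f ` (f ^^ n) ` S) (f ` (f ^^ n) ` T)"
  by (rule ovl_image[OF u unim_pow_image[OF u S] Suc])
 then show ?case by (simp add: image_comp)
qed (use o in auto)

lemma pow_Icc:
 assumes u: "unim f c" and ab: "-1 \<le> a" "a < b" "b \<le> 1"
 obtains l h where "(f ^^ n) ` {a..b} = {l..h}" "l < h" "-1 \<le> l" "h \<le> 1"
proof -
 have "continuous_on {a..b} (f ^^ n)"
  using unim_pow_cont_on[OF u] ab by simp
 then obtain l h where lh: "(f ^^ n) ` {a..b} = {l..h}"
  using ab continuous_image_closed_interval[of a b "f ^^ n"] by auto
 have "ovl {a..b} {a..b}" using ab by (simp add: ovl_Icc)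
 then have "ovl {l..h} {l..h}" using ovl_pow[OF u, of "{a..b}" "{a..b}" n] ab lh by auto
 then have "l < h" by (simp add: ovl_Icc)
 moreover have "{l..h} \<subseteq> {-1..1}" using unim_pow_image[OF u, of "{a..b}" n] ab lh by auto
 ultimately show ?thesis using that lh by auto
qed

lemma pow_Icc_ex:
 assumes "unim f c" "-1 \<le> a" "a < c" "c < b" "b \<le> 1"
 shows "\<exists>l h. (f ^^ n) ` {a..b} = {l..h} \<and> l < h \<and> -1 \<le> l \<and> h \<le> 1"
proof -
 have "a < b" using assms by simp
 then show ?thesis using pow_Icc[OF assms(1,2) _ assms(5), of n] by metis
qed

lemma pow_in_image: "x \<in> S ==> (f ^^ n) x \<in> (f ^^ n) ` S" by blast

lemma cyc_no_ovl: "cyc f c m a b ==> 0 < s ==> s < m ==> \<not> ovl ((f ^^ s) ` {a..b}) {a..b}"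
 by (simp add: cyc_def)

lemma cyc_inv: "cyc f c m a b ==> a \<le> x ==> x \<le> b ==> a \<le> (f ^^ m) x \<and> (f ^^ m) x \<le> b"
 unfolding cyc_def by (meson atLeastAtMost_iff image_subset_iff)

lemma cyc_bounds: "cyc f c m a b ==> -1 \<le> a" "cyc f c m a b ==> a < c"
  "cyc f c m a b ==> c < b" "cyc f c m a b ==> b \<le> 1"
 unfolding cyc_def by blast+

lemma image_Icc_D: "g ` {a..b} = {l..h} ==> a \<le> x ==> x \<le> b ==> l \<le> g x \<and> g x \<le> h"
 for g :: "real \<Rightarrow> real"
 by (metis atLeastAtMost_iff image_eqI)

text \<open>The point \<open>c\<close> is interior to [a,b], so a nondegenerate image interval
  through \<open>c\<close> would overlap [a,b].\<close>

lemma cyc_avoid: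
 assumes u: "unim f c" and cy: "cyc f c m a b" and s: "0 < s" "s < m"
 shows "c \<notin> (f ^^ s) ` {a..b}"
proof
 assume c: "c \<in> (f ^^ s) ` {a..b}"
 have ab: "-1 \<le> a" "a < c" "c < b" "b \<le> 1" using cyc_bounds[OF cy] by blast+
 obtain l h where lh: "(f ^^ s) ` {a..b} = {l..h}" "l < h"
  using pow_Icc_ex[OF u ab, of s] by blast
 have "ovl {l..h} {a..b}" using lh c ab by (auto simp: ovl_Icc)
 then show False using cyc_no_ovl[OF cy s] lh by simp
qed

text \<open>Away from \<open>c\<close> the map \<open>f\<close> is monotone, so the iterates inherit the fold at \<open>c\<close>.\<close>

lemma pow_fold:
 assumes u: "unim f c" and ab: "-1 \<le> a" "a < c" "c < b" "b \<le> 1"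
  and av: "\<And>i. 0 < i ==> i < s ==> c \<notin> (f ^^ i) ` {a..b}" and s: "0 < s"
 shows "peak (f ^^ s) a c b \<or> valley (f ^^ s) a c b"
 using s av
proof (induction s)
 case (Suc s)
 show ?case
 proof (cases "s = 0")
  case True
  then show ?thesis using u ab by (auto simp: unim_def peak_def valley_def)
 next
  case False
  then have IH: "peak (f ^^ s) a c b \<or> valley (f ^^ s) a c b" using Suc by auto
  have cn: "c \<notin> (f ^^ s) ` {a..b}" using Suc.prems(2)[of s] False by auto
  obtain l h where lh: "(f ^^ s) ` {a..b} = {l..h}" "l < h" "-1 \<le> l" "h \<le> 1"
   using pow_Icc_ex[OF u ab, of s] by blast
  have inI: "\<And>x. a \<le> x ==> x \<le> b ==> l \<le> (f ^^ s) x \<and> (f ^^ s) x \<le> h" using lh(1) by auto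
  have side: "h < c \<or> c < l" using cn lh by auto
  have "(\<forall>x y. l \<le> x \<longrightarrow> x < y \<longrightarrow> y \<le> h \<longrightarrow> f x < f y) \<or> (\<forall>x y. l \<le> x \<longrightarrow> x < y \<longrightarrow> y \<le> h \<longrightarrow> f y < f x)"
   using side u lh(3,4) unfolding unim_def peak_def valley_def by (smt (verit))
  then show ?thesis
  proof
   assume m: "\<forall>x y. l \<le> x \<longrightarrow> x < y \<longrightarrow> y \<le> h \<longrightarrow> f x < f y"
   then have "\<And>x y. a \<le> x ==> x \<le> b ==> a \<le> y ==> y \<le> b ==> (f ^^ s) x < (f ^^ s) y ==> (f ^^ Suc s) x < (f ^^ Suc s) y"
    using inI by auto
   then show ?thesis using IH ab unfolding peak_def valley_def by (smt (verit))
  next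
   assume m: "\<forall>x y. l \<le> x \<longrightarrow> x < y \<longrightarrow> y \<le> h \<longrightarrow> f y < f x"
   then have "\<And>x y. a \<le> x ==> x \<le> b ==> a \<le> y ==> y \<le> b ==> (f ^^ s) x < (f ^^ s) y ==> (f ^^ Suc s) y < (f ^^ Suc s) x"
    using inI by auto
   then show ?thesis using IH ab unfolding peak_def valley_def by (smt (verit))
  qed
 qed
qed simp

text \<open>Conjugation by x -> -x. It exchanges peaks with valleys and left endpoints with right
  ones, which halves the case distinctions below.\<close>

definition refl_map :: "(real \<Rightarrow> real) \<Rightarrow> real \<Rightarrow> real" where "refl_map f x = - f (- x)"

lemma refl_map_pow: "(refl_map f ^^ n) x = - (f ^^ n) (- x)"
 by (induction n) (auto simp: refl_map_def)

lemma refl_map_image: "(refl_map f ^^ n) ` {-b..-a} = uminus ` (f ^^ n) ` {a..b}"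
proof -
 have "(refl_map f ^^ n) = uminus \<circ> (f ^^ n) \<circ> uminus" by (auto simp: refl_map_pow)
 moreover have "uminus ` {-b..-a} = {a..b}" for a b :: real by simp
 ultimately show ?thesis by (metis image_comp)
qed

lemma ovl_uminus: "ovl (uminus ` S) (uminus ` T) \<longleftrightarrow> ovl S T"
proof -
 have *: "ovl (uminus ` S) (uminus ` T)" if o: "ovl S T" for S T
 proof -
  obtain x y where xy: "x < y" "{x..y} \<subseteq> S \<inter> T" using o by (auto simp: ovl_def)
  have "uminus ` {x..y} \<subseteq> uminus ` S \<inter> uminus ` T" using xy by blast
  then have "{-y..-x} \<subseteq> uminus ` S \<inter> uminus ` T" by simp
  then show ?thesis unfolding ovl_def using xy(1) by (intro exI[of _ "-y"] exI[of _ "-x"]) simp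
 qed
 show ?thesis using *[of S T] *[of "uminus ` S" "uminus ` T"] by (auto simp: image_image)
qed

lemma peak_refl: "peak (\<lambda>x. - g (- x)) (-b) (-c) (-a) \<longleftrightarrow> valley g a c b"
 unfolding peak_def valley_def
 by (smt (verit, ccfv_SIG) minus_minus)

lemma valley_refl: "valley (\<lambda>x. - g (- x)) (-b) (-c) (-a) \<longleftrightarrow> peak g a c b"
 using peak_refl[of "\<lambda>x. - g (- x)" "-a" "-c" "-b"] by simp

lemma unim_refl: assumes "unim f c" shows "unim (refl_map f) (-c)"
proof -
 have "refl_map f = (\<lambda>x. - f (- x))" by (auto simp: refl_map_def)
 moreover have "continuous_on {-1..1} (\<lambda>x. - f (- x))"
  by (rule continuous_on_minus, rule continuous_on_compose2[OF unim_cont[OF assms]])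
   (auto intro: continuous_on_minus)
 moreover have "(\<lambda>x. - f (- x)) ` {-1..1} \<subseteq> {-1..1}"
 proof clarsimp
  fix x :: real assume "-1 \<le> x" "x \<le> 1"
  then have "f (-x) \<in> {-1..1}" using unim_maps[OF assms, of "-x"] by auto
  then show "f (- x) \<le> 1 \<and> - 1 \<le> f (- x)" by auto
 qed
 moreover have "peak (\<lambda>x. - f (- x)) (-1) (-c) 1 \<or> valley (\<lambda>x. - f (- x)) (-1) (-c) 1"
  using assms peak_refl[of f 1 c "-1"] valley_refl[of f 1 c "-1"] unfolding unim_def by (metis minus_minus)
 moreover have "-1 < -c" "-c < 1" using unim_c[OF assms] by simp_all
 ultimately show ?thesis unfolding unim_def by simp
qed

lemma cyc_refl: assumes "cyc f c m a b" shows "cyc (refl_map f) (-c) m (-b) (-a)"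
proof -
 have "(f ^^ m) ` {a..b} \<subseteq> {a..b}" using assms by (simp add: cyc_def)
 then have "uminus ` (f ^^ m) ` {a..b} \<subseteq> uminus ` {a..b}" by blast
 then have 1: "(refl_map f ^^ m) ` {-b..-a} \<subseteq> {-b..-a}" by (simp add: refl_map_image)
 have "\<not> ovl ((refl_map f ^^ s) ` {-b..-a}) {-b..-a}" if "0 < s" "s < m" for s
 proof -
  have "\<not> ovl ((f ^^ s) ` {a..b}) {a..b}" using assms that by (simp add: cyc_def)
  then show ?thesis using ovl_uminus[of "(f ^^ s) ` {a..b}" "{a..b}"] by (simp add: refl_map_image)
 qed
 then show ?thesis using cyc_bounds[OF assms] 1 by (simp add: cyc_def)
qed

lemma refl_refl [simp]: "refl_map (refl_map f) = f" by (auto simp: refl_map_def)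

section \<open>Unions of cyclic intervals and the maximal one\<close>

lemma no_ovl_cases:
 assumes "\<not> ovl {l..h} {a..b}" "l < h" "a < b"
 shows "h \<le> a \<or> b \<le> l"
 using assms by (auto simp: ovl_Icc)

text \<open>With g = f^s and h = f^(m-s), the iterate f^m is both h o g and g o h. An overlap forces
  a point of the first interval to the left of the second, which makes g increasing on [a1,c] and
  then h increasing on [c,b2]. Read as h o g, f^m increases somewhere left of \<open>c\<close>, so
  it must decrease on the right; read as g o h, it increases somewhere on the right.\<close>

lemma union_aux:
 assumes u: "unim f c" and c1: "cyc f c m a1 b1" and c2: "cyc f c m a2 b2"
  and s: "0 < s" "s < m" and rt: "c < (f ^^ s) c" and b12: "b1 < b2"
  and o: "ovl ((f ^^ s) ` {min a1 a2..b2}) {min a1 a2..b2}"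
 shows False
proof -
 let ?g = "f ^^ s" and ?h = "f ^^ (m - s)" and ?F = "f ^^ m"
 have ab1: "-1 \<le> a1" "a1 < c" "c < b1" "b1 \<le> 1" and ab2: "-1 \<le> a2" "a2 < c" "c < b2" "b2 \<le> 1"
  using cyc_bounds[OF c1] cyc_bounds[OF c2] by blast+
 have Fgh: "?F x = ?h (?g x)" "?F x = ?g (?h x)" for x
  using s funpow_add[of "m - s" s f, THEN fun_cong, of x] funpow_add[of s "m - s" f, THEN fun_cong, of x] by simp_all
 have F1: "?F x \<in> {a1..b1}" if "x \<in> {a1..b1}" for x using cyc_inv[OF c1] that by simp
 have far: "b \<le> ?g x" if "cyc f c m a b" "x \<in> {a..b}" for a b x
 proof -
  have ab: "-1 \<le> a" "a < c" "c < b" "b \<le> 1" using cyc_bounds[OF that(1)] by blast+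
  obtain l h where lh: "?g ` {a..b} = {l..h}" "l < h" using pow_Icc_ex[OF u ab, of s] by blast
  have "?g c \<in> {l..h}" using image_Icc_D[OF lh(1), of c] ab by simp
  moreover have "h \<le> a \<or> b \<le> l" using no_ovl_cases[of l h a b] cyc_no_ovl[OF that(1) s] lh ab by simp
  moreover have "?g x \<in> {l..h}" using image_Icc_D[OF lh(1), of x] that(2) by simp
  ultimately show ?thesis using ab rt by simp
 qed
 note far1 = far[OF c1] and far2 = far[OF c2]
 define a where "a = min a1 a2"
 obtain y1 y2 where y: "y1 < y2" "{y1..y2} \<subseteq> ?g ` {a..b2} \<inter> {a..b2}"
  using o unfolding ovl_def a_def by blast
 have "y1 \<in> ?g ` {a..b2}" "y2 \<in> {a..b2}" using y by auto
 then obtain x1 where x1: "x1 \<in> {a..b2}" "?g x1 < b2" using y(1) by (metis atLeastAtMost_iff imageE less_le_trans)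
 have x1J: "x1 \<notin> {a2..b2}" using far2[of x1] x1(2) by (meson not_le)
 then have x1a: "x1 < a2" "a1 \<le> x1" "a1 < a2" "a = a1" using x1 unfolding a_def by auto
 have gc: "b2 \<le> ?g c" using far2[of c] ab2 by auto
 have avoid: "c \<notin> (f ^^ i) ` {a1..b2}" if "0 < i" "i < m" for i
 proof -
  have "{a1..b2} = {a1..b1} \<union> {a2..b2}" using x1a ab1 ab2 b12 by auto
  then show ?thesis using cyc_avoid[OF u c1 that] cyc_avoid[OF u c2 that] by (simp add: image_Un)
 qed
 have foldg: "peak ?g a1 c b2 \<or> valley ?g a1 c b2"
  using pow_fold[OF u, of a1 b2 s] ab1 ab2 avoid s by auto
 have foldh: "peak ?h a1 c b2 \<or> valley ?h a1 c b2"
  using pow_fold[OF u, of a1 b2 "m - s"] ab1 ab2 avoid s by auto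
 have foldF: "peak ?F a1 c b2 \<or> valley ?F a1 c b2"
  using pow_fold[OF u, of a1 b2 m] ab1 ab2 avoid s by auto
 have x1c: "x1 < c" using x1a ab2 by auto
 have ginc: "\<forall>x y. a1 \<le> x \<longrightarrow> x < y \<longrightarrow> y \<le> c \<longrightarrow> ?g x < ?g y"
  using foldg gc x1 x1a x1c unfolding peak_def valley_def by (smt (verit))
 have cont: "continuous_on {p..q} (f ^^ n)" if "-1 \<le> p" "q \<le> 1" for p q n
  using unim_pow_cont_on[OF u that] .
 \<comment> \<open>A preimage of \<open>b2\<close> under g. It turns out to lie left of
   \<open>a2\<close>, hence in the first interval, and so does h b2 = F z by invariance.\<close>
 obtain z where z: "x1 \<le> z" "z \<le> c" "?g z = b2"
  using IVT'[of ?g x1 b2 c] x1 x1c gc cont[of x1 c s] ab1 x1a ab2 by auto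
 have za: "z \<le> a2"
 proof (rule ccontr)
  assume "\<not> z \<le> a2"
  then have "?g a2 < ?g z" using ginc x1a z by auto
  then show False using far2[of a2] ab2 z by auto
 qed
 have x1z: "x1 < z" using x1 z by (metis less_le)
 define w where "w = ?h b2"
 have wF: "w = ?F z" unfolding w_def using Fgh(1)[of z] z by simp
 have w1: "w \<in> {a1..b1}" unfolding wF using F1[of z] z x1a za ab2 ab1 by auto
 obtain l h where lh: "?h ` {a2..b2} = {l..h}" "l < h" using pow_Icc_ex[OF u ab2, of "m - s"] by blast
 have "w \<in> {l..h}" using image_Icc_D[OF lh(1), of b2] ab2 unfolding w_def by simp
 moreover have "h \<le> a2 \<or> b2 \<le> l" using no_ovl_cases[of l h a2 b2] cyc_no_ovl[OF c2, of "m - s"] s lh ab2 by simp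
 ultimately have ha: "h \<le> a2" "w \<le> a2" using w1 b12 by auto
 have "?h c \<in> {l..h}" using image_Icc_D[OF lh(1), of c] ab2 by simp
 then have hc: "?h c \<le> a2" using ha by auto
 obtain l' h' where lh': "?h ` {a1..b1} = {l'..h'}" "l' < h'" using pow_Icc_ex[OF u ab1, of "m - s"] by blast
 have hc': "?h c \<in> {l'..h'}" using image_Icc_D[OF lh'(1), of c] ab1 by simp
 have "h' \<le> a1 \<or> b1 \<le> l'" using no_ovl_cases[of l' h' a1 b1] cyc_no_ovl[OF c1, of "m - s"] s lh' ab1 by simp
 then have ua: "?h c \<le> a1" using hc hc' ab1 ab2 by auto
 have hinc: "\<forall>x y. c \<le> x \<longrightarrow> x < y \<longrightarrow> y \<le> b2 \<longrightarrow> ?h x < ?h y"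
  using foldh ua w1 ab2 unfolding peak_def valley_def w_def by (smt (verit) atLeastAtMost_iff)
 have "?h (?g x1) < ?h (?g z)"
  using hinc far1[of x1] x1 x1a ab1 z x1c by auto
 then have Fx: "?F x1 < ?F z" by (simp add: Fgh(1))
 then have Fdec: "\<forall>x y. c \<le> x \<longrightarrow> x < y \<longrightarrow> y \<le> b2 \<longrightarrow> ?F y < ?F x"
  using foldF x1z z x1a unfolding peak_def valley_def by (smt (verit))
 have wa: "a1 < w" using Fx F1[of x1] x1a x1c ab1 wF by auto
 \<comment> \<open>Any value strictly between \<open>a1\<close> and \<open>w\<close> serves: its
   preimage y < b2 under h satisfies F y < F b2, against the decrease of F on [c,b2].\<close>
 obtain y where y: "c \<le> y" "y \<le> b2" "?h y = (a1 + w) / 2"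
  using IVT'[of ?h c "(a1 + w)/2" b2] ua wa cont[of c b2 "m - s"] ab1 ab2 unfolding w_def by auto
 have yb: "y < b2" using y wa unfolding w_def by (cases "y = b2") auto
 have "?g ((a1 + w)/2) < ?g w" using ginc wa ha ab2 by auto
 then have "?F y < ?F b2" unfolding Fgh(2) y(3) w_def[symmetric] .
 then show False using Fdec y yb by (meson le_less_trans less_asym order_refl)
qed

lemma union_no_ovl:
 assumes u: "unim f c" and c1: "cyc f c m a1 b1" and c2: "cyc f c m a2 b2"
  and s: "0 < s" "s < m" and rt: "c < (f ^^ s) c"
 shows "\<not> ovl ((f ^^ s) ` {min a1 a2..max b1 b2}) {min a1 a2..max b1 b2}"
proof
 assume o: "ovl ((f ^^ s) ` {min a1 a2..max b1 b2}) {min a1 a2..max b1 b2}"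
 show False
 proof (cases b1 b2 rule: linorder_cases)
  case less
  then show ?thesis using union_aux[OF u c1 c2 s rt] o by (simp add: max_absorb2)
 next
  case greater
  then show ?thesis using union_aux[OF u c2 c1 s rt] o by (simp add: max_absorb1 min.commute)
 next
  case equal
  define a where "a = min a1 a2"
  have "a = a1 \<or> a = a2" by (auto simp: a_def)
  then have "cyc f c m a b1" using c1 c2 equal by metis
  then show ?thesis using o equal cyc_no_ovl[OF _ s] unfolding a_def by simp
 qed
qed

text \<open>Makes the cyclic intervals of one period a directed family, which is the reason why a
  maximal one exists. The case f^s c < c is reduced to the other one by reflection.\<close>

lemma cyc_union:
 assumes u: "unim f c" and c1: "cyc f c m a1 b1" and c2: "cyc f c m a2 b2"
 shows "cyc f c m (min a1 a2) (max b1 b2)"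
proof -
 have ab1: "-1 \<le> a1" "a1 < c" "c < b1" "b1 \<le> 1" and ab2: "-1 \<le> a2" "a2 < c" "c < b2" "b2 \<le> 1"
  using cyc_bounds[OF c1] cyc_bounds[OF c2] by blast+
 have un: "{min a1 a2..max b1 b2} = {a1..b1} \<union> {a2..b2}" using ab1 ab2 by auto
 have inv: "(f ^^ m) ` {min a1 a2..max b1 b2} \<subseteq> {min a1 a2..max b1 b2}"
  using c1 c2 unfolding un cyc_def by blast
 have "\<not> ovl ((f ^^ s) ` {min a1 a2..max b1 b2}) {min a1 a2..max b1 b2}" if s: "0 < s" "s < m" for s
 proof -
  have "(f ^^ s) c \<noteq> c" using cyc_avoid[OF u c1 s] ab1 by (metis atLeastAtMost_iff less_imp_le pow_in_image)
  then consider "c < (f ^^ s) c" | "(f ^^ s) c < c" by linarith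
  then show ?thesis
  proof cases
   case 1 then show ?thesis using union_no_ovl[OF u c1 c2 s] by simp
  next
   case 2
   then have "- c < (refl_map f ^^ s) (- c)" by (simp add: refl_map_pow)
   then have "\<not> ovl ((refl_map f ^^ s) ` {min (-b1) (-b2)..max (-a1) (-a2)}) {min (-b1) (-b2)..max (-a1) (-a2)}"
    using union_no_ovl[OF unim_refl[OF u] cyc_refl[OF c1] cyc_refl[OF c2] s] by simp
   moreover have "min (-b1) (-b2) = - max b1 b2" "max (-a1) (-a2) = - min a1 a2" by auto
   ultimately show ?thesis using ovl_uminus[of "(f ^^ s) ` {min a1 a2..max b1 b2}" "{min a1 a2..max b1 b2}"]
    by (simp add: refl_map_image)
  qed
 qed
 moreover have "-1 \<le> min a1 a2" "min a1 a2 < c" "c < max b1 b2" "max b1 b2 \<le> 1" using ab1 ab2 by auto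
 ultimately show ?thesis using inv unfolding cyc_def by blast
qed

text \<open>Take the infimum of the left endpoints and the supremum of the right ones. By
  \<open>cyc_union\<close> each compact part of the open interval between them lies in a cyclic
  interval; invariance then passes to the closure, and an overlap of the limit would already occur
  in some cyclic interval.\<close>

lemma cyc_max_exists:
 assumes u: "unim f c" and ex: "cyc f c m a0 b0"
 shows "\<exists>A B. cyc f c m A B \<and> (\<forall>a b. cyc f c m a b \<longrightarrow> A \<le> a \<and> b \<le> B)"
proof -
 define SA where "SA = {a. \<exists>b. cyc f c m a b}"
 define SB where "SB = {b. \<exists>a. cyc f c m a b}"
 define A where "A = Inf SA"
 define B where "B = Sup SB"
 have ne: "SA \<noteq> {}" "SB \<noteq> {}" using ex unfolding SA_def SB_def by blast+
 have bA: "bdd_below SA" unfolding SA_def using cyc_bounds(1) by (intro bdd_belowI[of _ "-1"]) blast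
 have bB: "bdd_above SB" unfolding SB_def using cyc_bounds(4) by (intro bdd_aboveI[of _ 1]) blast
 have maxi: "A \<le> a \<and> b \<le> B" if "cyc f c m a b" for a b
 proof -
  have "a \<in> SA" "b \<in> SB" using that unfolding SA_def SB_def by blast+
  then show ?thesis unfolding A_def B_def using cInf_lower[OF _ bA] cSup_upper[OF _ bB] by simp
 qed
 have bd: "-1 \<le> A" "A < c" "c < B" "B \<le> 1"
 proof -
  show "-1 \<le> A" unfolding A_def using ne(1) cyc_bounds(1) by (intro cInf_greatest) (auto simp: SA_def)
  show "B \<le> 1" unfolding B_def using ne(2) cyc_bounds(4) by (intro cSup_least) (auto simp: SB_def)
  show "A < c" "c < B" using maxi[OF ex] cyc_bounds(2,3)[OF ex] by linarith+
 qed
 have cover: "\<exists>a b. cyc f c m a b \<and> a \<le> x \<and> y \<le> b" if xy: "A < x" "y < B" for x y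
 proof -
  obtain a where a: "a \<in> SA" "a < x" using cInf_lessD[OF ne(1)] xy(1) unfolding A_def by blast
  obtain b where b: "b \<in> SB" "y < b" using less_cSupD[OF ne(2)] xy(2) unfolding B_def by blast
  obtain b' where b': "cyc f c m a b'" using a unfolding SA_def by blast
  obtain a' where a': "cyc f c m a' b" using b unfolding SB_def by blast
  have "cyc f c m (min a a') (max b' b)" by (rule cyc_union[OF u b' a'])
  moreover have "min a a' \<le> x" "y \<le> max b' b" using a(2) b(2) by auto
  ultimately show ?thesis by blast
 qed
 have inv: "(f ^^ m) ` {A..B} \<subseteq> {A..B}"
 proof -
  have "(f ^^ m) ` {A<..<B} \<subseteq> {A..B}"
  proof
   fix y assume "y \<in> (f ^^ m) ` {A<..<B}"
   then obtain x where x: "A < x" "x < B" "y = (f ^^ m) x" by (metis greaterThanLessThan_iff imageE)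
   obtain a b where ab: "cyc f c m a b" "a \<le> x" "x \<le> b" using cover[OF x(1,2)] by blast
   show "y \<in> {A..B}" using cyc_inv[OF ab] maxi[OF ab(1)] x(3) by simp
  qed
  moreover have "closure {A<..<B} = {A..B}" using bd by (intro closure_greaterThanLessThan) simp
  ultimately show ?thesis
   using image_closure_subset[of "{A<..<B}" "f ^^ m" "{A..B}"] unim_pow_cont_on[OF u bd(1,4)] by simp
 qed
 have "\<not> ovl ((f ^^ s) ` {A..B}) {A..B}" if s: "0 < s" "s < m" for s
 proof
  assume "ovl ((f ^^ s) ` {A..B}) {A..B}"
  then obtain x y where xy: "x < y" "{x..y} \<subseteq> (f ^^ s) ` {A..B} \<inter> {A..B}" unfolding ovl_def by blast
  \<comment> \<open>Two points of the overlap that are not images of the endpoints: their preimages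
    are interior, so a single cyclic interval contains both preimages and both points.\<close>
  have "infinite ({x<..<y} - {(f ^^ s) A, (f ^^ s) B})" using xy(1) infinite_Ioo[of x y] by simp
  then obtain P where P: "P \<subseteq> {x<..<y} - {(f ^^ s) A, (f ^^ s) B}" "card P = 2" "finite P"
   by (meson infinite_arbitrarily_large)
  then obtain p q where pq: "P = {p, q}" "p \<noteq> q" by (meson card_2_iff)
  define x' where "x' = min p q" define y' where "y' = max p q"
  have x'y': "x' < y'" using pq(2) unfolding x'_def y'_def by auto
  have "x' \<in> P" "y' \<in> P" unfolding x'_def y'_def pq min_def max_def by auto
  then have xy': "x < x'" "y' < y" "x' \<noteq> (f ^^ s) A" "x' \<noteq> (f ^^ s) B" "y' \<noteq> (f ^^ s) A" "y' \<noteq> (f ^^ s) B"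
   using P(1) by auto
  have "x \<in> {x..y}" "y \<in> {x..y}" using xy(1) by auto
  then have "x \<in> {A..B}" "y \<in> {A..B}" using xy(2) by blast+
  then have AB: "A \<le> x" "y \<le> B" by auto
  have "x' \<in> {x..y}" "y' \<in> {x..y}" using xy' x'y' by auto
  then obtain w v where wv: "w \<in> {A..B}" "x' = (f ^^ s) w" "v \<in> {A..B}" "y' = (f ^^ s) v" using xy(2) by blast
  have wv': "A < w" "w < B" "A < v" "v < B" using wv xy' by (metis atLeastAtMost_iff less_le)+
  have "A < min (min w v) x'" "max (max w v) y' < B" using wv' xy' x'y' AB by auto
  then obtain a b where ab: "cyc f c m a b" "a \<le> min (min w v) x'" "max (max w v) y' \<le> b"
   using cover by blast
  obtain l h where lh: "(f ^^ s) ` {a..b} = {l..h}" using pow_Icc_ex[OF u cyc_bounds[OF ab(1)]] by blast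
  have "l \<le> x'" "y' \<le> h" using image_Icc_D[OF lh, of w] image_Icc_D[OF lh, of v] wv ab by auto
  then have "ovl {l..h} {a..b}" using ab x'y' by (simp add: ovl_Icc)
  then show False using cyc_no_ovl[OF ab(1) s] lh by simp
 qed
 then have "cyc f c m A B" using bd inv unfolding cyc_def by blast
 then show ?thesis using maxi by blast
qed

lemma pow_add_image: "(f ^^ (i + j)) ` S = (f ^^ i) ` (f ^^ j) ` S"
 by (simp add: funpow_add image_comp)

text \<open>Applying f^(m-l) turns an overlap of the i-th and l-th images into one of the image of
  order m - l + i with [a,b]. The index l = m is allowed when i > 0, because later the images are
  indexed by 1, ..., m.\<close>

lemma cyc_disjoint:
 assumes u: "unim f c" and cy: "cyc f c m a b" and il: "i < l" "l < m + (if i = 0 then 0 else 1)"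
 shows "\<not> ovl ((f ^^ i) ` {a..b}) ((f ^^ l) ` {a..b})"
proof
 assume o: "ovl ((f ^^ i) ` {a..b}) ((f ^^ l) ` {a..b})"
 have ab: "{a..b} \<subseteq> {-1..1}" using cyc_bounds(1,4)[OF cy] by auto
 have lm: "l \<le> m" using il by (auto split: if_splits)
 have "ovl ((f ^^ (m - l)) ` (f ^^ i) ` {a..b}) ((f ^^ (m - l)) ` (f ^^ l) ` {a..b})"
  by (rule ovl_pow[OF u unim_pow_image[OF u ab] o])
 then have "ovl ((f ^^ (m - l + i)) ` {a..b}) ((f ^^ m) ` {a..b})"
  using lm unfolding pow_add_image[of "m - l" l f, symmetric] pow_add_image[of "m - l" i f, symmetric] by simp
 then have "ovl ((f ^^ (m - l + i)) ` {a..b}) {a..b}"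
  using cy unfolding cyc_def by (meson ovl_mono order_refl)
 moreover have "0 < m - l + i" "m - l + i < m" using il lm by (auto split: if_splits)
 ultimately show False using cyc_no_ovl[OF cy, of "m - l + i"] by simp
qed

lemma interior_ovl:
 assumes "S = {l..h}" "T = {l'..h'}"
 shows "interior S \<inter> interior T = {} \<longleftrightarrow> \<not> ovl S T"
proof -
 have "interior S \<inter> interior T = {max l l'<..<min h h'}"
  using assms by (auto simp: interior_atLeastAtMost_real)
 then show ?thesis using assms ovl_Icc[of l h l' h'] by (auto simp: greaterThanLessThan_empty_iff)
qed

lemma renorm_interval_cyc:
 assumes u: "unim f c" and c: "crit f = c"
 shows "renorm_interval f m a b \<longleftrightarrow> cyc f c m a b"
proof
 assume r: "renorm_interval f m a b"
 then have bd: "-1 \<le> a" "a < c" "c < b" "b \<le> 1" and inv: "(f ^^ m) ` {a..b} \<subseteq> {a..b}"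
  unfolding renorm_interval_def c by auto
 have "\<not> ovl ((f ^^ s) ` {a..b}) {a..b}" if "0 < s" "s < m" for s
 proof -
  have "interior ((f ^^ s) ` {a..b}) \<inter> interior ((f ^^ 0) ` {a..b}) = {}"
   using r that unfolding renorm_interval_def by (metis less_numeral_extra(3) order.strict_trans)
  moreover obtain l h where "(f ^^ s) ` {a..b} = {l..h}" using pow_Icc_ex[OF u bd] by blast
  ultimately show ?thesis using interior_ovl[of "(f ^^ s) ` {a..b}" l h "{a..b}" a b] by simp
 qed
 then show "cyc f c m a b" using bd inv unfolding cyc_def by blast
next
 assume cy: "cyc f c m a b"
 note bd = cyc_bounds[OF cy]
 have inv: "(f ^^ m) ` {a..b} \<subseteq> {a..b}" using cy unfolding cyc_def by blast
 have *: "interior ((f ^^ i) ` {a..b}) \<inter> interior ((f ^^ j) ` {a..b}) = {}" if "i < j" "j < m" for i j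
 proof -
  obtain l h where 1: "(f ^^ i) ` {a..b} = {l..h}" using pow_Icc_ex[OF u bd] by blast
  obtain l' h' where 2: "(f ^^ j) ` {a..b} = {l'..h'}" using pow_Icc_ex[OF u bd] by blast
  show ?thesis using interior_ovl[OF 1 2] cyc_disjoint[OF u cy that(1)] that(2) by simp
 qed
 have "interior ((f ^^ i) ` {a..b}) \<inter> interior ((f ^^ j) ` {a..b}) = {}" if "i < m" "j < m" "i \<noteq> j" for i j
  using *[of i j] *[of j i] that by (metis Int_commute linorder_neqE_nat)
 then show "renorm_interval f m a b" using bd inv unfolding renorm_interval_def c by auto
qed

section \<open>Endpoints of the maximal cyclic interval\<close>

lemma cyc_near:
 assumes u: "unim f c" and ab: "-1 \<le> a" "a < b" "b \<le> 1" and e: "0 < e"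
 obtains d where "0 < d" "d \<le> e"
  "\<And>x. -1 \<le> x ==> x \<le> 1 ==> a - d \<le> x ==> x \<le> b + d ==> \<exists>y\<in>{a..b}. \<bar>(f ^^ s) x - (f ^^ s) y\<bar> < e"
proof -
 have "uniformly_continuous_on {-1..1} (f ^^ s)"
  by (rule compact_uniformly_continuous[OF unim_pow_cont[OF u]]) simp
 then obtain d where d: "0 < d" "\<And>x y. x \<in> {-1..1} ==> y \<in> {-1..1} ==> dist y x < d ==> dist ((f ^^ s) y) ((f ^^ s) x) < e"
  unfolding uniformly_continuous_on_def using e by metis
 define d' where "d' = min (d/2) e"
 have "\<exists>y\<in>{a..b}. \<bar>(f ^^ s) x - (f ^^ s) y\<bar> < e" if "-1 \<le> x" "x \<le> 1" "a - d' \<le> x" "x \<le> b + d'" for x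
 proof -
  define y where "y = max a (min b x)"
  have y: "y \<in> {a..b}" "y \<in> {-1..1}" using ab unfolding y_def by auto
  have "\<bar>x - y\<bar> \<le> d'" using that ab d(1) e unfolding y_def d'_def by (auto simp: min_def max_def)
  then have "dist x y < d" using d(1) unfolding dist_real_def d'_def by (auto simp: min_def split: if_splits)
  then have "dist ((f ^^ s) x) ((f ^^ s) y) < e" using d(2)[of y x] y that by simp
  then show ?thesis using y(1) unfolding dist_real_def by blast
 qed
 moreover have "0 < d'" "d' \<le> e" using d(1) e unfolding d'_def by auto
 ultimately show ?thesis using that by blast
qed

text \<open>Disjoint compact intervals have positive distance, and uniform continuity keeps them
  apart after a small enlargement. This is the room used to extend an interval that is not
  maximal.\<close>

lemma cyc_sep:
 assumes u: "unim f c" and ab: "-1 \<le> a" "a < b" "b \<le> 1" and dj: "(f ^^ s) ` {a..b} \<inter> {a..b} = {}"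
 obtains d where "0 < d" "\<And>x. -1 \<le> x ==> x \<le> 1 ==> a - d \<le> x ==> x \<le> b + d ==> (f ^^ s) x \<notin> {a-d..b+d}"
proof -
 obtain l h where lh: "(f ^^ s) ` {a..b} = {l..h}" "l < h" using pow_Icc[OF u ab, of s] by metis
 have "h < a \<or> b < l"
 proof (rule ccontr)
  assume n: "\<not> (h < a \<or> b < l)"
  then have "max l a \<in> {l..h} \<inter> {a..b}" using lh(2) ab by auto
  then show False using dj lh by blast
 qed
 define e where "e = (if h < a then (a - h)/2 else (l - b)/2)"
 have e: "0 < e" using \<open>h < a \<or> b < l\<close> unfolding e_def by auto
 obtain d where d: "0 < d" "d \<le> e" "\<And>x. -1 \<le> x ==> x \<le> 1 ==> a - d \<le> x ==> x \<le> b + d ==> \<exists>y\<in>{a..b}. \<bar>(f ^^ s) x - (f ^^ s) y\<bar> < e"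
  using cyc_near[OF u ab e] by metis
 have "(f ^^ s) x \<notin> {a-d..b+d}" if x: "-1 \<le> x" "x \<le> 1" "a - d \<le> x" "x \<le> b + d" for x
 proof
  assume m: "(f ^^ s) x \<in> {a-d..b+d}"
  obtain y where y: "y \<in> {a..b}" "\<bar>(f ^^ s) x - (f ^^ s) y\<bar> < e" using d(3)[OF x] by blast
  have "l \<le> (f ^^ s) y" "(f ^^ s) y \<le> h" using image_Icc_D[OF lh(1), of y] y(1) by auto
  then show False using y(2) m d(2) \<open>h < a \<or> b < l\<close> lh(2) ab unfolding e_def
   by (auto split: if_splits simp: abs_if)
 qed
 then show ?thesis using that d(1) by blast
qed

lemma finite_min_pos:
 fixes d :: "nat \<Rightarrow> real" assumes "\<And>s. s < m ==> 0 < d s"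
 shows "\<exists>e>0. \<forall>s<m. e \<le> d s"
 using assms
proof (induction m)
 case 0 show ?case by (intro exI[of _ 1]) simp
next
 case (Suc m)
 then obtain e where e: "e > 0" "\<forall>s<m. e \<le> d s" by (meson less_SucI)
 show ?case using e Suc.prems[of m] by (intro exI[of _ "min e (d m)"]) (auto simp: less_Suc_eq)
qed

definition maxcyc :: "(real \<Rightarrow> real) \<Rightarrow> real \<Rightarrow> nat \<Rightarrow> real \<Rightarrow> real \<Rightarrow> bool" where
 "maxcyc f c m a b \<longleftrightarrow> cyc f c m a b \<and> (\<forall>a' b'. cyc f c m a' b' \<longrightarrow> a \<le> a' \<and> b' \<le> b)"

text \<open>Two intervals that do not overlap share at most one point, and f^m maps each of the two
  into itself.\<close>

lemma cyc_touch:
 assumes u: "unim f c" and cy: "cyc f c m a b" and s: "0 < s" "s < m"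
  and e: "e \<in> (f ^^ s) ` {a..b} \<inter> {a..b}"
 shows "(f ^^ m) e = e"
proof -
 have bd: "-1 \<le> a" "a < c" "c < b" "b \<le> 1" using cyc_bounds[OF cy] by blast+
 obtain l h where lh: "(f ^^ s) ` {a..b} = {l..h}" "l < h" using pow_Icc_ex[OF u bd, of s] by blast
 have hl: "h \<le> a \<or> b \<le> l" using no_ovl_cases[of l h a b] cyc_no_ovl[OF cy s] lh bd by simp
 obtain x where x: "a \<le> x" "x \<le> b" "e = (f ^^ s) x" using e by auto
 have "(f ^^ m) e = (f ^^ s) ((f ^^ m) x)" unfolding x(3)
  by (metis add.commute comp_apply funpow_add)
 moreover have "a \<le> (f ^^ m) x" "(f ^^ m) x \<le> b" using cyc_inv[OF cy x(1,2)] by auto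
 ultimately have "l \<le> (f ^^ m) e" "(f ^^ m) e \<le> h" using image_Icc_D[OF lh(1), of "(f ^^ m) x"] by auto
 moreover have "a \<le> e" "e \<le> b" using e by auto
 moreover have "a \<le> (f ^^ m) e" "(f ^^ m) e \<le> b" using cyc_inv[OF cy \<open>a \<le> e\<close> \<open>e \<le> b\<close>] by auto
 moreover have "l \<le> e" "e \<le> h" using e lh by auto
 ultimately show ?thesis using hl by linarith
qed

text \<open>If f^m moved a inward, then [a-d,b] would be cyclic for small d. Contact with another
  image is no obstacle: a contact point is a or b and is fixed by f^m, but a is moved by assumption
  and f^m b < f^m c \<le> b.\<close>

lemma max_peak_left:
 assumes u: "unim f c" and mc: "maxcyc f c m a b" and pk: "peak (f ^^ m) a c b" and a: "-1 < a"
 shows "(f ^^ m) a = a"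
proof (rule ccontr)
 assume ne: "(f ^^ m) a \<noteq> a"
 have cy: "cyc f c m a b" using mc by (simp add: maxcyc_def)
 have bd: "-1 \<le> a" "a < c" "c < b" "b \<le> 1" using cyc_bounds[OF cy] by blast+
 have Fa: "a < (f ^^ m) a" using ne cyc_inv[OF cy, of a] bd by simp
 have Fc: "(f ^^ m) c \<le> b" using cyc_inv[OF cy, of c] bd by simp
 have ac: "(f ^^ m) a < (f ^^ m) c" "(f ^^ m) b < (f ^^ m) c" using pk bd unfolding peak_def by auto
 have ab: "a < b" using bd by simp
 have "\<exists>d>0. \<forall>x. -1 \<le> x \<longrightarrow> a - d \<le> x \<longrightarrow> x \<le> b \<longrightarrow> (f ^^ s) x \<notin> {a-d..b}" if s: "s < m" "0 < s" for s
 proof -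
  have "(f ^^ s) ` {a..b} \<inter> {a..b} = {}"
  proof (rule ccontr)
   assume "(f ^^ s) ` {a..b} \<inter> {a..b} \<noteq> {}"
   then obtain e where e: "e \<in> (f ^^ s) ` {a..b} \<inter> {a..b}" by blast
   have Fe: "(f ^^ m) e = e" by (rule cyc_touch[OF u cy s(2,1) e])
   obtain l h where lh: "(f ^^ s) ` {a..b} = {l..h}" "l < h" using pow_Icc_ex[OF u bd, of s] by blast
   have "h \<le> a \<or> b \<le> l" using no_ovl_cases[of l h a b] cyc_no_ovl[OF cy s(2,1)] lh ab by simp
   then have "e = a \<or> e = b" using e lh by auto
   then show False using Fe ne ac Fc by auto
  qed
  then obtain d where d: "0 < d" "\<And>x. -1 \<le> x ==> x \<le> 1 ==> a - d \<le> x ==> x \<le> b + d ==> (f ^^ s) x \<notin> {a-d..b+d}"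
   using cyc_sep[OF u bd(1) ab bd(4), of s] by blast
  show ?thesis
  proof (intro exI[of _ d] conjI allI impI d(1))
   fix x assume "-1 \<le> x" "a - d \<le> x" "x \<le> b"
   then have "(f ^^ s) x \<notin> {a-d..b+d}" using d(2)[of x] bd(4) d(1) by simp
   then show "(f ^^ s) x \<notin> {a-d..b}" using d(1) by auto
  qed
 qed
 then have "\<forall>s. \<exists>d>0. s < m \<longrightarrow> 0 < s \<longrightarrow> (\<forall>x. -1 \<le> x \<longrightarrow> a - d \<le> x \<longrightarrow> x \<le> b \<longrightarrow> (f ^^ s) x \<notin> {a-d..b})"
  by (metis zero_less_one)
 then obtain D where D: "\<And>s. 0 < D s" "\<And>s x. s < m ==> 0 < s ==> -1 \<le> x ==> a - D s \<le> x ==> x \<le> b ==> (f ^^ s) x \<notin> {a-D s..b}"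
  by metis
 obtain d1 where d1: "d1 > 0" "\<forall>s<m. d1 \<le> D s" using finite_min_pos[of m D] D(1) by blast
 \<comment> \<open>The room of f^m a inside (a,b): points slightly to the left of a are still mapped
   into (a,b), so invariance survives the extension.\<close>
 define e where "e = min ((f ^^ m) a - a) (b - (f ^^ m) a)"
 have e: "0 < e" using Fa ac Fc unfolding e_def by auto
 have "continuous_on {-1..1} (f ^^ m)" by (rule unim_pow_cont[OF u])
 then have "\<exists>d>0. \<forall>x\<in>{-1..1}. dist x a < d \<longrightarrow> dist ((f ^^ m) x) ((f ^^ m) a) < e"
  using e bd unfolding continuous_on_iff by simp
 then obtain d2 where d2: "d2 > 0" "\<And>x. -1 \<le> x ==> x \<le> 1 ==> \<bar>x - a\<bar> < d2 ==> \<bar>(f ^^ m) x - (f ^^ m) a\<bar> < e"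
  unfolding dist_real_def by auto
 define d where "d = min (min d1 (d2/2)) (a + 1)"
 have d: "0 < d" "d \<le> d1" "d < d2" "-1 \<le> a - d" using d1 d2 a unfolding d_def by auto
 have Fin: "(f ^^ m) x \<in> {a-d..b}" if x: "x \<in> {a-d..b}" for x
 proof (cases "a \<le> x")
  case True then show ?thesis using cyc_inv[OF cy, of x] x d by simp
 next
  case False
  then have "\<bar>(f ^^ m) x - (f ^^ m) a\<bar> < e" using d2(2)[of x] x d bd by auto
  then show ?thesis using d(1) unfolding e_def by (auto simp: abs_if split: if_splits)
 qed
 have "\<not> ovl ((f ^^ s) ` {a-d..b}) {a-d..b}" if s: "0 < s" "s < m" for s
 proof
  assume "ovl ((f ^^ s) ` {a-d..b}) {a-d..b}"
  then obtain y where "y \<in> (f ^^ s) ` {a-d..b} \<inter> {a-d..b}" unfolding ovl_def by (meson atLeastAtMost_iff less_imp_le order_refl subset_iff)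
  then obtain x where x: "x \<in> {a-d..b}" "(f ^^ s) x \<in> {a-d..b}" by blast
  have "d \<le> D s" using d(2) d1 s by fastforce
  then show False using D(2)[OF s(2,1), of x] x d by auto
 qed
 moreover have "(f ^^ m) ` {a-d..b} \<subseteq> {a-d..b}" using Fin by blast
 ultimately have "cyc f c m (a - d) b" using bd d unfolding cyc_def by auto
 then show False using mc d(1) unfolding maxcyc_def by force
qed

text \<open>The interval is now extended beyond b. An image may touch it at a fixed endpoint a, so
  enlarged images are only kept out of the half-open interval from a (excluded) to b + d.\<close>

lemma max_peak_right:
 assumes u: "unim f c" and mc: "maxcyc f c m a b" and pk: "peak (f ^^ m) a c b" and b: "b < 1"
 shows "(f ^^ m) b = a"
proof (rule ccontr)
 assume ne: "(f ^^ m) b \<noteq> a"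
 have cy: "cyc f c m a b" using mc by (simp add: maxcyc_def)
 have bd: "-1 \<le> a" "a < c" "c < b" "b \<le> 1" using cyc_bounds[OF cy] by blast+
 have Fb: "a < (f ^^ m) b" using ne cyc_inv[OF cy, of b] bd by simp
 have Fc: "(f ^^ m) c \<le> b" using cyc_inv[OF cy, of c] bd by simp
 have ac: "(f ^^ m) a < (f ^^ m) c" "(f ^^ m) b < (f ^^ m) c" using pk bd unfolding peak_def by auto
 have ab: "a < b" using bd by simp
 have "\<exists>d>0. \<forall>x. x \<le> 1 \<longrightarrow> a \<le> x \<longrightarrow> x \<le> b + d \<longrightarrow> (f ^^ s) x \<notin> {a<..b+d}" if s: "s < m" "0 < s" for s
 proof (cases "(f ^^ s) ` {a..b} \<inter> {a..b} = {}")
  case True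
  then obtain d where d: "0 < d" "\<And>x. -1 \<le> x ==> x \<le> 1 ==> a - d \<le> x ==> x \<le> b + d ==> (f ^^ s) x \<notin> {a-d..b+d}"
   using cyc_sep[OF u bd(1) ab bd(4), of s] by blast
  show ?thesis
  proof (intro exI[of _ d] conjI allI impI d(1))
   fix x assume "x \<le> 1" "a \<le> x" "x \<le> b + d"
   then have "(f ^^ s) x \<notin> {a-d..b+d}" using d(2)[of x] bd d(1) by simp
   then show "(f ^^ s) x \<notin> {a<..b+d}" using d(1) by auto
  qed
 next
  case False
  then obtain e where e: "e \<in> (f ^^ s) ` {a..b} \<inter> {a..b}" by blast
  have Fe: "(f ^^ m) e = e" by (rule cyc_touch[OF u cy s(2,1) e])
  obtain l h where lh: "(f ^^ s) ` {a..b} = {l..h}" "l < h" using pow_Icc_ex[OF u bd, of s] by blast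
  have hl: "h \<le> a \<or> b \<le> l" using no_ovl_cases[of l h a b] cyc_no_ovl[OF cy s(2,1)] lh ab by simp
  have eb: "e \<noteq> b" using Fe ac Fc by auto
  have eh: "e = a" "h = a" using hl eb e lh by auto
  have Fa: "(f ^^ m) a = a" using Fe eh by simp
  have le: "(f ^^ s) x \<le> a" if "a \<le> x" "x \<le> b" for x using image_Icc_D[OF lh(1), of x] that eh by simp
  have fold: "peak (f ^^ s) a c b \<or> valley (f ^^ s) a c b"
   using pow_fold[OF u bd _ s(2)] cyc_avoid[OF u cy] s(1) by (meson order.strict_trans)
  \<comment> \<open>Strictness leaves room to move past b. If f^s b were a, then f^s would be a
    valley that also takes the value a at the interior point f^m b, since f^s commutes with f^m and
    f^m a = a; but inside (a,b) a valley stays below the larger of its endpoint values.\<close>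
  have sb: "(f ^^ s) b < a"
  proof (rule ccontr)
   assume "\<not> (f ^^ s) b < a"
   then have sb: "(f ^^ s) b = a" using le[of b] ab by simp
   have "(f ^^ s) ((f ^^ m) b) = (f ^^ m) ((f ^^ s) b)" by (metis add.commute comp_apply funpow_add)
   then have sF: "(f ^^ s) ((f ^^ m) b) = a" using sb Fa by simp
   have v: "valley (f ^^ s) a c b"
   proof (rule ccontr)
    assume "\<not> valley (f ^^ s) a c b"
    then have "peak (f ^^ s) a c b" using fold by simp
    then have "(f ^^ s) b < (f ^^ s) c" using bd unfolding peak_def by auto
    then show False using sb le[of c] bd by simp
   qed
   show False
   proof (cases "(f ^^ m) b \<le> c")
    case True
    then have "(f ^^ s) ((f ^^ m) b) < (f ^^ s) a" using v Fb unfolding valley_def by auto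
    then show False using sF le[of a] ab by simp
   next
    case False
    then have "(f ^^ s) ((f ^^ m) b) < (f ^^ s) b" using v ac Fc unfolding valley_def by auto
    then show False using sF sb by simp
   qed
  qed
  have "\<exists>d>0. \<forall>x\<in>{-1..1}. dist x b < d \<longrightarrow> dist ((f ^^ s) x) ((f ^^ s) b) < a - (f ^^ s) b"
   using sb bd unim_pow_cont[OF u, of s] unfolding continuous_on_iff by simp
  then obtain d where d: "0 < d" "\<forall>x\<in>{-1..1}. dist x b < d \<longrightarrow> dist ((f ^^ s) x) ((f ^^ s) b) < a - (f ^^ s) b" by blast
  show ?thesis
  proof (intro exI[of _ "d/2"] conjI allI impI)
   fix x assume x: "x \<le> 1" "a \<le> x" "x \<le> b + d/2"
   have "(f ^^ s) x \<le> a"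
   proof (cases "x \<le> b")
    case True then show ?thesis using le x by simp
   next
    case False
    then have "dist ((f ^^ s) x) ((f ^^ s) b) < a - (f ^^ s) b" using d x bd by (auto simp: dist_real_def)
    then show ?thesis by (simp add: dist_real_def)
   qed
   then show "(f ^^ s) x \<notin> {a<..b+d/2}" by simp
  qed (use d in simp)
 qed
 then have "\<forall>s. \<exists>d>0. s < m \<longrightarrow> 0 < s \<longrightarrow> (\<forall>x. x \<le> 1 \<longrightarrow> a \<le> x \<longrightarrow> x \<le> b + d \<longrightarrow> (f ^^ s) x \<notin> {a<..b+d})"
  by (metis zero_less_one)
 then obtain D where D: "\<And>s. 0 < D s" "\<And>s x. s < m ==> 0 < s ==> x \<le> 1 ==> a \<le> x ==> x \<le> b + D s ==> (f ^^ s) x \<notin> {a<..b+D s}"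
  by metis
 obtain d1 where d1: "d1 > 0" "\<forall>s<m. d1 \<le> D s" using finite_min_pos[of m D] D(1) by blast
 define e where "e = min ((f ^^ m) b - a) (b - (f ^^ m) b)"
 have e: "0 < e" using Fb ac Fc unfolding e_def by auto
 have "continuous_on {-1..1} (f ^^ m)" by (rule unim_pow_cont[OF u])
 then have "\<exists>d>0. \<forall>x\<in>{-1..1}. dist x b < d \<longrightarrow> dist ((f ^^ m) x) ((f ^^ m) b) < e"
  using e bd unfolding continuous_on_iff by simp
 then obtain d2 where d2: "d2 > 0" "\<And>x. -1 \<le> x ==> x \<le> 1 ==> \<bar>x - b\<bar> < d2 ==> \<bar>(f ^^ m) x - (f ^^ m) b\<bar> < e"
  unfolding dist_real_def by auto
 define d where "d = min (min d1 (d2/2)) (1 - b)"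
 have d: "0 < d" "d \<le> d1" "d < d2" "b + d \<le> 1" using d1 d2 b unfolding d_def by auto
 have Fin: "(f ^^ m) x \<in> {a..b+d}" if x: "x \<in> {a..b+d}" for x
 proof (cases "x \<le> b")
  case True then show ?thesis using cyc_inv[OF cy, of x] x d by simp
 next
  case False
  then have "\<bar>(f ^^ m) x - (f ^^ m) b\<bar> < e" using d2(2)[of x] x d bd by auto
  then show ?thesis using d(1) unfolding e_def by (auto simp: abs_if split: if_splits)
 qed
 have "\<not> ovl ((f ^^ s) ` {a..b+d}) {a..b+d}" if s: "0 < s" "s < m" for s
 proof
  assume "ovl ((f ^^ s) ` {a..b+d}) {a..b+d}"
  then obtain x0 y where y0: "x0 < y" "{x0..y} \<subseteq> (f ^^ s) ` {a..b+d} \<inter> {a..b+d}" unfolding ovl_def by blast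
  have "x0 \<in> {x0..y}" "y \<in> {x0..y}" using y0(1) by auto
  then have y: "y \<in> (f ^^ s) ` {a..b+d}" "y \<le> b + d" "a \<le> x0" using y0(2) by (auto simp del: atLeastAtMost_iff simp: subset_iff) (meson atLeastAtMost_iff)+
  then obtain x where x: "x \<in> {a..b+d}" "(f ^^ s) x = y" by blast
  have "d \<le> D s" using d(2) d1 s by fastforce
  then show False using D(2)[OF s(2,1), of x] x d y y0(1) by auto
 qed
 moreover have "(f ^^ m) ` {a..b+d} \<subseteq> {a..b+d}" using Fin by blast
 ultimately have "cyc f c m a (b + d)" using bd d unfolding cyc_def by auto
 then show False using mc d(1) unfolding maxcyc_def by force
qed

lemma maxcyc_refl: assumes "maxcyc f c m a b" shows "maxcyc (refl_map f) (-c) m (-b) (-a)"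
proof -
 have "- b \<le> a' \<and> b' \<le> - a" if "cyc (refl_map f) (-c) m a' b'" for a' b'
  using cyc_refl[OF that] assms unfolding maxcyc_def by force
 then show ?thesis using assms cyc_refl unfolding maxcyc_def by blast
qed

lemma peak_refl_pow: "peak (refl_map f ^^ m) (-b) (-c) (-a) \<longleftrightarrow> valley (f ^^ m) a c b"
proof -
 have "refl_map f ^^ m = (\<lambda>x. - (f ^^ m) (- x))" by (auto simp: refl_map_pow)
 then show ?thesis by (simp add: peak_refl)
qed

lemma max_valley_right:
 assumes u: "unim f c" and mc: "maxcyc f c m a b" and pk: "valley (f ^^ m) a c b" and b: "b < 1"
 shows "(f ^^ m) b = b"
 using max_peak_left[OF unim_refl[OF u] maxcyc_refl[OF mc]] pk b by (simp add: peak_refl_pow refl_map_pow)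

lemma max_valley_left:
 assumes u: "unim f c" and mc: "maxcyc f c m a b" and pk: "valley (f ^^ m) a c b" and a: "-1 < a"
 shows "(f ^^ m) a = b"
 using max_peak_right[OF unim_refl[OF u] maxcyc_refl[OF mc]] pk a by (simp add: peak_refl_pow refl_map_pow)

section \<open>The renormalization interval and its endpoints\<close>

lemma at_Icc_not_bot: "x \<in> {-1..1::real} ==> at x within {-1..1} \<noteq> bot"
 by (simp add: at_within_Icc_at trivial_limit_within islimpt_Icc)

lemma deriv_unique_Icc:
 fixes f :: "real \<Rightarrow> real"
 assumes "(f has_real_derivative D) (at x within {-1..1})" "(f has_real_derivative E) (at x within {-1..1})" "x \<in> {-1..1}"
 shows "D = E"
 using has_field_derivative_unique[OF assms(1,2)] at_Icc_not_bot[OF assms(3)] by blast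

lemma turning_point_unique:
 assumes "turning_point f c" "turning_point f d"
 shows "c = d"
proof -
 have False if t: "turning_point f c" "turning_point f d" "c < d" for c d
 proof -
  define x where "x = (c + d) / 2"
  have cd: "-1 < c" "d < 1" using t unfolding turning_point_def by auto
  have x: "x \<in> {c<..1}" "x \<in> {-1..<d}" "x \<in> {-1..1}" using t(3) cd unfolding x_def by auto
  obtain D where D: "D < 0" "(f has_real_derivative D) (at x within {-1..1})" using t(1) x(1) unfolding turning_point_def by blast
  obtain E where E: "E > 0" "(f has_real_derivative E) (at x within {-1..1})" using t(2) x(2) unfolding turning_point_def by blast
  show False using deriv_unique_Icc[OF D(2) E(2) x(3)] D(1) E(1) by simp
 qed
 then show ?thesis using assms by (meson linorder_neqE)
qed

lemma crit_eq: "turning_point f c ==> crit f = c"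
 unfolding crit_def using turning_point_unique by (metis the_equality)

text \<open>A continuous derivative \<open>df\<close> on the closed interval, one-sided at -1 and 1,
  is fixed together with f, because products of it along orbits are estimated later.\<close>

definition umap :: "real \<Rightarrow> (real \<Rightarrow> real) \<Rightarrow> (real \<Rightarrow> real) \<Rightarrow> real \<Rightarrow> bool" where
 "umap \<alpha> f df c \<longleftrightarrow> unim f c \<and> peak f (-1) c 1 \<and> crit f = c \<and> continuous_on {-1..1} df \<and>
  (\<forall>x\<in>{-1..1}. (f has_real_derivative df x) (at x within {-1..1})) \<and>
  (\<forall>x. -1 \<le> x \<longrightarrow> x < c \<longrightarrow> 0 < df x) \<and> (\<forall>x. c < x \<longrightarrow> x \<le> 1 \<longrightarrow> df x < 0) \<and> df c = 0 \<and>
  smooth_on f {-1..<c} \<and> smooth_on f {c<..1} \<and> (\<exists>\<phi> \<psi>. normal_form \<alpha> f c \<phi> \<psi>)"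

lemma unimodal_umap:
 assumes f: "f \<in> unimodal \<alpha>"
 shows "\<exists>df. umap \<alpha> f df (crit f)"
proof -
 obtain c where c: "turning_point f c" "smooth_on f {-1..<c}" "smooth_on f {c<..1}" "\<exists>\<phi> \<psi>. normal_form \<alpha> f c \<phi> \<psi>"
  and maps: "f ` {-1..1} \<subseteq> {-1..1}" and C1: "C1_on f {-1..1}"
  using f unfolding unimodal_def by blast
 obtain df where df: "continuous_on {-1..1} df" "\<And>x. x \<in> {-1..1} ==> (f has_real_derivative df x) (at x within {-1..1})"
  using C1 unfolding C1_on_def by blast
 have cb: "-1 < c" "c < 1" using c(1) unfolding turning_point_def by auto
 have pos: "0 < df x" if x: "-1 \<le> x" "x < c" for x
 proof -
  obtain D where D: "D > 0" "(f has_real_derivative D) (at x within {-1..1})"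
   using c(1) x unfolding turning_point_def by (meson atLeastLessThan_iff)
  then show ?thesis using deriv_unique_Icc[OF D(2) df(2)] x cb by simp
 qed
 have neg: "df x < 0" if x: "c < x" "x \<le> 1" for x
 proof -
  obtain D where D: "D < 0" "(f has_real_derivative D) (at x within {-1..1})"
   using c(1) x unfolding turning_point_def by (meson greaterThanAtMost_iff)
  then show ?thesis using deriv_unique_Icc[OF D(2) df(2)] x cb by simp
 qed
 have cont: "continuous_on {-1..1} f"
  using df(2) by (meson DERIV_continuous continuous_on_eq_continuous_within)
 have der: "DERIV f x :> df x" if "-1 < x" "x < 1" for x
  using df(2)[of x] that by (simp add: at_within_Icc_at)
 have inc: "f x < f y" if "-1 \<le> x" "x < y" "y \<le> c" for x y
 proof (rule DERIV_pos_imp_increasing_open[OF that(2)])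
  fix z assume z: "x < z" "z < y"
  then show "\<exists>d. DERIV f z :> d \<and> 0 < d" using der[of z] pos[of z] that cb by auto
 next
  show "continuous_on {x..y} f" using that cb by (intro continuous_on_subset[OF cont]) auto
 qed
 have dec: "f y < f x" if "c \<le> x" "x < y" "y \<le> 1" for x y
 proof (rule DERIV_neg_imp_decreasing_open[OF that(2)])
  fix z assume z: "x < z" "z < y"
  then show "\<exists>d. DERIV f z :> d \<and> d < 0" using der[of z] neg[of z] that cb by auto
 next
  show "continuous_on {x..y} f" using that cb by (intro continuous_on_subset[OF cont]) auto
 qed
 have pk: "peak f (-1) c 1" unfolding peak_def using inc dec by blast
 have dfc: "df c = 0"
 proof -
  have "isCont df c" using df(1) cb continuous_on_interior[of "{-1..1}" df c] by simp
  then have t: "(df \<longlongrightarrow> df c) (at_left c)" "(df \<longlongrightarrow> df c) (at_right c)"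
   unfolding isCont_def by (auto intro: tendsto_mono[OF at_le])
  have "\<forall>\<^sub>F x in at_left c. 0 \<le> df x"
   using eventually_at_left_real[OF cb(1)] by eventually_elim (auto intro!: less_imp_le pos)
  then have "0 \<le> df c" using tendsto_lowerbound[OF t(1)] by simp
  moreover have "\<forall>\<^sub>F x in at_right c. df x \<le> 0"
   using eventually_at_right_real[OF cb(2)] by eventually_elim (auto intro!: less_imp_le neg)
  then have "df c \<le> 0" using tendsto_upperbound[OF t(2)] by simp
  ultimately show ?thesis by simp
 qed
 have "unim f c" unfolding unim_def using cont maps cb pk by blast
 moreover have "crit f = c" by (rule crit_eq[OF c(1)])
 ultimately show ?thesis unfolding umap_def using c(2-4) pk df pos neg dfc by auto
qed

lemma umapD:
 assumes "umap \<alpha> f df c"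
 shows "unim f c" "peak f (-1) c 1" "crit f = c" "continuous_on {-1..1} df"
  "x \<in> {-1..1} ==> (f has_real_derivative df x) (at x within {-1..1})"
  "-1 \<le> x ==> x < c ==> 0 < df x" "c < x ==> x \<le> 1 ==> df x < 0" "df c = 0"
  "-1 < c" "c < 1"
 using assms unim_c[of f c] unfolding umap_def by simp_all

definition dpow :: "(real \<Rightarrow> real) \<Rightarrow> (real \<Rightarrow> real) \<Rightarrow> nat \<Rightarrow> real \<Rightarrow> real" where
 "dpow f df n x = (\<Prod>i<n. df ((f ^^ i) x))"

lemma dpow_deriv:
 assumes u: "umap \<alpha> f df c" and x: "x \<in> {-1..1}"
 shows "((f ^^ n) has_real_derivative dpow f df n x) (at x within {-1..1})"
proof (induction n)
 case (Suc n)
 have m: "(f ^^ n) ` {-1..1} \<subseteq> {-1..1}" by (rule unim_pow_image[OF umapD(1)[OF u]]) simp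
 have "(f has_real_derivative df ((f ^^ n) x)) (at ((f ^^ n) x) within (f ^^ n) ` {-1..1})"
  by (rule has_field_derivative_subset[OF umapD(5)[OF u] m]) (rule unim_pow_maps[OF umapD(1)[OF u] x])
 from DERIV_image_chain[OF this Suc] show ?case by (simp add: dpow_def mult.commute comp_def)
qed (simp add: dpow_def id_def)

lemma dpow_nonzero:
 assumes u: "umap \<alpha> f df c" and x: "x \<in> {-1..1}" and av: "\<And>i. i < n ==> (f ^^ i) x \<noteq> c"
 shows "dpow f df n x \<noteq> 0"
proof -
 have "df ((f ^^ i) x) \<noteq> 0" if "i < n" for i
 proof -
  have "(f ^^ i) x \<in> {-1..1}" by (rule unim_pow_maps[OF umapD(1)[OF u] x])
  then show ?thesis using umapD(6,7)[OF u, of "(f ^^ i) x"] av[OF that] by force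
 qed
 then show ?thesis unfolding dpow_def by simp
qed

text \<open>Discharges the definite description: the maximal cyclic interval is unique because two
  maximal intervals contain each other.\<close>

lemma max_renorm_interval_eq:
 assumes u: "umap \<alpha> f df c" and mc: "maxcyc f c (renorm_period f) A B"
 shows "max_renorm_interval f = (A, B)"
proof -
 have e: "renorm_interval f m a b \<longleftrightarrow> cyc f c m a b" for m a b
  by (rule renorm_interval_cyc[OF umapD(1,3)[OF u]])
 have AB: "cyc f c (renorm_period f) A B" using mc by (simp add: maxcyc_def)
 show ?thesis unfolding max_renorm_interval_def e
 proof (rule the_equality)
  show "case (A, B) of (a, b) \<Rightarrow> cyc f c (renorm_period f) a b \<and> (\<forall>a' b'. cyc f c (renorm_period f) a' b' \<longrightarrow> {a'..b'} \<subseteq> {a..b})"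
   using mc unfolding maxcyc_def by (auto simp: )
 next
  fix x assume x: "case x of (a, b) \<Rightarrow> cyc f c (renorm_period f) a b \<and> (\<forall>a' b'. cyc f c (renorm_period f) a' b' \<longrightarrow> {a'..b'} \<subseteq> {a..b})"
  obtain a b where ab: "x = (a, b)" by (cases x)
  have c1: "cyc f c (renorm_period f) a b" "{A..B} \<subseteq> {a..b}" using x AB ab by auto
  have "A \<le> a" "b \<le> B" using mc c1(1) unfolding maxcyc_def by blast+
  moreover have "A \<le> B" using cyc_bounds(2,3)[OF AB] by simp
  ultimately show "x = (A, B)" using c1(2) ab by auto
 qed
qed

lemma inv_aff: "p \<noteq> q ==> inv (aff p q) x = ((q - p) * x + p + q) / 2" for p q :: "'a::field_char_0"
proof (rule inv_f_eq)
 assume pq: "p \<noteq> q"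
 show "inj (aff p q)" using pq by (auto simp: inj_def aff_def divide_simps)
 show "aff p q (((q - p) * x + p + q) / 2) = x" using pq by (simp add: aff_def field_simps)
qed

lemma aff_ends: "p \<noteq> q ==> aff p q p = -1" "p \<noteq> q ==> aff p q q = 1" for p q :: "'a::field_char_0"
 by (simp_all add: aff_def divide_simps)

lemma aff_inv_aff: "p \<noteq> q ==> inv (aff p q) (aff p q x) = x" "p \<noteq> q ==> aff p q (inv (aff p q) x) = x" for p q :: "'a::field_char_0"
 by (simp_all add: inv_aff) (simp_all add: aff_def field_simps)

text \<open>The orientation of the rescaling is read off the fold of \<open>f\<^sup>m\<close>: the endpoint \<open>p\<close> is fixed by \<open>f\<^sup>m\<close>.\<close>

lemma endpoints:
 assumes u: "umap \<alpha> f df c" and mc: "maxcyc f c m a b" and m: "2 \<le> m"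
 shows "b < 1" "(peak (f ^^ m) a c b \<and> -1 < a \<and> (f ^^ m) a = a \<and> (f ^^ m) b = a) \<or>
  (valley (f ^^ m) a c b \<and> (f ^^ m) b = b \<and> (f (-1) = -1 \<longrightarrow> -1 < a \<and> (f ^^ m) a = b))"
proof -
 note un = umapD(1)[OF u] and pk = umapD(2)[OF u]
 have cy: "cyc f c m a b" using mc by (simp add: maxcyc_def)
 note bd = cyc_bounds[OF cy]
 have fmax: "f x \<le> f c" if "x \<in> {-1..1}" for x
  using pk that bd unfolding peak_def by (metis atLeastAtMost_iff less_eq_real_def linorder_neqE_linordered_idom)
 have fmax': "f x < f c" if "x \<in> {-1..1}" "x \<noteq> c" for x
  using pk that bd unfolding peak_def by (metis atLeastAtMost_iff less_eq_real_def linorder_neqE_linordered_idom)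
 have fmin: "-1 < f x" if "-1 < x" "x < 1" for x
 proof (cases "x \<le> c")
  case True
  then have "f (-1) < f x" using pk that unfolding peak_def by auto
  then show ?thesis using unim_maps[OF un, of "-1"] by auto
 next
  case False
  then have "f 1 < f x" using pk that unfolding peak_def by auto
  then show ?thesis using unim_maps[OF un, of 1] by auto
 qed
 obtain l h where lh: "(f ^^ m) ` {a..b} = {l..h}" "l < h" using pow_Icc_ex[OF un bd, of m] by blast
 obtain l1 h1 where lh1: "(f ^^ 1) ` {a..b} = {l1..h1}" "l1 < h1" "-1 \<le> l1" "h1 \<le> 1" using pow_Icc_ex[OF un bd, of 1] by blast
 have d1: "h1 \<le> a \<or> b \<le> l1" using no_ovl_cases[of l1 h1 a b] cyc_no_ovl[OF cy, of 1] m lh1 bd by simp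
 \<comment> \<open>If b = 1, the first image lies left of a, so f c \<le> a; then f^m = f o f^(m-1)
   sends [a,b] to the single point a.\<close>
 show b1: "b < 1"
 proof (rule ccontr)
  assume "\<not> b < 1"
  then have "b = 1" using bd by simp
  then have "h1 \<le> a" using d1 lh1 by auto
  then have fca: "f c \<le> a" using image_Icc_D[OF lh1(1), of c] bd by simp
  have "(f ^^ m) x \<le> a" if "x \<in> {-1..1}" for x
  proof -
   have "(f ^^ m) x = f ((f ^^ (m - 1)) x)" using m by (cases m) auto
   also have "\<dots> \<le> f c" by (rule fmax[OF unim_pow_maps[OF un that]])
   finally show ?thesis using fca by simp
  qed
  then have "(f ^^ m) x = a" if "x \<in> {a..b}" for x using cyc_inv[OF cy, of x] that bd by (meson atLeastAtMost_iff order_antisym order_trans)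
  then have "(f ^^ m) ` {a..b} \<subseteq> {a}" by blast
  then have "l = a" "h = a" using lh by auto
  then show False using lh(2) by simp
 qed
 \<comment> \<open>If a = -1 is a fixed point, the first image begins at a and overlaps
   [a,b].\<close>
 have am1: "-1 < a" if "f (-1) = -1"
 proof (rule ccontr)
  assume "\<not> -1 < a"
  then have a: "a = -1" using bd by simp
  then have "l1 = -1" using image_Icc_D[OF lh1(1), of "-1"] that lh1(3) bd by simp
  then show False using d1 lh1(2) a bd by simp
 qed
 have fold: "peak (f ^^ m) a c b \<or> valley (f ^^ m) a c b"
  using pow_fold[OF un bd, of m] cyc_avoid[OF un cy] m by simp
 \<comment> \<open>Inside (-1,1) the values of f exceed -1, so one step earlier the orbit of x is at
   -1 or 1. At -1, the image of order m - 1 would overlap [a,b]; at 1, the point before that is c,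
   which only x = c allows. Used at x = b to exclude a = -1 when f^m is a peak.\<close>
 have hitm1: "x = c" if x: "x \<in> {a..b}" "(f ^^ m) x = -1" "a = -1" for x
 proof (rule ccontr)
  assume xc: "x \<noteq> c"
  have xI: "x \<in> {-1..1}" using x bd by auto
  obtain k where k: "m = Suc (Suc k)" using m by (metis Suc_le_D numeral_2_eq_2 Suc_le_mono)
  define w where "w = (f ^^ k) x"
  define y where "y = f w"
  have y: "y = (f ^^ Suc k) x" "f y = -1" unfolding y_def w_def using x(2) k by auto
  have wI: "w \<in> {-1..1}" unfolding w_def by (rule unim_pow_maps[OF un xI])
  have yI: "y \<in> {-1..1}" unfolding y_def by (rule unim_maps[OF un wI])
  have "y = -1 \<or> y = 1" using fmin[of y] y(2) yI by force
  then show False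
  proof
   assume y1: "y = -1"
   obtain l2 h2 where lh2: "(f ^^ Suc k) ` {a..b} = {l2..h2}" "l2 < h2" "-1 \<le> l2" using pow_Icc_ex[OF un bd, of "Suc k"] by blast
   have "l2 \<le> -1" using image_Icc_D[OF lh2(1), of x] x(1) y y1 by simp
   moreover have "h2 \<le> a \<or> b \<le> l2" using no_ovl_cases[of l2 h2 a b] cyc_no_ovl[OF cy, of "Suc k"] k lh2 bd by simp
   ultimately show False using lh2 x(3) bd by auto
  next
   assume y1: "y = 1"
   have "w = c" using fmax'[of w] wI y1 y_def unim_maps[OF un, of c] bd by force
   then have "k \<noteq> 0" using xc unfolding w_def by (cases k) auto
   then have "c \<notin> (f ^^ k) ` {a..b}" using cyc_avoid[OF un cy, of k] k by simp
   then show False using \<open>w = c\<close> x(1) unfolding w_def by blast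
  qed
 qed
 show "(peak (f ^^ m) a c b \<and> -1 < a \<and> (f ^^ m) a = a \<and> (f ^^ m) b = a) \<or>
  (valley (f ^^ m) a c b \<and> (f ^^ m) b = b \<and> (f (-1) = -1 \<longrightarrow> -1 < a \<and> (f ^^ m) a = b))"
  using fold
 proof
  assume p: "peak (f ^^ m) a c b"
  have Fb: "(f ^^ m) b = a" by (rule max_peak_right[OF un mc p b1])
  have "a \<noteq> -1" using hitm1[of b] Fb bd by auto
  then have "-1 < a" using bd by simp
  then show ?thesis using p Fb max_peak_left[OF un mc p] by blast
 next
  assume v: "valley (f ^^ m) a c b"
  show ?thesis using v max_valley_right[OF un mc v b1] max_valley_left[OF un mc v] am1 by blast
 qed
qed

text \<open>Links the derivative test in \<open>rescaling_points\<close> to the shape of the fold.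
  The orbit of a avoids c before time m, so the derivative of f^m at a is nonzero and its sign is
  that of the monotonicity on [a,c].\<close>

lemma deriv_at_left_end:
 assumes u: "umap \<alpha> f df c" and cy: "cyc f c m a b"
 shows "peak (f ^^ m) a c b ==> \<exists>D>0. ((f ^^ m) has_real_derivative D) (at a within {-1..1})"
  "valley (f ^^ m) a c b ==> \<not> (\<exists>D>0. ((f ^^ m) has_real_derivative D) (at a within {-1..1}))"
proof -
 note un = umapD(1)[OF u]
 note bd = cyc_bounds[OF cy]
 have aI: "a \<in> {-1..1}" using bd by simp
 have "(f ^^ i) a \<noteq> c" if "i < m" for i
 proof (cases "i = 0")
  case True then show ?thesis using bd by simp
 next
  case False
  have "(f ^^ i) a \<in> (f ^^ i) ` {a..b}" using bd by auto
  then show ?thesis using cyc_avoid[OF un cy, of i] that False by auto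
 qed
 then have nz: "dpow f df m a \<noteq> 0" by (rule dpow_nonzero[OF u aI])
 have d: "((f ^^ m) has_real_derivative dpow f df m a) (at a within {-1..1})" by (rule dpow_deriv[OF u aI])
 show "\<exists>D>0. ((f ^^ m) has_real_derivative D) (at a within {-1..1})" if p: "peak (f ^^ m) a c b"
 proof (cases "0 < dpow f df m a")
  case True then show ?thesis using d by blast
 next
  case False
  then obtain e where e: "e > 0" "\<And>h. h > 0 ==> a + h \<in> {-1..1} ==> h < e ==> (f ^^ m) (a + h) < (f ^^ m) a"
   using has_real_derivative_neg_dec_right[OF d] nz by force
  define h where "h = min (e/2) (c - a)"
  have h: "0 < h" "h < e" "a + h \<le> c" using e(1) bd unfolding h_def by auto
  then have "(f ^^ m) (a + h) < (f ^^ m) a" using e(2)[of h] bd by auto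
  moreover have "(f ^^ m) a < (f ^^ m) (a + h)" using p h unfolding peak_def by auto
  ultimately show ?thesis by simp
 qed
 show "\<not> (\<exists>D>0. ((f ^^ m) has_real_derivative D) (at a within {-1..1}))" if p: "valley (f ^^ m) a c b"
 proof
  assume "\<exists>D>0. ((f ^^ m) has_real_derivative D) (at a within {-1..1})"
  then obtain D where D: "D > 0" "((f ^^ m) has_real_derivative D) (at a within {-1..1})" by blast
  obtain e where e: "e > 0" "\<And>h. h > 0 ==> a + h \<in> {-1..1} ==> h < e ==> (f ^^ m) a < (f ^^ m) (a + h)"
   using has_real_derivative_pos_inc_right[OF D(2,1)] by blast
  define h where "h = min (e/2) (c - a)"
  have h: "0 < h" "h < e" "a + h \<le> c" using e(1) bd unfolding h_def by auto
  then have "(f ^^ m) a < (f ^^ m) (a + h)" using e(2)[of h] bd by auto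
  moreover have "(f ^^ m) (a + h) < (f ^^ m) a" using p h unfolding valley_def by auto
  ultimately show False by simp
 qed
qed

lemma renorm_structure:
 assumes u: "umap \<alpha> f df c" and r: "renormalizable f"
 obtains m p q where "m = renorm_period f" "2 \<le> m" "rescaling_points f = (p, q)" "p \<noteq> q"
  "cyc f c m (min p q) (max p q)" "max p q < 1" "(f ^^ m) p = p"
  "f (-1) = -1 ==> -1 < min p q \<and> (f ^^ m) q = p"
  "renorm f = aff p q \<circ> (f ^^ m) \<circ> inv (aff p q)"
proof -
 note un = umapD(1)[OF u]
 have e: "renorm_interval f m a b \<longleftrightarrow> cyc f c m a b" for m a b
  by (rule renorm_interval_cyc[OF umapD(1,3)[OF u]])
 define m where "m = renorm_period f"
 have "\<exists>m. m \<ge> 2 \<and> (\<exists>a b. renorm_interval f m a b)" using r unfolding renormalizable_def by blast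
 then have "m \<ge> 2 \<and> (\<exists>a b. renorm_interval f m a b)" unfolding m_def renorm_period_def by (rule LeastI_ex)
 then obtain a0 b0 where m: "2 \<le> m" and c0: "cyc f c m a0 b0" unfolding e by blast
 obtain a b where mc: "maxcyc f c m a b" using cyc_max_exists[OF un c0] unfolding maxcyc_def by blast
 have cy: "cyc f c m a b" using mc by (simp add: maxcyc_def)
 note bd = cyc_bounds[OF cy]
 have mi: "max_renorm_interval f = (a, b)" using max_renorm_interval_eq[OF u] mc unfolding m_def by blast
 have rp: "rescaling_points f = (if \<exists>D>0. ((f ^^ m) has_real_derivative D) (at a within {-1..1}) then (a, b) else (b, a))"
  unfolding rescaling_points_def mi m_def by simp
 have ren: "renorm f = aff p q \<circ> (f ^^ m) \<circ> inv (aff p q)" if "rescaling_points f = (p, q)" for p q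
  unfolding renorm_def that m_def by simp
 note ends = endpoints[OF u mc m]
 have ab: "a < b" using bd by simp
 from ends(2) show ?thesis
 proof
  assume A: "peak (f ^^ m) a c b \<and> -1 < a \<and> (f ^^ m) a = a \<and> (f ^^ m) b = a"
  have "rescaling_points f = (a, b)" using rp deriv_at_left_end(1)[OF u cy] A by simp
  then show ?thesis using that[of m a b] m_def m cy ends(1) A ren ab by (simp add: min_absorb1 max_absorb2)
 next
  assume A: "valley (f ^^ m) a c b \<and> (f ^^ m) b = b \<and> (f (-1) = -1 \<longrightarrow> -1 < a \<and> (f ^^ m) a = b)"
  have "rescaling_points f = (b, a)" using rp deriv_at_left_end(2)[OF u cy] A by simp
  then show ?thesis using that[of m b a] m_def m cy ends(1) A ren ab by (simp add: min_absorb2 max_absorb1)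
 qed
qed

text \<open>The endpoint p is fixed by f^m and corresponds to -1. Hence one renormalization produces
  the fixed point -1, and a second one also sends 1 to -1.\<close>

lemma renorm_boundary:
 assumes u: "umap \<alpha> f df c" and r: "renormalizable f"
 shows "renorm f (-1) = -1" "f (-1) = -1 ==> renorm f 1 = -1"
proof -
 obtain m p q where S: "p \<noteq> q" "(f ^^ m) p = p" "f (-1) = -1 ==> -1 < min p q \<and> (f ^^ m) q = p"
  "renorm f = aff p q \<circ> (f ^^ m) \<circ> inv (aff p q)" using renorm_structure[OF u r] by metis
 have "inv (aff p q) (-1) = p" "inv (aff p q) 1 = q" using S(1) by (simp_all add: inv_aff)
 then show "renorm f (-1) = -1" "f (-1) = -1 ==> renorm f 1 = -1"
  using S by (auto simp: aff_ends)
qed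

text \<open>If f c \<le> c, the image of [a,b] lies in [-1,a], which f then maps into itself, so f^m
  would collapse [a,b] to the point a. If f c = 1, the orbit of c ends at the fixed point -1, which
  is outside [a,b].\<close>

lemma cyc_not_beyond:
 assumes u: "umap \<alpha> f df c" and r: "renormalizable f" and f1: "f (-1) = -1" "f 1 = -1"
 shows "c < f c" "f c < 1"
proof -
 note un = umapD(1)[OF u] and pk = umapD(2)[OF u]
 obtain m p q where S: "2 \<le> m" "p \<noteq> q" "cyc f c m (min p q) (max p q)" "max p q < 1"
  "-1 < min p q \<and> (f ^^ m) q = p" using renorm_structure[OF u r] f1 by metis
 define a where "a = min p q" define b where "b = max p q"
 have cy: "cyc f c m a b" and am: "-1 < a" and b1: "b < 1" using S unfolding a_def b_def by auto
 note bd = cyc_bounds[OF cy]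
 obtain l h where lh: "(f ^^ m) ` {a..b} = {l..h}" "l < h" using pow_Icc_ex[OF un bd, of m] by blast
 obtain l1 h1 where lh1: "(f ^^ 1) ` {a..b} = {l1..h1}" "l1 < h1" using pow_Icc_ex[OF un bd, of 1] by blast
 show "c < f c"
 proof (rule ccontr)
  assume n: "\<not> c < f c"
  have d1: "h1 \<le> a \<or> b \<le> l1" using no_ovl_cases[of l1 h1 a b] cyc_no_ovl[OF cy, of 1] S(1) lh1 bd by simp
  then have "h1 \<le> a" using image_Icc_D[OF lh1(1), of c] n bd by auto
  then have fa: "f x \<le> a" if "a \<le> x" "x \<le> b" for x using image_Icc_D[OF lh1(1), of x] that by simp
  have "(f ^^ Suc i) x \<in> {-1..a}" if x: "x \<in> {a..b}" for x i
  proof (induction i)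
   case 0 then show ?case using fa[of x] x unim_maps[OF un, of x] bd by auto
  next
   case (Suc i)
   define y where "y = (f ^^ Suc i) x"
   have y: "-1 \<le> y" "y \<le> a" using Suc unfolding y_def by auto
   have "f y \<le> f a" using pk y bd unfolding peak_def by (metis less_eq_real_def)
   then have "f y \<le> a" using fa[of a] bd by simp
   moreover have "-1 \<le> f y" using unim_maps[OF un, of y] y bd by auto
   ultimately show ?case unfolding y_def by simp
  qed
  from this[of _ "m - 1"] have "(f ^^ m) x \<le> a" if "x \<in> {a..b}" for x using that S(1) by (metis Suc_pred' atLeastAtMost_iff less_le_trans pos2)
  then have "(f ^^ m) x = a" if "x \<in> {a..b}" for x using cyc_inv[OF cy, of x] that by (meson atLeastAtMost_iff order_antisym)
  then have "(f ^^ m) ` {a..b} \<subseteq> {a}" by blast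
  then have "l = a" "h = a" using lh by auto
  then show False using lh(2) by simp
 qed
 show "f c < 1"
 proof (rule ccontr)
  assume "\<not> f c < 1"
  then have fc: "f c = 1" using unim_maps[OF un, of c] bd by auto
  have "(f ^^ (i + 2)) c = -1" for i
  proof (induction i)
   case 0 then show ?case using fc f1 by (simp add: numeral_2_eq_2)
  qed (use f1 in simp)
  from this[of "m - 2"] have "(f ^^ m) c = -1" using S(1) by (metis le_add_diff_inverse2)
  then show False using cyc_inv[OF cy, of c] am bd by simp
 qed
qed

section \<open>Levels of an infinitely renormalizable map\<close>

text \<open>The affine coordinate of level k: it maps [-1,1] onto the k-th interval around the
  critical point, possibly reversing orientation, and conjugates \<open>(renorm ^^ k) f\<close> to
  the iterate of f of order \<open>tper f k\<close>.\<close>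

primrec scale_map :: "(real \<Rightarrow> real) \<Rightarrow> nat \<Rightarrow> real \<Rightarrow> real" where
 "scale_map f 0 = id"
| "scale_map f (Suc k) = scale_map f k \<circ> inv (case_prod aff (rescaling_points ((renorm ^^ k) f)))"

primrec tper :: "(real \<Rightarrow> real) \<Rightarrow> nat \<Rightarrow> nat" where
 "tper f 0 = 1"
| "tper f (Suc k) = tper f k * renorm_period ((renorm ^^ k) f)"

lemma aff_alt: "aff p q z = (2 * z - p - q) / (q - p)"
 unfolding aff_def by (simp add: algebra_simps)

lemma inf_renormD:
 assumes "g \<in> inf_renormalizable_maps \<alpha>"
 shows "(renorm ^^ k) g \<in> unimodal \<alpha>" "renormalizable ((renorm ^^ k) g)" "\<exists>df. umap \<alpha> ((renorm ^^ k) g) df (crit ((renorm ^^ k) g))"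
proof -
 have "(renorm ^^ k) g \<in> renormalizable_maps \<alpha>" using assms unfolding inf_renormalizable_maps_def by blast
 then show "(renorm ^^ k) g \<in> unimodal \<alpha>" "renormalizable ((renorm ^^ k) g)" unfolding renormalizable_maps_def by simp_all
 then show "\<exists>df. umap \<alpha> ((renorm ^^ k) g) df (crit ((renorm ^^ k) g))" using unimodal_umap by blast
qed

lemma inv_aff_between:
 assumes "p \<noteq> q" "x \<in> {-1..1::real}"
 shows "min p q \<le> inv (aff p q) x \<and> inv (aff p q) x \<le> max p q"
proof -
 have "2 * (inv (aff p q) x) = p * (1 - x) + q * (1 + x)" using assms(1) by (simp add: inv_aff field_simps)
 moreover have "min p q * (1 - x) \<le> p * (1 - x)" "min p q * (1 + x) \<le> q * (1 + x)"
  "p * (1 - x) \<le> max p q * (1 - x)" "q * (1 + x) \<le> max p q * (1 + x)"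
  using assms(2) by (intro mult_right_mono; simp)+
 moreover have "min p q * (1 - x) + min p q * (1 + x) = 2 * min p q" "max p q * (1 - x) + max p q * (1 + x) = 2 * max p q"
  by (simp_all add: algebra_simps)
 ultimately show ?thesis by linarith
qed

text \<open>At any point other than the one over crit f the derivative of f^m is a product of
  nonzero factors, whereas the derivative of \<open>renorm f\<close> vanishes at its own critical
  point.\<close>

lemma renorm_crit:
 assumes u: "umap \<alpha> f df (crit f)" and u': "umap \<alpha> (renorm f) df' (crit (renorm f))"
  and st: "p \<noteq> q" "cyc f (crit f) m (min p q) (max p q)" "renorm f = aff p q \<circ> (f ^^ m) \<circ> inv (aff p q)"
 shows "inv (aff p q) (crit (renorm f)) = crit f"
proof (rule ccontr)
 assume ne: "inv (aff p q) (crit (renorm f)) \<noteq> crit f"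
 let ?f' = "renorm f" define x where "x = crit ?f'"
 define A where "A = inv (aff p q)"
 have A: "A y = ((q - p) * y + p + q) / 2" for y unfolding A_def by (rule inv_aff[OF st(1)])
 have A1: "A y \<in> {min p q..max p q}" if "y \<in> {-1..1}" for y using inv_aff_between[OF st(1) that] unfolding A_def by auto
 have pq: "{min p q..max p q} \<subseteq> {-1..1}" using st(2) unfolding cyc_def by auto
 have x: "x \<in> {-1..1}" using umapD(9,10)[OF u'] unfolding x_def by simp
 have av: "(f ^^ i) (A x) \<noteq> crit f" if "i < m" for i
 proof (cases "i = 0")
  case True then show ?thesis using ne unfolding x_def A_def by simp
 next
  case False
  then have "crit f \<notin> (f ^^ i) ` {min p q..max p q}" using cyc_avoid[OF umapD(1)[OF u] st(2)] that by simp
  then show ?thesis using A1[OF x] by (metis imageI)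
 qed
 have Ax: "A x \<in> {-1..1}" using A1[OF x] pq by blast
 define D where "D = dpow f df m (A x)"
 have D0: "D \<noteq> 0" unfolding D_def by (rule dpow_nonzero[OF u Ax av])
 have "((f ^^ m) has_real_derivative D) (at (A x) within A ` {-1..1})"
  unfolding D_def by (rule DERIV_subset[OF dpow_deriv[OF u Ax]]) (use A1 pq in blast)
 moreover have "(A has_real_derivative (q - p) / 2) (at x within {-1..1})"
  unfolding A[abs_def] by (auto intro!: derivative_eq_intros)
 ultimately have "((\<lambda>y. (f ^^ m) (A y)) has_real_derivative D * ((q - p) / 2)) (at x within {-1..1})"
  by (rule DERIV_image_chain[unfolded comp_def])
 then have "((\<lambda>y. 2 / (q - p) * (f ^^ m) (A y) + - (p + q) / (q - p)) has_real_derivative 2 / (q - p) * (D * ((q - p) / 2)) + 0) (at x within {-1..1})"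
  by (intro DERIV_add DERIV_cmult DERIV_const)
 moreover have "2 / (q - p) * (D * ((q - p) / 2)) + 0 = D" using st(1) by simp
 moreover have "(\<lambda>y. 2 / (q - p) * (f ^^ m) (A y) + - (p + q) / (q - p)) = ?f'"
  unfolding st(3) A_def by (rule ext) (simp add: aff_alt add_divide_distrib diff_divide_distrib)
 ultimately have "(?f' has_real_derivative D) (at x within {-1..1})" by simp
 moreover have "(?f' has_real_derivative 0) (at x within {-1..1})"
  using umapD(5)[OF u' x] umapD(8)[OF u'] unfolding x_def by simp
 ultimately show False using deriv_unique_Icc[OF _ _ x] D0 by blast
qed

text \<open>The clauses are proved together because the induction step uses them jointly. Part (i)
  applies them to g itself, whose boundary values are arbitrary.\<close>

lemma inf_scale:
 assumes g: "g \<in> inf_renormalizable_maps \<alpha>"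
 shows "(\<exists>u v. v \<noteq> 0 \<and> (\<forall>x. scale_map g k x = u + v * x)) \<and> 0 < tper g k \<and>
  (\<forall>x. (g ^^ tper g k) (scale_map g k x) = scale_map g k ((renorm ^^ k) g x)) \<and>
  scale_map g k ` {-1..1} \<subseteq> {-1..1} \<and> scale_map g k (crit ((renorm ^^ k) g)) = crit g \<and>
  (\<forall>x\<in>{-1..1}. \<forall>i. 0 < i \<longrightarrow> i < tper g k \<longrightarrow> (g ^^ i) (scale_map g k x) \<noteq> crit g)"
proof (induction k)
 case 0
 have "\<exists>u v. v \<noteq> 0 \<and> (\<forall>x. scale_map g 0 x = u + v * (x::real))" by (rule exI[of _ 0], rule exI[of _ 1]) simp
 then show ?case by simp
next
 case (Suc k)
 define f where "f = (renorm ^^ k) g"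
 define S where "S = scale_map g k"
 define N where "N = tper g k"
 obtain a b where ab: "b \<noteq> 0" "\<And>x. S x = a + b * x" using Suc.IH unfolding S_def by blast
 have N: "0 < N" "\<And>x. (g ^^ N) (S x) = S (f x)" "S ` {-1..1} \<subseteq> {-1..1}" "S (crit f) = crit g"
  "\<And>x i. x \<in> {-1..1} ==> 0 < i ==> i < N ==> (g ^^ i) (S x) \<noteq> crit g"
  using Suc.IH unfolding S_def N_def f_def by blast+
 obtain df where u: "umap \<alpha> f df (crit f)" using inf_renormD(3)[OF g, of k] unfolding f_def by blast
 obtain df' where u': "umap \<alpha> (renorm f) df' (crit (renorm f))" using inf_renormD(3)[OF g, of "Suc k"] unfolding f_def by auto
 obtain m p q where st: "m = renorm_period f" "2 \<le> m" "rescaling_points f = (p, q)" "p \<noteq> q"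
  "cyc f (crit f) m (min p q) (max p q)" "renorm f = aff p q \<circ> (f ^^ m) \<circ> inv (aff p q)"
  using renorm_structure[OF u] inf_renormD(2)[OF g, of k] unfolding f_def by metis
 define A where "A = inv (aff p q)"
 have S': "scale_map g (Suc k) x = S (A x)" for x unfolding S_def A_def f_def[symmetric] using st(3) by (simp add: scale_map.simps(2) f_def)
 have N': "tper g (Suc k) = N * m" unfolding N_def st(1) f_def by (simp add: tper.simps(2))
 have it: "(g ^^ (N * j)) (S x) = S ((f ^^ j) x)" for j x
 proof (induction j)
  case (Suc j)
  then show ?case using N(2) by (simp add: funpow_add)
 qed simp
 have A: "A x \<in> {min p q..max p q}" if "x \<in> {-1..1}" for x using inv_aff_between[OF st(4) that] unfolding A_def by auto
 have pq: "{min p q..max p q} \<subseteq> {-1..1}" using st(5) unfolding cyc_def by auto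
 have fm: "(f ^^ j) y \<in> {-1..1}" if "y \<in> {-1..1}" for j y by (rule unim_pow_maps[OF umapD(1)[OF u] that])
 have inA: "A x \<in> {-1..1}" if "x \<in> {-1..1}" for x using A[OF that] pq by blast
 have aA: "A x = (p + q) / 2 + (q - p) / 2 * x" for x unfolding A_def inv_aff[OF st(4)] by (simp add: field_simps)
 have "scale_map g (Suc k) x = (a + b * ((p + q) / 2)) + (b * ((q - p) / 2)) * x" for x
  unfolding S' ab(2) aA by (simp only: distrib_left mult.assoc add.assoc)
 moreover have "b * ((q - p) / 2) \<noteq> 0" using ab(1) st(4) by simp
 ultimately have 1: "\<exists>u v. v \<noteq> 0 \<and> (\<forall>x. scale_map g (Suc k) x = u + v * x)" by blast
 have 2: "0 < tper g (Suc k)" unfolding N' using N(1) st(2) by simp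
 have 3: "(g ^^ tper g (Suc k)) (scale_map g (Suc k) x) = scale_map g (Suc k) ((renorm ^^ Suc k) g x)" for x
 proof -
  have "(renorm ^^ Suc k) g x = aff p q ((f ^^ m) (A x))" using st(6) unfolding f_def A_def by simp
  then have "A ((renorm ^^ Suc k) g x) = (f ^^ m) (A x)" unfolding A_def using aff_inv_aff(1)[OF st(4)] by simp
  then show ?thesis unfolding N' S' it by simp
 qed
 have 4: "scale_map g (Suc k) ` {-1..1} \<subseteq> {-1..1}"
 proof (rule image_subsetI)
  fix x :: real assume "x \<in> {-1..1}"
  then show "scale_map g (Suc k) x \<in> {-1..1}" unfolding S' using inA N(3) by blast
 qed
 have 5: "scale_map g (Suc k) (crit ((renorm ^^ Suc k) g)) = crit g"
  using renorm_crit[OF u u' st(4-6)] N(4) unfolding S' A_def f_def by simp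
 have 6: "(g ^^ i) (scale_map g (Suc k) x) \<noteq> crit g" if x: "x \<in> {-1..1}" and i: "0 < i" "i < tper g (Suc k)" for x i
 proof -
  \<comment> \<open>For s > 0 the point is in an intermediate image of the level-k interval, for s =
    0 in the j-th image of the renormalization interval of the k-th renormalization; in both cases
    it differs from the critical point.\<close>
  define j where "j = i div N" define s where "s = i mod N"
  have ij: "i = s + N * j" "s < N" unfolding j_def s_def using N(1) by simp_all
  have "N * j < N * m" using i(2) ij(1) unfolding N' by linarith
  then have jm: "j < m" unfolding mult_less_cancel1 by blast
  have eq: "(g ^^ i) (scale_map g (Suc k) x) = (g ^^ s) (S ((f ^^ j) (A x)))"
   unfolding ij(1) S' funpow_add comp_apply it ..
  show ?thesis
  proof (cases "s = 0")
   case False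
   then show ?thesis unfolding eq using N(5)[OF fm[OF inA[OF x]], of s j] ij(2) by simp
  next
   case True
   then have j0: "0 < j" using ij i(1) by (cases j) simp_all
   have "crit f \<notin> (f ^^ j) ` {min p q..max p q}" by (rule cyc_avoid[OF umapD(1)[OF u] st(5) j0 jm])
   then have "(f ^^ j) (A x) \<noteq> crit f" using A[OF x] by (metis imageI)
   then have "S ((f ^^ j) (A x)) \<noteq> S (crit f)" unfolding ab(2) using ab(1) by simp
   then show ?thesis unfolding eq True N(4) by simp
  qed
 qed
 show ?case using 1 2 3 4 5 6 by blast
qed

text \<open>The two boundary conditions may fail for \<open>f\<close> itself, but they hold from \<open>\<R>\<^sup>2 f\<close> on.\<close>

definition inf_base :: "real \<Rightarrow> (real \<Rightarrow> real) \<Rightarrow> bool" where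
 "inf_base \<alpha> f \<longleftrightarrow> f \<in> inf_renormalizable_maps \<alpha> \<and> f (-1) = -1 \<and> f 1 = -1"

lemma inf_base_renorm:
 assumes "inf_base \<alpha> f" shows "inf_base \<alpha> (renorm f)"
proof -
 have inf: "(renorm ^^ n) f \<in> renormalizable_maps \<alpha>" for n
  using assms unfolding inf_base_def inf_renormalizable_maps_def by blast
 have "(renorm ^^ n) (renorm f) \<in> renormalizable_maps \<alpha>" for n
  using inf[of "Suc n"] by (simp add: funpow_swap1)
 moreover have "f \<in> unimodal \<alpha>" "renormalizable f" using inf[of 0] unfolding renormalizable_maps_def by simp_all
 then obtain df where u: "umap \<alpha> f df (crit f)" using unimodal_umap by blast
 ultimately show ?thesis using renorm_boundary[OF u \<open>renormalizable f\<close>] assms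
  unfolding inf_base_def inf_renormalizable_maps_def by simp
qed

lemma inf_base_pow: "inf_base \<alpha> f ==> inf_base \<alpha> ((renorm ^^ k) f)"
 by (induction k) (auto intro: inf_base_renorm)

lemma inf_base_umap:
 assumes "inf_base \<alpha> f"
 shows "\<exists>df. umap \<alpha> f df (crit f)" "renormalizable f"
proof -
 have "(renorm ^^ 0) f \<in> renormalizable_maps \<alpha>"
  using assms unfolding inf_base_def inf_renormalizable_maps_def by blast
 then have "f \<in> unimodal \<alpha>" "renormalizable f" unfolding renormalizable_maps_def by simp_all
 then show "\<exists>df. umap \<alpha> f df (crit f)" "renormalizable f" using unimodal_umap by blast+
qed

lemma inf_base_structure:
 assumes b: "inf_base \<alpha> f"
 obtains m p q where "m = renorm_period f" "2 \<le> m" "rescaling_points f = (p, q)" "p \<noteq> q"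
  "cyc f (crit f) m (min p q) (max p q)" "-1 < min p q" "max p q < 1" "(f ^^ m) p = p" "(f ^^ m) q = p"
  "renorm f = aff p q \<circ> (f ^^ m) \<circ> inv (aff p q)"
proof -
 obtain df where u: "umap \<alpha> f df (crit f)" using inf_base_umap(1)[OF b] by blast
 have f1: "f (-1) = -1" using b unfolding inf_base_def by simp
 obtain m p q where "m = renorm_period f" "2 \<le> m" "rescaling_points f = (p, q)" "p \<noteq> q"
  "cyc f (crit f) m (min p q) (max p q)" "max p q < 1" "(f ^^ m) p = p"
  "f (-1) = -1 ==> -1 < min p q \<and> (f ^^ m) q = p"
  "renorm f = aff p q \<circ> (f ^^ m) \<circ> inv (aff p q)"
  using renorm_structure[OF u inf_base_umap(2)[OF b]] by metis
 then show ?thesis using that f1 by simp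
qed

lemma inf_base_scale:
 assumes "inf_base \<alpha> f"
 shows scale_affine: "\<exists>u v. v \<noteq> 0 \<and> (\<forall>x. scale_map f k x = u + v * x)"
  and scale_conj: "(f ^^ tper f k) (scale_map f k x) = scale_map f k ((renorm ^^ k) f x)"
  and scale_crit: "scale_map f k (crit ((renorm ^^ k) f)) = crit f"
 using inf_scale[of f \<alpha> k] assms unfolding inf_base_def by blast+

lemma scale_step_range:
 assumes b: "inf_base \<alpha> f" and x: "x \<in> {-1..1}"
 shows "inv (case_prod aff (rescaling_points ((renorm ^^ k) f))) x \<in> {-1<..<1}"
proof -
 obtain p q where pq: "rescaling_points ((renorm ^^ k) f) = (p, q)" "p \<noteq> q" "-1 < min p q" "max p q < 1"
  using inf_base_structure[OF inf_base_pow[OF b, of k]] by metis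
 show ?thesis using inv_aff_between[OF pq(2) x] pq by auto
qed

lemma scale_range_aux:
 assumes b: "inf_base \<alpha> f"
 shows "x \<in> {-1..1} ==> scale_map f k x \<in> {-1..1} \<and> (x \<in> {-1<..<1} \<longrightarrow> scale_map f k x \<in> {-1<..<1})"
proof (induction k arbitrary: x)
 case (Suc k)
 define y where "y = inv (case_prod aff (rescaling_points ((renorm ^^ k) f))) x"
 have y: "y \<in> {-1<..<1}" unfolding y_def by (rule scale_step_range[OF b Suc.prems])
 then have "y \<in> {-1..1}" by simp
 from Suc.IH[OF this] y show ?case unfolding y_def by simp
qed simp

lemma scale_range:
 assumes b: "inf_base \<alpha> f" and x: "x \<in> {-1..1}"
 shows "scale_map f k x \<in> {-1..1}" "k > 0 ==> scale_map f k x \<in> {-1<..<1}"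
proof -
 show "scale_map f k x \<in> {-1..1}" using scale_range_aux[OF b x] by blast
 show "scale_map f k x \<in> {-1<..<1}" if k0: "k > 0"
 proof -
  obtain j where k: "k = Suc j" using k0 by (cases k) simp_all
  define y where "y = inv (case_prod aff (rescaling_points ((renorm ^^ j) f))) x"
  have y: "y \<in> {-1<..<1}" unfolding y_def by (rule scale_step_range[OF b x])
  then have "y \<in> {-1..1}" by simp
  from scale_range_aux[OF b this, of j] y show ?thesis unfolding k y_def by simp
 qed
qed

lemma renorm_maps:
 assumes b: "inf_base \<alpha> f" and x: "x \<in> {-1..1}"
 shows "(renorm ^^ k) f x \<in> {-1..1}"
proof -
 obtain df where "umap \<alpha> ((renorm ^^ k) f) df (crit ((renorm ^^ k) f))"
  using inf_base_umap(1)[OF inf_base_pow[OF b]] by blast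
 then show ?thesis using unim_maps umapD(1) x by blast
qed

lemma renorm_pow_maps:
 assumes b: "inf_base \<alpha> f" and x: "x \<in> {-1..1}"
 shows "(((renorm ^^ k) f) ^^ n) x \<in> {-1..1}"
 by (induction n) (use x renorm_maps[OF b] in auto)

lemma scale_conj_iter:
 assumes b: "inf_base \<alpha> f"
 shows "(f ^^ (tper f k * n)) (scale_map f k x) = scale_map f k ((((renorm ^^ k) f) ^^ n) x)"
 by (induction n) (simp_all add: funpow_add scale_conj[OF b])

section \<open>Level intervals as cyclic intervals of the original map\<close>

definition lo :: "(real \<Rightarrow> real) \<Rightarrow> nat \<Rightarrow> real" where "lo f k = min (scale_map f k (-1)) (scale_map f k 1)"
definition hi :: "(real \<Rightarrow> real) \<Rightarrow> nat \<Rightarrow> real" where "hi f k = max (scale_map f k (-1)) (scale_map f k 1)"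

lemma affine_image_Icc:
 fixes u v :: real
 assumes "v \<noteq> 0" "l \<le> h"
 shows "(\<lambda>x. u + v * x) ` {l..h} = {min (u + v * l) (u + v * h)..max (u + v * l) (u + v * h)}"
proof -
 have "(\<lambda>x. u + v * x) ` {l..h} = (+) u ` (*) v ` {l..h}" by (simp add: image_image)
 also have "\<dots> = (if 0 < v then {u + v * l..u + v * h} else {u + v * h..u + v * l})"
 proof (cases "0 < v")
  case True then show ?thesis using assms by (simp add: image_mult_atLeastAtMost)
 next
  case False
  then have "v < 0" using assms by simp
  then have "(*) v ` {l..h} = {v * h..v * l}"
   using image_mult_atLeastAtMost_if[of v l h] assms by simp
  then show ?thesis using False by simp
 qed
 also have "\<dots> = {min (u + v * l) (u + v * h)..max (u + v * l) (u + v * h)}"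
  using assms by (auto simp: min_def max_def mult_le_cancel_left split: if_splits)
 finally show ?thesis .
qed

lemma scale_image:
 assumes b: "inf_base \<alpha> f" and lh: "l \<le> h"
 shows "scale_map f k ` {l..h} = {min (scale_map f k l) (scale_map f k h)..max (scale_map f k l) (scale_map f k h)}"
proof -
 obtain u v where uv: "v \<noteq> 0" "\<forall>x. scale_map f k x = u + v * x" using scale_affine[OF b] by blast
 then have "scale_map f k = (\<lambda>x. u + v * x)" by auto
 then show ?thesis using affine_image_Icc[OF uv(1) lh] by simp
qed

lemma scale_inj: "inf_base \<alpha> f ==> scale_map f k x = scale_map f k y ==> x = y"
 using scale_affine[of \<alpha> f k] by auto

lemma level_image: "inf_base \<alpha> f ==> scale_map f k ` {-1..1} = {lo f k..hi f k}"
 using scale_image[of \<alpha> f "-1" 1 k] by (simp add: lo_def hi_def)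

text \<open>Besides being cyclic, the interval has equal values of f at its ends, and its q-th image
  has c in the interior; so among the images of order 1, ..., q only the last one contains the
  critical point.\<close>

definition lev :: "(real \<Rightarrow> real) \<Rightarrow> real \<Rightarrow> nat \<Rightarrow> real \<Rightarrow> real \<Rightarrow> bool" where
 "lev f c q a b \<longleftrightarrow> 0 < q \<and> cyc f c q a b \<and> f a = f b \<and> c \<in> interior ((f ^^ q) ` {a..b})"

lemma affine_between:
 fixes x y :: real
 assumes "y \<noteq> 0" "l < z" "z < h"
 shows "min (x + y * l) (x + y * h) < x + y * z \<and> x + y * z < max (x + y * l) (x + y * h)"
proof (cases "y > 0")
 case True
 then have "y * l < y * z" "y * z < y * h" using assms by simp_all
 then show ?thesis by linarith
next
 case False
 then have "y * z < y * l" "y * h < y * z" using assms by (simp_all add: mult_less_cancel_left)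
 then show ?thesis by linarith
qed

lemma affine_no_ovl:
 fixes x y :: real
 assumes "y \<noteq> 0" "l \<le> h" "l' \<le> h'" "h \<le> l' \<or> h' \<le> l"
 shows "min (max (x + y * l) (x + y * h)) (max (x + y * l') (x + y * h')) \<le>
    max (min (x + y * l) (x + y * h)) (min (x + y * l') (x + y * h'))"
proof (cases "y > 0")
 case True
 then have "y * l \<le> y * h" "y * l' \<le> y * h'" "y * h \<le> y * l' \<or> y * h' \<le> y * l" using assms by (simp_all add: mult_le_cancel_left)
 then show ?thesis by linarith
next
 case False
 then have "y * h \<le> y * l" "y * h' \<le> y * l'" "y * l' \<le> y * h \<or> y * l \<le> y * h'" using assms by (simp_all add: mult_le_cancel_left)
 then show ?thesis by linarith
qed

text \<open>The images of order 1, ..., n-1 avoid c, so f is injective on each of them; only the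
  first application of f can identify two points.\<close>

lemma pow_eq_imp_eq:
 assumes un: "unim f c" and ab: "-1 \<le> a" "a < b" "b \<le> 1" and av: "\<And>i. 0 < i ==> i < n ==> c \<notin> (f ^^ i) ` {a..b}"
  and n: "0 < n" and x: "x \<in> {a..b}" and y: "y \<in> {a..b}" and eq: "(f ^^ n) x = (f ^^ n) y"
 shows "f x = f y"
proof -
 have "f x = f y" if "j < n" "(f ^^ Suc j) x = (f ^^ Suc j) y" for j
  using that
 proof (induction j)
  case (Suc j)
  define x' where "x' = (f ^^ Suc j) x" define y' where "y' = (f ^^ Suc j) y"
  obtain l h where lh: "(f ^^ Suc j) ` {a..b} = {l..h}" "l < h" "-1 \<le> l" "h \<le> 1" by (rule pow_Icc[OF un ab])
  have "c \<notin> {l..h}" using av[of "Suc j"] Suc.prems(1) lh by simp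
  then have sd: "c < l \<or> h < c" by auto
  have xy: "l \<le> x'" "x' \<le> h" "l \<le> y'" "y' \<le> h"
   using image_Icc_D[OF lh(1), of x] image_Icc_D[OF lh(1), of y] x y unfolding x'_def y'_def by auto
  have fxy: "f x' = f y'" using Suc.prems(2) unfolding x'_def y'_def by simp
  have "x' = y'"
  proof (rule linorder_cases[of x' y'])
   assume "x' < y'" then show ?thesis using unim_inj[OF un, of x' y'] sd xy lh fxy by auto
  next
   assume "y' < x'" then show ?thesis using unim_inj[OF un, of y' x'] sd xy lh fxy by auto
  qed
  then show ?case using Suc.IH Suc.prems(1) unfolding x'_def y'_def by simp
 qed simp
 from this[of "n - 1"] show ?thesis using n eq by simp
qed

text \<open>For level k+1 an iterate s is split as r + \<open>tper f k\<close> i: r > 0 is settled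
  by the disjointness at level k, r = 0 by the renormalization interval of g, the k-th
  renormalization. Equal endpoint values come from g (-1) = g 1, and the position of c from crit g <
  g (crit g).\<close>

lemma level_lev:
 assumes b: "inf_base \<alpha> f"
 shows "lev f (crit f) (tper f k) (lo f k) (hi f k)"
proof -
 obtain df where u: "umap \<alpha> f df (crit f)" using inf_base_umap(1)[OF b] by blast
 note un = umapD(1)[OF u]
 let ?c = "crit f"
 have level_c: "lo f k < ?c \<and> ?c < hi f k" for k
 proof -
  obtain dg where "umap \<alpha> ((renorm ^^ k) f) dg (crit ((renorm ^^ k) f))" using inf_base_umap(1)[OF inf_base_pow[OF b]] by blast
  note cg = umapD(9,10)[OF this]
  obtain x y where uv: "y \<noteq> 0" "\<And>z. scale_map f k z = x + y * z" using scale_affine[OF b, of k] by blast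
  have "?c = x + y * crit ((renorm ^^ k) f)" using scale_crit[OF b, of k] uv by simp
  moreover have "min (x + y * -1) (x + y * 1) < x + y * crit ((renorm ^^ k) f) \<and>
    x + y * crit ((renorm ^^ k) f) < max (x + y * -1) (x + y * 1)"
   by (rule affine_between[OF uv(1) cg])
  ultimately show ?thesis unfolding lo_def hi_def uv(2) by simp
 qed
 have range: "-1 \<le> lo f k" "hi f k \<le> 1" for k
  using scale_range(1)[OF b, of "-1" k] scale_range(1)[OF b, of 1 k] unfolding lo_def hi_def by auto
 have inv: "(f ^^ tper f k) ` {lo f k..hi f k} \<subseteq> {lo f k..hi f k}" for k
 proof -
  have "(f ^^ tper f k) ` scale_map f k ` {-1..1} \<subseteq> scale_map f k ` {-1..1}"
   using scale_conj[OF b] renorm_maps[OF b] by (auto intro!: imageI)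
  then show ?thesis by (simp add: level_image[OF b])
 qed
 have cy: "0 < tper f k \<and> cyc f ?c (tper f k) (lo f k) (hi f k)"
 proof (induction k)
  case 0
  then show ?case using range[of 0] level_c[of 0] inv[of 0] unfolding cyc_def by simp
 next
  case (Suc k)
  define g where "g = (renorm ^^ k) f"
  have bg: "inf_base \<alpha> g" using inf_base_pow[OF b, of k] unfolding g_def .
  obtain m p q where S: "m = renorm_period g" "2 \<le> m" "rescaling_points g = (p, q)" "p \<noteq> q" "cyc g (crit g) m (min p q) (max p q)"
   using inf_base_structure[OF bg] by metis
  have Q: "tper f (Suc k) = tper f k * m" using S(1) unfolding g_def by simp
  have pq: "-1 \<le> min p q" "max p q \<le> 1" "min p q \<le> max p q" using cyc_bounds[OF S(5)] by auto
  have "inv (aff p q) ` {-1..1} = {min p q..max p q}"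
  proof -
   have "inv (aff p q) = (\<lambda>x. (p + q) / 2 + (q - p) / 2 * x)"
    using S(4) by (auto simp: inv_aff algebra_simps add_divide_distrib diff_divide_distrib)
   then show ?thesis using affine_image_Icc[of "(q - p)/2" "-1" 1 "(p + q)/2"] S(4)
    by (simp add: field_simps)
  qed
  moreover have "scale_map f (Suc k) ` {-1..1} = scale_map f k ` inv (aff p q) ` {-1..1}"
   using S(3) unfolding g_def by (simp add: image_comp)
  ultimately have J': "{lo f (Suc k)..hi f (Suc k)} = scale_map f k ` {min p q..max p q}"
   unfolding level_image[OF b, symmetric] by simp
  have sub: "{lo f (Suc k)..hi f (Suc k)} \<subseteq> {lo f k..hi f k}"
  proof -
   have "scale_map f k ` {min p q..max p q} \<subseteq> scale_map f k ` {-1..1}" by (rule image_mono) (use pq in auto)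
   then show ?thesis using J' level_image[OF b, of k] by simp
  qed
  have "\<not> ovl ((f ^^ s) ` {lo f (Suc k)..hi f (Suc k)}) {lo f (Suc k)..hi f (Suc k)}" if s: "0 < s" "s < tper f k * m" for s
  proof
   assume o: "ovl ((f ^^ s) ` {lo f (Suc k)..hi f (Suc k)}) {lo f (Suc k)..hi f (Suc k)}"
   define i where "i = s div tper f k" define r where "r = s mod tper f k"
   have sr: "s = r + tper f k * i" unfolding i_def r_def by simp
   have im: "i < m" using s(2) Suc unfolding i_def by (simp add: less_mult_imp_div_less mult.commute)
   have img: "(f ^^ (tper f k * i)) ` {lo f (Suc k)..hi f (Suc k)} = scale_map f k ` (g ^^ i) ` {min p q..max p q}"
   proof -
    have "(f ^^ (tper f k * i)) (scale_map f k x) = scale_map f k ((g ^^ i) x)" if "x \<in> {min p q..max p q}" for x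
    proof -
     have "-1 \<le> x" "x \<le> 1" using that pq unfolding atLeastAtMost_iff by linarith+
     then show ?thesis using scale_conj_iter[OF b, of k i x] unfolding g_def by simp
    qed
    then have "(\<lambda>x. (f ^^ (tper f k * i)) (scale_map f k x)) ` {min p q..max p q} =
      (\<lambda>x. scale_map f k ((g ^^ i) x)) ` {min p q..max p q}"
     by (intro image_cong) simp_all
    then show ?thesis unfolding J' image_image .
   qed
   have gs: "(g ^^ i) ` {min p q..max p q} \<subseteq> {-1..1}"
    unfolding g_def
    by (rule image_subsetI, rule renorm_pow_maps[OF b]) (use pq in auto)
   show False
   proof (cases "r = 0")
    case False
    have "(f ^^ s) ` {lo f (Suc k)..hi f (Suc k)} = (f ^^ r) ` scale_map f k ` (g ^^ i) ` {min p q..max p q}"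
     unfolding sr pow_add_image img ..
    also have "\<dots> \<subseteq> (f ^^ r) ` {lo f k..hi f k}"
     unfolding level_image[OF b, symmetric] by (rule image_mono, rule image_mono, rule gs)
    finally have "ovl ((f ^^ r) ` {lo f k..hi f k}) {lo f k..hi f k}" using ovl_mono[OF o] sub by blast
    moreover have "0 < r" "r < tper f k" using False Suc unfolding r_def by auto
    ultimately show False using Suc cyc_no_ovl[of f ?c "tper f k" "lo f k" "hi f k" r] by simp
   next
    case True
    then have o': "ovl (scale_map f k ` (g ^^ i) ` {min p q..max p q}) (scale_map f k ` {min p q..max p q})"
     using o img sr J' by simp
    obtain dg where ug: "umap \<alpha> g dg (crit g)" using inf_base_umap(1)[OF bg] by blast
    obtain l h where lh: "(g ^^ i) ` {min p q..max p q} = {l..h}" "l < h" using pow_Icc_ex[OF umapD(1)[OF ug] cyc_bounds[OF S(5)]] by blast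
    have i0: "0 < i" using True s sr by (cases i) auto
    have "\<not> ovl {l..h} {min p q..max p q}" using cyc_no_ovl[OF S(5) i0 im] lh by simp
    then have hl: "h \<le> min p q \<or> max p q \<le> l" using no_ovl_cases[of l h "min p q" "max p q"] lh(2) cyc_bounds[OF S(5)] by simp
    obtain x y where uv: "y \<noteq> 0" "\<And>z. scale_map f k z = x + y * z" using scale_affine[OF b, of k] by blast
    have "ovl {min (x + y * l) (x + y * h)..max (x + y * l) (x + y * h)} {min (x + y * min p q) (x + y * max p q)..max (x + y * min p q) (x + y * max p q)}"
     using o' unfolding lh scale_image[OF b less_imp_le[OF lh(2)]] scale_image[OF b pq(3)] uv(2) .
    then have "max (min (x + y * l) (x + y * h)) (min (x + y * min p q) (x + y * max p q)) < min (max (x + y * l) (x + y * h)) (max (x + y * min p q) (x + y * max p q))"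
     by (simp only: ovl_Icc)
    then show False using affine_no_ovl[OF uv(1) less_imp_le[OF lh(2)] pq(3) hl, of x] by linarith
   qed
  qed
  then show ?case unfolding Q using Suc S(2) range[of "Suc k"] level_c[of "Suc k"] inv[of "Suc k"] unfolding cyc_def Q by simp
 qed
 have fab: "f (lo f k) = f (hi f k)"
 proof -
  define g where "g = (renorm ^^ k) f"
  have g1: "g (-1) = -1" "g 1 = -1" using inf_base_pow[OF b, of k] unfolding inf_base_def g_def by auto
  define Q where "Q = tper f k"
  have "(f ^^ Q) (scale_map f k (-1)) = (f ^^ Q) (scale_map f k 1)"
   unfolding Q_def using scale_conj[OF b, of k "-1"] scale_conj[OF b, of k 1] g1 unfolding g_def by simp
  then have eq: "(f ^^ Q) (lo f k) = (f ^^ Q) (hi f k)" unfolding lo_def hi_def by (auto simp: min_def max_def)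
  have cyQ: "cyc f ?c Q (lo f k) (hi f k)" using cy unfolding Q_def by simp
  note bd = cyc_bounds[OF cyQ]
  show ?thesis by (rule pow_eq_imp_eq[OF un bd(1) _ bd(4) cyc_avoid[OF un cyQ] _ _ _ eq]) (use bd cy in \<open>auto simp: Q_def\<close>)
 qed
 have int: "?c \<in> interior ((f ^^ tper f k) ` {lo f k..hi f k})"
 proof -
  define g where "g = (renorm ^^ k) f"
  have bg: "inf_base \<alpha> g" using inf_base_pow[OF b, of k] unfolding g_def .
  obtain dg where ug: "umap \<alpha> g dg (crit g)" using inf_base_umap(1)[OF bg] by blast
  have g1: "g (-1) = -1" "g 1 = -1" using bg unfolding inf_base_def by auto
  have cg: "crit g < g (crit g)" by (rule cyc_not_beyond[OF ug inf_base_umap(2)[OF bg] g1])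
  have c1: "-1 < crit g" by (rule umapD(9)[OF ug])
  have "(f ^^ tper f k) ` {lo f k..hi f k} = scale_map f k ` g ` {-1..1}"
  proof -
   have "(\<lambda>x. (f ^^ tper f k) (scale_map f k x)) ` {-1..1} = (\<lambda>x. scale_map f k (g x)) ` {-1..1}"
    using scale_conj[OF b, of k] unfolding g_def by (intro image_cong) simp_all
   then show ?thesis unfolding level_image[OF b, symmetric] image_image .
  qed
  moreover have "{-1..g (crit g)} \<subseteq> g ` {-1..1}"
  proof -
   have co: "continuous_on {-1..crit g} g"
    by (rule continuous_on_subset[OF unim_cont[OF umapD(1)[OF ug]]]) (use umapD(10)[OF ug] in simp)
   have "{min (g (-1)) (g (crit g))..max (g (-1)) (g (crit g))} \<subseteq> g ` {-1..crit g}"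
    by (rule image_contains_Icc[OF co]) (use c1 in simp)
   moreover have "g ` {-1..crit g} \<subseteq> g ` {-1..1}" by (rule image_mono) (use umapD(10)[OF ug] in simp)
   moreover have "min (g (-1)) (g (crit g)) = -1" "max (g (-1)) (g (crit g)) = g (crit g)" using g1 cg c1 by simp_all
   ultimately show ?thesis by simp
  qed
  ultimately have "scale_map f k ` {-1..g (crit g)} \<subseteq> (f ^^ tper f k) ` {lo f k..hi f k}" by (metis image_mono)
  then have i: "interior (scale_map f k ` {-1..g (crit g)}) \<subseteq> interior ((f ^^ tper f k) ` {lo f k..hi f k})" by (rule interior_mono)
  obtain x y where uv: "y \<noteq> 0" "\<And>z. scale_map f k z = x + y * z" using scale_affine[OF b, of k] by blast
  have "?c = x + y * crit g" using scale_crit[OF b, of k] uv unfolding g_def by simp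
  moreover have "min (x + y * -1) (x + y * g (crit g)) < x + y * crit g \<and>
    x + y * crit g < max (x + y * -1) (x + y * g (crit g))"
   by (rule affine_between[OF uv(1) c1 cg])
  ultimately have "?c \<in> {min (scale_map f k (-1)) (scale_map f k (g (crit g)))<..<max (scale_map f k (-1)) (scale_map f k (g (crit g)))}"
   unfolding uv(2) by simp
  moreover have "-1 \<le> g (crit g)" using cg c1 by simp
  ultimately have "?c \<in> interior (scale_map f k ` {-1..g (crit g)})"
   using scale_image[OF b, of "-1" "g (crit g)" k] by (simp add: interior_atLeastAtMost_real)
  then show ?thesis using i by blast
 qed
 show ?thesis using cy fab int unfolding lev_def by blast
qed

section \<open>A distortion kernel and cross ratios\<close>

text \<open>The difference f'(x) f'(y) / (f x - f y)^2 - 1 / (x - y)^2 is the mixed second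
  derivative of ln ((f x - f y) / (x - y)), and the condition bounds it above by \<open>C\<close>.
  Clearing denominators makes it meaningful on the diagonal.\<close>

definition kb :: "(real \<Rightarrow> real) \<Rightarrow> (real \<Rightarrow> real) \<Rightarrow> real set \<Rightarrow> real \<Rightarrow> bool" where
 "kb f f' S C \<longleftrightarrow> (\<forall>x\<in>S. \<forall>y\<in>S. f' x * f' y * (x - y)\<^sup>2 \<le> (1 + C * (x - y)\<^sup>2) * (f x - f y)\<^sup>2)"

lemma kbD: "kb f f' S C ==> x \<in> S ==> y \<in> S ==> f' x * f' y * (x - y)\<^sup>2 \<le> (1 + C * (x - y)\<^sup>2) * (f x - f y)\<^sup>2"
 unfolding kb_def by blast

lemma kb_mono: "kb f f' S C ==> T \<subseteq> S ==> C \<le> D ==> kb f f' T D"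
 unfolding kb_def
proof (intro ballI)
 fix x y assume h: "\<forall>x\<in>S. \<forall>y\<in>S. f' x * f' y * (x - y)\<^sup>2 \<le> (1 + C * (x - y)\<^sup>2) * (f x - f y)\<^sup>2" "T \<subseteq> S" "C \<le> D" "x \<in> T" "y \<in> T"
 have "f' x * f' y * (x - y)\<^sup>2 \<le> (1 + C * (x - y)\<^sup>2) * (f x - f y)\<^sup>2" using h by blast
 also have "\<dots> \<le> (1 + D * (x - y)\<^sup>2) * (f x - f y)\<^sup>2"
  using h(3) by (intro mult_right_mono add_left_mono) simp_all
 finally show "f' x * f' y * (x - y)\<^sup>2 \<le> (1 + D * (x - y)\<^sup>2) * (f x - f y)\<^sup>2" .
qed

lemma kb_neg: "kb f f' S C ==> kb (\<lambda>x. - f x) (\<lambda>x. - f' x) S C"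
 unfolding kb_def by (simp add: power2_commute)

text \<open>The mixed derivative for the composition is the one for f at (g x, g y) times g'(x)
  g'(y), plus the one for g. The sign condition places g'(x) g'(y) between 0 and M^2.\<close>

lemma kb_comp:
 assumes f: "kb f f' T C2" and g: "kb g g' S C1" and gT: "g ` S \<subseteq> T" and C2: "0 \<le> C2"
  and sg: "(\<forall>x\<in>S. 0 \<le> g' x) \<or> (\<forall>x\<in>S. g' x \<le> 0)" and M: "\<And>x. x \<in> S ==> \<bar>g' x\<bar> \<le> M"
  and inj: "inj_on g S"
 shows "kb (\<lambda>x. f (g x)) (\<lambda>x. f' (g x) * g' x) S (C1 + C2 * M\<^sup>2)"
 unfolding kb_def
proof (intro ballI)
 fix x y assume xy: "x \<in> S" "y \<in> S"
 show "f' (g x) * g' x * (f' (g y) * g' y) * (x - y)\<^sup>2 \<le> (1 + (C1 + C2 * M\<^sup>2) * (x - y)\<^sup>2) * (f (g x) - f (g y))\<^sup>2"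
 proof (cases "x = y")
  case False
  define gg where "gg = g' x * g' y"
  define P where "P = (x - y)\<^sup>2"
  define Q where "Q = (g x - g y)\<^sup>2"
  define R where "R = (f (g x) - f (g y))\<^sup>2"
  have Q: "0 < Q" unfolding Q_def using inj xy False by (auto dest: inj_onD)
  have P: "0 \<le> P" and R: "0 \<le> R" unfolding P_def R_def by simp_all
  have gg: "0 \<le> gg" unfolding gg_def using sg xy by (auto intro: mult_nonneg_nonneg mult_nonpos_nonpos)
  have "gg \<le> \<bar>g' x\<bar> * \<bar>g' y\<bar>" unfolding gg_def by (simp add: abs_mult[symmetric])
  also have "\<dots> \<le> M * M" by (intro mult_mono M xy abs_ge_zero order_trans[OF abs_ge_zero M[OF xy(1)]])
  finally have ggM: "gg \<le> M\<^sup>2" by (simp add: power2_eq_square)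
  have k1: "gg * P \<le> (1 + C1 * P) * Q" using kbD[OF g xy] unfolding gg_def P_def Q_def .
  have k2: "f' (g x) * f' (g y) * Q \<le> (1 + C2 * Q) * R" using kbD[OF f, of "g x" "g y"] gT xy unfolding Q_def R_def by blast
  have "f' (g x) * f' (g y) * gg * P = (f' (g x) * f' (g y) * Q) * (gg * P / Q)" using Q by simp
  also have "\<dots> \<le> ((1 + C2 * Q) * R) * (gg * P / Q)" using k2 gg P Q by (intro mult_right_mono) simp_all
  also have "\<dots> = R * (gg * P / Q + C2 * gg * P)" using Q by (simp add: field_simps)
  also have "\<dots> \<le> R * ((1 + C1 * P) + C2 * M\<^sup>2 * P)"
  proof (intro mult_left_mono add_mono R)
   show "gg * P / Q \<le> 1 + C1 * P" using k1 Q by (simp add: divide_le_eq)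
   show "C2 * gg * P \<le> C2 * M\<^sup>2 * P" using ggM C2 P by (intro mult_right_mono mult_left_mono)
  qed
  finally show ?thesis unfolding gg_def P_def R_def by (simp add: algebra_simps)
 qed simp
qed

text \<open>The trapezoidal rule: the slope of h over [x,y] differs from the mean of h'(x) and h'(y)
  by at most M (y - x)^2 / 2, and by the inequality of arithmetic and geometric means h'(x) h'(y) is
  at most the square of that mean.\<close>

lemma kb_C3:
 assumes conv: "is_interval S"
  and d1: "\<And>x. x \<in> S ==> DERIV h x :> h1 x" and d2: "\<And>x. x \<in> S ==> DERIV h1 x :> h2 x"
  and d3: "\<And>x. x \<in> S ==> DERIV h2 x :> h3 x"
  and mu: "0 < \<mu>" "\<And>x. x \<in> S ==> \<mu> \<le> h1 x" and M: "\<And>x. x \<in> S ==> \<bar>h3 x\<bar> \<le> M" "0 \<le> M"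
  and L: "\<And>x y. x \<in> S ==> y \<in> S ==> \<bar>x - y\<bar> \<le> L"
 shows "kb h h1 S (M / \<mu> + M\<^sup>2 * L\<^sup>2 / (4 * \<mu>\<^sup>2))"
proof -
 let ?C = "M / \<mu> + M\<^sup>2 * L\<^sup>2 / (4 * \<mu>\<^sup>2)"
 have *: "h1 x * h1 y * (x - y)\<^sup>2 \<le> (1 + ?C * (x - y)\<^sup>2) * (h x - h y)\<^sup>2" if xy: "x \<in> S" "y \<in> S" "x < y" for x y
 proof -
  have inS: "t \<in> S" if "x \<le> t" "t \<le> y" for t
   using conv xy that unfolding is_interval_1 by blast
  define \<delta> where "\<delta> = y - x"
  have de: "0 < \<delta>" using xy(3) unfolding \<delta>_def by simp
  have dL: "\<delta> \<le> L" using L[OF xy(2,1)] unfolding \<delta>_def by simp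
  \<comment> \<open>The error of the trapezoidal rule on [x,t]; two applications of the mean value
    theorem bound its derivative in t by M \<delta>^2 / 2.\<close>
  define g where "g = (\<lambda>t. h t - h x - (t - x) * (h1 t + h1 x) / 2)"
  have dg: "DERIV g t :> (h1 t - h1 x) / 2 - (t - x) * h2 t / 2" if "x \<le> t" "t \<le> y" for t
   unfolding g_def by (rule derivative_eq_intros d1 d2 inS that refl | simp add: field_simps)+
  have gb: "\<bar>(h1 t - h1 x) / 2 - (t - x) * h2 t / 2\<bar> \<le> M * \<delta>\<^sup>2 / 2" if t: "x \<le> t" "t \<le> y" for t
  proof (cases "t = x")
   case False
   then have tx: "x < t" using t by simp
   obtain \<xi> where \<xi>: "x < \<xi>" "\<xi> < t" "h1 t - h1 x = (t - x) * h2 \<xi>"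
    using MVT2[OF tx, of h1 h2] d2 inS t by (meson order_trans)
   obtain \<eta> where \<eta>: "\<xi> < \<eta>" "\<eta> < t" "h2 t - h2 \<xi> = (t - \<xi>) * h3 \<eta>"
    using MVT2[OF \<xi>(2), of h2 h3] d3 inS t \<xi> by (meson order_trans less_imp_le)
   have "\<bar>h2 \<xi> - h2 t\<bar> = \<bar>(t - \<xi>) * h3 \<eta>\<bar>" by (metis \<eta>(3) abs_minus_commute)
   also have "\<dots> = (t - \<xi>) * \<bar>h3 \<eta>\<bar>" using \<xi> by (simp add: abs_mult)
   also have "\<dots> \<le> \<delta> * M" using \<xi> \<eta>(1,2) t M inS[of \<eta>] unfolding \<delta>_def by (intro mult_mono) auto
   finally have "\<bar>(t - x) * (h2 \<xi> - h2 t)\<bar> \<le> \<delta> * (\<delta> * M)"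
    unfolding abs_mult using t tx unfolding \<delta>_def by (intro mult_mono) auto
   then show ?thesis using \<xi>(3) by (simp add: power2_eq_square algebra_simps diff_divide_distrib[symmetric])
  qed (use M(2) in simp)
  obtain \<zeta> where \<zeta>: "x < \<zeta>" "\<zeta> < y" "g y - g x = (y - x) * ((h1 \<zeta> - h1 x) / 2 - (\<zeta> - x) * h2 \<zeta> / 2)"
   using MVT2[OF xy(3) dg] by blast
  have "\<bar>g y - g x\<bar> \<le> \<delta> * (M * \<delta>\<^sup>2 / 2)"
   unfolding \<zeta>(3) abs_mult using gb[of \<zeta>] \<zeta> de unfolding \<delta>_def by (intro mult_mono) auto
  then have gy: "\<bar>h y - h x - \<delta> * ((h1 y + h1 x) / 2)\<bar> \<le> \<delta> * (M * \<delta>\<^sup>2 / 2)"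
   unfolding g_def \<delta>_def by simp
  define \<Delta> where "\<Delta> = (h y - h x) / \<delta>"
  have hD: "h y - h x = \<delta> * \<Delta>" using de unfolding \<Delta>_def by simp
  obtain t where t: "x < t" "t < y" "h y - h x = (y - x) * h1 t" using MVT2[OF xy(3), of h h1] d1 inS by blast
  have Dm: "\<mu> \<le> \<Delta>" using t mu(2)[OF inS[of t]] de unfolding \<Delta>_def \<delta>_def by simp
  define A where "A = (h1 y + h1 x) / 2"
  have "\<delta> * \<bar>\<Delta> - A\<bar> \<le> \<delta> * (M * \<delta>\<^sup>2 / 2)"
   using gy de unfolding hD A_def by (simp add: abs_mult[symmetric] right_diff_distrib abs_mult_pos' )
  then have AD: "\<bar>\<Delta> - A\<bar> \<le> M * \<delta>\<^sup>2 / 2" using de by simp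
  have h1p: "0 < h1 x" "0 < h1 y" using mu xy by (auto intro: less_le_trans)
  have A0: "0 \<le> A" using h1p unfolding A_def by simp
  have "0 \<le> (h1 x - h1 y)\<^sup>2" by simp
  then have "h1 x * h1 y \<le> A\<^sup>2" unfolding A_def by (simp add: power2_eq_square field_simps)
  also have "A\<^sup>2 \<le> (\<Delta> + M * \<delta>\<^sup>2 / 2)\<^sup>2" using AD A0 by (intro power_mono) linarith+
  also have "\<dots> = \<Delta>\<^sup>2 + \<Delta> * M * \<delta>\<^sup>2 + M\<^sup>2 * \<delta>\<^sup>2 / 4 * \<delta>\<^sup>2" by (simp add: power2_eq_square field_simps)
  also have "\<dots> \<le> \<Delta>\<^sup>2 + (\<Delta>\<^sup>2 * (M / \<mu>)) * \<delta>\<^sup>2 + (\<Delta>\<^sup>2 * (M\<^sup>2 * L\<^sup>2 / (4 * \<mu>\<^sup>2))) * \<delta>\<^sup>2"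
  proof (intro add_mono mult_right_mono order_refl)
   have "\<Delta> * \<mu> \<le> \<Delta>\<^sup>2" using Dm mu(1) by (simp add: power2_eq_square)
   then have "\<Delta> * \<mu> * (M / \<mu>) \<le> \<Delta>\<^sup>2 * (M / \<mu>)" using M(2) mu(1) by (intro mult_right_mono) simp_all
   then show "\<Delta> * M \<le> \<Delta>\<^sup>2 * (M / \<mu>)" using mu(1) by simp
   have "\<mu>\<^sup>2 * \<delta>\<^sup>2 \<le> \<Delta>\<^sup>2 * L\<^sup>2" using Dm mu(1) dL de by (intro mult_mono power_mono) simp_all
   then have "(\<mu>\<^sup>2 * \<delta>\<^sup>2) * (M\<^sup>2 / (4 * \<mu>\<^sup>2)) \<le> (\<Delta>\<^sup>2 * L\<^sup>2) * (M\<^sup>2 / (4 * \<mu>\<^sup>2))" by (intro mult_right_mono) simp_all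
   then show "M\<^sup>2 * \<delta>\<^sup>2 / 4 \<le> \<Delta>\<^sup>2 * (M\<^sup>2 * L\<^sup>2 / (4 * \<mu>\<^sup>2))" using mu(1) by (simp add: field_simps)
  qed simp_all
  also have "\<dots> = (1 + ?C * \<delta>\<^sup>2) * \<Delta>\<^sup>2" by (simp add: algebra_simps)
  finally have "h1 x * h1 y * \<delta>\<^sup>2 \<le> (1 + ?C * \<delta>\<^sup>2) * \<Delta>\<^sup>2 * \<delta>\<^sup>2" by (intro mult_right_mono) simp_all
  then have "h1 x * h1 y * \<delta>\<^sup>2 \<le> (1 + ?C * \<delta>\<^sup>2) * (h y - h x)\<^sup>2" unfolding hD by (simp add: power_mult_distrib mult_ac)
  then show ?thesis unfolding \<delta>_def by (simp add: power2_commute)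
 qed
 show ?thesis unfolding kb_def
 proof (intro ballI)
  fix x y assume xy: "x \<in> S" "y \<in> S"
  show "h1 x * h1 y * (x - y)\<^sup>2 \<le> (1 + ?C * (x - y)\<^sup>2) * (h x - h y)\<^sup>2"
  proof (cases x y rule: linorder_cases)
   case less then show ?thesis using *[OF xy] by simp
  next
   case greater
   then show ?thesis using *[OF xy(2,1)] by (simp add: power2_commute mult.commute)
  qed simp
 qed
qed

lemma sinh_scale: fixes s \<alpha> :: real assumes "1 \<le> \<alpha>" "0 \<le> s" shows "\<alpha> * sinh s \<le> sinh (\<alpha> * s)"
proof -
 have "sinh (\<alpha> * 0) - \<alpha> * sinh 0 \<le> sinh (\<alpha> * s) - \<alpha> * sinh s"
 proof (rule DERIV_nonneg_imp_nondecreasing[OF assms(2)])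
  fix x :: real assume x: "0 \<le> x" "x \<le> s"
  have "DERIV (\<lambda>x. sinh (\<alpha> * x) - \<alpha> * sinh x) x :> \<alpha> * cosh (\<alpha> * x) - \<alpha> * cosh x"
   by (auto intro!: derivative_eq_intros)
  moreover have "x \<le> \<alpha> * x" using assms x mult_right_mono[of 1 \<alpha> x] by simp
  then have "cosh x \<le> cosh (\<alpha> * x)" using x assms by (subst cosh_real_nonneg_le_iff) auto
  then have "0 \<le> \<alpha> * cosh (\<alpha> * x) - \<alpha> * cosh x" using assms by simp
  ultimately show "\<exists>y. ((\<lambda>x. sinh (\<alpha> * x) - \<alpha> * sinh x) has_real_derivative y) (at x) \<and> 0 \<le> y" by blast
 qed
 then show ?thesis by simp
qed

text \<open>In logarithmic coordinates, with s half the difference of ln x and ln y, the inequality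
  becomes \<open>\<alpha> * sinh s \<le> sinh (\<alpha> * s)\<close>. The power map thus has
  constant 0 right up to its singular point.\<close>

lemma kb_powr:
 assumes a: "1 < \<alpha>"
 shows "kb (\<lambda>t. t powr \<alpha>) (\<lambda>t. \<alpha> * t powr (\<alpha> - 1)) {0<..} 0"
proof -
 have *: "\<alpha> * x powr (\<alpha> - 1) * (\<alpha> * y powr (\<alpha> - 1)) * (x - y)\<^sup>2 \<le> (x powr \<alpha> - y powr \<alpha>)\<^sup>2" if xy: "0 < y" "y \<le> x" for x y :: real
 proof -
  define u where "u = ln x" define v where "v = ln y"
  define s where "s = (u - v) / 2" define r where "r = (u + v) / 2"
  have s0: "0 \<le> s" using xy unfolding s_def u_def v_def by simp
  have u: "u = r + s" "v = r - s" unfolding s_def r_def by (simp_all add: field_simps)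
  have x: "x = exp u" "y = exp v" using xy unfolding u_def v_def by simp_all
  have 1: "x - y = 2 * exp r * sinh s" unfolding x u by (simp add: sinh_def exp_add exp_diff exp_minus field_simps)
  have 2: "x powr \<alpha> - y powr \<alpha> = 2 * exp (\<alpha> * r) * sinh (\<alpha> * s)"
   unfolding x u by (simp add: powr_def sinh_def exp_add[symmetric] exp_minus[symmetric] algebra_simps)
  have 3: "x powr (\<alpha> - 1) * y powr (\<alpha> - 1) = (exp (\<alpha> * r) / exp r)\<^sup>2"
   unfolding x u by (simp add: powr_def power2_eq_square exp_add[symmetric] exp_diff[symmetric] algebra_simps)
  have "\<alpha> * x powr (\<alpha> - 1) * (\<alpha> * y powr (\<alpha> - 1)) * (x - y)\<^sup>2 = \<alpha>\<^sup>2 * (x powr (\<alpha> - 1) * y powr (\<alpha> - 1)) * (x - y)\<^sup>2"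
   by (simp add: power2_eq_square)
  also have "\<dots> = (2 * exp (\<alpha> * r))\<^sup>2 * (\<alpha> * sinh s)\<^sup>2"
   unfolding 1 3 by (simp add: power_mult_distrib power_divide)
  also have "\<dots> \<le> (2 * exp (\<alpha> * r))\<^sup>2 * (sinh (\<alpha> * s))\<^sup>2"
   using sinh_scale[of \<alpha> s] a s0 by (intro mult_left_mono power_mono) auto
  also have "\<dots> = (x powr \<alpha> - y powr \<alpha>)\<^sup>2" unfolding 2 by (simp add: power_mult_distrib)
  finally show ?thesis .
 qed
 show ?thesis unfolding kb_def
 proof (intro ballI)
  fix x y :: real assume "x \<in> {0<..}" "y \<in> {0<..}"
  then show "\<alpha> * x powr (\<alpha> - 1) * (\<alpha> * y powr (\<alpha> - 1)) * (x - y)\<^sup>2 \<le> (1 + 0 * (x - y)\<^sup>2) * (x powr \<alpha> - y powr \<alpha>)\<^sup>2"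
   using *[of x y] *[of y x] by (cases "y \<le> x") (simp_all add: power2_commute mult_ac)
 qed
qed

section \<open>Cross ratio inequalities from the kernel bound\<close>

definition slope_ln :: "(real \<Rightarrow> real) \<Rightarrow> real \<Rightarrow> real \<Rightarrow> real" where
 "slope_ln f a b = ln ((f b - f a) / (b - a))"

context
 fixes f f' :: "real \<Rightarrow> real" and w z C :: real
 assumes der: "\<And>t. t \<in> {w..z} ==> DERIV f t :> f' t"
  and pos: "\<And>t. t \<in> {w..z} ==> 0 < f' t"
  and k: "kb f f' {w..z} C"
begin

lemma kb_inc:
 assumes "w \<le> a" "a < b" "b \<le> z"
 shows "f a < f b"
proof (rule DERIV_pos_imp_increasing[OF assms(2)])
 fix x assume "a \<le> x" "x \<le> b"
 then have "x \<in> {w..z}" using assms by simp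
 from der[OF this] pos[OF this] show "\<exists>y. DERIV f x :> y \<and> 0 < y" by blast
qed

lemma slope_ln_eq: "w \<le> a ==> a < b ==> b \<le> z ==> slope_ln f a b = ln (f b - f a) - ln (b - a)"
 unfolding slope_ln_def using kb_inc[of a b] by (simp add: ln_div)

text \<open>The left side is the second difference of the logarithmic slope over the rectangle [p,q]
  x [x,y], that is, the integral of its mixed derivative; two mean value theorems replace the
  integration.\<close>

lemma kb_rect:
 assumes "w \<le> p" "p < q" "q < x" "x < y" "y \<le> z"
 shows "slope_ln f q y - slope_ln f q x - slope_ln f p y + slope_ln f p x \<le> C * (q - p) * (y - x)"
proof -
 define th where "th t = ln (f y - f t) - ln (f x - f t) - ln (y - t) + ln (x - t)" for t
 define th' where "th' t = - f' t / (f y - f t) + f' t / (f x - f t) + 1 / (y - t) - 1 / (x - t)" for t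
 have dth: "DERIV th t :> th' t" if t: "p \<le> t" "t \<le> q" for t
  unfolding th_def th'_def
  by (rule derivative_eq_intros der refl | use t assms kb_inc[of t y] kb_inc[of t x] in \<open>force simp: divide_simps\<close>)+
 obtain t where t: "p < t" "t < q" "th q - th p = (q - p) * th' t"
  using MVT2[OF assms(2), of th th'] dth by blast
 define s where "s v = - f' t / (f v - f t) + 1 / (v - t)" for v
 define s' where "s' v = f' t * f' v / (f v - f t)\<^sup>2 - 1 / (v - t)\<^sup>2" for v
 have ds: "DERIV s v :> s' v" if v: "x \<le> v" "v \<le> y" for v
 proof -
  have ft: "f v - f t \<noteq> 0" "v - t \<noteq> 0" using kb_inc[of t v] t v assms by auto
  have "DERIV (\<lambda>v. - f' t / (f v - f t) + 1 / (v - t)) v :> f' t * f' v / ((f v - f t) * (f v - f t)) + - 1 / ((v - t) * (v - t))"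
   by (rule derivative_eq_intros der refl ft | use t v assms ft in \<open>force\<close>)+
  then show ?thesis unfolding s_def s'_def power2_eq_square by simp
 qed
 obtain v where v: "x < v" "v < y" "s y - s x = (y - x) * s' v" using MVT2[OF assms(4), of s s'] ds by blast
 have "f' t * f' v * (t - v)\<^sup>2 \<le> (1 + C * (t - v)\<^sup>2) * (f t - f v)\<^sup>2"
  using kbD[OF k, of t v] t v assms by simp
 moreover have "0 < (t - v)\<^sup>2" "0 < (f t - f v)\<^sup>2" using kb_inc[of t v] t v assms by simp_all
 ultimately have "f' t * f' v / (f t - f v)\<^sup>2 \<le> (1 + C * (t - v)\<^sup>2) / (t - v)\<^sup>2"
  by (simp add: divide_le_eq le_divide_eq mult_ac)
 also have "\<dots> = 1 / (t - v)\<^sup>2 + C" using \<open>0 < (t - v)\<^sup>2\<close> by (simp add: add_divide_distrib)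
 finally have "s' v \<le> C" unfolding s'_def by (simp add: power2_commute)
 then have "s y - s x \<le> (y - x) * C" unfolding v(3) using assms by simp
 moreover have "th' t = s y - s x" unfolding th'_def s_def by simp
 ultimately have "th q - th p \<le> (q - p) * ((y - x) * C)" unfolding t(3) using assms by simp
 moreover have "th q - th p = slope_ln f q y - slope_ln f q x - slope_ln f p y + slope_ln f p x"
  unfolding th_def using assms by (simp add: slope_ln_eq)
 ultimately show ?thesis by (simp add: mult_ac)
qed

lemma slope_limit:
 assumes "w \<le> p" "p < q" "q \<le> z"
 shows "((\<lambda>t. slope_ln f t q) \<longlongrightarrow> ln (f' q)) (at_left q)"
proof -
 have "((\<lambda>t. (f t - f q) / (t - q)) \<longlongrightarrow> f' q) (at_left q)"
  using der[of q] assms unfolding has_field_derivative_iff by (auto intro: tendsto_mono[OF at_le])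
 then have "((\<lambda>t. ln ((f t - f q) / (t - q))) \<longlongrightarrow> ln (f' q)) (at_left q)"
  using pos[of q] assms by (intro tendsto_ln) auto
 moreover have "(f t - f q) / (t - q) = (f q - f t) / (q - t)" for t
  by (metis minus_diff_eq minus_divide_divide)
 ultimately show ?thesis unfolding slope_ln_def by simp
qed

text \<open>The limit of \<open>kb_rect\<close> as the rectangle reaches the diagonal: at that
  corner the logarithmic slope becomes the logarithm of the derivative.\<close>

lemma kb_corner:
 assumes "w \<le> p" "p < x" "x < y" "y \<le> z"
 shows "slope_ln f x y - ln (f' x) - slope_ln f p y + slope_ln f p x \<le> C * (x - p) * (y - x)"
proof -
 have cf: "(f \<longlongrightarrow> f x) (at_left x)"
  using der[of x] assms by (auto dest!: DERIV_isCont simp: isCont_def intro: tendsto_mono[OF at_le])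
 have "((\<lambda>t. (f y - f t) / (y - t)) \<longlongrightarrow> (f y - f x) / (y - x)) (at_left x)"
  using assms by (intro tendsto_intros cf) auto
 then have "((\<lambda>t. slope_ln f t y) \<longlongrightarrow> slope_ln f x y) (at_left x)"
  unfolding slope_ln_def using kb_inc[of x y] assms by (intro tendsto_ln) auto
 then have l1: "((\<lambda>t. slope_ln f t y - slope_ln f t x - slope_ln f p y + slope_ln f p x) \<longlongrightarrow>
   slope_ln f x y - ln (f' x) - slope_ln f p y + slope_ln f p x) (at_left x)"
  using assms by (intro tendsto_intros slope_limit[of p]) auto
 have l2: "((\<lambda>t. C * (t - p) * (y - x)) \<longlongrightarrow> C * (x - p) * (y - x)) (at_left x)"
  by (intro tendsto_intros)
 have "\<forall>\<^sub>F t in at_left x. slope_ln f t y - slope_ln f t x - slope_ln f p y + slope_ln f p x \<le> C * (t - p) * (y - x)"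
  using eventually_at_left_real[OF assms(2)]
  by eventually_elim (use kb_rect[of p _ x y] assms in auto)
 then show ?thesis using tendsto_le[OF _ l2 l1] by simp
qed

text \<open>A sum over the tiles of [w,y] x [x,z]: three rectangles, two of them with a corner on
  the diagonal, and the square [x,y] x [x,y]. Their areas add up to (y - w) (z - x).\<close>

lemma kb_cross_ln:
 assumes "w < x" "x < y" "y < z"
 shows "slope_ln f w x + slope_ln f y z - slope_ln f x y - slope_ln f w z \<le> C * (y - w) * (z - x)"
proof -
 have R1: "slope_ln f x y - ln (f' x) - slope_ln f w y + slope_ln f w x \<le> C * (x - w) * (y - x)"
  using kb_corner[of w x y] assms by simp
 have R2: "slope_ln f x z - slope_ln f x y - slope_ln f w z + slope_ln f w y \<le> C * (x - w) * (z - y)"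
  using kb_rect[of w x y z] assms by simp
 have R3: "slope_ln f y z - ln (f' y) - slope_ln f x z + slope_ln f x y \<le> C * (y - x) * (z - y)"
  using kb_corner[of x y z] assms by simp
 define D where "D = (f y - f x) / (y - x)"
 have D0: "0 < D" unfolding D_def using kb_inc[of x y] assms by simp
 have p: "0 < f' x" "0 < f' y" using pos assms by simp_all
 have yx: "0 < (y - x)\<^sup>2" using assms by simp
 \<comment> \<open>The square needs no integration: its contribution is ln f'(x) + ln f'(y) minus
   twice the logarithmic slope, and the kernel inequality at the pair (y,x) together with ln t \<le>
   t - 1 bounds it.\<close>
 have "f' y * f' x * (y - x)\<^sup>2 \<le> (1 + C * (y - x)\<^sup>2) * (f y - f x)\<^sup>2" using kbD[OF k, of y x] assms by simp
 moreover have "(f y - f x)\<^sup>2 = D\<^sup>2 * (y - x)\<^sup>2" unfolding D_def using assms by (simp add: power_divide)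
 ultimately have "f' y * f' x \<le> (1 + C * (y - x)\<^sup>2) * D\<^sup>2" using yx by (simp add: mult.assoc[symmetric])
 then have le: "f' y * f' x / D\<^sup>2 \<le> 1 + C * (y - x)\<^sup>2" using D0 by (simp add: divide_le_eq)
 have "ln (f' y * f' x / D\<^sup>2) \<le> f' y * f' x / D\<^sup>2 - 1" using p D0 by (intro ln_le_minus_one) simp
 also have "\<dots> \<le> C * (y - x)\<^sup>2" using le by simp
 finally have R4: "ln (f' x) + ln (f' y) - 2 * slope_ln f x y \<le> C * (y - x)\<^sup>2"
  using p D0 unfolding slope_ln_def D_def[symmetric] by (simp add: ln_div ln_mult ln_realpow)
 have "C * (x - w) * (y - x) + C * (x - w) * (z - y) + C * (y - x) * (z - y) + C * (y - x)\<^sup>2 = C * (y - w) * (z - x)"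
  by (simp add: power2_eq_square algebra_simps)
 then show ?thesis using R1 R2 R3 R4 by linarith
qed

end

text \<open>The cross ratio |M| |T| / (|L| |R|) of a middle interval M in T with flanks L and R. An
  upper bound for it means definite space on both sides of M.\<close>

definition cr :: "real \<Rightarrow> real \<Rightarrow> real \<Rightarrow> real \<Rightarrow> real" where
 "cr w x y z = (\<bar>y - x\<bar> * \<bar>z - w\<bar>) / (\<bar>x - w\<bar> * \<bar>z - y\<bar>)"

lemma cr_rev: "cr z y x w = cr w x y z"
 unfolding cr_def by (simp add: abs_minus_commute mult_ac)

lemma cr_neg: "cr (-w) (-x) (-y) (-z) = cr w x y z"
 unfolding cr_def by (simp add: abs_minus_commute)

lemma kb_cross_open_pos:
 assumes der: "\<And>t. t \<in> {w..z} ==> DERIV f t :> f' t" and pos: "\<And>t. t \<in> {w..z} ==> 0 < f' t"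
  and k: "kb f f' {w..z} C" and C: "0 \<le> C" and o: "w < x" "x < y" "y < z"
 shows "exp (- C * (z - w)\<^sup>2) * cr w x y z \<le> cr (f w) (f x) (f y) (f z)"
proof -
 note inc = kb_inc[OF der pos k] and sl = slope_ln_eq[OF der pos k]
 have i: "f w < f x" "f x < f y" "f y < f z" "f w < f z" using inc[of w x] inc[of x y] inc[of y z] inc[of w z] o by simp_all
 have "slope_ln f w x + slope_ln f y z - slope_ln f x y - slope_ln f w z \<le> C * (y - w) * (z - x)"
  by (rule kb_cross_ln[OF der pos k o])
 also have "C * (y - w) * (z - x) = C * ((y - w) * (z - x))" by simp
 also have "\<dots> \<le> C * ((z - w) * (z - w))" using o C by (intro mult_left_mono mult_mono) auto
 finally have 1: "slope_ln f w x + slope_ln f y z - slope_ln f x y - slope_ln f w z \<le> C * (z - w)\<^sup>2" by (simp add: power2_eq_square)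
 have "ln (cr w x y z) = ln (y - x) + ln (z - w) - ln (x - w) - ln (z - y)"
  unfolding cr_def using o by (simp add: ln_div ln_mult)
 moreover have "ln (cr (f w) (f x) (f y) (f z)) = ln (f y - f x) + ln (f z - f w) - ln (f x - f w) - ln (f z - f y)"
  unfolding cr_def using i by (simp add: ln_div ln_mult)
 ultimately have "- C * (z - w)\<^sup>2 + ln (cr w x y z) \<le> ln (cr (f w) (f x) (f y) (f z))"
  using 1 o sl[of w x] sl[of x y] sl[of y z] sl[of w z] by simp
 moreover have "0 < cr w x y z" "0 < cr (f w) (f x) (f y) (f z)" unfolding cr_def using o i by simp_all
 ultimately show ?thesis by (metis exp_add exp_le_cancel_iff exp_ln)
qed

lemma kb_cross_open:
 assumes der: "\<And>t. t \<in> {w..z} ==> DERIV f t :> f' t"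
  and sg: "(\<forall>t\<in>{w..z}. 0 < f' t) \<or> (\<forall>t\<in>{w..z}. f' t < 0)"
  and k: "kb f f' {w..z} C" and C: "0 \<le> C" and o: "w < x" "x < y" "y < z"
 shows "exp (- C * (z - w)\<^sup>2) * cr w x y z \<le> cr (f w) (f x) (f y) (f z)"
 using sg
proof
 assume "\<forall>t\<in>{w..z}. 0 < f' t" then show ?thesis using kb_cross_open_pos[OF der _ k C o] by blast
next
 assume n: "\<forall>t\<in>{w..z}. f' t < 0"
 have "exp (- C * (z - w)\<^sup>2) * cr w x y z \<le> cr (- f w) (- f x) (- f y) (- f z)"
 proof (rule kb_cross_open_pos[OF _ _ kb_neg[OF k] C o])
  show "DERIV (\<lambda>x. - f x) t :> - f' t" if "t \<in> {w..z}" for t by (rule DERIV_minus[OF der[OF that]])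
  show "0 < - f' t" if "t \<in> {w..z}" for t using n that by simp
 qed
 then show ?thesis by (simp only: cr_neg)
qed

text \<open>The kernel bound is only known off the critical point, but pulled-back intervals may end
  there. The two outer points are moved inward and the inequality passes to the limit; strict
  monotonicity keeps the limiting denominators nonzero.\<close>

lemma kb_cross:
 assumes cont: "continuous_on {w..z} f" and der: "\<And>t. t \<in> {w<..<z} ==> DERIV f t :> f' t"
  and sg: "(\<forall>t\<in>{w<..<z}. 0 < f' t) \<or> (\<forall>t\<in>{w<..<z}. f' t < 0)"
  and k: "kb f f' {w<..<z} C" and C: "0 \<le> C" and o: "w < x" "x < y" "y < z"
 shows "exp (- C * (z - w)\<^sup>2) * cr w x y z \<le> cr (f w) (f x) (f y) (f z)"
proof -
 have cw: "(f \<longlongrightarrow> f w) (at w within {w..z})" and cz: "(f \<longlongrightarrow> f z) (at z within {w..z})"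
  using cont o unfolding continuous_on by auto
 define W where "W t = w + t * (x - w)" for t define Z where "Z t = z - t * (z - y)" for t
 have Wt: "(W \<longlongrightarrow> w) (at_right 0)" "(Z \<longlongrightarrow> z) (at_right 0)"
  unfolding W_def Z_def by (auto intro!: tendsto_eq_intros)
 have rng: "w < W t \<and> W t < x \<and> y < Z t \<and> Z t < z" if "t \<in> {0<..<1}" for t
 proof -
  have "0 < t * (x - w)" "t * (x - w) < x - w" "0 < t * (z - y)" "t * (z - y) < z - y" using that o by simp_all
  then show ?thesis unfolding W_def Z_def by linarith
 qed
 have ev: "\<forall>\<^sub>F t in at_right (0::real). t \<in> {0<..<1}" by (rule eventually_at_right_real) simp
 have fW: "((\<lambda>t. f (W t)) \<longlongrightarrow> f w) (at_right 0)"
 proof (rule filterlim_compose[OF cw])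
  show "filterlim W (at w within {w..z}) (at_right 0)"
  proof -
   have "\<forall>\<^sub>F t in at_right 0. W t \<in> {w..z} \<and> W t \<noteq> w"
    using ev by eventually_elim (use rng o in \<open>force\<close>)
   then show ?thesis unfolding filterlim_at using Wt(1) by simp
  qed
 qed
 have fZ: "((\<lambda>t. f (Z t)) \<longlongrightarrow> f z) (at_right 0)"
 proof (rule filterlim_compose[OF cz])
  show "filterlim Z (at z within {w..z}) (at_right 0)"
  proof -
   have "\<forall>\<^sub>F t in at_right 0. Z t \<in> {w..z} \<and> Z t \<noteq> z"
    using ev by eventually_elim (use rng o in \<open>force\<close>)
   then show ?thesis unfolding filterlim_at using Wt(2) by simp
  qed
 qed
 have fne: "f w \<noteq> f x" "f z \<noteq> f y"
 proof -
  have mono: "f a \<noteq> f b" if "w \<le> a" "a < b" "b \<le> z" for a b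
   using sg
  proof
   assume s: "\<forall>t\<in>{w<..<z}. 0 < f' t"
   have "f a < f b"
   proof (rule DERIV_pos_imp_increasing_open[OF that(2)])
    fix x assume "a < x" "x < b"
    then have "x \<in> {w<..<z}" using that by simp
    from der[OF this] s this show "\<exists>y. DERIV f x :> y \<and> 0 < y" by blast
   qed (rule continuous_on_subset[OF cont], use that in auto)
   then show ?thesis by simp
  next
   assume s: "\<forall>t\<in>{w<..<z}. f' t < 0"
   have "f b < f a"
   proof (rule DERIV_neg_imp_decreasing_open[OF that(2)])
    fix x assume "a < x" "x < b"
    then have "x \<in> {w<..<z}" using that by simp
    from der[OF this] s this show "\<exists>y. DERIV f x :> y \<and> y < 0" by blast
   qed (rule continuous_on_subset[OF cont], use that in auto)
   then show ?thesis by simp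
  qed
  show "f w \<noteq> f x" "f z \<noteq> f y" using mono[of w x] mono[of y z] o by auto
 qed
 have t1: "((\<lambda>t. exp (- C * (Z t - W t)\<^sup>2) * cr (W t) x y (Z t)) \<longlongrightarrow> exp (- C * (z - w)\<^sup>2) * cr w x y z) (at_right 0)"
  unfolding cr_def using o by (intro tendsto_intros Wt) auto
 have t2: "((\<lambda>t. cr (f (W t)) (f x) (f y) (f (Z t))) \<longlongrightarrow> cr (f w) (f x) (f y) (f z)) (at_right 0)"
  unfolding cr_def using fne by (intro tendsto_intros fW fZ) auto
 have "\<forall>\<^sub>F t in at_right 0. exp (- C * (Z t - W t)\<^sup>2) * cr (W t) x y (Z t) \<le> cr (f (W t)) (f x) (f y) (f (Z t))"
  using ev
 proof eventually_elim
  case (elim t)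
  note r = rng[OF elim]
  have sub: "{W t..Z t} \<subseteq> {w<..<z}" using r by auto
  show ?case
   by (rule kb_cross_open[where f' = f']) (use sub sg r o C kb_mono[OF k sub order_refl] in \<open>auto intro!: der\<close>)
 qed
 then show ?thesis using tendsto_le[OF _ t2 t1] by simp
qed

section \<open>The kernel bound for unimodal maps\<close>

lemma smooth_on_open:
 assumes s: "smooth_on h U" and o: "open U"
 obtains D where "\<And>x. x \<in> U ==> DERIV h x :> D (1::nat) x" "\<And>n x. x \<in> U ==> DERIV (D n) x :> D (Suc n) x"
proof -
 obtain D where D0: "\<And>x. x \<in> U ==> D 0 x = h x"
  and D: "\<And>n x. x \<in> U ==> (D n has_real_derivative D (Suc n) x) (at x within U)"
  using s unfolding smooth_on_def by blast
 have 1: "DERIV (D n) x :> D (Suc n) x" if "x \<in> U" for n x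
  using D[OF that] at_within_open[OF that o] by simp
 have 2: "DERIV h x :> D 1 x" if "x \<in> U" for x
  using has_field_derivative_transform_within_open[OF 1[OF that, of 0] o that D0] by simp
 show ?thesis using that 1 2 by blast
qed

text \<open>Differentiability of the inverse rules out a zero derivative, monotonicity a negative
  one, and compactness of a smaller interval makes the bounds uniform.\<close>

lemma local_diffeo_derivs:
 assumes ld: "local_diffeo h x0"
 obtains e \<mu> M h1 h2 h3 where "0 < e" "0 < \<mu>"
  "\<And>x. \<bar>x - x0\<bar> \<le> e ==> DERIV h x :> h1 x" "\<And>x. \<bar>x - x0\<bar> \<le> e ==> DERIV h1 x :> h2 x"
  "\<And>x. \<bar>x - x0\<bar> \<le> e ==> DERIV h2 x :> h3 x" "\<And>x. \<bar>x - x0\<bar> \<le> e ==> \<mu> \<le> h1 x"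
  "\<And>x. \<bar>x - x0\<bar> \<le> e ==> h1 x \<le> M" "\<And>x. \<bar>x - x0\<bar> \<le> e ==> \<bar>h3 x\<bar> \<le> M"
proof -
 obtain e0 U where e0: "0 < e0" "U = {x0 - e0<..<x0 + e0}" "strict_mono_on U h" "open (h ` U)"
  "smooth_on h U" "smooth_on (inv_into U h) (h ` U)"
  using ld unfolding local_diffeo_def by (metis (no_types, lifting))
 have oU: "open U" using e0(2) by simp
 obtain D where D: "\<And>x. x \<in> U ==> DERIV h x :> D (1::nat) x" "\<And>n x. x \<in> U ==> DERIV (D n) x :> D (Suc n) x"
  using smooth_on_open[OF e0(5) oU] by metis
 obtain E where E: "\<And>x. x \<in> h ` U ==> DERIV (inv_into U h) x :> E (1::nat) x"
  using smooth_on_open[OF e0(6,4)] by metis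
 have inj: "inj_on h U" using e0(3) by (rule strict_mono_on_imp_inj_on)
 have pos: "0 < D 1 x" if x: "x \<in> U" for x
 proof -
  have "DERIV (\<lambda>y. inv_into U h (h y)) x :> E 1 (h x) * D 1 x"
   by (rule DERIV_chain2[OF E D(1)]) (use x in auto)
  moreover have "DERIV (\<lambda>y. inv_into U h (h y)) x :> 1"
   by (rule has_field_derivative_transform_within_open[OF DERIV_ident oU x]) (simp add: inj)
  ultimately have "E 1 (h x) * D 1 x = 1" by (rule DERIV_unique)
  then have ne: "D 1 x \<noteq> 0" by auto
  have "\<not> D 1 x < 0"
  proof
   assume "D 1 x < 0"
   then obtain d where d: "d > 0" "\<And>t. t > 0 ==> t < d ==> h (x + t) < h x"
    using DERIV_neg_dec_right[OF D(1)[OF x]] by blast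
   define t where "t = min (d / 2) ((x0 + e0 - x) / 2)"
   have t: "0 < t" "t < d" "x + t \<in> U" using d(1) x e0(2) unfolding t_def by (auto simp: min_def field_simps)
   then have "h x < h (x + t)" using strict_mono_onD[OF e0(3) x t(3)] by simp
   then show False using d(2)[OF t(1,2)] by simp
  qed
  then show ?thesis using ne by simp
 qed
 define e where "e = e0 / 2"
 have inU: "x \<in> U" if "x \<in> {x0 - e..x0 + e}" for x using that e0 unfolding e_def by auto
 have cont: "continuous_on {x0 - e..x0 + e} (D n)" for n
  using D(2) inU by (meson DERIV_isCont continuous_at_imp_continuous_on)
 have ne: "{x0 - e..x0 + e} \<noteq> {}" using e0(1) unfolding e_def by simp
 obtain xm where xm: "xm \<in> {x0 - e..x0 + e}" "\<forall>x\<in>{x0 - e..x0 + e}. D 1 xm \<le> D 1 x"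
  using continuous_attains_inf[OF compact_Icc ne cont] by blast
 obtain xM where xM: "xM \<in> {x0 - e..x0 + e}" "\<forall>x\<in>{x0 - e..x0 + e}. D 1 x \<le> D 1 xM"
  using continuous_attains_sup[OF compact_Icc ne cont] by blast
 have "continuous_on {x0 - e..x0 + e} (\<lambda>x. \<bar>D 3 x\<bar>)" by (intro continuous_intros cont)
 then obtain x3 where x3: "\<forall>x\<in>{x0 - e..x0 + e}. \<bar>D 3 x\<bar> \<le> \<bar>D 3 x3\<bar>"
  using continuous_attains_sup[OF compact_Icc ne] by blast
 have I: "x \<in> {x0 - e..x0 + e}" if "\<bar>x - x0\<bar> \<le> e" for x using that by (auto simp: abs_le_iff)
 show ?thesis
 proof (rule that[of e "D 1 xm" "D 1" "D 2" "D 3" "max (D 1 xM) \<bar>D 3 x3\<bar>"])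
  show "0 < e" using e0(1) unfolding e_def by simp
  show "0 < D 1 xm" using pos[OF inU[OF xm(1)]] .
  fix x assume x: "\<bar>x - x0\<bar> \<le> e"
  note xU = inU[OF I[OF x]]
  show "DERIV h x :> D 1 x" using D(1)[OF xU] .
  show "DERIV (D 1) x :> D 2 x" using D(2)[OF xU, of 1] by (simp add: numeral_2_eq_2)
  show "DERIV (D 2) x :> D 3 x" using D(2)[OF xU, of 2] by (simp add: numeral_3_eq_3 numeral_2_eq_2)
  show "D 1 xm \<le> D 1 x" using xm I[OF x] by blast
  show "D 1 x \<le> max (D 1 xM) \<bar>D 3 x3\<bar>" using xM I[OF x] by (meson max.coboundedI1)
  show "\<bar>D 3 x\<bar> \<le> max (D 1 xM) \<bar>D 3 x3\<bar>" using x3 I[OF x] by (meson max.coboundedI2)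
 qed
qed

text \<open>On one side of the critical point |\<phi>| is a diffeomorphism \<theta>, and the normal
  form composes three maps with known constants, of which the power map contributes 0.\<close>

lemma kb_side:
 assumes a: "1 < \<alpha>" and th: "kb \<theta> \<theta>' S C1" and pos: "\<And>x. x \<in> S ==> 0 < \<theta> x"
  and sg: "(\<forall>x\<in>S. 0 \<le> \<theta>' x) \<or> (\<forall>x\<in>S. \<theta>' x \<le> 0)" and inj: "inj_on \<theta> S"
  and M: "\<And>x. x \<in> S ==> \<bar>\<theta>' x\<bar> \<le> M" "\<And>x. x \<in> S ==> \<theta> x \<le> M"
  and ps: "kb \<psi> \<psi>' T C2" "0 \<le> C2" and T: "\<And>x. x \<in> S ==> - (\<theta> x powr \<alpha>) \<in> T"
 shows "kb (\<lambda>x. \<psi> (- (\<theta> x powr \<alpha>))) (\<lambda>x. \<psi>' (- (\<theta> x powr \<alpha>)) * (- (\<alpha> * \<theta> x powr (\<alpha> - 1)) * \<theta>' x)) S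
  (C1 + C2 * (\<alpha> * M powr (\<alpha> - 1) * M)\<^sup>2)"
proof -
 have "kb (\<lambda>x. - (\<theta> x powr \<alpha>)) (\<lambda>x. - (\<alpha> * \<theta> x powr (\<alpha> - 1)) * \<theta>' x) S (C1 + 0 * M\<^sup>2)"
  by (rule kb_comp[OF kb_neg[OF kb_powr[OF a]] th _ _ sg M(1) inj]) (use pos in auto)
 then have k1: "kb (\<lambda>x. - (\<theta> x powr \<alpha>)) (\<lambda>x. - (\<alpha> * \<theta> x powr (\<alpha> - 1)) * \<theta>' x) S C1" by simp
 show ?thesis
 proof (rule kb_comp[OF ps(1) k1 _ ps(2)])
  show "(\<lambda>x. - (\<theta> x powr \<alpha>)) ` S \<subseteq> T" using T by blast
  show "(\<forall>x\<in>S. 0 \<le> - (\<alpha> * \<theta> x powr (\<alpha> - 1)) * \<theta>' x) \<or> (\<forall>x\<in>S. - (\<alpha> * \<theta> x powr (\<alpha> - 1)) * \<theta>' x \<le> 0)"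
   using sg a by (auto simp: mult_nonneg_nonpos)
  show "inj_on (\<lambda>x. - (\<theta> x powr \<alpha>)) S"
  proof (rule inj_onI)
   fix x y assume xy: "x \<in> S" "y \<in> S" "- (\<theta> x powr \<alpha>) = - (\<theta> y powr \<alpha>)"
   then have "(\<theta> x powr \<alpha>) powr (1 / \<alpha>) = (\<theta> y powr \<alpha>) powr (1 / \<alpha>)" by simp
   then have "\<theta> x = \<theta> y" using pos[OF xy(1)] pos[OF xy(2)] a by (simp add: powr_powr)
   then show "x = y" using inj xy by (auto dest: inj_onD)
  qed
  fix x assume x: "x \<in> S"
  have "\<bar>- (\<alpha> * \<theta> x powr (\<alpha> - 1)) * \<theta>' x\<bar> = \<alpha> * \<theta> x powr (\<alpha> - 1) * \<bar>\<theta>' x\<bar>" using a by (simp add: abs_mult)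
  also have "\<dots> \<le> \<alpha> * M powr (\<alpha> - 1) * M"
   using M x a pos[OF x] by (intro mult_mono mult_left_mono powr_mono2) (auto intro: less_imp_le)
  finally show "\<bar>- (\<alpha> * \<theta> x powr (\<alpha> - 1)) * \<theta>' x\<bar> \<le> \<alpha> * M powr (\<alpha> - 1) * M" .
 qed
qed

text \<open>Two points without a common piece are at least d apart. For such pairs strict
  monotonicity and compactness bound |f x - f y| from below by \<mu>, and the crude constant M^2 /
  \<mu>^2 suffices.\<close>

lemma kb_glue:
 assumes cont: "continuous_on {l..r} f"
  and mono: "(\<forall>x y. l \<le> x \<longrightarrow> x < y \<longrightarrow> y \<le> r \<longrightarrow> f x < f y) \<or> (\<forall>x y. l \<le> x \<longrightarrow> x < y \<longrightarrow> y \<le> r \<longrightarrow> f y < f x)"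
  and M: "\<And>x. x \<in> {l..r} ==> \<bar>f' x\<bar> \<le> M" and d: "0 < d"
  and k1: "kb f f' {l<..<s + d} C1" and k2: "kb f f' {s<..<r} C2"
 shows "\<exists>C\<ge>0. kb f f' {l<..<r} C"
proof -
 have "\<exists>\<mu>>0. \<forall>x y. l \<le> x \<longrightarrow> x + d \<le> y \<longrightarrow> y \<le> r \<longrightarrow> \<mu> \<le> \<bar>f x - f y\<bar>"
 proof (cases "l \<le> r - d")
  case True
  have "continuous_on {l..r - d} (\<lambda>x. \<bar>f x - f (x + d)\<bar>)"
   by (intro continuous_intros continuous_on_compose2[OF cont] continuous_on_subset[OF cont]) (use d in auto)
  moreover have "{l..r - d} \<noteq> {}" using True by simp
  ultimately obtain x0 where x0: "x0 \<in> {l..r - d}" "\<forall>x\<in>{l..r - d}. \<bar>f x0 - f (x0 + d)\<bar> \<le> \<bar>f x - f (x + d)\<bar>"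
   using continuous_attains_inf[of "{l..r - d}" "\<lambda>x. \<bar>f x - f (x + d)\<bar>"] by blast
  have m: "\<bar>f x - f (x + d)\<bar> \<le> \<bar>f x - f y\<bar>" if h: "l \<le> x" "x + d \<le> y" "y \<le> r" for x y
  proof (cases "x + d = y")
   case False
   then have h2: "x < x + d" "x + d < y" "l \<le> x + d" "x + d \<le> r" using h d by auto
   show ?thesis using mono
   proof
    assume "\<forall>x y. l \<le> x \<longrightarrow> x < y \<longrightarrow> y \<le> r \<longrightarrow> f x < f y"
    then have "f x < f (x + d)" "f (x + d) < f y" using h h2 by blast+
    then show ?thesis by linarith
   next
    assume "\<forall>x y. l \<le> x \<longrightarrow> x < y \<longrightarrow> y \<le> r \<longrightarrow> f y < f x"
    then have "f (x + d) < f x" "f y < f (x + d)" using h h2 by blast+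
    then show ?thesis by linarith
   qed
  qed simp
  have "l \<le> x0" "x0 < x0 + d" "x0 + d \<le> r" using x0(1) d by simp_all
  then have "f x0 \<noteq> f (x0 + d)" using mono by (metis less_irrefl)
  then have "0 < \<bar>f x0 - f (x0 + d)\<bar>" by simp
  moreover have "\<bar>f x0 - f (x0 + d)\<bar> \<le> \<bar>f x - f y\<bar>" if h: "l \<le> x" "x + d \<le> y" "y \<le> r" for x y
   using x0(2) m[OF h] h by force
  ultimately show ?thesis by blast
 next
  case False
  then show ?thesis by (intro exI[of _ 1]) auto
 qed
 then obtain \<mu> where mu: "0 < \<mu>" "\<And>x y. l \<le> x ==> x + d \<le> y ==> y \<le> r ==> \<mu> \<le> \<bar>f x - f y\<bar>" by blast
 define C where "C = max (max C1 C2) (M\<^sup>2 / \<mu>\<^sup>2)"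
 have C: "C1 \<le> C" "C2 \<le> C" "M\<^sup>2 / \<mu>\<^sup>2 \<le> C" unfolding C_def by auto
 then have C0: "0 \<le> C" by (meson order_trans divide_nonneg_nonneg zero_le_power2)
 have *: "f' x * f' y * (x - y)\<^sup>2 \<le> (1 + C * (x - y)\<^sup>2) * (f x - f y)\<^sup>2" if xy: "x \<in> {l<..<r}" "y \<in> {l<..<r}" "x \<le> y" for x y
 proof -
  consider "y < s + d" | "s < x" | "x \<le> s" "s + d \<le> y" by linarith
  then show ?thesis
  proof cases
   case 1 then show ?thesis using kbD[OF kb_mono[OF k1 order_refl C(1)], of x y] xy by simp
  next
   case 2 then show ?thesis using kbD[OF kb_mono[OF k2 order_refl C(2)], of x y] xy by simp
  next
   case 3
   have "\<mu> \<le> \<bar>f x - f y\<bar>" using mu(2)[of x y] 3 xy by simp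
   then have m2: "\<mu>\<^sup>2 \<le> (f x - f y)\<^sup>2" using mu(1) by (metis abs_le_square_iff abs_of_pos)
   have "f' x * f' y \<le> \<bar>f' x\<bar> * \<bar>f' y\<bar>" by (simp add: abs_mult[symmetric])
   also have "\<dots> \<le> M * M" using M[of x] M[of y] xy by (intro mult_mono) auto
   also have "\<dots> = M\<^sup>2 / \<mu>\<^sup>2 * \<mu>\<^sup>2" using mu(1) by (simp add: power2_eq_square)
   also have "\<dots> \<le> C * (f x - f y)\<^sup>2" using C m2 C0 by (intro mult_mono) simp_all
   finally have "f' x * f' y * (x - y)\<^sup>2 \<le> C * (f x - f y)\<^sup>2 * (x - y)\<^sup>2" by (intro mult_right_mono) simp_all
   also have "\<dots> \<le> (1 + C * (x - y)\<^sup>2) * (f x - f y)\<^sup>2" by (simp add: algebra_simps)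
   finally show ?thesis .
  qed
 qed
 have "kb f f' {l<..<r} C" unfolding kb_def
 proof (intro ballI)
  fix x y assume xy: "x \<in> {l<..<r}" "y \<in> {l<..<r}"
  show "f' x * f' y * (x - y)\<^sup>2 \<le> (1 + C * (x - y)\<^sup>2) * (f x - f y)\<^sup>2"
   using *[OF xy] *[OF xy(2,1)] by (cases "x \<le> y") (simp_all add: power2_commute mult.commute)
 qed
 then show ?thesis using C0 by blast
qed

lemma kb_cong: "kb f f' S C ==> (\<And>x. x \<in> S ==> g x = f x) ==> (\<And>x. x \<in> S ==> g' x = f' x) ==> kb g g' S C"
 unfolding kb_def by simp

lemma umap_deriv_in: "umap \<alpha> f df c ==> -1 < x ==> x < 1 ==> DERIV f x :> df x"
 using umapD(5)[of \<alpha> f df c x] by (simp add: at_within_Icc_at)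

text \<open>On a compact interval away from the critical point f' is bounded away from zero, so
  \<open>kb_C3\<close> applies. At -1 and 1 the smoothness is one-sided; the bounds are taken on the
  closed interval and used on the open one.\<close>

lemma kb_far:
 assumes u: "umap \<alpha> f df c" and s: "smooth_on f S" and sub: "{l..r} \<subseteq> S" "S \<subseteq> {-1..1}" "l < r" "is_interval S"
  and sg: "(\<forall>x\<in>S. 0 < df x) \<or> (\<forall>x\<in>S. df x < 0)"
 shows "\<exists>C\<ge>0. kb f df {l<..<r} C"
proof -
 obtain D where D0: "\<And>x. x \<in> S ==> D 0 x = f x"
  and D: "\<And>n x. x \<in> S ==> (D n has_real_derivative D (Suc n) x) (at x within S)"
  using s unfolding smooth_on_def by blast
 have DI: "(D n has_real_derivative D (Suc n) x) (at x within {l..r})" if "x \<in> {l..r}" for n x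
  using D[of x n] that sub by (meson DERIV_subset subsetD)
 have lr: "-1 \<le> l" "r \<le> 1"
 proof -
  have "l \<in> S" "r \<in> S" using sub(1,3) by auto
  then show "-1 \<le> l" "r \<le> 1" using sub(2) by auto
 qed
 have cont: "continuous_on {l..r} (D n)" for n
  using DI by (meson DERIV_continuous continuous_on_eq_continuous_within)
 have der: "DERIV (D n) x :> D (Suc n) x" if "x \<in> {l<..<r}" for n x
  using DI[of x n] that by (simp add: at_within_Icc_at)
 have d1: "D 1 x = df x" if x: "x \<in> {l<..<r}" for x
 proof -
  have xS: "-1 < x" "x < 1" using lr x by auto
  have "D 0 y = f y" if "y \<in> {l<..<r}" for y using D0[of y] sub(1) that by (simp add: subset_iff)
  from has_field_derivative_transform_within_open[OF der[OF x, of 0] open_greaterThanLessThan x this]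
  have "DERIV f x :> D 1 x" by simp
  then show ?thesis using umap_deriv_in[OF u xS] by (rule DERIV_unique)
 qed
 have dfc: "continuous_on {l..r} df" using umapD(4)[OF u] sub by (meson continuous_on_subset subset_trans)
 have ne: "{l..r} \<noteq> {}" using sub(3) by simp
 have "continuous_on {l..r} (\<lambda>x. \<bar>D 3 x\<bar>)" by (intro continuous_intros cont)
 then obtain x3 where x3: "\<forall>x\<in>{l..r}. \<bar>D 3 x\<bar> \<le> \<bar>D 3 x3\<bar>" using continuous_attains_sup[OF compact_Icc ne] by blast
 have "continuous_on {l..r} (\<lambda>x. \<bar>df x\<bar>)" by (intro continuous_intros dfc)
 then obtain x1 where x1: "x1 \<in> {l..r}" "\<forall>x\<in>{l..r}. \<bar>df x1\<bar> \<le> \<bar>df x\<bar>" using continuous_attains_inf[OF compact_Icc ne] by blast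
 define \<mu> where "\<mu> = \<bar>df x1\<bar>"
 have "x1 \<in> S" using x1(1) sub(1) by (rule subsetD[rotated])
 then have mu: "0 < \<mu>" using sg unfolding \<mu>_def by force
 define M where "M = \<bar>D 3 x3\<bar>"
 define K where "K = M / \<mu> + M\<^sup>2 * (r - l)\<^sup>2 / (4 * \<mu>\<^sup>2)"
 have K: "0 \<le> K" unfolding K_def M_def using mu by simp
 have iv: "is_interval {l<..<r}" by (rule is_interval_oo)
 from sg show ?thesis
 proof
  assume p: "\<forall>x\<in>S. 0 < df x"
  have "kb f df {l<..<r} K" unfolding K_def
  proof (rule kb_C3[OF iv, where ?h1.0 = df and ?h2.0 = "D 2" and ?h3.0 = "D 3"])
   fix x assume x: "x \<in> {l<..<r}"
   have xS: "-1 < x" "x < 1" using lr x by auto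
   show "DERIV f x :> df x" by (rule umap_deriv_in[OF u xS])
   show "DERIV df x :> D 2 x"
    using has_field_derivative_transform_within_open[OF der[OF x, of 1] open_greaterThanLessThan x d1] by (simp add: numeral_2_eq_2)
   show "DERIV (D 2) x :> D 3 x" using der[OF x, of 2] by (simp add: numeral_3_eq_3 numeral_2_eq_2)
   have xl: "x \<in> {l..r}" using x by simp
   then have xS: "x \<in> S" using sub(1) by (rule subsetD[rotated])
   show "\<mu> \<le> df x" using x1(2)[rule_format, OF xl] p[rule_format, OF xS] unfolding \<mu>_def by simp
   show "\<bar>D 3 x\<bar> \<le> M" using x3 xl unfolding M_def by blast
  qed (use mu in \<open>auto simp: M_def abs_le_iff\<close>)
  then show ?thesis using K by blast
 next
  assume p: "\<forall>x\<in>S. df x < 0"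
  have "kb (\<lambda>x. - f x) (\<lambda>x. - df x) {l<..<r} K" unfolding K_def
  proof (rule kb_C3[OF iv, where ?h2.0 = "\<lambda>x. - D 2 x" and ?h3.0 = "\<lambda>x. - D 3 x"])
   fix x assume x: "x \<in> {l<..<r}"
   have xS: "-1 < x" "x < 1" using lr x by auto
   show "DERIV (\<lambda>x. - f x) x :> - df x" by (rule DERIV_minus[OF umap_deriv_in[OF u xS]])
   have "DERIV df x :> D 2 x"
    using has_field_derivative_transform_within_open[OF der[OF x, of 1] open_greaterThanLessThan x d1] by (simp add: numeral_2_eq_2)
   then show "DERIV (\<lambda>x. - df x) x :> - D 2 x" by (rule DERIV_minus)
   have "DERIV (D 2) x :> D 3 x" using der[OF x, of 2] by (simp add: numeral_3_eq_3 numeral_2_eq_2)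
   then show "DERIV (\<lambda>x. - D 2 x) x :> - D 3 x" by (rule DERIV_minus)
   have xl: "x \<in> {l..r}" using x by simp
   then have xS: "x \<in> S" using sub(1) by (rule subsetD[rotated])
   show "\<mu> \<le> - df x" using x1(2)[rule_format, OF xl] p[rule_format, OF xS] unfolding \<mu>_def by simp
   show "\<bar>- D 3 x\<bar> \<le> M" using x3 xl unfolding M_def by simp
  qed (use mu in \<open>auto simp: M_def abs_le_iff\<close>)
  then have "kb f df {l<..<r} K" using kb_neg by fastforce
  then show ?thesis using K by blast
 qed
qed

lemma has_real_derivative_abs:
 fixes x :: real assumes "x \<noteq> 0" shows "DERIV abs x :> sgn x"
proof (cases "0 < x")
 case True
 have "DERIV abs x :> 1"
  by (rule has_field_derivative_transform_within_open[OF DERIV_ident open_greaterThan[of 0]]) (use True in auto)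
 then show ?thesis using True by simp
next
 case False
 have "DERIV abs x :> - 1"
  by (rule has_field_derivative_transform_within_open[OF DERIV_minus[OF DERIV_ident] open_lessThan[of 0]]) (use False assms in auto)
 then show ?thesis using False assms by simp
qed

text \<open>The normal form gives |\<phi>(x)| comparable to |x - c|. From it come the kernel bound
  on each side and the two power laws that later convert lengths at the critical value into lengths
  at the critical point.\<close>

lemma umap_near:
 assumes u: "umap \<alpha> f df c" and a: "1 < \<alpha>"
 obtains e C k K where "0 < e" "-1 < c - e" "c + e < 1" "0 \<le> C" "0 < k" "0 < K"
  "kb f df {c<..<c + e} C" "kb f df {c - e<..<c} C"
  "\<And>x. \<bar>x - c\<bar> < e ==> \<bar>df x\<bar> \<le> K * \<bar>x - c\<bar> powr (\<alpha> - 1)" "\<And>x. \<bar>x - c\<bar> < e ==> k * \<bar>x - c\<bar> powr \<alpha> \<le> f c - f x"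
proof -
 obtain \<phi> \<psi> where nf: "normal_form \<alpha> f c \<phi> \<psi>" using u unfolding umap_def by blast
 then have pc: "\<phi> c = 0" and l1: "local_diffeo \<phi> c" and l2: "local_diffeo \<psi> 0"
  and ev: "\<forall>\<^sub>F x in nhds c. f x = \<psi> (- (\<bar>\<phi> x\<bar> powr \<alpha>))" unfolding normal_form_def by blast+
 obtain e1 m1 M1 p1 p2 p3 where P: "0 < e1" "0 < m1"
  "\<And>x. \<bar>x - c\<bar> \<le> e1 ==> DERIV \<phi> x :> p1 x" "\<And>x. \<bar>x - c\<bar> \<le> e1 ==> DERIV p1 x :> p2 x"
  "\<And>x. \<bar>x - c\<bar> \<le> e1 ==> DERIV p2 x :> p3 x" "\<And>x. \<bar>x - c\<bar> \<le> e1 ==> m1 \<le> p1 x"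
  "\<And>x. \<bar>x - c\<bar> \<le> e1 ==> p1 x \<le> M1" "\<And>x. \<bar>x - c\<bar> \<le> e1 ==> \<bar>p3 x\<bar> \<le> M1"
  by (rule local_diffeo_derivs[OF l1]) (rule that)
 obtain e2 m2 M2 q1 q2 q3 where Q: "0 < e2" "0 < m2"
  "\<And>x. \<bar>x - 0\<bar> \<le> e2 ==> DERIV \<psi> x :> q1 x" "\<And>x. \<bar>x - 0\<bar> \<le> e2 ==> DERIV q1 x :> q2 x"
  "\<And>x. \<bar>x - 0\<bar> \<le> e2 ==> DERIV q2 x :> q3 x" "\<And>x. \<bar>x - 0\<bar> \<le> e2 ==> m2 \<le> q1 x"
  "\<And>x. \<bar>x - 0\<bar> \<le> e2 ==> q1 x \<le> M2" "\<And>x. \<bar>x - 0\<bar> \<le> e2 ==> \<bar>q3 x\<bar> \<le> M2"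
  by (rule local_diffeo_derivs[OF l2]) (rule that)
 have M12: "m1 \<le> M1" "m2 \<le> M2" using P(6,7)[of c] Q(6,7)[of 0] P(1) Q(1) by simp_all
 have phib: "m1 * \<bar>x - c\<bar> \<le> \<bar>\<phi> x\<bar> \<and> \<bar>\<phi> x\<bar> \<le> M1 * \<bar>x - c\<bar> \<and> (c < x \<longrightarrow> 0 < \<phi> x) \<and> (x < c \<longrightarrow> \<phi> x < 0)" if x: "\<bar>x - c\<bar> \<le> e1" for x
 proof (cases x c rule: linorder_cases)
  case less
  obtain t where t: "x < t" "t < c" "\<phi> c - \<phi> x = (c - x) * p1 t"
   using MVT2[OF less, of \<phi> p1] P(3) x by (smt (verit))
  have "m1 \<le> p1 t" "p1 t \<le> M1" using P(6,7)[of t] t x by auto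
  then have h: "(c - x) * m1 \<le> (c - x) * p1 t" "(c - x) * p1 t \<le> (c - x) * M1" "0 < (c - x) * m1" using less P(2) by (simp_all add: mult_left_mono)
  have "m1 * \<bar>x - c\<bar> = (c - x) * m1" "M1 * \<bar>x - c\<bar> = (c - x) * M1" using less by simp_all
  then show ?thesis using t(3) pc less h by (intro conjI impI) linarith+
 next
  case greater
  obtain t where t: "c < t" "t < x" "\<phi> x - \<phi> c = (x - c) * p1 t"
   using MVT2[OF greater, of \<phi> p1] P(3) x by (smt (verit))
  have "m1 \<le> p1 t" "p1 t \<le> M1" using P(6,7)[of t] t x by auto
  then have h: "(x - c) * m1 \<le> (x - c) * p1 t" "(x - c) * p1 t \<le> (x - c) * M1" "0 < (x - c) * m1" using greater P(2) by (simp_all add: mult_left_mono)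
  have "m1 * \<bar>x - c\<bar> = (x - c) * m1" "M1 * \<bar>x - c\<bar> = (x - c) * M1" using greater by simp_all
  then show ?thesis using t(3) pc greater h by (intro conjI impI) linarith+
 qed (use pc in simp)
 have "isCont \<phi> c" using P(1) P(3)[of c] DERIV_isCont by auto
 then have "((\<lambda>x. \<bar>\<phi> x\<bar> powr \<alpha>) \<longlongrightarrow> \<bar>\<phi> c\<bar> powr \<alpha>) (nhds c)"
  using a unfolding isCont_def tendsto_at_iff_tendsto_nhds
  by (intro tendsto_powr2 tendsto_rabs tendsto_const) auto
 then have ev2: "\<forall>\<^sub>F x in nhds c. \<bar>\<phi> x\<bar> powr \<alpha> < e2"
  using pc a Q(1) by (intro order_tendstoD(2)[where y = "\<bar>\<phi> c\<bar> powr \<alpha>"]) simp_all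
 have cb: "-1 < c" "c < 1" using umapD(9,10)[OF u] .
 obtain e3 where e3: "0 < e3" "\<And>x. \<bar>x - c\<bar> < e3 ==> f x = \<psi> (- (\<bar>\<phi> x\<bar> powr \<alpha>)) \<and> \<bar>\<phi> x\<bar> powr \<alpha> < e2"
  using eventually_conj[OF ev ev2] unfolding eventually_nhds_metric dist_real_def by blast
 define e where "e = min (min e1 e3) (min 1 (min ((1 - c)/2) ((1 + c)/2)))"
 have e: "0 < e" "e \<le> e1" "e \<le> e3" "e \<le> 1" "-1 < c - e" "c + e < 1"
  using P(1) e3(1) cb unfolding e_def by (auto simp: min_def field_simps)
 have kp: "kb \<phi> p1 {c - e..c + e} (M1 / m1 + M1\<^sup>2 * 2\<^sup>2 / (4 * m1\<^sup>2))"
 proof (rule kb_C3[OF is_interval_cc, where ?h2.0 = p2 and ?h3.0 = p3])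
  fix x assume "x \<in> {c - e..c + e}"
  then have "\<bar>x - c\<bar> \<le> e1" using e(2) by (auto simp: abs_le_iff)
  then show "DERIV \<phi> x :> p1 x" "DERIV p1 x :> p2 x" "DERIV p2 x :> p3 x" "m1 \<le> p1 x" "\<bar>p3 x\<bar> \<le> M1" using P by blast+
 qed (use P(2) M12 e in auto)
 have kq: "kb \<psi> q1 {-e2..e2} (M2 / m2 + M2\<^sup>2 * (2 * e2)\<^sup>2 / (4 * m2\<^sup>2))"
 proof (rule kb_C3[OF is_interval_cc, where ?h2.0 = q2 and ?h3.0 = q3])
  fix x assume "x \<in> {-e2..e2}"
  then have "\<bar>x - 0\<bar> \<le> e2" by (auto simp: abs_le_iff)
  then show "DERIV \<psi> x :> q1 x" "DERIV q1 x :> q2 x" "DERIV q2 x :> q3 x" "m2 \<le> q1 x" "\<bar>q3 x\<bar> \<le> M2" using Q by blast+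
 qed (use Q(2) M12 in \<open>auto simp: abs_le_iff\<close>)
 have phim: "\<phi> x < \<phi> y" if "c - e \<le> x" "x < y" "y \<le> c + e" for x y
 proof (rule DERIV_pos_imp_increasing[OF that(2)])
  fix t assume "x \<le> t" "t \<le> y"
  then have "\<bar>t - c\<bar> \<le> e1" using that e(2) by (auto simp: abs_le_iff)
  then show "\<exists>y. DERIV \<phi> t :> y \<and> 0 < y" using P(3,6) P(2) by (meson less_le_trans)
 qed
 have der: "DERIV f x :> q1 (- (\<bar>\<phi> x\<bar> powr \<alpha>)) * (- (\<alpha> * \<bar>\<phi> x\<bar> powr (\<alpha> - 1)) * (sgn (\<phi> x) * p1 x))"
  if x: "\<bar>x - c\<bar> < e" "x \<noteq> c" for x
 proof -
  have px: "\<phi> x \<noteq> 0" using phib[of x] x e(2) by auto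
  have "DERIV (\<lambda>x. \<bar>\<phi> x\<bar>) x :> sgn (\<phi> x) * p1 x"
   using px x e(2) by (intro DERIV_chain2[where f = abs] P(3) has_real_derivative_abs) auto
  then have "DERIV (\<lambda>x. \<bar>\<phi> x\<bar> powr \<alpha>) x :> (\<alpha> * \<bar>\<phi> x\<bar> powr (\<alpha> - 1)) * (sgn (\<phi> x) * p1 x)"
   using px by (intro DERIV_chain2[where f = "\<lambda>t. t powr \<alpha>"] has_real_derivative_powr) auto
  then have "DERIV (\<lambda>x. - (\<bar>\<phi> x\<bar> powr \<alpha>)) x :> - ((\<alpha> * \<bar>\<phi> x\<bar> powr (\<alpha> - 1)) * (sgn (\<phi> x) * p1 x))" by (rule DERIV_minus)
  then have "DERIV (\<lambda>x. \<psi> (- (\<bar>\<phi> x\<bar> powr \<alpha>))) x :> q1 (- (\<bar>\<phi> x\<bar> powr \<alpha>)) * (- ((\<alpha> * \<bar>\<phi> x\<bar> powr (\<alpha> - 1)) * (sgn (\<phi> x) * p1 x)))"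
   using e3(2)[of x] x e(3) by (intro DERIV_chain2[where f = \<psi>] Q(3)) auto
  moreover have "open (ball c e)" "x \<in> ball c e" using x by (auto simp: dist_real_def)
  moreover have "\<psi> (- (\<bar>\<phi> y\<bar> powr \<alpha>)) = f y" if "y \<in> ball c e" for y
   using e3(2)[of y] that e(3) by (auto simp: dist_real_def abs_minus_commute)
  ultimately have "DERIV f x :> q1 (- (\<bar>\<phi> x\<bar> powr \<alpha>)) * (- ((\<alpha> * \<bar>\<phi> x\<bar> powr (\<alpha> - 1)) * (sgn (\<phi> x) * p1 x)))"
   by (rule has_field_derivative_transform_within_open)
  then show ?thesis by simp
 qed
 have dfeq: "df x = q1 (- (\<bar>\<phi> x\<bar> powr \<alpha>)) * (- (\<alpha> * \<bar>\<phi> x\<bar> powr (\<alpha> - 1)) * (sgn (\<phi> x) * p1 x))"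
  if x: "\<bar>x - c\<bar> < e" "x \<noteq> c" for x
 proof -
  have "-1 < x" "x < 1" using x e by auto
  then show ?thesis using DERIV_unique[OF umap_deriv_in[OF u] der[OF x]] by blast
 qed
 define C1 where "C1 = M1 / m1 + M1\<^sup>2 * 2\<^sup>2 / (4 * m1\<^sup>2)"
 define C2 where "C2 = M2 / m2 + M2\<^sup>2 * (2 * e2)\<^sup>2 / (4 * m2\<^sup>2)"
 have C12: "0 \<le> C1" "0 \<le> C2" unfolding C1_def C2_def using P(2) Q(2) M12 by simp_all
 define C where "C = C1 + C2 * (\<alpha> * M1 powr (\<alpha> - 1) * M1)\<^sup>2"
 have C0: "0 \<le> C" unfolding C_def using C12 by simp
 \<comment> \<open>The sign \<sigma> selects the side: there |\<phi>| = \<sigma> \<phi>, so that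
   both sides are treated at once.\<close>
 have side: "kb f df S C" if S: "S \<subseteq> {c - e<..<c + e}" "\<sigma> = 1 \<or> \<sigma> = -1" "\<And>x. x \<in> S ==> 0 < \<sigma> * (x - c)" for S \<sigma>
 proof -
  have near: "\<bar>x - c\<bar> \<le> e1" "\<bar>x - c\<bar> < e3" "\<bar>x - c\<bar> \<le> 1" "\<bar>x - c\<bar> < e" if "x \<in> S" for x
   using subsetD[OF S(1) that] e by (auto simp: abs_if)
  have pos: "0 < \<sigma> * \<phi> x" if "x \<in> S" for x using S(2) S(3)[OF that] phib[OF near(1)[OF that]] by auto
  have p1pos: "0 \<le> p1 x" if "x \<in> S" for x using P(6)[OF near(1)[OF that]] P(2) by simp
  have ab: "\<bar>\<phi> x\<bar> = \<sigma> * \<phi> x" "sgn (\<phi> x) = \<sigma>" if "x \<in> S" for x using S(2) pos[OF that] by auto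
  have "kb (\<lambda>x. \<psi> (- ((\<sigma> * \<phi> x) powr \<alpha>))) (\<lambda>x. q1 (- ((\<sigma> * \<phi> x) powr \<alpha>)) * (- (\<alpha> * (\<sigma> * \<phi> x) powr (\<alpha> - 1)) * (\<sigma> * p1 x))) S C"
   unfolding C_def
  proof (rule kb_side[OF a _ _ _ _ _ _ kq[folded C2_def] C12(2)])
   have k0: "kb \<phi> p1 S C1" by (rule kb_mono[OF kp[folded C1_def] _ order_refl]) (use S(1) in auto)
   show "kb (\<lambda>x. \<sigma> * \<phi> x) (\<lambda>x. \<sigma> * p1 x) S C1" using S(2) k0 kb_neg[OF k0] by auto
   show "inj_on (\<lambda>x. \<sigma> * \<phi> x) S"
   proof (rule linorder_inj_onI')
    fix i j assume "i \<in> S" "j \<in> S" "i < j"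
    then show "\<sigma> * \<phi> i \<noteq> \<sigma> * \<phi> j" using phim[of i j] subsetD[OF S(1), of i] subsetD[OF S(1), of j] S(2) by auto
   qed
   fix x assume x: "x \<in> S"
   show "0 < \<sigma> * \<phi> x" by (rule pos[OF x])
   show "\<bar>\<sigma> * p1 x\<bar> \<le> M1" using P(6,7)[OF near(1)[OF x]] P(2) S(2) by auto
   have "M1 * \<bar>x - c\<bar> \<le> M1 * 1" using near(3)[OF x] M12 P(2) by (intro mult_left_mono) simp_all
   then show "\<sigma> * \<phi> x \<le> M1" using phib[OF near(1)[OF x]] ab(1)[OF x] by linarith
   have "(\<sigma> * \<phi> x) powr \<alpha> < e2" using e3(2)[OF near(2)[OF x]] unfolding ab(1)[OF x] by blast
   moreover have "0 \<le> (\<sigma> * \<phi> x) powr \<alpha>" by simp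
   ultimately show "- ((\<sigma> * \<phi> x) powr \<alpha>) \<in> {-e2..e2}" unfolding atLeastAtMost_iff using Q(1) by linarith
  next
   show "(\<forall>x\<in>S. 0 \<le> \<sigma> * p1 x) \<or> (\<forall>x\<in>S. \<sigma> * p1 x \<le> 0)"
    using S(2) p1pos by auto
  qed
  then show ?thesis
  proof (rule kb_cong)
   fix x assume x: "x \<in> S"
   show "f x = \<psi> (- ((\<sigma> * \<phi> x) powr \<alpha>))" using e3(2)[OF near(2)[OF x]] unfolding ab(1)[OF x] by blast
   have "x \<noteq> c" using S(3)[OF x] by auto
   then show "df x = q1 (- ((\<sigma> * \<phi> x) powr \<alpha>)) * (- (\<alpha> * (\<sigma> * \<phi> x) powr (\<alpha> - 1)) * (\<sigma> * p1 x))"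
    using dfeq[OF near(4)[OF x]] unfolding ab[OF x] by blast
  qed
 qed
 have right: "kb f df {c<..<c + e} C" by (rule side[of _ 1]) (use e in auto)
 have left: "kb f df {c - e<..<c} C" by (rule side[of _ "-1"]) (use e in auto)
 define K where "K = M2 * (\<alpha> * M1 powr (\<alpha> - 1) * M1)"
 define k where "k = m2 * m1 powr \<alpha>"
 have K0: "0 < K" "0 < k" unfolding K_def k_def using P(2) Q(2) M12 a by simp_all
 have Kb: "\<bar>df x\<bar> \<le> K * \<bar>x - c\<bar> powr (\<alpha> - 1)" if x: "\<bar>x - c\<bar> < e" for x
 proof (cases "x = c")
  case True then show ?thesis using umapD(8)[OF u] by simp
 next
  case False
  have x': "\<bar>x - c\<bar> \<le> e1" "\<bar>x - c\<bar> < e3" using x e by auto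
  have px: "\<phi> x \<noteq> 0" using phib[OF x'(1)] False by auto
  have "\<bar>- (\<bar>\<phi> x\<bar> powr \<alpha>) - 0\<bar> \<le> e2" using e3(2)[OF x'(2)] by simp
  from Q(6,7)[OF this] have q: "\<bar>q1 (- (\<bar>\<phi> x\<bar> powr \<alpha>))\<bar> \<le> M2" using Q(2) by simp
  have p: "\<bar>p1 x\<bar> \<le> M1" using P(6,7)[OF x'(1)] P(2) by simp
  have "\<bar>df x\<bar> = \<bar>q1 (- (\<bar>\<phi> x\<bar> powr \<alpha>))\<bar> * (\<alpha> * \<bar>\<phi> x\<bar> powr (\<alpha> - 1) * \<bar>p1 x\<bar>)"
   unfolding dfeq[OF x False] using px a by (simp add: abs_mult abs_sgn_eq)
  also have "\<dots> \<le> M2 * (\<alpha> * (M1 * \<bar>x - c\<bar>) powr (\<alpha> - 1) * M1)"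
   using q p phib[OF x'(1)] a Q(2) M12 P(2) by (intro mult_mono powr_mono2 mult_nonneg_nonneg) auto
  also have "\<dots> = K * \<bar>x - c\<bar> powr (\<alpha> - 1)" unfolding K_def using M12 P(2) by (simp add: powr_mult)
  finally show ?thesis .
 qed
 have kbd: "k * \<bar>x - c\<bar> powr \<alpha> \<le> f c - f x" if x: "\<bar>x - c\<bar> < e" for x
 proof -
  have x': "\<bar>x - c\<bar> \<le> e1" "\<bar>x - c\<bar> < e3" using x e by auto
  have fc: "f c = \<psi> 0" using e3(2)[of c] e3(1) pc a by simp
  define t where "t = \<bar>\<phi> x\<bar> powr \<alpha>"
  have fx: "f x = \<psi> (- t)" and t: "0 \<le> t" "t < e2" using e3(2)[OF x'(2)] unfolding t_def by auto
  have "m2 * t \<le> \<psi> 0 - \<psi> (- t)"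
  proof (cases "t = 0")
   case False
   then have t0: "- t < 0" using t by simp
   obtain s where s: "- t < s" "s < 0" "\<psi> 0 - \<psi> (- t) = (0 - - t) * q1 s"
    using MVT2[OF t0, of \<psi> q1] Q(3) t by (smt (verit))
   have "m2 \<le> q1 s" using Q(6)[of s] s t by simp
   then show ?thesis unfolding s(3) using t mult_left_mono[of m2 "q1 s" t] by (simp add: mult.commute)
  qed simp
  moreover have "m2 * ((m1 * \<bar>x - c\<bar>) powr \<alpha>) \<le> m2 * t" unfolding t_def using phib[OF x'(1)] a P(2) Q(2)
   by (intro mult_left_mono powr_mono2) auto
  ultimately show ?thesis unfolding fc fx k_def using P(2) by (simp add: powr_mult mult.assoc)
 qed
 show ?thesis by (rule that[OF e(1,5,6) C0 K0(2,1) right left Kb kbd])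
qed

text \<open>On each branch the local and the far estimate overlap on an interval of length e/2 and
  are glued. Away from c the power laws follow from compactness and from the monotonicity of the
  branches.\<close>

lemma umap_global:
 assumes u: "umap \<alpha> f df c" and a: "1 < \<alpha>"
 shows "\<exists>C\<ge>0. kb f df {-1<..<c} C \<and> kb f df {c<..<1} C"
  and "\<exists>k>0. \<exists>K>0. \<forall>x\<in>{-1..1}. \<bar>df x\<bar> \<le> K * \<bar>x - c\<bar> powr (\<alpha> - 1) \<and> k * \<bar>x - c\<bar> powr \<alpha> \<le> f c - f x"
proof -
 obtain e C k K where E: "0 < e" "-1 < c - e" "c + e < 1" "0 \<le> C" "0 < k" "0 < K"
  "kb f df {c<..<c + e} C" "kb f df {c - e<..<c} C"
  "\<And>x. \<bar>x - c\<bar> < e ==> \<bar>df x\<bar> \<le> K * \<bar>x - c\<bar> powr (\<alpha> - 1)" "\<And>x. \<bar>x - c\<bar> < e ==> k * \<bar>x - c\<bar> powr \<alpha> \<le> f c - f x"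
  by (rule umap_near[OF u a]) (rule that)
 have pk: "\<And>x y. -1 \<le> x ==> x < y ==> y \<le> c ==> f x < f y" "\<And>x y. c \<le> x ==> x < y ==> y \<le> 1 ==> f y < f x"
  using umapD(2)[OF u] unfolding peak_def by blast+
 have cb: "-1 < c" "c < 1" using umapD(9,10)[OF u] .
 have "continuous_on {-1..1} (\<lambda>x. \<bar>df x\<bar>)" by (intro continuous_intros umapD(4)[OF u])
 moreover have "{-1..1::real} \<noteq> {}" by simp
 ultimately obtain xM where xM: "\<forall>x\<in>{-1..1}. \<bar>df x\<bar> \<le> \<bar>df xM\<bar>"
  using continuous_attains_sup[of "{-1..1}" "\<lambda>x. \<bar>df x\<bar>"] by blast
 define M where "M = \<bar>df xM\<bar>"
 have M: "\<And>x. x \<in> {-1..1} ==> \<bar>df x\<bar> \<le> M" using xM unfolding M_def by blast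
 have cont: "continuous_on {-1..1} f" by (rule unim_cont[OF umapD(1)[OF u]])
 obtain Cl where Cl: "0 \<le> Cl" "kb f df {-1<..<c - e/2} Cl"
 proof -
  have "\<exists>C\<ge>0. kb f df {-1<..<c - e/2} C"
  proof (rule kb_far[OF u, of "{-1..<c}"])
   show "smooth_on f {-1..<c}" using u unfolding umap_def by blast
   show "(\<forall>x\<in>{-1..<c}. 0 < df x) \<or> (\<forall>x\<in>{-1..<c}. df x < 0)" using umapD(6)[OF u] by simp
  qed (use E cb in \<open>auto simp: is_interval_co\<close>)
  then show ?thesis using that by blast
 qed
 obtain Cr where Cr: "0 \<le> Cr" "kb f df {c + e/2<..<1} Cr"
 proof -
  have "\<exists>C\<ge>0. kb f df {c + e/2<..<1} C"
  proof (rule kb_far[OF u, of "{c<..1}"])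
   show "smooth_on f {c<..1}" using u unfolding umap_def by blast
   show "(\<forall>x\<in>{c<..1}. 0 < df x) \<or> (\<forall>x\<in>{c<..1}. df x < 0)" using umapD(7)[OF u] by simp
  qed (use E cb in \<open>auto simp: is_interval_oc\<close>)
  then show ?thesis using that by blast
 qed
 have "\<exists>C\<ge>0. kb f df {-1<..<c} C"
 proof (rule kb_glue[where s = "c - e" and d = "e/2" and M = M])
  show "continuous_on {-1..c} f" by (rule continuous_on_subset[OF cont]) (use cb in auto)
  show "kb f df {-1<..<c - e + e/2} Cl" using Cl(2) by (simp add: field_simps)
 qed (use pk M cb E in auto)
 then obtain A where A: "0 \<le> A" "kb f df {-1<..<c} A" by blast
 have "\<exists>C\<ge>0. kb f df {c<..<1} C"
 proof (rule kb_glue[where s = "c + e/2" and d = "e/2" and M = M])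
  show "continuous_on {c..1} f" by (rule continuous_on_subset[OF cont]) (use cb in auto)
  show "kb f df {c<..<c + e/2 + e/2} C" using E(7) by (simp add: add.commute)
 qed (use pk M cb E Cr in auto)
 then obtain B where B: "0 \<le> B" "kb f df {c<..<1} B" by blast
 have "kb f df {-1<..<c} (max A B)" "kb f df {c<..<1} (max A B)"
  by (rule kb_mono[OF A(2)]; simp) (rule kb_mono[OF B(2)]; simp)
 then show "\<exists>C\<ge>0. kb f df {-1<..<c} C \<and> kb f df {c<..<1} C" using A(1) by (intro exI[of _ "max A B"]) simp
 define d where "d = min (f c - f (c - e)) (f c - f (c + e))"
 have d: "0 < d" using pk(1)[of "c - e" c] pk(2)[of c "c + e"] E unfolding d_def by simp
 define K' where "K' = max K (M / e powr (\<alpha> - 1))"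
 define k' where "k' = min k (d / 2 powr \<alpha>)"
 have K': "0 < K'" "K \<le> K'" "M / e powr (\<alpha> - 1) \<le> K'" unfolding K'_def using E(6) by auto
 have k': "0 < k'" "k' \<le> k" "k' \<le> d / 2 powr \<alpha>" unfolding k'_def using E(5) d by auto
 have "\<bar>df x\<bar> \<le> K' * \<bar>x - c\<bar> powr (\<alpha> - 1) \<and> k' * \<bar>x - c\<bar> powr \<alpha> \<le> f c - f x" if x: "x \<in> {-1..1}" for x
 proof (cases "\<bar>x - c\<bar> < e")
  case True
  have "K * \<bar>x - c\<bar> powr (\<alpha> - 1) \<le> K' * \<bar>x - c\<bar> powr (\<alpha> - 1)" "k' * \<bar>x - c\<bar> powr \<alpha> \<le> k * \<bar>x - c\<bar> powr \<alpha>"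
   using K' k' by (auto intro: mult_right_mono)
  then show ?thesis using E(9,10)[OF True] by linarith
 next
  case False
  have "M = M / e powr (\<alpha> - 1) * e powr (\<alpha> - 1)" using E(1) by simp
  also have "\<dots> \<le> K' * \<bar>x - c\<bar> powr (\<alpha> - 1)" using K' False E(1) a by (intro mult_mono powr_mono2) auto
  finally have 1: "\<bar>df x\<bar> \<le> K' * \<bar>x - c\<bar> powr (\<alpha> - 1)" using M[OF x] by simp
  have "d \<le> f c - f x"
  proof (cases "x < c")
   case True
   then have "x \<le> c - e" using False by simp
   then have "f x \<le> f (c - e)" using pk(1)[of x "c - e"] x E by (cases "x = c - e") auto
   then show ?thesis unfolding d_def by simp
  next
   case nl: False
   then have "c + e \<le> x" using False by simp
   then have "f x \<le> f (c + e)" using pk(2)[of "c + e" x] x E by (cases "x = c + e") auto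
   then show ?thesis unfolding d_def by simp
  qed
  moreover have "k' * \<bar>x - c\<bar> powr \<alpha> \<le> d / 2 powr \<alpha> * 2 powr \<alpha>"
   using k' x cb a d by (intro mult_mono powr_mono2) auto
  ultimately show ?thesis using 1 by simp
 qed
 then show "\<exists>k>0. \<exists>K>0. \<forall>x\<in>{-1..1}. \<bar>df x\<bar> \<le> K * \<bar>x - c\<bar> powr (\<alpha> - 1) \<and> k * \<bar>x - c\<bar> powr \<alpha> \<le> f c - f x"
  using K'(1) k'(1) by blast
qed

section \<open>Chains of intervals and real bounds\<close>

definition smono :: "(real \<Rightarrow> real) \<Rightarrow> real \<Rightarrow> real \<Rightarrow> bool" where
 "smono g l h \<longleftrightarrow> (\<forall>x y. l \<le> x \<longrightarrow> x < y \<longrightarrow> y \<le> h \<longrightarrow> g x < g y) \<or> (\<forall>x y. l \<le> x \<longrightarrow> x < y \<longrightarrow> y \<le> h \<longrightarrow> g y < g x)"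

lemma smono_sub: "smono g l h ==> l \<le> l' ==> h' \<le> h ==> smono g l' h'"
 unfolding smono_def by (meson order_trans)

lemma smono_image_ends:
 assumes "smono g l h" "g ` {l..h} = {l'..h'}" "l \<le> h"
 shows "(g l = l' \<and> g h = h' \<and> (\<forall>x y. l \<le> x \<longrightarrow> x < y \<longrightarrow> y \<le> h \<longrightarrow> g x < g y)) \<or>
    (g l = h' \<and> g h = l' \<and> (\<forall>x y. l \<le> x \<longrightarrow> x < y \<longrightarrow> y \<le> h \<longrightarrow> g y < g x))"
proof -
 have ne: "l' \<le> h'" using assms(2,3) by (metis atLeastatMost_empty_iff image_is_empty)
 have "l' \<in> g ` {l..h}" "h' \<in> g ` {l..h}" unfolding assms(2) using ne by simp_all
 then obtain p r where "p \<in> {l..h}" "g p = l'" "r \<in> {l..h}" "g r = h'" by blast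
 then have pr: "l \<le> p" "p \<le> h" "g p = l'" "l \<le> r" "r \<le> h" "g r = h'" by simp_all
 have bd: "l' \<le> g x \<and> g x \<le> h'" if "l \<le> x" "x \<le> h" for x using image_Icc_D[OF assms(2) that] .
 from assms(1)[unfolded smono_def] show ?thesis
 proof
  assume m: "\<forall>x y. l \<le> x \<longrightarrow> x < y \<longrightarrow> y \<le> h \<longrightarrow> g x < g y"
  have "p = l" using m[rule_format, of l p] pr bd[of l] assms(3) by force
  moreover have "r = h" using m[rule_format, of r h] pr bd[of h] assms(3) by force
  ultimately show ?thesis using pr m by blast
 next
  assume m: "\<forall>x y. l \<le> x \<longrightarrow> x < y \<longrightarrow> y \<le> h \<longrightarrow> g y < g x"
  have "r = l" using m[rule_format, of l r] pr bd[of l] assms(3) by force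
  moreover have "p = h" using m[rule_format, of p h] pr bd[of h] assms(3) by force
  ultimately show ?thesis using pr m by blast
 qed
qed

lemma mono_preimage:
 fixes g :: "real \<Rightarrow> real"
 assumes cont: "continuous_on {p..r} g" and pr: "p \<le> r"
  and m: "\<forall>x y. p \<le> x \<longrightarrow> x < y \<longrightarrow> y \<le> r \<longrightarrow> g x < g y" and y: "g p \<le> y1" "y1 \<le> y2" "y2 \<le> g r"
 shows "\<exists>x1 x2. p \<le> x1 \<and> x1 \<le> x2 \<and> x2 \<le> r \<and> g x1 = y1 \<and> g x2 = y2 \<and> g ` {x1..x2} = {y1..y2}"
proof -
 obtain x1 where x1: "p \<le> x1" "x1 \<le> r" "g x1 = y1" using IVT'[of g p y1 r] cont pr y by auto
 obtain x2 where x2: "p \<le> x2" "x2 \<le> r" "g x2 = y2" using IVT'[of g p y2 r] cont pr y by auto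
 have le: "x1 \<le> x2"
 proof (rule ccontr)
  assume "\<not> x1 \<le> x2"
  then have "g x2 < g x1" using m x1 x2 by auto
  then show False using x1 x2 y by simp
 qed
 have wm: "g x \<le> g y" if "p \<le> x" "x \<le> y" "y \<le> r" for x y using m that by (metis less_eq_real_def)
 have "g ` {x1..x2} = {y1..y2}"
 proof
  show "g ` {x1..x2} \<subseteq> {y1..y2}" using wm x1 x2 by fastforce
  have "continuous_on {x1..x2} g" using x1 x2 by (intro continuous_on_subset[OF cont]) auto
  from image_contains_Icc[OF this le] show "{y1..y2} \<subseteq> g ` {x1..x2}" using x1 x2 y by simp
 qed
 then show ?thesis using x1 x2 le by blast
qed

lemma mono_preimage_dec:
 fixes g :: "real \<Rightarrow> real"
 assumes cont: "continuous_on {p..r} g" and pr: "p \<le> r"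
  and m: "\<forall>x y. p \<le> x \<longrightarrow> x < y \<longrightarrow> y \<le> r \<longrightarrow> g y < g x" and y: "g r \<le> y1" "y1 \<le> y2" "y2 \<le> g p"
 shows "\<exists>x1 x2. p \<le> x1 \<and> x1 \<le> x2 \<and> x2 \<le> r \<and> g x1 = y2 \<and> g x2 = y1 \<and> g ` {x1..x2} = {y1..y2}"
proof -
 obtain x1 x2 where x: "p \<le> x1" "x1 \<le> x2" "x2 \<le> r" "- g x1 = - y2" "- g x2 = - y1" "(\<lambda>x. - g x) ` {x1..x2} = {-y2..-y1}"
  using mono_preimage[of p r "\<lambda>x. - g x" "-y2" "-y1"] cont pr m y by (auto intro: continuous_on_minus)
 have "g ` {x1..x2} = uminus ` (\<lambda>x. - g x) ` {x1..x2}" by (simp add: image_image)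
 then have "g ` {x1..x2} = {y1..y2}" using x(6) by simp
 then show ?thesis using x by auto
qed

text \<open>One level of one map: [a,b] is the interval around c, q its period, C the kernel
  constant on both branches. The boundary values ensure that each branch of f covers everything from
  -1 up to f c, as pull-backs require.\<close>

locale lvl =
 fixes \<alpha> :: real and f df :: "real \<Rightarrow> real" and c :: real and q :: nat and a b C :: real
 assumes u: "umap \<alpha> f df c" and f1: "f (-1) = -1" "f 1 = -1" and lv: "lev f c q a b"
  and C0: "0 \<le> C" and kbl: "kb f df {-1<..<c} C" and kbr: "kb f df {c<..<1} C"
begin

lemmas un = umapD(1)[OF u]

lemma q0: "0 < q" and cy: "cyc f c q a b" and fab: "f a = f b" and cint: "c \<in> interior ((f ^^ q) ` {a..b})"
 using lv unfolding lev_def by blast+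

lemmas bd = cyc_bounds[OF cy]

lemma inc: "-1 \<le> x ==> x < y ==> y \<le> c ==> f x < f y" and dec: "c \<le> x ==> x < y ==> y \<le> 1 ==> f y < f x"
 using umapD(2)[OF u] unfolding peak_def by blast+

lemma fmax: "x \<in> {-1..1} ==> f x \<le> f c"
 using inc[of x c] dec[of c x] by (cases x c rule: linorder_cases) auto

text \<open>The endpoints of the i-th image I_i of [a,b]. The non-overlapping ones are I_1, ...,
  I_q, where I_1 ends at the critical value and I_q contains c.\<close>

definition Lo :: "nat \<Rightarrow> real" where "Lo i = Inf ((f ^^ i) ` {a..b})"
definition Hi :: "nat \<Rightarrow> real" where "Hi i = Sup ((f ^^ i) ` {a..b})"

lemma Iv: "(f ^^ i) ` {a..b} = {Lo i..Hi i}" "Lo i < Hi i" "-1 \<le> Lo i" "Hi i \<le> 1"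
proof -
 obtain l h where lh: "(f ^^ i) ` {a..b} = {l..h}" "l < h" "-1 \<le> l" "h \<le> 1" using pow_Icc_ex[OF un bd, of i] by blast
 then have "Lo i = l" "Hi i = h" unfolding Lo_def Hi_def by simp_all
 then show "(f ^^ i) ` {a..b} = {Lo i..Hi i}" "Lo i < Hi i" "-1 \<le> Lo i" "Hi i \<le> 1" using lh by simp_all
qed

lemma Iv_pow: "(f ^^ n) ` {Lo i..Hi i} = {Lo (n + i)..Hi (n + i)}"
 using pow_add_image[of n i f "{a..b}"] by (simp add: Iv)

lemma Iv_wrap: "Lo i \<le> Lo (q + i)" "Hi (q + i) \<le> Hi i"
proof -
 have "(f ^^ q) ` {a..b} \<subseteq> {a..b}" using cy unfolding cyc_def by blast
 then have "(f ^^ i) ` (f ^^ q) ` {a..b} \<subseteq> (f ^^ i) ` {a..b}" by (rule image_mono)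
 then have "(f ^^ (i + q)) ` {a..b} \<subseteq> (f ^^ i) ` {a..b}" by (simp only: pow_add_image)
 then have "{Lo (i + q)..Hi (i + q)} \<subseteq> {Lo i..Hi i}" by (simp only: Iv)
 then show "Lo i \<le> Lo (q + i)" "Hi (q + i) \<le> Hi i" using Iv(2)[of "i + q"] by (auto simp: add.commute)
qed

lemma disj: "1 \<le> i ==> i < l ==> l \<le> q ==> Hi i \<le> Lo l \<or> Hi l \<le> Lo i"
 using cyc_disjoint[OF un cy, of i l] no_ovl_cases[of "Lo i" "Hi i" "Lo l" "Hi l"] Iv(1,2)[of i] Iv(1,2)[of l] by auto

lemma disj': "1 \<le> i ==> i \<le> q ==> 1 \<le> l ==> l \<le> q ==> i \<noteq> l ==> Hi i \<le> Lo l \<or> Hi l \<le> Lo i"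
 using disj[of i l] disj[of l i] by (meson linorder_neqE_nat)

lemma crit_q: "Lo q < c" "c < Hi q"
 using cint unfolding Iv(1) by (simp_all add: interior_atLeastAtMost_real)

lemma crit_av: "1 \<le> i ==> i < q ==> c < Lo i \<or> Hi i < c"
 using disj[of i q] crit_q by auto

lemma Iv_0: "Lo 0 = a" "Hi 0 = b"
 unfolding Lo_def Hi_def using bd by simp_all

lemma Iv_q: "a \<le> Lo q" "Hi q \<le> b"
 using Iv_wrap[of 0] Iv_0 by simp_all

lemma Iv_1: "Lo 1 = f a" "Hi 1 = f c"
proof -
 have "f x \<in> {f a..f c}" if "x \<in> {a..b}" for x
  using that inc[of a x] dec[of x b] fmax[of x] bd fab by (cases "x \<le> c") (cases "x = a"; cases "x = b"; force)+
 moreover have "f a \<in> f ` {a..b}" "f c \<in> f ` {a..b}" using bd by auto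
 ultimately have "Lo 1 \<le> f a" "f a \<le> Lo 1" "Hi 1 \<le> f c" "f c \<le> Hi 1"
 proof -
  assume A: "\<And>x. x \<in> {a..b} ==> f x \<in> {f a..f c}" "f a \<in> f ` {a..b}" "f c \<in> f ` {a..b}"
  have eq: "f ` {a..b} = {Lo 1..Hi 1}" using Iv(1)[of 1] by simp
  show "Lo 1 \<le> f a" "f c \<le> Hi 1" using A(2,3) unfolding eq by auto
  have "Lo 1 \<in> f ` {a..b}" "Hi 1 \<in> f ` {a..b}" unfolding eq using Iv(2)[of 1] by auto
  then show "f a \<le> Lo 1" "Hi 1 \<le> f c" using A(1) by (metis atLeastAtMost_iff imageE)+
 qed
 then show "Lo 1 = f a" "Hi 1 = f c" by simp_all
qed

text \<open>No value of f exceeds f c, which is the right end of I_1, and I_i does not overlap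
  I_1.\<close>

lemma left_of_1: "2 \<le> i ==> i \<le> q ==> Hi i \<le> f a"
proof -
 assume i: "2 \<le> i" "i \<le> q"
 have "Hi i \<le> f c"
 proof -
  have "Hi i \<in> (f ^^ i) ` {a..b}" using Iv(1,2)[of i] by simp
  then obtain x where x: "x \<in> {a..b}" "Hi i = (f ^^ i) x" by blast
  have "(f ^^ i) x = f ((f ^^ (i - 1)) x)" using i by (cases i) auto
  moreover have "(f ^^ (i - 1)) x \<in> {-1..1}" using unim_pow_maps[OF un, of x] x bd by auto
  ultimately show ?thesis using fmax x by simp
 qed
 then show "Hi i \<le> f a" using disj[of 1 i] i Iv(2)[of i] Iv_1 by auto
qed

text \<open>A chain pulls an interval back along the orbit of \<open>[a,b]\<close> by monotone branches of \<open>f\<close>.\<close>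

definition chain :: "nat \<Rightarrow> nat \<Rightarrow> (nat \<Rightarrow> real) \<Rightarrow> (nat \<Rightarrow> real) \<Rightarrow> bool" where
 "chain i0 j s t \<longleftrightarrow> (\<forall>i. i0 \<le> i \<longrightarrow> i \<le> j \<longrightarrow> -1 \<le> s i \<and> s i \<le> Lo i \<and> Hi i \<le> t i \<and> t i \<le> 1) \<and>
  (\<forall>i. i0 \<le> i \<longrightarrow> i < j \<longrightarrow> f ` {s i..t i} = {s (Suc i)..t (Suc i)} \<and> (t i \<le> c \<or> c \<le> s i))"

lemma chainD:
 assumes "chain i0 j s t" "i0 \<le> i"
 shows "i \<le> j ==> -1 \<le> s i" "i \<le> j ==> s i \<le> Lo i" "i \<le> j ==> Hi i \<le> t i" "i \<le> j ==> t i \<le> 1" "i \<le> j ==> s i < t i"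
  "i < j ==> f ` {s i..t i} = {s (Suc i)..t (Suc i)}" "i < j ==> t i \<le> c \<or> c \<le> s i"
 using assms Iv(2)[of i] unfolding chain_def by force+

lemma chain_pow:
 assumes ch: "chain i0 j s t" and i: "i0 \<le> i"
 shows "i + n \<le> j ==> (f ^^ n) ` {s i..t i} = {s (i + n)..t (i + n)} \<and> smono (f ^^ n) (s i) (t i)"
proof (induction n)
 case (Suc n)
 then have IH: "(f ^^ n) ` {s i..t i} = {s (i + n)..t (i + n)}" "smono (f ^^ n) (s i) (t i)" by simp_all
 have ii: "i0 \<le> i + n" "i + n < j" using i Suc.prems by simp_all
 note D = chainD[OF ch ii(1)]
 have 1: "(f ^^ Suc n) ` {s i..t i} = {s (i + Suc n)..t (i + Suc n)}"
 proof -
  have "(f ^^ Suc n) ` {s i..t i} = f ` (f ^^ n) ` {s i..t i}" by (simp add: image_comp)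
  then show ?thesis using D(6)[OF ii(2)] IH(1) by simp
 qed
 have fm: "smono f (s (i + n)) (t (i + n))"
  using D(7)[OF ii(2)] D(1,4)[OF less_imp_le[OF ii(2)]]
  unfolding smono_def using inc dec by (meson order_trans)
 have rng: "s (i + n) \<le> (f ^^ n) x \<and> (f ^^ n) x \<le> t (i + n)" if "s i \<le> x" "x \<le> t i" for x
  using image_Icc_D[OF IH(1) that] .
 have 2: "smono (f ^^ Suc n) (s i) (t i)"
 proof -
  have A: "(f ^^ Suc n) x < (f ^^ Suc n) y" if "\<forall>x y. s (i + n) \<le> x \<longrightarrow> x < y \<longrightarrow> y \<le> t (i + n) \<longrightarrow> f x < f y"
   "(f ^^ n) x < (f ^^ n) y" "s i \<le> x" "x \<le> t i" "s i \<le> y" "y \<le> t i" for x y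
   using that rng by simp
  have B: "(f ^^ Suc n) y < (f ^^ Suc n) x" if "\<forall>x y. s (i + n) \<le> x \<longrightarrow> x < y \<longrightarrow> y \<le> t (i + n) \<longrightarrow> f y < f x"
   "(f ^^ n) x < (f ^^ n) y" "s i \<le> x" "x \<le> t i" "s i \<le> y" "y \<le> t i" for x y
   using that rng by simp
  show ?thesis using fm[unfolded smono_def] IH(2)[unfolded smono_def]
  proof (elim disjE)
   assume h: "\<forall>x y. s (i + n) \<le> x \<longrightarrow> x < y \<longrightarrow> y \<le> t (i + n) \<longrightarrow> f x < f y" "\<forall>x y. s i \<le> x \<longrightarrow> x < y \<longrightarrow> y \<le> t i \<longrightarrow> (f ^^ n) x < (f ^^ n) y"
   have "(f ^^ Suc n) x < (f ^^ Suc n) y" if "s i \<le> x" "x < y" "y \<le> t i" for x y using A[OF h(1), of x y] h(2) that by simp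
   then show ?thesis unfolding smono_def by blast
  next
   assume h: "\<forall>x y. s (i + n) \<le> x \<longrightarrow> x < y \<longrightarrow> y \<le> t (i + n) \<longrightarrow> f x < f y" "\<forall>x y. s i \<le> x \<longrightarrow> x < y \<longrightarrow> y \<le> t i \<longrightarrow> (f ^^ n) y < (f ^^ n) x"
   have "(f ^^ Suc n) y < (f ^^ Suc n) x" if "s i \<le> x" "x < y" "y \<le> t i" for x y using A[OF h(1), of y x] h(2) that by simp
   then show ?thesis unfolding smono_def by blast
  next
   assume h: "\<forall>x y. s (i + n) \<le> x \<longrightarrow> x < y \<longrightarrow> y \<le> t (i + n) \<longrightarrow> f y < f x" "\<forall>x y. s i \<le> x \<longrightarrow> x < y \<longrightarrow> y \<le> t i \<longrightarrow> (f ^^ n) x < (f ^^ n) y"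
   have "(f ^^ Suc n) y < (f ^^ Suc n) x" if "s i \<le> x" "x < y" "y \<le> t i" for x y using B[OF h(1), of x y] h(2) that by simp
   then show ?thesis unfolding smono_def by blast
  next
   assume h: "\<forall>x y. s (i + n) \<le> x \<longrightarrow> x < y \<longrightarrow> y \<le> t (i + n) \<longrightarrow> f y < f x" "\<forall>x y. s i \<le> x \<longrightarrow> x < y \<longrightarrow> y \<le> t i \<longrightarrow> (f ^^ n) y < (f ^^ n) x"
   have "(f ^^ Suc n) x < (f ^^ Suc n) y" if "s i \<le> x" "x < y" "y \<le> t i" for x y using B[OF h(1), of y x] h(2) that by simp
   then show ?thesis unfolding smono_def by blast
  qed
 qed
 show ?case using 1 2 by blast
next
 case 0
 have "smono (\<lambda>x. x) (s i) (t i)" unfolding smono_def by simp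
 then show ?case by simp
qed

lemma chain_inside:
 assumes ch: "chain i0 j s t" and i: "i0 \<le> i" "i + n \<le> j" and x: "s i \<le> x" "x \<le> y" "y \<le> t i"
  and im: "(f ^^ n) ` {x..y} = {x'..y'}"
 shows "s i < x ==> y < t i ==> s (i + n) < x' \<and> y' < t (i + n)"
proof -
 assume st: "s i < x" "y < t i"
 note P = chain_pow[OF ch i]
 have le: "s i \<le> t i" using x by simp
 have "smono (f ^^ n) x y" using smono_sub[of "f ^^ n" "s i" "t i" x y] P x by simp
 from smono_image_ends[OF this im x(2)]
 have e2: "x' \<in> {(f ^^ n) x, (f ^^ n) y}" "y' \<in> {(f ^^ n) x, (f ^^ n) y}" by blast+
 have xy: "s i < x" "x < t i" "s i < y" "y < t i" using st x by simp_all
 from smono_image_ends[OF conjunct2[OF P] conjunct1[OF P] le] show ?thesis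
 proof
  assume A: "(f ^^ n) (s i) = s (i + n) \<and> (f ^^ n) (t i) = t (i + n) \<and> (\<forall>x y. s i \<le> x \<longrightarrow> x < y \<longrightarrow> y \<le> t i \<longrightarrow> (f ^^ n) x < (f ^^ n) y)"
  then have b: "s (i + n) < (f ^^ n) z \<and> (f ^^ n) z < t (i + n)" if "s i < z" "z < t i" for z
   using A[THEN conjunct2, THEN conjunct2, rule_format, of "s i" z] A[THEN conjunct2, THEN conjunct2, rule_format, of z "t i"] that by simp
  show ?thesis using b[OF xy(1,2)] b[OF xy(3,4)] e2 by auto
 next
  assume A: "(f ^^ n) (s i) = t (i + n) \<and> (f ^^ n) (t i) = s (i + n) \<and> (\<forall>x y. s i \<le> x \<longrightarrow> x < y \<longrightarrow> y \<le> t i \<longrightarrow> (f ^^ n) y < (f ^^ n) x)"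
  then have b: "s (i + n) < (f ^^ n) z \<and> (f ^^ n) z < t (i + n)" if "s i < z" "z < t i" for z
   using A[THEN conjunct2, THEN conjunct2, rule_format, of "s i" z] A[THEN conjunct2, THEN conjunct2, rule_format, of z "t i"] that by simp
  show ?thesis using b[OF xy(1,2)] b[OF xy(3,4)] e2 by auto
 qed
qed

text \<open>Write T_i for [s i, t i]. A pull-back can only fail when T_(i+1) reaches beyond f c. It
  then strictly contains I_1, and pushing forward shows that [h1,h2] strictly contains some I_l with
  l < j.\<close>

lemma chain_exists:
 assumes j: "1 \<le> j" "j \<le> q" and H: "-1 \<le> h1" "h1 \<le> Lo j" "Hi j \<le> h2" "h2 \<le> 1"
  and no: "\<And>l. 1 \<le> l ==> l < j ==> \<not> (h1 < Lo l \<and> Hi l < h2)"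
 shows "\<exists>s t. chain 1 j s t \<and> s j = h1 \<and> t j = h2"
proof -
 have "\<exists>s t. chain (j - d) j s t \<and> s j = h1 \<and> t j = h2" if "d < j" for d
  using that
 proof (induction d)
  case 0
  show ?case
   by (rule exI[of _ "\<lambda>_. h1"], rule exI[of _ "\<lambda>_. h2"]) (use H in \<open>auto simp: chain_def\<close>)
 next
  case (Suc d)
  then obtain s t where ch: "chain (j - d) j s t" and e: "s j = h1" "t j = h2" by auto
  define i where "i = j - Suc d"
  have i: "1 \<le> i" "i < j" "Suc i = j - d" using Suc.prems unfolding i_def by auto
  note D = chainD[OF ch, of "Suc i"]
  have D: "-1 \<le> s (Suc i)" "s (Suc i) \<le> Lo (Suc i)" "Hi (Suc i) \<le> t (Suc i)" "t (Suc i) \<le> 1" "s (Suc i) < t (Suc i)"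
   using D i by simp_all
  have top: "t (Suc i) \<le> f c"
  proof (rule ccontr)
   assume n: "\<not> t (Suc i) \<le> f c"
   have "Hi (Suc i) \<le> f a" using left_of_1[of "Suc i"] i j by simp
   then have st: "s (Suc i) < Lo 1" "Hi 1 < t (Suc i)" using D(2) Iv(2)[of "Suc i"] n Iv_1 by auto
   \<comment> \<open>f^d carries T_(i+1) onto [h1,h2] and I_1 onto I_(d+1), where d + 1 < j.\<close>
   define n where "n = d"
   have im: "(f ^^ n) ` {Lo 1..Hi 1} = {Lo (n + 1)..Hi (n + 1)}" by (rule Iv_pow)
   have "Suc i + n = j" "j - d \<le> Suc i" using i unfolding n_def by auto
   then have "s j < Lo (n + 1) \<and> Hi (n + 1) < t j"
    using chain_inside[OF ch _ _ _ _ _ im, of "Suc i"] st Iv(2)[of 1] by simp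
   then show False using no[of "n + 1"] Suc.prems e unfolding n_def by simp
  qed
  have "\<exists>x1 x2. -1 \<le> x1 \<and> x1 \<le> Lo i \<and> Hi i \<le> x2 \<and> x2 \<le> 1 \<and> f ` {x1..x2} = {s (Suc i)..t (Suc i)} \<and> (x2 \<le> c \<or> c \<le> x1)"
  proof -
   have fI: "s (Suc i) \<le> f x \<and> f x \<le> t (Suc i)" if "Lo i \<le> x" "x \<le> Hi i" for x
    using image_Icc_D[OF Iv_pow[of 1 i], of x] that D by simp
   have LI: "-1 \<le> Lo i" "Lo i < Hi i" "Hi i \<le> 1" using Iv by auto
   consider "c < Lo i" | "Hi i < c" using crit_av[of i] i j by auto
   then show ?thesis
   proof cases
    case 1
    have "continuous_on {c..1} f" by (rule continuous_on_subset[OF unim_cont[OF un]]) (use bd in auto)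
    then obtain x1 x2 where x: "c \<le> x1" "x1 \<le> x2" "x2 \<le> 1" "f x1 = t (Suc i)" "f x2 = s (Suc i)" "f ` {x1..x2} = {s (Suc i)..t (Suc i)}"
     using mono_preimage_dec[of c 1 f "s (Suc i)" "t (Suc i)"] dec D top f1 bd by auto
    have "x1 \<le> Lo i"
    proof (rule ccontr)
     assume "\<not> x1 \<le> Lo i"
     then have "f x1 < f (Lo i)" using dec[of "Lo i" x1] 1 x by simp
     then show False using fI[of "Lo i"] LI x by simp
    qed
    moreover have "Hi i \<le> x2"
    proof (rule ccontr)
     assume "\<not> Hi i \<le> x2"
     then have "f (Hi i) < f x2" using dec[of x2 "Hi i"] x LI by simp
     then show False using fI[of "Hi i"] LI x by simp
    qed
    moreover have "-1 \<le> x1" using x bd by linarith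
    ultimately show ?thesis using x by blast
   next
    case 2
    have "continuous_on {-1..c} f" by (rule continuous_on_subset[OF unim_cont[OF un]]) (use bd in auto)
    then obtain x1 x2 where x: "-1 \<le> x1" "x1 \<le> x2" "x2 \<le> c" "f x1 = s (Suc i)" "f x2 = t (Suc i)" "f ` {x1..x2} = {s (Suc i)..t (Suc i)}"
     using mono_preimage[of "-1" c f "s (Suc i)" "t (Suc i)"] inc D top f1 bd by auto
    have "x1 \<le> Lo i"
    proof (rule ccontr)
     assume "\<not> x1 \<le> Lo i"
     then have "f (Lo i) < f x1" using inc[of "Lo i" x1] x LI by simp
     then show False using fI[of "Lo i"] LI x by simp
    qed
    moreover have "Hi i \<le> x2"
    proof (rule ccontr)
     assume "\<not> Hi i \<le> x2"
     then have "f x2 < f (Hi i)" using inc[of x2 "Hi i"] x 2 by simp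
     then show False using fI[of "Hi i"] LI x by simp
    qed
    moreover have "x2 \<le> 1" using x bd by linarith
    ultimately show ?thesis using x by blast
   qed
  qed
  then obtain x1 x2 where x: "-1 \<le> x1" "x1 \<le> Lo i" "Hi i \<le> x2" "x2 \<le> 1" "f ` {x1..x2} = {s (Suc i)..t (Suc i)}" "x2 \<le> c \<or> c \<le> x1" by blast
  have "chain i j (s(i := x1)) (t(i := x2))"
   unfolding chain_def
  proof (intro conjI allI impI)
   fix k assume k: "i \<le> k" "k \<le> j"
   show "-1 \<le> (s(i := x1)) k" "(s(i := x1)) k \<le> Lo k" "Hi k \<le> (t(i := x2)) k" "(t(i := x2)) k \<le> 1"
    using x chainD(1-4)[OF ch, of k] k i(3) by (cases "k = i"; simp)+
  next
   fix k assume k: "i \<le> k" "k < j"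
   show "f ` {(s(i := x1)) k..(t(i := x2)) k} = {(s(i := x1)) (Suc k)..(t(i := x2)) (Suc k)}"
    using x(5) chainD(6)[OF ch, of k] k i(3) by (cases "k = i") simp_all
   show "(t(i := x2)) k \<le> c \<or> c \<le> (s(i := x1)) k"
    using x(6) chainD(7)[OF ch, of k] k i(3) by (cases "k = i") simp_all
  qed
  moreover have "(s(i := x1)) j = h1" "(t(i := x2)) j = h2" using e i by simp_all
  ultimately show ?case unfolding i_def by blast
 qed
 from this[of "j - 1"] show ?thesis using j by simp
qed

section \<open>Counting the intervals met by a chain\<close>

definition widx :: "nat \<Rightarrow> nat \<Rightarrow> nat" where "widx l n = (if l + n \<le> q then l + n else l + n - q)"

lemma widx_inj: "l \<le> q ==> l' \<le> q ==> 1 \<le> l ==> 1 \<le> l' ==> n \<le> q ==> widx l n = widx l' n ==> l = l'"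
 unfolding widx_def by (auto split: if_splits)

lemma widx_inj2: "n < q ==> n' < q ==> l \<le> q ==> 1 \<le> l ==> widx l n = widx l n' ==> n = n'"
 unfolding widx_def by (auto split: if_splits)

lemma widx_range: "1 \<le> l ==> l \<le> q ==> n \<le> q ==> 1 \<le> widx l n \<and> widx l n \<le> q"
 unfolding widx_def by (auto split: if_splits)

text \<open>Indices are reduced modulo q into 1, ..., q. This is compatible with the dynamics
  because the image of order i + q lies inside the one of order i.\<close>

lemma widx_image: "l \<le> q ==> n \<le> q ==> {Lo (l + n)..Hi (l + n)} \<subseteq> {Lo (widx l n)..Hi (widx l n)}"
 using Iv_wrap[of "l + n - q"] unfolding widx_def by auto

definition meets :: "real \<Rightarrow> real \<Rightarrow> nat set" where
 "meets x y = {l \<in> {1..q}. ovl {Lo l..Hi l} {x..y}}"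

lemma meets_push:
 assumes l: "1 \<le> l" "l \<le> q" and n: "n \<le> q" and xy: "-1 \<le> x" "y \<le> 1" and o: "ovl {Lo l..Hi l} {x..y}"
  and im: "(f ^^ n) ` {x..y} \<subseteq> {x'..y'}"
 shows "widx l n \<in> meets x' y'"
proof -
 have "ovl ((f ^^ n) ` {Lo l..Hi l}) ((f ^^ n) ` {x..y})"
  using ovl_pow[OF un, of "{Lo l..Hi l}" "{x..y}" n] Iv(3,4)[of l] o by auto
 then have "ovl {Lo (widx l n)..Hi (widx l n)} {x'..y'}"
  using im widx_image[OF l(2) n] Iv_pow[of n l] by (metis add.commute ovl_mono)
 then show ?thesis using widx_range[OF l n] unfolding meets_def by simp
qed

text \<open>f^(j-i) carries an overlap of I_l with T_i to one of I_(l+j-i) with T_j, and the shift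
  of indices is injective modulo q.\<close>

lemma chain_meets_card:
 assumes ch: "chain 1 j s t" and j: "j \<le> q" and i: "1 \<le> i" "i \<le> j"
 shows "card (meets (s i) (t i)) \<le> card (meets (s j) (t j))"
proof (rule card_inj_on_le[where f = "\<lambda>l. widx l (j - i)"])
 have im: "(f ^^ (j - i)) ` {s i..t i} \<subseteq> {s j..t j}" using chain_pow[OF ch i(1), of "j - i"] i by simp
 show "inj_on (\<lambda>l. widx l (j - i)) (meets (s i) (t i))"
  unfolding meets_def using widx_inj[of _ _ "j - i"] j by (intro inj_onI) auto
 show "(\<lambda>l. widx l (j - i)) ` meets (s i) (t i) \<subseteq> meets (s j) (t j)"
 proof
  fix y assume "y \<in> (\<lambda>l. widx l (j - i)) ` meets (s i) (t i)"
  then obtain l where l: "1 \<le> l" "l \<le> q" "ovl {Lo l..Hi l} {s i..t i}" "y = widx l (j - i)" unfolding meets_def by auto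
  have n: "j - i \<le> q" using j by simp
  show "y \<in> meets (s j) (t j)" unfolding l(4) by (rule meets_push[OF l(1,2) n chainD(1)[OF ch i] chainD(4)[OF ch i] l(3) im])
 qed
 show "finite (meets (s j) (t j))" unfolding meets_def by simp
qed

text \<open>The dual count: l is fixed and i varies. The shifts j - i are smaller than q, so
  different i still produce different intervals met by T_j.\<close>

lemma chain_hits_card:
 assumes ch: "chain 1 j s t" and j: "j \<le> q" and l: "1 \<le> l" "l \<le> q"
 shows "card {i \<in> {1..j}. ovl {Lo l..Hi l} {s i..t i}} \<le> card (meets (s j) (t j))"
proof (rule card_inj_on_le[where f = "\<lambda>i. widx l (j - i)"])
 show "inj_on (\<lambda>i. widx l (j - i)) {i \<in> {1..j}. ovl {Lo l..Hi l} {s i..t i}}"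
 proof (rule inj_onI)
  fix i i' assume h: "i \<in> {i \<in> {1..j}. ovl {Lo l..Hi l} {s i..t i}}" "i' \<in> {i \<in> {1..j}. ovl {Lo l..Hi l} {s i..t i}}"
   "widx l (j - i) = widx l (j - i')"
  then have "j - i < q" "j - i' < q" using j by auto
  then have "j - i = j - i'" using widx_inj2[of "j - i" "j - i'" l] l h by auto
  then show "i = i'" using h by auto
 qed
 show "(\<lambda>i. widx l (j - i)) ` {i \<in> {1..j}. ovl {Lo l..Hi l} {s i..t i}} \<subseteq> meets (s j) (t j)"
 proof
  fix y assume "y \<in> (\<lambda>i. widx l (j - i)) ` {i \<in> {1..j}. ovl {Lo l..Hi l} {s i..t i}}"
  then obtain i where i: "1 \<le> i" "i \<le> j" "ovl {Lo l..Hi l} {s i..t i}" "y = widx l (j - i)" by auto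
  have im: "(f ^^ (j - i)) ` {s i..t i} \<subseteq> {s j..t j}" using chain_pow[OF ch i(1), of "j - i"] i by simp
  have n: "j - i \<le> q" using j by simp
  show "y \<in> meets (s j) (t j)" unfolding i(4) by (rule meets_push[OF l n chainD(1)[OF ch i(1,2)] chainD(4)[OF ch i(1,2)] i(3) im])
 qed
 show "finite (meets (s j) (t j))" unfolding meets_def by simp
qed

text \<open>7 = 3 + 3 + 1. If T_i contains x while I_i lies to the right of x, then T_i overlaps the
  leftmost such I_l, and \<open>chain_hits_card\<close> counts these i; the left side is symmetric,
  and x is interior to at most one I_i.\<close>

lemma chain_multiplicity:
 assumes ch: "chain 1 j s t" and j: "j \<le> q" and m: "card (meets (s j) (t j)) \<le> 3"
 shows "card {i \<in> {1..j}. x \<in> {s i..t i}} \<le> 7"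
proof -
 define A where "A = {i \<in> {1..j}. x \<in> {s i..t i} \<and> x \<le> Lo i}"
 define B where "B = {i \<in> {1..j}. x \<in> {s i..t i} \<and> Hi i \<le> x}"
 define Z where "Z = {i \<in> {1..j}. Lo i < x \<and> x < Hi i}"
 have fin: "finite A" "finite B" "finite Z" unfolding A_def B_def Z_def by simp_all
 have A3: "card A \<le> 3"
 proof (cases "A = {}")
  case False
  obtain l where l: "l \<in> A" "\<And>i. i \<in> A ==> Lo l \<le> Lo i" using arg_min_if_finite[OF fin(1) False, of Lo] by (metis not_le)
  have lq: "1 \<le> l" "l \<le> q" using l(1) j unfolding A_def by auto
  have "A \<subseteq> {i \<in> {1..j}. ovl {Lo l..Hi l} {s i..t i}}"
  proof
   fix i assume i: "i \<in> A"
   have ij: "1 \<le> i" "i \<le> j" "s i \<le> x" "x \<le> Lo i" using i unfolding A_def by auto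
   note D = chainD[OF ch ij(1)]
   have "max (Lo l) (s i) < min (Hi l) (t i)"
   proof (cases "i = l")
    case True
    then show ?thesis using D(2,3)[OF ij(2)] Iv(2)[of i] by simp
   next
    case False
    have "Hi l \<le> Lo i" using disj'[of i l] ij lq j False l(2)[OF i] Iv(2)[of i] Iv(2)[of l] by auto
    moreover have "x \<le> Lo l" using l(1) unfolding A_def by simp
    ultimately show ?thesis using D(3)[OF ij(2)] Iv(2)[of i] Iv(2)[of l] ij by auto
   qed
   then show "i \<in> {i \<in> {1..j}. ovl {Lo l..Hi l} {s i..t i}}" using ij by (simp add: ovl_Icc)
  qed
  then have "card A \<le> card {i \<in> {1..j}. ovl {Lo l..Hi l} {s i..t i}}" by (intro card_mono) simp_all
  also have "\<dots> \<le> 3" using chain_hits_card[OF ch j lq] m by simp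
  finally show ?thesis .
 qed simp
 have B3: "card B \<le> 3"
 proof (cases "B = {}")
  case False
  obtain l where l: "l \<in> B" "\<And>i. i \<in> B ==> - Hi l \<le> - Hi i" using arg_min_if_finite[OF fin(2) False, of "\<lambda>i. - Hi i"] by (metis not_le)
  have lq: "1 \<le> l" "l \<le> q" using l(1) j unfolding B_def by auto
  have "B \<subseteq> {i \<in> {1..j}. ovl {Lo l..Hi l} {s i..t i}}"
  proof
   fix i assume i: "i \<in> B"
   have ij: "1 \<le> i" "i \<le> j" "x \<le> t i" "Hi i \<le> x" using i unfolding B_def by auto
   note D = chainD[OF ch ij(1)]
   have "max (Lo l) (s i) < min (Hi l) (t i)"
   proof (cases "i = l")
    case True
    then show ?thesis using D(2,3)[OF ij(2)] Iv(2)[of i] by simp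
   next
    case False
    have "Hi i \<le> Lo l" using disj'[of i l] ij lq j False l(2)[OF i] Iv(2)[of i] Iv(2)[of l] by auto
    moreover have "Hi l \<le> x" using l(1) unfolding B_def by simp
    ultimately show ?thesis using D(2)[OF ij(2)] Iv(2)[of i] Iv(2)[of l] ij by auto
   qed
   then show "i \<in> {i \<in> {1..j}. ovl {Lo l..Hi l} {s i..t i}}" using ij by (simp add: ovl_Icc)
  qed
  then have "card B \<le> card {i \<in> {1..j}. ovl {Lo l..Hi l} {s i..t i}}" by (intro card_mono) simp_all
  also have "\<dots> \<le> 3" using chain_hits_card[OF ch j lq] m by simp
  finally show ?thesis .
 qed simp
 have Z1: "card Z \<le> 1"
 proof -
  have "i = i'" if "i \<in> Z" "i' \<in> Z" for i i'
   using that disj'[of i i'] j unfolding Z_def by force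
  then show ?thesis using fin(3) by (metis One_nat_def card_le_Suc0_iff_eq)
 qed
 have "{i \<in> {1..j}. x \<in> {s i..t i}} \<subseteq> A \<union> B \<union> Z" unfolding A_def B_def Z_def by auto
 then have "card {i \<in> {1..j}. x \<in> {s i..t i}} \<le> card (A \<union> B \<union> Z)" using fin by (intro card_mono) auto
 also have "\<dots> \<le> card A + card B + card Z" by (meson card_Un_le add_le_mono1 order_trans)
 finally show ?thesis using A3 B3 Z1 by simp
qed

text \<open>Integrating the multiplicity over [-1,1] gives 7 * 2 = 14.\<close>

lemma chain_sum:
 assumes ch: "chain 1 j s t" and j: "j \<le> q" and m: "card (meets (s j) (t j)) \<le> 3"
 shows "(\<Sum>i\<in>{1..j}. t i - s i) \<le> 14"
proof -
 have int: "integrable lborel (indicat_real {x..y})" for x y :: real by (simp add: integrable_indicator_iff emeasure_lborel_Icc_eq)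
 have "(\<Sum>i\<in>{1..j}. t i - s i) = (\<Sum>i\<in>{1..j}. integral\<^sup>L lborel (indicat_real {s i..t i}))"
  using chainD(5)[OF ch] by (intro sum.cong) (auto intro: less_imp_le)
 also have "\<dots> = integral\<^sup>L lborel (\<lambda>x. \<Sum>i\<in>{1..j}. indicat_real {s i..t i} x)"
  by (rule Bochner_Integration.integral_sum[symmetric]) (rule int)
 also have "\<dots> \<le> integral\<^sup>L lborel (\<lambda>x. 7 * indicat_real {-1..1::real} x)"
 proof (rule Bochner_Integration.integral_mono)
  show "integrable lborel (\<lambda>x. \<Sum>i\<in>{1..j}. indicat_real {s i..t i} x)" by (rule Bochner_Integration.integrable_sum) (rule int)
  show "integrable lborel (\<lambda>x. 7 * indicat_real {-1..1::real} x)" by (intro integrable_mult_right int)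
  fix x :: real
  have eq: "(\<Sum>i\<in>{1..j}. indicat_real {s i..t i} x) = real (card {i \<in> {1..j}. x \<in> {s i..t i}})"
   by (simp add: indicator_def sum.If_cases Int_def)
  show "(\<Sum>i\<in>{1..j}. indicat_real {s i..t i} x) \<le> 7 * indicat_real {-1..1} x"
  proof (cases "x \<in> {-1..1}")
   case True
   then show ?thesis unfolding eq using chain_multiplicity[OF ch j m, of x] by simp
  next
   case False
   have "{i \<in> {1..j}. x \<in> {s i..t i}} = {}"
   proof (rule ccontr)
    assume "{i \<in> {1..j}. x \<in> {s i..t i}} \<noteq> {}"
    then obtain i where i: "1 \<le> i" "i \<le> j" "s i \<le> x" "x \<le> t i" by auto
    then show False using chainD(1,4)[OF ch i(1,2)] False by simp
   qed
   then show ?thesis unfolding eq using False by simp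
  qed
 qed
 also have "\<dots> = 14" by simp
 finally show ?thesis .
qed

lemma cross_step:
 assumes T: "-1 \<le> x1" "x2 \<le> 1" "x2 \<le> c \<or> c \<le> x1" and p: "x1 \<le> w" "w < x" "x < y" "y < z" "z \<le> x2"
 shows "exp (- C * (x2 - x1)\<^sup>2) * cr w x y z \<le> cr (f w) (f x) (f y) (f z)"
proof -
 have sub: "{w<..<z} \<subseteq> {-1<..<c} \<or> {w<..<z} \<subseteq> {c<..<1}" using T p by auto
 have "exp (- C * (z - w)\<^sup>2) * cr w x y z \<le> cr (f w) (f x) (f y) (f z)"
 proof (rule kb_cross[where f' = df])
  show "continuous_on {w..z} f" by (rule continuous_on_subset[OF unim_cont[OF un]]) (use T p in auto)
  show "DERIV f t :> df t" if "t \<in> {w<..<z}" for t by (rule umap_deriv_in[OF u]) (use that T p in auto)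
  show "(\<forall>t\<in>{w<..<z}. 0 < df t) \<or> (\<forall>t\<in>{w<..<z}. df t < 0)"
   using sub
  proof
   assume s: "{w<..<z} \<subseteq> {-1<..<c}"
   have "0 < df t" if "t \<in> {w<..<z}" for t using subsetD[OF s that] umapD(6)[OF u, of t] by simp
   then show ?thesis by blast
  next
   assume s: "{w<..<z} \<subseteq> {c<..<1}"
   have "df t < 0" if "t \<in> {w<..<z}" for t using subsetD[OF s that] umapD(7)[OF u, of t] by simp
   then show ?thesis by blast
  qed
  show "kb f df {w<..<z} C" using sub kb_mono[OF kbl _ order_refl] kb_mono[OF kbr _ order_refl] by blast
 qed (use C0 p in auto)
 moreover have "exp (- C * (x2 - x1)\<^sup>2) \<le> exp (- C * (z - w)\<^sup>2)"
  using C0 p by (auto intro!: mult_left_mono power_mono)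
 moreover have "0 \<le> cr w x y z" unfolding cr_def by simp
 ultimately show ?thesis by (meson mult_right_mono order_trans)
qed

text \<open>The step from T_k costs a factor exp (- C |T_k|^2). As |T_k| \<le> 2, the squares sum to
  at most twice the total length, 2 * 14 = 28.\<close>

lemma chain_cross:
 assumes ch: "chain 1 j s t" and j: "j \<le> q" and m: "card (meets (s j) (t j)) \<le> 3" and i: "1 \<le> i" "i + n \<le> j"
  and p: "s i \<le> w" "w < x" "x < y" "y < z" "z \<le> t i"
 shows "exp (- (28 * C)) * cr w x y z \<le> cr ((f ^^ n) w) ((f ^^ n) x) ((f ^^ n) y) ((f ^^ n) z)"
proof -
 have "exp (- C * (\<Sum>k\<in>{i..<i + n'}. (t k - s k)\<^sup>2)) * cr w x y z \<le> cr ((f ^^ n') w) ((f ^^ n') x) ((f ^^ n') y) ((f ^^ n') z)" if "i + n' \<le> j" for n'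
  using that
 proof (induction n')
  case (Suc n)
  have P: "(f ^^ n) ` {s i..t i} = {s (i + n)..t (i + n)}" "smono (f ^^ n) (s i) (t i)" using chain_pow[OF ch i(1), of n] Suc.prems by simp_all
  have ii: "1 \<le> i + n" "i + n < j" using i Suc.prems by simp_all
  note D = chainD[OF ch ii(1)]
  let ?g = "f ^^ n"
  have r: "s (i + n) \<le> ?g v" "?g v \<le> t (i + n)" if "s i \<le> v" "v \<le> t i" for v using image_Icc_D[OF P(1) that] by simp_all
  have step: "exp (- C * (t (i + n) - s (i + n))\<^sup>2) * cr (?g w) (?g x) (?g y) (?g z) \<le> cr (f (?g w)) (f (?g x)) (f (?g y)) (f (?g z))"
   using P(2)[unfolded smono_def]
  proof
   assume "\<forall>x y. s i \<le> x \<longrightarrow> x < y \<longrightarrow> y \<le> t i \<longrightarrow> ?g x < ?g y"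
   then have "?g w < ?g x" "?g x < ?g y" "?g y < ?g z" using p by auto
   then show ?thesis using cross_step[of "s (i + n)" "t (i + n)"] D(1,4,7) ii r p by simp
  next
   assume "\<forall>x y. s i \<le> x \<longrightarrow> x < y \<longrightarrow> y \<le> t i \<longrightarrow> ?g y < ?g x"
   then have "?g z < ?g y" "?g y < ?g x" "?g x < ?g w" using p by auto
   then have "exp (- C * (t (i + n) - s (i + n))\<^sup>2) * cr (?g z) (?g y) (?g x) (?g w) \<le> cr (f (?g z)) (f (?g y)) (f (?g x)) (f (?g w))"
    using cross_step[of "s (i + n)" "t (i + n)"] D(1,4,7) ii r p by simp
   then show ?thesis by (simp only: cr_rev)
  qed
  define E where "E = exp (- C * (t (i + n) - s (i + n))\<^sup>2)"
  define S where "S = (\<Sum>k\<in>{i..<i + n}. (t k - s k)\<^sup>2)"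
  have "exp (- C * (\<Sum>k\<in>{i..<i + Suc n}. (t k - s k)\<^sup>2)) = E * exp (- C * S)"
   unfolding E_def S_def by (simp add: exp_add[symmetric] distrib_left)
  then have "exp (- C * (\<Sum>k\<in>{i..<i + Suc n}. (t k - s k)\<^sup>2)) * cr w x y z = E * (exp (- C * S) * cr w x y z)"
   by (simp only: mult.assoc)
  also have "\<dots> \<le> E * cr (?g w) (?g x) (?g y) (?g z)"
   using Suc unfolding E_def S_def by (intro mult_left_mono) simp_all
  also have "\<dots> \<le> cr (f (?g w)) (f (?g x)) (f (?g y)) (f (?g z))" using step unfolding E_def .
  finally show ?case by simp
 qed simp
 from this[OF i(2)] have 1: "exp (- C * (\<Sum>k\<in>{i..<i + n}. (t k - s k)\<^sup>2)) * cr w x y z \<le> cr ((f ^^ n) w) ((f ^^ n) x) ((f ^^ n) y) ((f ^^ n) z)" .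
 have "(\<Sum>k\<in>{i..<i + n}. (t k - s k)\<^sup>2) \<le> (\<Sum>k\<in>{1..j}. (t k - s k)\<^sup>2)"
  using i by (intro sum_mono2) auto
 also have "\<dots> \<le> (\<Sum>k\<in>{1..j}. 2 * (t k - s k))"
 proof (rule sum_mono)
  fix k assume "k \<in> {1..j}"
  then have k: "1 \<le> k" "k \<le> j" by auto
  note D = chainD(1,4,5)[OF ch k]
  have "t k - s k \<le> 2" using D by simp
  then show "(t k - s k)\<^sup>2 \<le> 2 * (t k - s k)" unfolding power2_eq_square using D by (intro mult_right_mono) simp_all
 qed
 also have "\<dots> = 2 * (\<Sum>k\<in>{1..j}. t k - s k)" by (rule sum_distrib_left[symmetric])
 also have "\<dots> \<le> 28" using chain_sum[OF ch j m] by linarith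
 finally have "C * (\<Sum>k\<in>{i..<i + n}. (t k - s k)\<^sup>2) \<le> C * 28" using C0 by (intro mult_left_mono)
 then have "exp (- (28 * C)) \<le> exp (- C * (\<Sum>k\<in>{i..<i + n}. (t k - s k)\<^sup>2))" by (simp add: mult.commute)
 moreover have "0 \<le> cr w x y z" unfolding cr_def by simp
 ultimately show ?thesis using 1 by (meson mult_right_mono order_trans)
qed

end

section \<open>Space around the intervals of a chain\<close>

lemma cr_margins:
 assumes "w < x" "x < y" "y < z"
 shows "y - x \<le> cr w x y z * (x - w)" "y - x \<le> cr w x y z * (z - y)"
proof -
 have "cr w x y z * (x - w) = (y - x) * ((z - w) / (z - y))" unfolding cr_def using assms by simp
 moreover have "1 \<le> (z - w) / (z - y)" using assms by simp
 ultimately show "y - x \<le> cr w x y z * (x - w)" using assms mult_left_mono[of 1 "(z - w) / (z - y)" "y - x"] by simp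
 have "cr w x y z * (z - y) = (y - x) * ((z - w) / (x - w))" unfolding cr_def using assms by simp
 moreover have "1 \<le> (z - w) / (x - w)" using assms by simp
 ultimately show "y - x \<le> cr w x y z * (z - y)" using assms mult_left_mono[of 1 "(z - w) / (x - w)" "y - x"] by simp
qed

lemma cr_upper:
 assumes "w < x" "x < y" "y < z" and d: "0 < \<delta>" and m: "\<delta> * L \<le> x - w" "\<delta> * L \<le> z - y" "y - x \<le> L"
 shows "cr w x y z \<le> 1 / \<delta>\<^sup>2 + 2 / \<delta>"
proof -
 define A where "A = x - w" define B where "B = z - y" define I where "I = y - x"
 have "\<delta> * (y - x) \<le> \<delta> * L" by (rule mult_left_mono[OF m(3) less_imp_le[OF d]])
 then have p: "0 < A" "0 < B" "0 < I" "\<delta> * I \<le> A" "\<delta> * I \<le> B"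
  using assms unfolding A_def B_def I_def by linarith+
 have "cr w x y z = I * (A + I + B) / (A * B)" unfolding cr_def A_def B_def I_def using assms by simp
 also have "\<dots> = (I / A) * (I / B) + I / A + I / B" using p by (simp add: field_simps)
 also have "\<dots> \<le> (1 / \<delta>) * (1 / \<delta>) + 1 / \<delta> + 1 / \<delta>"
  using p d by (intro add_mono mult_mono) (simp_all add: field_simps)
 finally show ?thesis by (simp add: power2_eq_square)
qed

context lvl
begin

text \<open>An interval of length at least \<eta> that begins within distance \<eta> of y occupies
  the place where a second one would have to begin.\<close>

lemma far_unique:
 assumes eta: "\<And>l. 1 \<le> l ==> l \<le> q ==> \<eta> \<le> Hi l - Lo l"
  and l: "1 \<le> l" "l \<le> q" "1 \<le> l'" "l' \<le> q"
 shows "y \<le> Lo l ==> y \<le> Lo l' ==> Lo l < y + \<eta> ==> Lo l' < y + \<eta> ==> l = l'"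
  and "Hi l \<le> y ==> Hi l' \<le> y ==> y - \<eta> < Hi l ==> y - \<eta> < Hi l' ==> l = l'"
 using disj'[OF l] eta[OF l(1,2)] eta[OF l(3,4)] by fastforce+

text \<open>T_j is I_j with a collar of width \<eta> on each side, and no I_l is shorter than
  \<eta>. So each collar is entered by at most one further interval and cannot contain it strictly.
  The bound \<eta> \<le> \<rho> keeps T_j inside [-1,1].\<close>

lemma small_chain:
 assumes rho: "\<And>l. 1 \<le> l ==> l \<le> q ==> -1 + \<rho> \<le> Lo l \<and> Hi l \<le> 1 - \<rho>" and e: "0 < \<eta>" "\<eta> \<le> \<rho>"
  and eta: "\<And>l. 1 \<le> l ==> l \<le> q ==> \<eta> \<le> Hi l - Lo l" and j: "1 \<le> j" "j \<le> q"
 shows "card (meets (Lo j - \<eta>) (Hi j + \<eta>)) \<le> 3" "\<exists>s t. chain 1 j s t \<and> s j = Lo j - \<eta> \<and> t j = Hi j + \<eta>"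
proof -
 define M where "M = meets (Lo j - \<eta>) (Hi j + \<eta>)"
 define R where "R = {l \<in> M. Hi j \<le> Lo l}"
 define L where "L = {l \<in> M. Hi l \<le> Lo j}"
 have Mm: "1 \<le> l \<and> l \<le> q \<and> Lo l < Hi j + \<eta> \<and> Lo j - \<eta> < Hi l" if "l \<in> M" for l
  using that unfolding M_def meets_def by (auto simp: ovl_Icc)
 have fin: "finite M" unfolding M_def meets_def by simp
 have R1: "card R \<le> 1"
 proof -
  have "l = l'" if "l \<in> R" "l' \<in> R" for l l'
   using far_unique(1)[OF eta, of l l' "Hi j"] Mm[of l] Mm[of l'] that unfolding R_def by auto
  then show ?thesis using fin card_le_Suc0_iff_eq[of R] unfolding R_def by auto
 qed
 have L1: "card L \<le> 1"
 proof -
  have "l = l'" if "l \<in> L" "l' \<in> L" for l l'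
   using far_unique(2)[OF eta, of l l' "Lo j"] Mm[of l] Mm[of l'] that unfolding L_def by auto
  then show ?thesis using fin card_le_Suc0_iff_eq[of L] unfolding L_def by auto
 qed
 have "M \<subseteq> {j} \<union> (L \<union> R)"
 proof
  fix l assume l: "l \<in> M"
  show "l \<in> {j} \<union> (L \<union> R)" using disj'[of l j] Mm[OF l] j l unfolding L_def R_def by auto
 qed
 then have "card M \<le> card ({j} \<union> (L \<union> R))" using fin unfolding L_def R_def by (intro card_mono) auto
 also have "\<dots> \<le> card {j} + (card L + card R)" by (meson card_Un_le add_le_mono order_refl order_trans)
 finally show "card (meets (Lo j - \<eta>) (Hi j + \<eta>)) \<le> 3" using L1 R1 unfolding M_def by simp
 show "\<exists>s t. chain 1 j s t \<and> s j = Lo j - \<eta> \<and> t j = Hi j + \<eta>"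
 proof (rule chain_exists[OF j])
  show "-1 \<le> Lo j - \<eta>" "Hi j + \<eta> \<le> 1" using rho[OF j] e by auto
  fix l assume l: "1 \<le> l" "l < j"
  show "\<not> (Lo j - \<eta> < Lo l \<and> Hi l < Hi j + \<eta>)"
   using disj'[of l j] eta[of l] l j by auto
 qed (use e in auto)
qed

text \<open>The monotone iterate carries the endpoints of T_i and I_i to those of T_j and I_j,
  possibly in reverse order, so the cross ratio at i is controlled by the one at j.\<close>

lemma chain_space:
 assumes ch: "chain 1 j s t" and j: "j \<le> q" and m: "card (meets (s j) (t j)) \<le> 3" and i: "1 \<le> i" "i \<le> j"
  and st: "s j < Lo j" "Hi j < t j"
 shows "s i < Lo i" "Hi i < t i" "exp (- (28 * C)) * cr (s i) (Lo i) (Hi i) (t i) \<le> cr (s j) (Lo j) (Hi j) (t j)"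
proof -
 define n where "n = j - i"
 have n: "i + n \<le> j" "i + n = j" "n + i = j" using i unfolding n_def by auto
 let ?g = "f ^^ n"
 have P: "?g ` {s i..t i} = {s j..t j}" "smono ?g (s i) (t i)" using chain_pow[OF ch i(1) n(1)] n(2) by simp_all
 note D = chainD(1-5)[OF ch i]
 have I: "?g ` {Lo i..Hi i} = {Lo j..Hi j}" using Iv_pow[of n i] n(3) by simp
 have Im: "smono ?g (Lo i) (Hi i)" by (rule smono_sub[OF P(2) D(2,3)])
 note E1 = smono_image_ends[OF P(2,1) less_imp_le[OF D(5)]]
 note E2 = smono_image_ends[OF Im I less_imp_le[OF Iv(2)]]
 have gi: "Lo j \<le> ?g x \<and> ?g x \<le> Hi j" if "Lo i \<le> x" "x \<le> Hi i" for x using image_Icc_D[OF I that] .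
 show A: "s i < Lo i"
 proof (rule ccontr)
  assume "\<not> s i < Lo i"
  then have "s i = Lo i" using D(2) by simp
  then show False using E1 gi[of "Lo i"] st Iv(2)[of i] by auto
 qed
 show B: "Hi i < t i"
 proof (rule ccontr)
  assume "\<not> Hi i < t i"
  then have "t i = Hi i" using D(3) by simp
  then show False using E1 gi[of "Hi i"] st Iv(2)[of i] by auto
 qed
 have "exp (- (28 * C)) * cr (s i) (Lo i) (Hi i) (t i) \<le> cr (?g (s i)) (?g (Lo i)) (?g (Hi i)) (?g (t i))"
  by (rule chain_cross[OF ch j m i(1) n(1) order_refl A Iv(2) B order_refl])
 also have "\<dots> = cr (s j) (Lo j) (Hi j) (t j)"
  using E1
 proof
  assume e: "?g (s i) = s j \<and> ?g (t i) = t j \<and> (\<forall>x y. s i \<le> x \<longrightarrow> x < y \<longrightarrow> y \<le> t i \<longrightarrow> ?g x < ?g y)"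
  then have "?g (Lo i) < ?g (Hi i)" using A B Iv(2)[of i] by simp
  then have "?g (Lo i) = Lo j" "?g (Hi i) = Hi j" using E2 Iv(2)[of j] by auto
  then show ?thesis using e by simp
 next
  assume e: "?g (s i) = t j \<and> ?g (t i) = s j \<and> (\<forall>x y. s i \<le> x \<longrightarrow> x < y \<longrightarrow> y \<le> t i \<longrightarrow> ?g y < ?g x)"
  then have "?g (Hi i) < ?g (Lo i)" using A B Iv(2)[of i] by simp
  then have "?g (Lo i) = Hi j" "?g (Hi i) = Lo j" using E2 Iv(2)[of j] by auto
  then show ?thesis using e by (simp add: cr_rev)
 qed
 finally show "exp (- (28 * C)) * cr (s i) (Lo i) (Hi i) (t i) \<le> cr (s j) (Lo j) (Hi j) (t j)" .
qed

text \<open>The collar makes the cross ratio at j at most \<theta>^2 + 2 \<theta>; transported to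
  index 1 it gives space on the left of I_1, the side that can be pulled back through the critical
  point.\<close>

lemma first_space:
 assumes ch: "chain 1 j s t" and j: "1 \<le> j" "j \<le> q" and m: "card (meets (s j) (t j)) \<le> 3"
  and st: "s j = Lo j - \<eta>" "t j = Hi j + \<eta>" and e: "0 < \<eta>" and th: "Hi j - Lo j \<le> \<theta> * \<eta>"
 shows "s 1 < f a" "f c - f a \<le> exp (28 * C) * (\<theta>\<^sup>2 + 2 * \<theta>) * (f a - s 1)"
proof -
 have st': "s j < Lo j" "Hi j < t j" using st e by simp_all
 note S = chain_space[OF ch j(2) m order_refl j(1) st']
 show s1: "s 1 < f a" using S(1) Iv_1 by simp
 have th0: "0 < \<theta>" using th e Iv(2)[of j] by (smt (verit) mult_nonpos_nonneg)
 have 1: "cr (s j) (Lo j) (Hi j) (t j) \<le> \<theta>\<^sup>2 + 2 * \<theta>"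
  using cr_upper[of "s j" "Lo j" "Hi j" "t j" "1 / \<theta>" "\<theta> * \<eta>"] st st' th th0 Iv(2)[of j] by (simp add: power_divide)
 have "cr (s 1) (Lo 1) (Hi 1) (t 1) = exp (28 * C) * (exp (- (28 * C)) * cr (s 1) (Lo 1) (Hi 1) (t 1))"
  by (simp add: mult.assoc[symmetric] exp_add[symmetric])
 also have "\<dots> \<le> exp (28 * C) * (\<theta>\<^sup>2 + 2 * \<theta>)" using S(3) 1 by (intro mult_left_mono) simp_all
 finally have "cr (s 1) (Lo 1) (Hi 1) (t 1) * (Lo 1 - s 1) \<le> exp (28 * C) * (\<theta>\<^sup>2 + 2 * \<theta>) * (Lo 1 - s 1)"
  using S(1) by (intro mult_right_mono) simp_all
 then show "f c - f a \<le> exp (28 * C) * (\<theta>\<^sup>2 + 2 * \<theta>) * (f a - s 1)"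
  using cr_margins(1)[OF S(1) Iv(2) S(2)] unfolding Iv_1 by simp
qed

lemma fold_preimage:
 assumes "-1 \<le> y" "y < f a"
 obtains x x' where "-1 \<le> x" "x < a" "b < x'" "x' \<le> 1" "f x = y" "f x' = y" "f ` {x..x'} = {y..f c}"
proof -
 have c1: "continuous_on {-1..a} f" "continuous_on {b..1} f"
  by (rule continuous_on_subset[OF unim_cont[OF un]]; use bd in auto)+
 obtain x where x: "-1 \<le> x" "x \<le> a" "f x = y" using IVT'[of f "-1" y a] c1(1) assms f1 bd by auto
 obtain x' where x': "b \<le> x'" "x' \<le> 1" "f x' = y" using IVT2'[of f 1 y b] c1(2) assms f1 fab bd by auto
 have ne: "x \<noteq> a" "x' \<noteq> b" using x x' assms fab by auto
 have "f ` {x..x'} = {y..f c}"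
 proof
  show "f ` {x..x'} \<subseteq> {y..f c}"
  proof
   fix v assume "v \<in> f ` {x..x'}"
   then obtain z where z: "x \<le> z" "z \<le> x'" "v = f z" by auto
   have "f z \<le> f c" using fmax[of z] z x x' by auto
   moreover have "y \<le> f z"
   proof (cases "z \<le> c")
    case True then show ?thesis using inc[of x z] x z by (cases "x = z") auto
   next
    case False then show ?thesis using dec[of z x'] x' z by (cases "x' = z") auto
   qed
   ultimately show "v \<in> {y..f c}" using z by simp
  qed
  have "continuous_on {x..c} f" by (rule continuous_on_subset[OF unim_cont[OF un]]) (use x bd in auto)
  from image_contains_Icc[OF this] have "{min (f x) (f c)..max (f x) (f c)} \<subseteq> f ` {x..c}" using x bd by simp
  moreover have "f x \<le> f c" using fmax[of x] x bd by auto
  moreover have "f ` {x..c} \<subseteq> f ` {x..x'}" using x' bd by (intro image_mono) auto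
  ultimately show "{y..f c} \<subseteq> f ` {x..x'}" using x by auto
 qed
 moreover have "x < a" "b < x'" using x(2) x'(1) ne by simp_all
 ultimately show ?thesis using that x(1,3) x'(2,3) by blast
qed

text \<open>The pull-back [x,x'] of [s 1, f c] through the fold is a neighbourhood of [a,b] and can
  start a second chain of full length q. For an I_l with l < q that overlaps it, the interval of
  index l + j modulo q reaches into one fixed collar of I_j, and \<open>far_unique\<close> leaves
  room for only one such l.\<close>

lemma return_chain:
 assumes ch: "chain 1 j s t" and j: "1 \<le> j" "j \<le> q"
  and st: "s j = Lo j - \<eta>" "t j = Hi j + \<eta>" and e: "0 < \<eta>"
  and eta: "\<And>l. 1 \<le> l ==> l \<le> q ==> \<eta> \<le> Hi l - Lo l"
  and x: "-1 \<le> x" "x < a" "b < x'" "x' \<le> 1" "f x = s 1" "f x' = s 1" and im: "f ` {x..x'} = {s 1..f c}"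
  and s1: "s 1 < f a"
 shows "card (meets x x') \<le> 3" "\<exists>s' t'. chain 1 q s' t' \<and> s' q = x \<and> t' q = x'"
proof -
 define n where "n = j - 1"
 have n: "1 + n \<le> j" "1 + n = j" "n + 1 = j" "n \<le> q" "j = Suc n" using j unfolding n_def by auto
 let ?g = "f ^^ n"
 have P: "?g ` {s 1..t 1} = {s j..t j}" "smono ?g (s 1) (t 1)" using chain_pow[OF ch order_refl n(1)] n(2) by simp_all
 note D = chainD(1-5)[OF ch order_refl j(1)]
 have I: "?g ` {Lo 1..Hi 1} = {Lo j..Hi j}" using Iv_pow[of n 1] n(3) by simp
 have Im: "smono ?g (Lo 1) (Hi 1)" by (rule smono_sub[OF P(2) D(2,3)])
 note E1 = smono_image_ends[OF P(2,1) less_imp_le[OF D(5)]]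
 note E2 = smono_image_ends[OF Im I less_imp_le[OF Iv(2)]]
 \<comment> \<open>The part of T_1 left of I_1 goes into the right or the left collar of I_j,
   according to the orientation of g on T_1.\<close>
 have G: "(\<forall>z. s 1 < z \<longrightarrow> z < f a \<longrightarrow> Hi j < ?g z \<and> ?g z < Hi j + \<eta>) \<or>
     (\<forall>z. s 1 < z \<longrightarrow> z < f a \<longrightarrow> Lo j - \<eta> < ?g z \<and> ?g z < Lo j)"
  using E1
 proof
  assume A: "?g (s 1) = s j \<and> ?g (t 1) = t j \<and> (\<forall>x y. s 1 \<le> x \<longrightarrow> x < y \<longrightarrow> y \<le> t 1 \<longrightarrow> ?g x < ?g y)"
  then have "?g (Lo 1) < ?g (Hi 1)" using D Iv(2)[of 1] by simp
  then have "?g (Lo 1) = Lo j" using E2 Iv(2)[of j] by auto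
  moreover note mm = A[THEN conjunct2, THEN conjunct2, rule_format]
  ultimately have "Lo j - \<eta> < ?g z \<and> ?g z < Lo j" if "s 1 < z" "z < f a" for z
  proof -
   have zt: "z \<le> t 1" "z < Lo 1" "s 1 \<le> z" "Lo 1 \<le> t 1" using that D Iv_1 Iv(2)[of 1] by linarith+
   show ?thesis using mm[OF order_refl that(1) zt(1)] mm[OF zt(3,2,4)] A st \<open>?g (Lo 1) = _\<close> by simp
  qed
  then show ?thesis by blast
 next
  assume A: "?g (s 1) = t j \<and> ?g (t 1) = s j \<and> (\<forall>x y. s 1 \<le> x \<longrightarrow> x < y \<longrightarrow> y \<le> t 1 \<longrightarrow> ?g y < ?g x)"
  then have "?g (Hi 1) < ?g (Lo 1)" using D Iv(2)[of 1] by simp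
  then have "?g (Lo 1) = Hi j" using E2 Iv(2)[of j] by auto
  moreover note mm = A[THEN conjunct2, THEN conjunct2, rule_format]
  ultimately have "Hi j < ?g z \<and> ?g z < Hi j + \<eta>" if "s 1 < z" "z < f a" for z
  proof -
   have zt: "z \<le> t 1" "z < Lo 1" "s 1 \<le> z" "Lo 1 \<le> t 1" using that D Iv_1 Iv(2)[of 1] by linarith+
   show ?thesis using mm[OF order_refl that(1) zt(1)] mm[OF zt(3,2,4)] A st \<open>?g (Lo 1) = _\<close> by simp
  qed
  then show ?thesis by blast
 qed
 define N where "N = {l \<in> {1..<q}. ovl {Lo l..Hi l} {x..x'}}"
 have Nw: "(Hi j \<le> Lo (widx (l + 1) n) \<and> Lo (widx (l + 1) n) < Hi j + \<eta> \<and> (\<forall>z. s 1 < z \<longrightarrow> z < f a \<longrightarrow> Hi j < ?g z)) \<or>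
   (Hi (widx (l + 1) n) \<le> Lo j \<and> Lo j - \<eta> < Hi (widx (l + 1) n) \<and> \<not> (\<forall>z. s 1 < z \<longrightarrow> z < f a \<longrightarrow> Hi j < ?g z))" if l: "l \<in> N" for l
 proof -
  have lq: "1 \<le> l" "l < q" and o: "ovl {Lo l..Hi l} {x..x'}" using l unfolding N_def by auto
  have "ovl (f ` {Lo l..Hi l}) (f ` {x..x'})"
   using ovl_image[OF un _ o] Iv(3,4)[of l] by auto
  then have "ovl {Lo (l + 1)..Hi (l + 1)} {s 1..f c}" using Iv_pow[of 1 l] im by simp
  moreover have h: "Hi (l + 1) \<le> f a" using left_of_1[of "l + 1"] lq by simp
  ultimately have mx: "max (Lo (l + 1)) (s 1) < Hi (l + 1)" by (simp add: ovl_Icc)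
  define p where "p = max (Lo (l + 1)) (s 1)"
  define y1 where "y1 = (2 * p + Hi (l + 1)) / 3" define y2 where "y2 = (p + 2 * Hi (l + 1)) / 3"
  have y: "p < y1" "y1 < y2" "y2 < Hi (l + 1)" using mx unfolding p_def[symmetric] y1_def y2_def by (auto simp: field_simps)
  have yl: "Lo (l + 1) \<le> y1" "s 1 < y1" "y2 < f a" "y1 < f a" using y h unfolding p_def by auto
  have wi: "Lo (widx (l + 1) n) \<le> ?g z \<and> ?g z \<le> Hi (widx (l + 1) n)" if "Lo (l + 1) \<le> z" "z \<le> Hi (l + 1)" for z
  proof -
   have "?g z \<in> ?g ` {Lo (l + 1)..Hi (l + 1)}" using that by auto
   then have "?g z \<in> {Lo (l + 1 + n)..Hi (l + 1 + n)}" using Iv_pow[of n "l + 1"] by (simp add: add.commute)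
   then show ?thesis using widx_image[of "l + 1" n] n(4) lq by auto
  qed
  have w1: "Lo (widx (l + 1) n) \<le> ?g y1" "?g y1 \<le> Hi (widx (l + 1) n)" using wi[of y1] yl y by auto
  have wq: "1 \<le> widx (l + 1) n" "widx (l + 1) n \<le> q" using widx_range[of "l + 1" n] lq n(4) by auto
  have wj: "widx (l + 1) n \<noteq> j" using lq n j unfolding widx_def by auto
  have dj: "Hi j \<le> Lo (widx (l + 1) n) \<or> Hi (widx (l + 1) n) \<le> Lo j" using disj'[OF j wq] wj by auto
  from G show ?thesis
  proof
   assume A: "\<forall>z. s 1 < z \<longrightarrow> z < f a \<longrightarrow> Hi j < ?g z \<and> ?g z < Hi j + \<eta>"
   then have "Hi j < ?g y1" "?g y1 < Hi j + \<eta>" using yl by auto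
   then have "Hi j \<le> Lo (widx (l + 1) n) \<and> Lo (widx (l + 1) n) < Hi j + \<eta>" using dj w1 Iv(2)[of j] by linarith
   then show ?thesis using A by blast
  next
   assume A: "\<forall>z. s 1 < z \<longrightarrow> z < f a \<longrightarrow> Lo j - \<eta> < ?g z \<and> ?g z < Lo j"
   then have b: "Lo j - \<eta> < ?g y1" "?g y1 < Lo j" using yl by auto
   then have "Hi (widx (l + 1) n) \<le> Lo j \<and> Lo j - \<eta> < Hi (widx (l + 1) n)" using dj w1 Iv(2)[of j] by linarith
   moreover have "\<not> Hi j < ?g y1" using b Iv(2)[of j] by linarith
   ultimately show ?thesis using yl by blast
  qed
 qed
 have N1: "card N \<le> 1"
 proof -
  have "l = l'" if h: "l \<in> N" "l' \<in> N" for l l'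
  proof -
   have lq: "1 \<le> l" "l < q" "1 \<le> l'" "l' < q" using h unfolding N_def by auto
   have wq: "1 \<le> widx (l + 1) n" "widx (l + 1) n \<le> q" "1 \<le> widx (l' + 1) n" "widx (l' + 1) n \<le> q"
    using widx_range[of "l + 1" n] widx_range[of "l' + 1" n] lq n(4) by auto
   have "widx (l + 1) n = widx (l' + 1) n"
    using Nw[OF h(1)] Nw[OF h(2)] far_unique[OF eta wq, of "Hi j"] far_unique[OF eta wq, of "Lo j"] by blast
   then show ?thesis using widx_inj[of "l + 1" "l' + 1" n] lq n(4) by auto
  qed
  moreover have "finite N" unfolding N_def by simp
  ultimately show ?thesis using card_le_Suc0_iff_eq[of N] by auto
 qed
 have "meets x x' \<subseteq> N \<union> {q}" unfolding meets_def N_def by auto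
 moreover have fN: "finite (N \<union> {q})" unfolding N_def by simp
 ultimately have "card (meets x x') \<le> card (N \<union> {q})" by (intro card_mono) auto
 also have "\<dots> \<le> card N + card {q}" by (rule card_Un_le)
 finally show "card (meets x x') \<le> 3" using N1 by simp
 show "\<exists>s' t'. chain 1 q s' t' \<and> s' q = x \<and> t' q = x'"
 proof (rule chain_exists)
  show "1 \<le> q" using q0 by simp
  show "x \<le> Lo q" "Hi q \<le> x'" using Iv_q x by auto
  fix l assume l: "1 \<le> l" "l < q"
  show "\<not> (x < Lo l \<and> Hi l < x')"
  proof
   assume h: "x < Lo l \<and> Hi l < x'"
   have fl: "f ` {Lo l..Hi l} = {Lo (l + 1)..Hi (l + 1)}" using Iv_pow[of 1 l] by simp
   have sl: "s 1 < f z" if z: "Lo l \<le> z" "z \<le> Hi l" for z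
   proof (cases "z \<le> c")
    case True then show ?thesis using inc[of x z] x h z by auto
   next
    case False then show ?thesis using dec[of z x'] x h z by auto
   qed
   have "Lo (l + 1) \<in> f ` {Lo l..Hi l}" unfolding fl using Iv(2)[of "l + 1"] by simp
   then have s2: "s 1 < Lo (l + 1)" using sl by auto
   have h2: "Hi (l + 1) \<le> f a" using left_of_1[of "l + 1"] l by simp
   show False
   \<comment> \<open>If l + j \<le> q, then I_(l+j) would be shorter than \<eta>, being squeezed
     into a collar. Otherwise f^(q-l-1) carries I_(l+1) to I_q, so T_(q-l) of the old chain would
     have c in its interior although q - l < j.\<close>
   proof (cases "l + j \<le> q")
    case True
    have lj: "n + (l + 1) = l + j" using n by simp
    have gI: "?g ` {Lo (l + 1)..Hi (l + 1)} = {Lo (l + j)..Hi (l + j)}" using Iv_pow[of n "l + 1"] unfolding lj .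
    have sm: "smono ?g (Lo (l + 1)) (Hi (l + 1))" by (rule smono_sub[OF P(2)]) (use s2 h2 D Iv_1 Iv(2)[of 1] in auto)
    have len: "\<eta> \<le> Hi (l + j) - Lo (l + j)" using eta[of "l + j"] True l by simp
    define z1 where "z1 = Lo (l + 1)" define z2 where "z2 = Hi (l + 1)"
    have "\<bar>?g z1 - ?g z2\<bar> = Hi (l + j) - Lo (l + j)"
     using smono_image_ends[OF sm gI less_imp_le[OF Iv(2)]] Iv(2)[of "l + j"] unfolding z1_def z2_def by auto
    then have z: "Lo (l + 1) \<le> z1" "z1 < z2" "z2 \<le> Hi (l + 1)" "\<bar>?g z1 - ?g z2\<bar> = Hi (l + j) - Lo (l + j)"
     using Iv(2)[of "l + 1"] unfolding z1_def z2_def by simp_all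
    have "s 1 < z1" "z1 < f a" "s 1 < z2" using z s2 h2 by auto
    have G': "(Hi j < ?g z1 \<and> ?g z1 < Hi j + \<eta> \<and> Hi j \<le> ?g z2 \<and> ?g z2 < Hi j + \<eta>) \<or>
     (Lo j - \<eta> < ?g z1 \<and> ?g z1 < Lo j \<and> Lo j - \<eta> < ?g z2 \<and> ?g z2 \<le> Lo j)"
    proof (cases "z2 < f a")
     case True
     then show ?thesis using G \<open>s 1 < z1\<close> \<open>z1 < f a\<close> \<open>s 1 < z2\<close> by (meson less_imp_le)
    next
     case False
     then have z2: "z2 = Lo 1" using z h2 Iv_1 by simp
     from E1 show ?thesis
     proof
      assume A: "?g (s 1) = s j \<and> ?g (t 1) = t j \<and> (\<forall>x y. s 1 \<le> x \<longrightarrow> x < y \<longrightarrow> y \<le> t 1 \<longrightarrow> ?g x < ?g y)"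
      then have "?g (Lo 1) < ?g (Hi 1)" using D Iv(2)[of 1] by simp
      then have gl: "?g z2 = Lo j" using E2 Iv(2)[of j] z2 by auto
      have "?g z1 < ?g z2" "?g (s 1) < ?g z1" using A z \<open>s 1 < z1\<close> z2 D Iv(2)[of 1] by auto
      then show ?thesis using gl A st e by auto
     next
      assume A: "?g (s 1) = t j \<and> ?g (t 1) = s j \<and> (\<forall>x y. s 1 \<le> x \<longrightarrow> x < y \<longrightarrow> y \<le> t 1 \<longrightarrow> ?g y < ?g x)"
      then have "?g (Hi 1) < ?g (Lo 1)" using D Iv(2)[of 1] by simp
      then have gl: "?g z2 = Hi j" using E2 Iv(2)[of j] z2 by auto
      have "?g z2 < ?g z1" "?g z1 < ?g (s 1)" using A z \<open>s 1 < z1\<close> z2 D Iv(2)[of 1] by auto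
      then show ?thesis using gl A st e by auto
     qed
    qed
    then show False using z(4) len by (auto simp: abs_if split: if_splits)
   next
    case False
    define k where "k = q - l"
    have k: "1 \<le> k" "k < j" "k - 1 + (l + 1) = q" "1 + (k - 1) = k" using l False unfolding k_def by auto
    have im1: "(f ^^ (k - 1)) ` {Lo (l + 1)..Hi (l + 1)} = {Lo q..Hi q}" using Iv_pow[of "k - 1" "l + 1"] unfolding k(3) .
    have im2: "(f ^^ (k - 1)) ` {s 1..t 1} = {s k..t k}" using chain_pow[OF ch order_refl, of "k - 1"] k by simp
    have "{Lo (l + 1)..Hi (l + 1)} \<subseteq> {s 1..t 1}" using s2 h2 D Iv_1 Iv(2)[of 1] by auto
    then have "{Lo q..Hi q} \<subseteq> {s k..t k}" using im1 im2 by (metis image_mono)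
    then have "s k \<le> Lo q" "Hi q \<le> t k" using Iv(2)[of q] by auto
    then show False using chainD(7)[OF ch k(1,2)] crit_q by auto
   qed
  qed
 qed (use x in auto)
qed

end

section \<open>Margins at the critical point and Koebe-type derivative bounds\<close>

lemma koebe_algebra:
 fixes w v u' u gw gv gu' gu E I' D :: real
 assumes ord: "(w < v \<and> v < u' \<and> u' < u) \<or> (u < u' \<and> u' < v \<and> v < w)"
  and cr: "exp (- E) * cr w v u' u \<le> cr gw gv gu' gu"
  and b: "\<bar>gv - gu'\<bar> \<le> I'" "\<bar>gv - gu\<bar> \<le> I'" "I' \<le> D * \<bar>gw - gv\<bar>" and D: "0 \<le> D" and ne: "gu' \<noteq> gu" "gw \<noteq> gv"
 shows "\<bar>gu' - gu\<bar> * \<bar>v - u'\<bar> \<le> exp E * (I' * (1 + D)) * \<bar>u' - u\<bar>"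
proof -
 have p: "0 < \<bar>u' - u\<bar>" "0 < \<bar>w - v\<bar>" "0 < \<bar>gu' - gu\<bar>" "0 < \<bar>gw - gv\<bar>" "\<bar>w - v\<bar> \<le> \<bar>w - u\<bar>" using ord ne by auto
 have "\<bar>v - u'\<bar> / \<bar>u' - u\<bar> \<le> cr w v u' u"
 proof -
  have "cr w v u' u = \<bar>v - u'\<bar> / \<bar>u' - u\<bar> * (\<bar>w - u\<bar> / \<bar>w - v\<bar>)"
   unfolding cr_def by (simp add: abs_minus_commute)
  moreover have "1 \<le> \<bar>w - u\<bar> / \<bar>w - v\<bar>" using p by simp
  ultimately show ?thesis using mult_left_mono[of 1 "\<bar>w - u\<bar> / \<bar>w - v\<bar>" "\<bar>v - u'\<bar> / \<bar>u' - u\<bar>"] by simp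
 qed
 then have "exp (- E) * (\<bar>v - u'\<bar> / \<bar>u' - u\<bar>) \<le> exp (- E) * cr w v u' u" by (intro mult_left_mono) simp_all
 also have "\<dots> \<le> cr gw gv gu' gu" by (rule cr)
 also have "\<dots> = \<bar>gv - gu'\<bar> * (\<bar>gw - gu\<bar> / \<bar>gw - gv\<bar>) / \<bar>gu' - gu\<bar>"
  unfolding cr_def by (simp add: abs_minus_commute)
 also have "\<dots> \<le> I' * (1 + D) / \<bar>gu' - gu\<bar>"
 proof (intro divide_right_mono mult_mono b)
  have "\<bar>gw - gu\<bar> \<le> \<bar>gw - gv\<bar> + \<bar>gv - gu\<bar>" by simp
  also have "\<dots> \<le> (1 + D) * \<bar>gw - gv\<bar>" using b by (simp add: algebra_simps)
  finally show "\<bar>gw - gu\<bar> / \<bar>gw - gv\<bar> \<le> 1 + D" using p by (simp add: divide_le_eq)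
 qed (use b in auto)
 finally have "exp (- E) * (\<bar>v - u'\<bar> / \<bar>u' - u\<bar>) \<le> I' * (1 + D) / \<bar>gu' - gu\<bar>" .
 then have "exp E * (exp (- E) * (\<bar>v - u'\<bar> / \<bar>u' - u\<bar>)) \<le> exp E * (I' * (1 + D) / \<bar>gu' - gu\<bar>)" by (intro mult_left_mono) simp_all
 then have "\<bar>v - u'\<bar> / \<bar>u' - u\<bar> \<le> exp E * (I' * (1 + D)) / \<bar>gu' - gu\<bar>"
  using exp_minus_inverse[of E] by (simp only: mult.assoc[symmetric]) simp
 then show ?thesis using p by (simp add: divide_le_eq le_divide_eq mult_ac)
qed

context lvl
begin

text \<open>Space next to the critical value becomes space next to [a,b]. With B = b - a, f c - f a
  is at least k (B/2)^\<alpha>, while over a distance d \<le> B outside [a,b] f changes by at most d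
  K (2B)^(\<alpha>-1). All powers of B cancel except one factor B, which is compared with d.\<close>

lemma margin:
 assumes al: "1 < \<alpha>" and kK: "0 < k" "0 < K"
  and pw: "\<And>x. x \<in> {-1..1} ==> \<bar>df x\<bar> \<le> K * \<bar>x - c\<bar> powr (\<alpha> - 1) \<and> k * \<bar>x - c\<bar> powr \<alpha> \<le> f c - f x"
  and tau: "0 < \<tau>" and x: "-1 \<le> x" "x < a" "b < x'" "x' \<le> 1" "f x' = f x" and sp: "\<tau> * (f c - f a) \<le> f a - f x"
  and del: "\<delta> \<le> 1" "\<delta> \<le> \<tau> * k / (K * (2 powr \<alpha> * 2 powr (\<alpha> - 1)))"
 shows "\<delta> * (b - a) \<le> a - x" "\<delta> * (b - a) \<le> x' - b"
proof -
 define B where "B = b - a"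
 have B: "0 < B" using bd unfolding B_def by simp
 have fc: "k * (B / 2) powr \<alpha> \<le> f c - f a"
 proof (cases "B / 2 \<le> c - a")
  case True
  then have "k * (B / 2) powr \<alpha> \<le> k * \<bar>a - c\<bar> powr \<alpha>" using B al kK by (intro mult_left_mono powr_mono2) auto
  then show ?thesis using pw[of a] bd by auto
 next
  case False
  then have "k * (B / 2) powr \<alpha> \<le> k * \<bar>b - c\<bar> powr \<alpha>" using B al kK bd unfolding B_def by (intro mult_left_mono powr_mono2) auto
  then show ?thesis using pw[of b] bd fab by auto
 qed
 have main: "\<delta> * B \<le> d" if d: "0 < d" and le: "d \<le> B ==> f a - f x \<le> d * (K * (2 * B) powr (\<alpha> - 1))" for d
 proof (cases "d \<le> B")
  case False
  then show ?thesis using mult_right_mono[OF del(1), of B] B by linarith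
 next
  case True
  have "\<tau> * (k * (B / 2) powr \<alpha>) \<le> \<tau> * (f c - f a)" using fc tau by (intro mult_left_mono) simp_all
  also have "\<dots> \<le> d * (K * (2 * B) powr (\<alpha> - 1))" using sp le[OF True] by simp
  finally have "\<tau> * k * (B powr \<alpha> / 2 powr \<alpha>) \<le> d * K * (2 powr (\<alpha> - 1) * B powr (\<alpha> - 1))"
   using B by (simp add: powr_divide powr_mult mult.assoc)
  moreover have "B powr \<alpha> = B * B powr (\<alpha> - 1)" using B by (simp add: powr_diff)
  moreover have Bp: "0 < B powr (\<alpha> - 1)" using B by simp
  ultimately have "\<tau> * k * B / 2 powr \<alpha> * B powr (\<alpha> - 1) \<le> d * K * 2 powr (\<alpha> - 1) * B powr (\<alpha> - 1)"
   by (simp add: mult_ac)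
  then have "\<tau> * k * B / 2 powr \<alpha> \<le> d * K * 2 powr (\<alpha> - 1)" using Bp by (simp only: mult_le_cancel_right_pos)
  then have "\<tau> * k / (K * (2 powr \<alpha> * 2 powr (\<alpha> - 1))) * B \<le> d" using kK by (simp add: field_simps)
  moreover have "\<delta> * B \<le> \<tau> * k / (K * (2 powr \<alpha> * 2 powr (\<alpha> - 1))) * B" using del(2) B by (intro mult_right_mono) simp_all
  ultimately show ?thesis by simp
 qed
 have "\<delta> * B \<le> a - x"
 proof (rule main)
  assume s: "a - x \<le> B"
  obtain \<xi> where xi: "x < \<xi>" "\<xi> < a" "f a - f x = (a - x) * df \<xi>"
  proof -
   have "continuous_on {x..a} f" by (rule continuous_on_subset[OF unim_cont[OF un]]) (use x bd in auto)
   then obtain l z where z: "x < z" "z < a" "DERIV f z :> l" "f a - f x = (a - x) * l"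
    using MVT[OF x(2), of f] umap_deriv_in[OF u] x bd by (metis (no_types, opaque_lifting) less_le_trans less_trans le_less_trans real_differentiable_def)
   moreover have "l = df z" using DERIV_unique[OF z(3) umap_deriv_in[OF u, of z]] z x bd by simp
   ultimately show ?thesis using that by blast
  qed
  have "df \<xi> \<le> K * \<bar>\<xi> - c\<bar> powr (\<alpha> - 1)" using pw[of \<xi>] xi x bd by auto
  also have "\<dots> \<le> K * (2 * B) powr (\<alpha> - 1)"
   using xi x bd s al kK unfolding B_def by (intro mult_left_mono powr_mono2) auto
  finally show "f a - f x \<le> (a - x) * (K * (2 * B) powr (\<alpha> - 1))" unfolding xi(3) using x by (intro mult_left_mono) simp_all
 qed (use x in simp)
 moreover have "\<delta> * B \<le> x' - b"
 proof (rule main)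
  assume s: "x' - b \<le> B"
  obtain \<xi> where xi: "b < \<xi>" "\<xi> < x'" "f x' - f b = (x' - b) * df \<xi>"
  proof -
   have "continuous_on {b..x'} f" by (rule continuous_on_subset[OF unim_cont[OF un]]) (use x bd in auto)
   then obtain l z where z: "b < z" "z < x'" "DERIV f z :> l" "f x' - f b = (x' - b) * l"
    using MVT[OF x(3), of f] umap_deriv_in[OF u] x bd by (metis (no_types, opaque_lifting) less_le_trans less_trans le_less_trans real_differentiable_def)
   moreover have "l = df z" using DERIV_unique[OF z(3) umap_deriv_in[OF u, of z]] z x bd by simp
   ultimately show ?thesis using that by blast
  qed
  have "- df \<xi> \<le> K * \<bar>\<xi> - c\<bar> powr (\<alpha> - 1)" using pw[of \<xi>] xi x bd by auto
  also have "\<dots> \<le> K * (2 * B) powr (\<alpha> - 1)"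
   using xi x bd s al kK unfolding B_def by (intro mult_left_mono powr_mono2) auto
  finally have "(x' - b) * (- df \<xi>) \<le> (x' - b) * (K * (2 * B) powr (\<alpha> - 1))" using x by (intro mult_left_mono) simp_all
  then show "f a - f x \<le> (x' - b) * (K * (2 * B) powr (\<alpha> - 1))" using xi(3) x fab by simp
 qed (use x in simp)
 ultimately show "\<delta> * (b - a) \<le> a - x" "\<delta> * (b - a) \<le> x' - b" unfolding B_def by simp_all
qed

text \<open>A one-sided Koebe principle. The last flank of the cross ratio of w, v, y, x shrinks as
  y tends to x, and its ratio to its image yields the derivative at x; the space around the interval
  of index n + 1 bounds the rest. The factor 2 comes from using the endpoint of I_1 that is farther
  from x.\<close>

lemma koebe:
 assumes ch: "chain 1 q s t" and m: "card (meets (s q) (t q)) \<le> 3" and n: "1 + n \<le> q" and D: "0 < D"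
  and mg: "Hi (1 + n) - Lo (1 + n) \<le> D * (Lo (1 + n) - s (1 + n))" "Hi (1 + n) - Lo (1 + n) \<le> D * (t (1 + n) - Hi (1 + n))"
  and st1: "s 1 < Lo 1" "Hi 1 < t 1" and ur: "Lo 1 \<le> x" "x \<le> Hi 1"
 shows "\<bar>dpow f df n x\<bar> * (Hi 1 - Lo 1) \<le> 2 * exp (28 * C) * (1 + D) * (Hi (1 + n) - Lo (1 + n))"
proof -
 let ?g = "f ^^ n"
 define I' where "I' = Hi (1 + n) - Lo (1 + n)"
 have I'0: "0 < I'" unfolding I'_def using Iv(2) by simp
 have I: "?g ` {Lo 1..Hi 1} = {Lo (1 + n)..Hi (1 + n)}" using Iv_pow[of n 1] by (simp add: add.commute)
 have P: "?g ` {s 1..t 1} = {s (1 + n)..t (1 + n)}" "smono ?g (s 1) (t 1)" using chain_pow[OF ch order_refl n] by simp_all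
 have D1: "-1 \<le> s 1" "t 1 \<le> 1" "s 1 < t 1" using chainD(1,4,5)[OF ch order_refl] q0 by simp_all
 note E1 = smono_image_ends[OF P(2,1) less_imp_le[OF D1(3)]]
 have gin: "Lo (1 + n) \<le> ?g z \<and> ?g z \<le> Hi (1 + n)" if "Lo 1 \<le> z" "z \<le> Hi 1" for z using image_Icc_D[OF I that] .
 have inj: "?g y \<noteq> ?g z" if "s 1 \<le> y" "y < z" "z \<le> t 1" for y z using P(2) that unfolding smono_def by (metis less_irrefl)
 have xI: "x \<in> {-1..1}" using ur Iv(3,4)[of 1] by auto
 have der: "(?g has_real_derivative dpow f df n x) (at x within {-1..1})" by (rule dpow_deriv[OF u xI])
 have endw: "I' \<le> D * \<bar>?g w - ?g v\<bar>" if w: "w = s 1 \<or> w = t 1" and v: "Lo 1 \<le> v" "v \<le> Hi 1" for w v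
 proof -
  have "?g w = s (1 + n) \<or> ?g w = t (1 + n)" using E1 w by auto
  then show ?thesis
  proof
   assume e: "?g w = s (1 + n)"
   have "Lo (1 + n) - s (1 + n) \<le> \<bar>?g w - ?g v\<bar>" using gin[OF v] e by linarith
   then have "D * (Lo (1 + n) - s (1 + n)) \<le> D * \<bar>?g w - ?g v\<bar>" using D by (intro mult_left_mono) simp_all
   then show ?thesis using mg(1) unfolding I'_def by linarith
  next
   assume e: "?g w = t (1 + n)"
   have "t (1 + n) - Hi (1 + n) \<le> \<bar>?g w - ?g v\<bar>" using gin[OF v] e by linarith
   then have "D * (t (1 + n) - Hi (1 + n)) \<le> D * \<bar>?g w - ?g v\<bar>" using D by (intro mult_left_mono) simp_all
   then show ?thesis using mg(2) unfolding I'_def by linarith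
  qed
 qed
 define Bc where "Bc = exp (28 * C) * (I' * (1 + D))"
 have key: "\<bar>(?g y - ?g x) / (y - x)\<bar> * \<bar>v - y\<bar> \<le> Bc"
  if o: "(w = s 1 \<and> v = Lo 1 \<and> v < y \<and> y < x) \<or> (w = t 1 \<and> v = Hi 1 \<and> x < y \<and> y < v)" for y v w
 proof -
  have o': "(w < v \<and> v < y \<and> y < x) \<or> (x < y \<and> y < v \<and> v < w)" using o st1 by auto
  have vr: "Lo 1 \<le> v" "v \<le> Hi 1" "Lo 1 \<le> y" "y \<le> Hi 1" using o ur Iv(2)[of 1] by auto
  have "exp (- (28 * C)) * cr w v y x \<le> cr (?g w) (?g v) (?g y) (?g x)"
   using o'
  proof
   assume h: "w < v \<and> v < y \<and> y < x"
   show ?thesis by (rule chain_cross[OF ch order_refl m order_refl n]) (use h o st1 ur in auto)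
  next
   assume h: "x < y \<and> y < v \<and> v < w"
   have "exp (- (28 * C)) * cr x y v w \<le> cr (?g x) (?g y) (?g v) (?g w)"
    by (rule chain_cross[OF ch order_refl m order_refl n]) (use h o st1 ur in auto)
   then show ?thesis by (simp only: cr_rev)
  qed
  moreover have "\<bar>?g v - ?g y\<bar> \<le> I'" "\<bar>?g v - ?g x\<bar> \<le> I'" using gin[OF vr(1,2)] gin[OF vr(3,4)] gin[OF ur] unfolding I'_def by auto
  moreover have "I' \<le> D * \<bar>?g w - ?g v\<bar>" using endw[of w v] o vr by blast
  moreover have "?g y \<noteq> ?g x" using inj[of y x] inj[of x y] o ur st1 vr by (metis less_imp_le order_trans)
  moreover have "?g w \<noteq> ?g v" using inj[of w v] inj[of v w] o' o st1 vr by (metis less_imp_le order_refl order_trans)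
  ultimately have "\<bar>?g y - ?g x\<bar> * \<bar>v - y\<bar> \<le> Bc * \<bar>y - x\<bar>"
   unfolding Bc_def using koebe_algebra[OF o'] D by (meson less_imp_le)
  moreover have "0 < \<bar>y - x\<bar>" using o by auto
  ultimately show ?thesis by (simp add: abs_divide divide_le_eq mult_ac)
 qed
 \<comment> \<open>The limit y -> x is taken within S, an interval between x and the chosen endpoint
   of I_1, where the cross ratio estimate is available.\<close>
 have lim: "\<bar>dpow f df n x\<bar> * \<bar>v - x\<bar> \<le> Bc"
  if sub: "S \<subseteq> {-1..1}" and nb: "at x within S \<noteq> bot" and k: "\<And>y. y \<in> S ==> \<bar>(?g y - ?g x) / (y - x)\<bar> * \<bar>v - y\<bar> \<le> Bc" for S v
 proof -
  have "((\<lambda>y. (?g y - ?g x) / (y - x)) \<longlongrightarrow> dpow f df n x) (at x within S)"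
   using has_field_derivative_subset[OF der sub] unfolding has_field_derivative_iff .
  then have "((\<lambda>y. \<bar>(?g y - ?g x) / (y - x)\<bar> * \<bar>v - y\<bar>) \<longlongrightarrow> \<bar>dpow f df n x\<bar> * \<bar>v - x\<bar>) (at x within S)"
   by (intro tendsto_intros)
  moreover have "\<forall>\<^sub>F y in at x within S. \<bar>(?g y - ?g x) / (y - x)\<bar> * \<bar>v - y\<bar> \<le> Bc"
   using k by (simp add: eventually_at_topological) blast
  ultimately show ?thesis using tendsto_upperbound nb by blast
 qed
 have "\<bar>dpow f df n x\<bar> * ((Hi 1 - Lo 1) / 2) \<le> Bc"
 proof (cases "x \<le> (Lo 1 + Hi 1) / 2")
  case True
  have xh: "x < Hi 1" using True Iv(2)[of 1] by simp
  have "\<bar>dpow f df n x\<bar> * \<bar>Hi 1 - x\<bar> \<le> Bc"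
  proof (rule lim[of "{x<..<Hi 1}"])
   show "{x<..<Hi 1} \<subseteq> {-1..1}" using xI Iv(4)[of 1] by auto
   show "at x within {x<..<Hi 1} \<noteq> bot" using xh by (simp add: trivial_limit_within islimpt_greaterThanLessThan1)
   show "\<bar>(?g y - ?g x) / (y - x)\<bar> * \<bar>Hi 1 - y\<bar> \<le> Bc" if "y \<in> {x<..<Hi 1}" for y
    using key[of "t 1" "Hi 1" y] that by simp
  qed
  moreover have "(Hi 1 - Lo 1) / 2 \<le> \<bar>Hi 1 - x\<bar>" using True xh by (simp add: field_simps)
  ultimately show ?thesis by (meson abs_ge_zero mult_left_mono order_trans)
 next
  case False
  have xh: "Lo 1 < x" using False Iv(2)[of 1] by simp
  have "\<bar>dpow f df n x\<bar> * \<bar>Lo 1 - x\<bar> \<le> Bc"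
  proof (rule lim[of "{Lo 1<..<x}"])
   show "{Lo 1<..<x} \<subseteq> {-1..1}" using xI Iv(3)[of 1] by auto
   show "at x within {Lo 1<..<x} \<noteq> bot" using xh by (simp add: trivial_limit_within islimpt_greaterThanLessThan2)
   show "\<bar>(?g y - ?g x) / (y - x)\<bar> * \<bar>Lo 1 - y\<bar> \<le> Bc" if "y \<in> {Lo 1<..<x}" for y
    using key[of "s 1" "Lo 1" y] that by simp
  qed
  moreover have "(Hi 1 - Lo 1) / 2 \<le> \<bar>Lo 1 - x\<bar>" using False xh by (simp add: field_simps)
  ultimately show ?thesis by (meson abs_ge_zero mult_left_mono order_trans)
 qed
 then show ?thesis unfolding Bc_def I'_def by (simp add: mult_ac)
qed

text \<open>As q \<ge> 4p, the coarse image [X,Y] contains at least four of the fine intervals,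
  whereas a chain interval meets at most as many as the last one does, hence at most three.\<close>

lemma coarse:
 assumes cA: "cyc f c p A B" and sub: "A \<le> a" "b \<le> B" and p: "1 \<le> p" "p dvd q" "4 * p \<le> q"
  and i: "i = i' + n0 * p" "1 \<le> i'" "i' \<le> p" "i \<le> q" and XY: "(f ^^ i') ` {A..B} = {X..Y}"
 shows "X \<le> Lo i" "Hi i \<le> Y"
  and "\<lbrakk>chain 1 j s t; j \<le> q; card (meets (s j) (t j)) \<le> 3; i \<le> j\<rbrakk> \<Longrightarrow> X < s i \<or> t i < Y"
proof -
 have inv: "(f ^^ (n * p)) ` {A..B} \<subseteq> {A..B}" for n
 proof (induction n)
  case (Suc n)
  have "(f ^^ (Suc n * p)) ` {A..B} = (f ^^ p) ` (f ^^ (n * p)) ` {A..B}" by (simp add: pow_add_image)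
  also have "\<dots> \<subseteq> (f ^^ p) ` {A..B}" using Suc by (rule image_mono)
  also have "\<dots> \<subseteq> {A..B}" using cA unfolding cyc_def by blast
  finally show ?case .
 qed simp
 have in_XY: "X \<le> Lo (i' + n * p) \<and> Hi (i' + n * p) \<le> Y" for n
 proof -
  have "{Lo (i' + n * p)..Hi (i' + n * p)} = (f ^^ i') ` (f ^^ (n * p)) ` {a..b}" using Iv(1)[of "i' + n * p"] pow_add_image[of i' "n * p" f "{a..b}"] by simp
  also have "\<dots> \<subseteq> (f ^^ i') ` (f ^^ (n * p)) ` {A..B}" using sub by (intro image_mono) auto
  also have "\<dots> \<subseteq> (f ^^ i') ` {A..B}" by (rule image_mono[OF inv])
  finally show ?thesis unfolding XY using Iv(2)[of "i' + n * p"] by auto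
 qed
 show "X \<le> Lo i" "Hi i \<le> Y" using in_XY[of n0] i(1) by auto
 show "X < s i \<or> t i < Y" if ch: "chain 1 j s t" and j: "j \<le> q" and m: "card (meets (s j) (t j)) \<le> 3" and ij: "i \<le> j"
 proof (rule ccontr)
  assume "\<not> (X < s i \<or> t i < Y)"
  then have le: "s i \<le> X" "Y \<le> t i" by auto
  have i1: "1 \<le> i" using i by simp
  have "(\<lambda>n. i' + n * p) ` {0..<4} \<subseteq> meets (s i) (t i)"
  proof
   fix l assume "l \<in> (\<lambda>n. i' + n * p) ` {0..<4}"
   then obtain n where n: "n < 4" "l = i' + n * p" by auto
   have "n * p \<le> 3 * p" using n by (intro mult_right_mono) simp_all
   then have "l \<le> q" using n(2) i(3) p(3) by linarith
   moreover have "max (Lo l) (s i) < min (Hi l) (t i)" using in_XY[of n] le Iv(2)[of l] n by auto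
   ultimately show "l \<in> meets (s i) (t i)" unfolding meets_def using n i by (simp add: ovl_Icc)
  qed
  moreover have "finite (meets (s i) (t i))" unfolding meets_def by simp
  ultimately have "card ((\<lambda>n. i' + n * p) ` {0..<4}) \<le> card (meets (s i) (t i))" by (rule card_mono[rotated])
  moreover have "card ((\<lambda>n. i' + n * p) ` {0..<4}) = 4" using p by (subst card_image) (auto intro: inj_onI)
  ultimately show False using chain_meets_card[OF ch j i1 ij] m by simp
 qed
qed

end

text \<open>One endpoint is at distance at least (b - a) / 2 from c, and f takes the same value at
  both endpoints.\<close>

lemma (in lvl) crit_gap:
 assumes al: "1 < \<alpha>" and k: "0 < k" and pw: "\<And>x. x \<in> {-1..1} ==> k * \<bar>x - c\<bar> powr \<alpha> \<le> f c - f x"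
 shows "k * ((b - a) / 2) powr \<alpha> \<le> f c - f a"
proof (cases "(b - a) / 2 \<le> c - a")
 case True
 then have "k * ((b - a) / 2) powr \<alpha> \<le> k * \<bar>a - c\<bar> powr \<alpha>" using bd al k by (intro mult_left_mono powr_mono2) auto
 then show ?thesis using pw[of a] bd by auto
next
 case False
 then have "k * ((b - a) / 2) powr \<alpha> \<le> k * \<bar>b - c\<bar> powr \<alpha>" using al k bd by (intro mult_left_mono powr_mono2) (auto simp: field_simps)
 then show ?thesis using pw[of b] bd fab by auto
qed

section \<open>Comparison of levels of one map\<close>

lemma tper_step:
 assumes b: "inf_base \<alpha> f" shows "tper f k dvd tper f (Suc k)" "2 * tper f k \<le> tper f (Suc k)"
proof -
 obtain m p q where "m = renorm_period ((renorm ^^ k) f)" "2 \<le> m" using inf_base_structure[OF inf_base_pow[OF b, of k]] by metis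
 then show "tper f k dvd tper f (Suc k)" "2 * tper f k \<le> tper f (Suc k)" by (simp_all add: tper.simps(2))
qed

declare tper.simps(2) [simp del] scale_map.simps(2) [simp del]

lemma tper_step2:
 assumes b: "inf_base \<alpha> f" shows "tper f k dvd tper f (k + 2)" "4 * tper f k \<le> tper f (k + 2)"
proof -
 have k: "k + 2 = Suc (Suc k)" by simp
 show "tper f k dvd tper f (k + 2)" unfolding k by (rule dvd_trans[OF tper_step(1)[OF b] tper_step(1)[OF b]])
 show "4 * tper f k \<le> tper f (k + 2)" unfolding k using tper_step(2)[OF b, of k] tper_step(2)[OF b, of "Suc k"] by linarith
qed

lemma level_nested:
 assumes b: "inf_base \<alpha> f" shows "lo f k \<le> lo f (Suc k)" "hi f (Suc k) \<le> hi f k"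
proof -
 have "scale_map f (Suc k) ` {-1..1} \<subseteq> scale_map f k ` {-1..1}"
 proof (rule image_subsetI)
  fix x :: real assume "x \<in> {-1..1}"
  then have "inv (case_prod aff (rescaling_points ((renorm ^^ k) f))) x \<in> {-1..1}" using scale_step_range[OF b, of x k] by simp
  then show "scale_map f (Suc k) x \<in> scale_map f k ` {-1..1}" unfolding scale_map.simps(2) comp_def by (rule imageI)
 qed
 then have "{lo f (Suc k)..hi f (Suc k)} \<subseteq> {lo f k..hi f k}" unfolding level_image[OF b] .
 moreover have "lo f (Suc k) \<le> hi f (Suc k)" unfolding lo_def hi_def by simp
 ultimately show "lo f k \<le> lo f (Suc k)" "hi f (Suc k) \<le> hi f k" by auto
qed

lemma level_nested_le:
 assumes b: "inf_base \<alpha> f" and "k \<le> n" shows "lo f k \<le> lo f n" "hi f n \<le> hi f k"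
 using assms(2) by (induction n rule: dec_induct) (use level_nested[OF b] in \<open>auto intro: order_trans\<close>)

lemma dpow_Suc_shift: "dpow f df (Suc n) x = df x * dpow f df n (f x)"
 unfolding dpow_def by (simp add: prod.lessThan_Suc_shift funpow_swap1 del: funpow.simps prod.lessThan_Suc) (simp add: funpow_swap1)

text \<open>All levels of one map with one kernel constant; \<open>lvl_k\<close> makes the
  single-level results available for every k.\<close>

locale rb =
 fixes \<alpha> :: real and f df :: "real \<Rightarrow> real" and C :: real
 assumes base: "inf_base \<alpha> f" and al: "1 < \<alpha>" and u: "umap \<alpha> f df (crit f)"
  and C0: "0 \<le> C" and kbl: "kb f df {-1<..<crit f} C" and kbr: "kb f df {crit f<..<1} C"
begin

lemma lvl_k: "lvl \<alpha> f df (crit f) (tper f k) (lo f k) (hi f k) C"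
 using base u C0 kbl kbr level_lev[OF base, of k] unfolding inf_base_def by unfold_locales auto

abbreviation LO where "LO k \<equiv> lvl.Lo f (lo f k) (hi f k)"
abbreviation HI where "HI k \<equiv> lvl.Hi f (lo f k) (hi f k)"

definition V where "V k = f (crit f) - f (lo f k)"

lemma open_invariant:
 assumes "x \<in> {-1<..<1}" shows "(f ^^ n) x \<in> {-1<..<1}"
proof (induction n)
 case (Suc n)
 have f1: "f (-1) = -1" "f 1 = -1" using base unfolding inf_base_def by auto
 interpret lvl \<alpha> f df "crit f" "tper f 0" "lo f 0" "hi f 0" C by (rule lvl_k)
 define y where "y = (f ^^ n) x"
 have y: "-1 < y" "y < 1" using Suc unfolding y_def by auto
 have "-1 < f y"
 proof (cases "y \<le> crit f")
  case True then show ?thesis using inc[of "-1" y] y f1 by simp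
 next
  case False then show ?thesis using dec[of y 1] y f1 by simp
 qed
 moreover have "f y < 1" using fmax[of y] y cyc_not_beyond(2)[OF u inf_base_umap(2)[OF base] f1] by simp
 ultimately show ?case unfolding y_def by simp
qed (use assms in simp)

text \<open>The level-1 interval and its images are compact in (-1,1), finitely many of them have to
  be considered, and every image at a deeper level lies in one of these. So collars of width \<rho>
  fit into [-1,1] at all levels k \<ge> 1.\<close>

lemma gap_exists: "\<exists>\<rho>>0. \<forall>k\<ge>1. \<forall>i. -1 + \<rho> \<le> LO k i \<and> HI k i \<le> 1 - \<rho>"
proof -
 interpret L: lvl \<alpha> f df "crit f" "tper f 1" "lo f 1" "hi f 1" C by (rule lvl_k)
 define Q where "Q = tper f 1"
 have "-1 < lo f 1" "hi f 1 < 1"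
  using scale_range(2)[OF base, of "-1" 1] scale_range(2)[OF base, of 1 1] unfolding lo_def hi_def by auto
 have pos: "0 < min (1 + LO 1 i) (1 - HI 1 i)" for i
 proof -
  have "LO 1 i \<in> (f ^^ i) ` {lo f 1..hi f 1}" "HI 1 i \<in> (f ^^ i) ` {lo f 1..hi f 1}" unfolding L.Iv(1) using L.Iv(2)[of i] by auto
  moreover have "(f ^^ i) ` {lo f 1..hi f 1} \<subseteq> {-1<..<1}"
   using open_invariant \<open>-1 < lo f 1\<close> \<open>hi f 1 < 1\<close> by (intro image_subsetI) auto
  ultimately have "LO 1 i \<in> {-1<..<1}" "HI 1 i \<in> {-1<..<1}" by blast+
  then show ?thesis by simp
 qed
 have "\<exists>e>0. \<forall>i<Q. e \<le> min (1 + LO 1 i) (1 - HI 1 i)" by (rule finite_min_pos) (rule pos)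
 then obtain \<rho> where rho: "0 < \<rho>" "\<forall>i<Q. \<rho> \<le> min (1 + LO 1 i) (1 - HI 1 i)" by (elim exE conjE)
 have "-1 + \<rho> \<le> LO k i \<and> HI k i \<le> 1 - \<rho>" if k: "1 \<le> k" for k i
 proof -
  interpret M: lvl \<alpha> f df "crit f" "tper f k" "lo f k" "hi f k" C by (rule lvl_k)
  define r where "r = i mod Q" define n where "n = i div Q"
  have i: "i = r + n * Q" unfolding r_def n_def by simp
  have r: "r < Q" unfolding r_def Q_def using L.q0 by simp
  have inv: "(f ^^ (n * Q)) ` {lo f 1..hi f 1} \<subseteq> {lo f 1..hi f 1}" for n
  proof (induction n)
   case (Suc n)
   have "(f ^^ (Suc n * Q)) ` {lo f 1..hi f 1} = (f ^^ Q) ` (f ^^ (n * Q)) ` {lo f 1..hi f 1}" by (simp add: pow_add_image)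
   also have "\<dots> \<subseteq> (f ^^ Q) ` {lo f 1..hi f 1}" using Suc by (rule image_mono)
   also have "\<dots> \<subseteq> {lo f 1..hi f 1}" using L.cy unfolding cyc_def Q_def by blast
   finally show ?case .
  qed simp
  have "(f ^^ i) ` {lo f k..hi f k} \<subseteq> (f ^^ i) ` {lo f 1..hi f 1}"
   using level_nested_le[OF base k] by (intro image_mono) auto
  also have "\<dots> = (f ^^ r) ` (f ^^ (n * Q)) ` {lo f 1..hi f 1}" unfolding i pow_add_image ..
  also have "\<dots> \<subseteq> (f ^^ r) ` {lo f 1..hi f 1}" by (rule image_mono[OF inv])
  finally have "{LO k i..HI k i} \<subseteq> {LO 1 r..HI 1 r}" unfolding M.Iv(1) L.Iv(1) .
  then have "LO 1 r \<le> LO k i" "HI k i \<le> HI 1 r" using M.Iv(2)[of i] by auto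
  then show ?thesis using rho(2)[rule_format, OF r] by auto
 qed
 then show ?thesis using rho(1) by blast
qed

text \<open>With j the index of the shortest interval, a collar of width |I_j| / \<theta> is at most
  as wide as every I_l; the role of \<theta> is to fit it into [-1,1]. Since T_1 contains f c but
  cannot cover the critical-value interval of level k, its left end lies inside the latter.\<close>

lemma phase1:
 assumes rho: "0 < \<rho>" "\<And>k i. 1 \<le> k ==> -1 + \<rho> \<le> LO k i \<and> HI k i \<le> 1 - \<rho>" and th: "1 \<le> \<theta>"
  and small: "\<exists>i. 1 \<le> i \<and> i \<le> tper f (k + 2) \<and> HI (k + 2) i - LO (k + 2) i \<le> \<theta> * \<rho>"
 shows "\<exists>j s t \<eta>. 1 \<le> j \<and> j \<le> tper f (k + 2) \<and> lvl.chain f (crit f) (lo f (k + 2)) (hi f (k + 2)) 1 j s t \<and>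
   s j = LO (k + 2) j - \<eta> \<and> t j = HI (k + 2) j + \<eta> \<and> 0 < \<eta> \<and>
   (\<forall>l. 1 \<le> l \<longrightarrow> l \<le> tper f (k + 2) \<longrightarrow> \<eta> \<le> HI (k + 2) l - LO (k + 2) l) \<and>
   s 1 < f (lo f (k + 2)) \<and> V (k + 2) \<le> exp (28 * C) * (\<theta>\<^sup>2 + 2 * \<theta>) * (f (lo f (k + 2)) - s 1) \<and>
   f (crit f) - s 1 \<le> V k"
proof -
 interpret L: lvl \<alpha> f df "crit f" "tper f (k + 2)" "lo f (k + 2)" "hi f (k + 2)" C by (rule lvl_k)
 interpret M: lvl \<alpha> f df "crit f" "tper f k" "lo f k" "hi f k" C by (rule lvl_k)
 define S where "S = {1..tper f (k + 2)}"
 have S: "finite S" "S \<noteq> {}" unfolding S_def using L.q0 by auto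
 define j where "j = arg_min_on (\<lambda>i. L.Hi i - L.Lo i) S"
 have j: "j \<in> S" "\<And>l. l \<in> S ==> L.Hi j - L.Lo j \<le> L.Hi l - L.Lo l"
  unfolding j_def by (rule arg_min_if_finite(1)[OF S], rule arg_min_least[OF S])
 have jq: "1 \<le> j" "j \<le> tper f (k + 2)" using j(1) unfolding S_def by auto
 define \<eta> where "\<eta> = (L.Hi j - L.Lo j) / \<theta>"
 have e0: "0 < \<eta>" unfolding \<eta>_def using L.Iv(2)[of j] th by simp
 have jth: "L.Hi j - L.Lo j = \<theta> * \<eta>" unfolding \<eta>_def using th by simp
 have "L.Hi j - L.Lo j \<le> \<theta> * \<rho>" using small j(2) unfolding S_def by fastforce
 then have er: "\<eta> \<le> \<rho>" unfolding jth using th by simp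
 have eta: "\<eta> \<le> L.Hi l - L.Lo l" if "1 \<le> l" "l \<le> tper f (k + 2)" for l
 proof -
  have "\<eta> \<le> \<theta> * \<eta>" using th e0 by simp
  also have "\<dots> \<le> L.Hi l - L.Lo l" using j(2)[of l] that unfolding jth[symmetric] S_def by simp
  finally show ?thesis .
 qed
 have rho': "-1 + \<rho> \<le> L.Lo l \<and> L.Hi l \<le> 1 - \<rho>" for l using rho(2)[of "k + 2" l] by simp
 note sc = L.small_chain[OF rho' e0 er eta jq]
 obtain s t where ch: "L.chain 1 j s t" "s j = L.Lo j - \<eta>" "t j = L.Hi j + \<eta>" using sc(2) by blast
 have m: "card (L.meets (s j) (t j)) \<le> 3" using sc(1) ch by simp
 note fs = L.first_space[OF ch(1) jq m ch(2,3) e0 eq_refl[OF jth]]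
 have XY: "(f ^^ 1) ` {lo f k..hi f k} = {f (lo f k)..f (crit f)}" unfolding M.Iv(1) M.Iv_1 ..
 have "f (lo f k) < s 1 \<or> t 1 < f (crit f)"
 proof (rule L.coarse(3)[OF M.cy _ _ _ _ _ _ _ _ _ XY ch(1) jq(2) m])
  show "lo f k \<le> lo f (k + 2)" "hi f (k + 2) \<le> hi f k" using level_nested_le[OF base, of k "k + 2"] by auto
  show "1 \<le> tper f k" using M.q0 by simp
  show "tper f k dvd tper f (k + 2)" "4 * tper f k \<le> tper f (k + 2)" using tper_step2[OF base] by auto
  show "1 = 1 + 0 * tper f k" by simp
  show "1 \<le> tper f k" using M.q0 by simp
  show "1 \<le> tper f (k + 2)" using jq by simp
 qed (use jq in auto)
 moreover have "f (crit f) \<le> t 1" using L.chainD(3)[OF ch(1) order_refl jq(1)] L.Iv_1(2) by simp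
 ultimately have "f (crit f) - s 1 \<le> V k" unfolding V_def by auto
 then show ?thesis using jq ch e0 eta fs unfolding V_def by blast
qed

definition maxlen where "maxlen k = Max ((\<lambda>i. HI k i - LO k i) ` {1..tper f k})"

lemma maxlen_ge: "1 \<le> i ==> i \<le> tper f k ==> HI k i - LO k i \<le> maxlen k"
 unfolding maxlen_def by (intro Max_ge) auto

text \<open>The pull-back from the shortest interval gives space at the critical value, which
  already implies the decay of \<open>V\<close>. A second pull-back, started around I_q with this
  space, gives space around all of I_1, ..., I_q with one constant D for every level.\<close>

lemma return_space:
 "\<exists>D>0. \<forall>k. \<exists>s t. lvl.chain f (crit f) (lo f (k + 2)) (hi f (k + 2)) 1 (tper f (k + 2)) s t \<and>
  card (lvl.meets f (tper f (k + 2)) (lo f (k + 2)) (hi f (k + 2)) (s (tper f (k + 2))) (t (tper f (k + 2)))) \<le> 3 \<and>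
  (\<forall>i. 1 \<le> i \<longrightarrow> i \<le> tper f (k + 2) \<longrightarrow> s i < LO (k + 2) i \<and> HI (k + 2) i < t i \<and>
    HI (k + 2) i - LO (k + 2) i \<le> D * (LO (k + 2) i - s i) \<and> HI (k + 2) i - LO (k + 2) i \<le> D * (t i - HI (k + 2) i))"
 and V_decay: "\<exists>\<tau>>0. \<forall>k. (1 + \<tau>) * V (k + 2) \<le> V k"
proof -
 obtain \<rho> where rho: "0 < \<rho>" "\<And>k i. 1 \<le> k ==> -1 + \<rho> \<le> LO k i \<and> HI k i \<le> 1 - \<rho>" using gap_exists by blast
 \<comment> \<open>With \<theta> \<rho> \<ge> 2 the smallness hypothesis of \<open>phase1\<close>
   holds at every level, at the price of a \<theta> that depends on f.\<close>
 define \<theta> where "\<theta> = max 1 (2 / \<rho>)"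
 have th: "1 \<le> \<theta>" "2 \<le> \<theta> * \<rho>" unfolding \<theta>_def using rho(1) by (auto simp: field_simps max_def)
 obtain k0 K where kK: "0 < k0" "0 < K" "\<And>x. x \<in> {-1..1} ==> \<bar>df x\<bar> \<le> K * \<bar>x - crit f\<bar> powr (\<alpha> - 1) \<and> k0 * \<bar>x - crit f\<bar> powr \<alpha> \<le> f (crit f) - f x"
  using umap_global(2)[OF u al] by blast
 define \<tau> where "\<tau> = 1 / (exp (28 * C) * (\<theta>\<^sup>2 + 2 * \<theta>))"
 have Ep: "0 < exp (28 * C) * (\<theta>\<^sup>2 + 2 * \<theta>)" using th by (intro mult_pos_pos add_pos_pos) auto
 have tau: "0 < \<tau>" unfolding \<tau>_def using Ep by simp
 define \<delta> where "\<delta> = min 1 (\<tau> * k0 / (K * (2 powr \<alpha> * 2 powr (\<alpha> - 1))))"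
 have del: "0 < \<delta>" "\<delta> \<le> 1" "\<delta> \<le> \<tau> * k0 / (K * (2 powr \<alpha> * 2 powr (\<alpha> - 1)))" unfolding \<delta>_def using tau kK by auto
 define D where "D = exp (28 * C) * (1 / \<delta>\<^sup>2 + 2 / \<delta>)"
 have D0: "0 < D" unfolding D_def using del by (intro mult_pos_pos add_pos_pos) auto
 have ph: "\<exists>j s t \<eta>. 1 \<le> j \<and> j \<le> tper f (k + 2) \<and> lvl.chain f (crit f) (lo f (k + 2)) (hi f (k + 2)) 1 j s t \<and>
   s j = LO (k + 2) j - \<eta> \<and> t j = HI (k + 2) j + \<eta> \<and> 0 < \<eta> \<and>
   (\<forall>l. 1 \<le> l \<longrightarrow> l \<le> tper f (k + 2) \<longrightarrow> \<eta> \<le> HI (k + 2) l - LO (k + 2) l) \<and>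
   s 1 < f (lo f (k + 2)) \<and> \<tau> * V (k + 2) \<le> f (lo f (k + 2)) - s 1 \<and>
   f (crit f) - s 1 \<le> V k" for k
 proof -
  interpret L: lvl \<alpha> f df "crit f" "tper f (k + 2)" "lo f (k + 2)" "hi f (k + 2)" C by (rule lvl_k)
  have sm: "\<exists>i. 1 \<le> i \<and> i \<le> tper f (k + 2) \<and> L.Hi i - L.Lo i \<le> \<theta> * \<rho>"
   using L.Iv(3,4)[of 1] th L.q0 by (intro exI[of _ 1]) auto
  have tV: "\<tau> * v \<le> w" if "v \<le> exp (28 * C) * (\<theta>\<^sup>2 + 2 * \<theta>) * w" for v w
   using that Ep unfolding \<tau>_def by (simp add: divide_le_eq mult.commute)
  show ?thesis using phase1[OF rho th(1) sm] tV by blast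
 qed
 have "(1 + \<tau>) * V (k + 2) \<le> V k" for k
 proof -
  obtain s :: "nat \<Rightarrow> real" where "\<tau> * V (k + 2) \<le> f (lo f (k + 2)) - s 1" "f (crit f) - s 1 \<le> V k" using ph[of k] by blast
  then show ?thesis unfolding V_def by (simp add: algebra_simps)
 qed
 then show "\<exists>\<tau>>0. \<forall>k. (1 + \<tau>) * V (k + 2) \<le> V k" using tau by blast
 have "\<exists>s t. lvl.chain f (crit f) (lo f (k + 2)) (hi f (k + 2)) 1 (tper f (k + 2)) s t \<and>
  card (lvl.meets f (tper f (k + 2)) (lo f (k + 2)) (hi f (k + 2)) (s (tper f (k + 2))) (t (tper f (k + 2)))) \<le> 3 \<and>
  (\<forall>i. 1 \<le> i \<longrightarrow> i \<le> tper f (k + 2) \<longrightarrow> s i < LO (k + 2) i \<and> HI (k + 2) i < t i \<and>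
    HI (k + 2) i - LO (k + 2) i \<le> D * (LO (k + 2) i - s i) \<and> HI (k + 2) i - LO (k + 2) i \<le> D * (t i - HI (k + 2) i))" for k
 proof -
  interpret L: lvl \<alpha> f df "crit f" "tper f (k + 2)" "lo f (k + 2)" "hi f (k + 2)" C by (rule lvl_k)
  define q where "q = tper f (k + 2)"
  obtain j s t \<eta> where h: "1 \<le> j" "j \<le> q" "L.chain 1 j s t" "s j = L.Lo j - \<eta>" "t j = L.Hi j + \<eta>" "0 < \<eta>"
   "\<And>l. 1 \<le> l ==> l \<le> q ==> \<eta> \<le> L.Hi l - L.Lo l" "s 1 < f (lo f (k + 2))" "\<tau> * V (k + 2) \<le> f (lo f (k + 2)) - s 1"
   using ph[of k] unfolding q_def by blast
  have s1: "-1 \<le> s 1" using L.chainD(1)[OF h(3) order_refl h(1)] .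
  obtain x x' where x: "-1 \<le> x" "x < lo f (k + 2)" "hi f (k + 2) < x'" "x' \<le> 1" "f x = s 1" "f x' = s 1" "f ` {x..x'} = {s 1..f (crit f)}"
   using L.fold_preimage[OF s1 h(8)] by metis
  note rc = L.return_chain[OF h(3,1) h(2)[unfolded q_def] h(4,5,6) h(7)[unfolded q_def] x h(8)]
  obtain s' t' where ch: "L.chain 1 q s' t'" "s' q = x" "t' q = x'" using rc(2) unfolding q_def by blast
  have m: "card (L.meets (s' q) (t' q)) \<le> 3" using rc(1) ch by simp
  have mg: "\<delta> * (hi f (k + 2) - lo f (k + 2)) \<le> lo f (k + 2) - x" "\<delta> * (hi f (k + 2) - lo f (k + 2)) \<le> x' - hi f (k + 2)"
   using L.margin[OF al kK tau x(1-4) _ _ del(2,3)] x h(9) unfolding V_def by simp_all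
  have q1: "1 \<le> q" using h by simp
  have st: "s' q < L.Lo q" "L.Hi q < t' q" using ch x L.Iv_q unfolding q_def by auto
  have crq: "cr (s' q) (L.Lo q) (L.Hi q) (t' q) \<le> 1 / \<delta>\<^sup>2 + 2 / \<delta>"
   by (rule cr_upper[OF st(1) L.Iv(2) st(2) del(1), of "hi f (k + 2) - lo f (k + 2)"]) (use mg ch L.Iv_q in \<open>auto simp: q_def\<close>)
  have "s' i < L.Lo i \<and> L.Hi i < t' i \<and> L.Hi i - L.Lo i \<le> D * (L.Lo i - s' i) \<and> L.Hi i - L.Lo i \<le> D * (t' i - L.Hi i)"
   if i: "1 \<le> i" "i \<le> q" for i
  proof -
   note S = L.chain_space[OF ch(1) _ m i st, unfolded q_def, OF order_refl, folded q_def]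
   have "cr (s' i) (L.Lo i) (L.Hi i) (t' i) = exp (28 * C) * (exp (- (28 * C)) * cr (s' i) (L.Lo i) (L.Hi i) (t' i))"
    by (simp add: mult.assoc[symmetric] exp_add[symmetric])
   also have "\<dots> \<le> D" unfolding D_def using S(3) crq by (intro mult_left_mono) simp_all
   finally have cD: "cr (s' i) (L.Lo i) (L.Hi i) (t' i) \<le> D" .
   have "cr (s' i) (L.Lo i) (L.Hi i) (t' i) * (L.Lo i - s' i) \<le> D * (L.Lo i - s' i)"
    "cr (s' i) (L.Lo i) (L.Hi i) (t' i) * (t' i - L.Hi i) \<le> D * (t' i - L.Hi i)"
    using cD S(1,2) by (auto intro!: mult_right_mono)
   then show ?thesis using cr_margins[OF S(1) L.Iv(2) S(2)] S(1,2) by linarith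
  qed
  then show ?thesis using ch(1) m unfolding q_def by blast
 qed
 then show "\<exists>D>0. \<forall>k. \<exists>s t. lvl.chain f (crit f) (lo f (k + 2)) (hi f (k + 2)) 1 (tper f (k + 2)) s t \<and>
  card (lvl.meets f (tper f (k + 2)) (lo f (k + 2)) (hi f (k + 2)) (s (tper f (k + 2))) (t (tper f (k + 2)))) \<le> 3 \<and>
  (\<forall>i. 1 \<le> i \<longrightarrow> i \<le> tper f (k + 2) \<longrightarrow> s i < LO (k + 2) i \<and> HI (k + 2) i < t i \<and>
    HI (k + 2) i - LO (k + 2) i \<le> D * (LO (k + 2) i - s i) \<and> HI (k + 2) i - LO (k + 2) i \<le> D * (t i - HI (k + 2) i))"
  using D0 by blast
qed

lemma maxlen_pos: "0 < maxlen k"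
proof -
 interpret L: lvl \<alpha> f df "crit f" "tper f k" "lo f k" "hi f k" C by (rule lvl_k)
 have "L.Hi 1 - L.Lo 1 \<le> maxlen k" using L.q0 by (intro maxlen_ge) auto
 then show ?thesis using L.Iv(2)[of 1] by simp
qed

text \<open>Let I_i be the longest fine interval. The coarse image around it is not covered by T_i,
  so on one side it contains the whole margin of I_i in T_i, which is at least |I_i| / D.\<close>

lemma maxlen_decay: "\<exists>\<tau>>0. \<forall>k. (1 + \<tau>) * maxlen (k + 2) \<le> maxlen k"
proof -
 obtain D where D: "0 < D" "\<And>k. \<exists>s t. lvl.chain f (crit f) (lo f (k + 2)) (hi f (k + 2)) 1 (tper f (k + 2)) s t \<and>
  card (lvl.meets f (tper f (k + 2)) (lo f (k + 2)) (hi f (k + 2)) (s (tper f (k + 2))) (t (tper f (k + 2)))) \<le> 3 \<and>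
  (\<forall>i. 1 \<le> i \<longrightarrow> i \<le> tper f (k + 2) \<longrightarrow> s i < LO (k + 2) i \<and> HI (k + 2) i < t i \<and>
    HI (k + 2) i - LO (k + 2) i \<le> D * (LO (k + 2) i - s i) \<and> HI (k + 2) i - LO (k + 2) i \<le> D * (t i - HI (k + 2) i))"
  using return_space by blast
 have "(1 + 1 / D) * maxlen (k + 2) \<le> maxlen k" for k
 proof -
  interpret L: lvl \<alpha> f df "crit f" "tper f (k + 2)" "lo f (k + 2)" "hi f (k + 2)" C by (rule lvl_k)
  interpret M: lvl \<alpha> f df "crit f" "tper f k" "lo f k" "hi f k" C by (rule lvl_k)
  obtain s t where ch: "L.chain 1 (tper f (k + 2)) s t" and m: "card (L.meets (s (tper f (k + 2))) (t (tper f (k + 2)))) \<le> 3"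
   and st: "\<And>i. 1 \<le> i ==> i \<le> tper f (k + 2) ==> s i < L.Lo i \<and> L.Hi i < t i \<and>
    L.Hi i - L.Lo i \<le> D * (L.Lo i - s i) \<and> L.Hi i - L.Lo i \<le> D * (t i - L.Hi i)"
   using D(2)[of k] by blast
  have "maxlen (k + 2) \<in> (\<lambda>i. L.Hi i - L.Lo i) ` {1..tper f (k + 2)}"
   unfolding maxlen_def by (rule Max_in) (use L.q0 in auto)
  then obtain i where "i \<in> {1..tper f (k + 2)}" "maxlen (k + 2) = L.Hi i - L.Lo i" by (rule imageE)
  then have i: "1 \<le> i" "i \<le> tper f (k + 2)" "maxlen (k + 2) = L.Hi i - L.Lo i" by simp_all
  define p where "p = tper f k"
  have p0: "0 < p" unfolding p_def by (rule M.q0)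
  \<comment> \<open>The residue of i modulo p is taken in 1, ..., p, to match the indexing of the
    coarse images.\<close>
  define i' where "i' = (i - 1) mod p + 1" define n0 where "n0 = (i - 1) div p"
  have i': "i = i' + n0 * p" "1 \<le> i'" "i' \<le> p" using i(1) p0 unfolding i'_def n0_def by (auto simp: Suc_leI)
  have XY: "(f ^^ i') ` {lo f k..hi f k} = {M.Lo i'..M.Hi i'}" by (rule M.Iv(1))
  have n: "lo f k \<le> lo f (k + 2)" "hi f (k + 2) \<le> hi f k" using level_nested_le[OF base, of k "k + 2"] by auto
  have p: "1 \<le> p" "p dvd tper f (k + 2)" "4 * p \<le> tper f (k + 2)" using tper_step2[OF base] p0 unfolding p_def by auto
  note co = L.coarse[OF M.cy[folded p_def] n p i' i(2) XY]
  have "M.Lo i' < s i \<or> t i < M.Hi i'" using co(3)[OF ch order_refl m i(2)] .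
  then have "(L.Hi i - L.Lo i) + (L.Hi i - L.Lo i) / D \<le> M.Hi i' - M.Lo i'"
  proof
   assume a: "M.Lo i' < s i"
   have "(L.Hi i - L.Lo i) / D \<le> L.Lo i - s i" using st[OF i(1,2)] D(1) by (simp add: divide_le_eq mult.commute)
   then show ?thesis using a co(2) by linarith
  next
   assume a: "t i < M.Hi i'"
   have "(L.Hi i - L.Lo i) / D \<le> t i - L.Hi i" using st[OF i(1,2)] D(1) by (simp add: divide_le_eq mult.commute)
   then show ?thesis using a co(1) by linarith
  qed
  also have "\<dots> \<le> maxlen k" using i' unfolding p_def by (intro maxlen_ge) auto
  finally show ?thesis unfolding i(3) by (simp add: distrib_right)
 qed
 then show ?thesis using D(1) by (intro exI[of _ "1 / D"]) simp
qed

end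

section \<open>Small kernel constants of deep renormalizations\<close>

lemma geometric_decay:
 fixes x :: "nat \<Rightarrow> real"
 assumes "0 < \<tau>" "\<And>k. (1 + \<tau>) * x (k + 2) \<le> x k"
 shows "x (k + 2 * n) \<le> x k * (1 / (1 + \<tau>)) ^ n"
proof (induction n)
 case (Suc n)
 have "x (k + 2 * Suc n) \<le> x (k + 2 * n) * (1 / (1 + \<tau>))"
  using assms(2)[of "k + 2 * n"] assms(1) by (simp add: le_divide_eq mult.commute)
 also have "\<dots> \<le> x k * (1 / (1 + \<tau>)) ^ n * (1 / (1 + \<tau>))" using Suc assms(1) by (intro mult_right_mono) simp_all
 finally show ?case by (simp add: mult_ac)
qed simp

lemma geometric_decay_small:
 fixes x :: "nat \<Rightarrow> real"
 assumes t: "0 < \<tau>" and x: "\<And>k. (1 + \<tau>) * x (k + 2) \<le> x k" and e: "0 < e"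
 shows "\<forall>\<^sub>F n in sequentially. x (2 * n) < e"
proof -
 have "(\<lambda>n. x 0 * (1 / (1 + \<tau>)) ^ n) \<longlonglongrightarrow> x 0 * 0"
  using t by (intro tendsto_mult tendsto_const LIMSEQ_realpow_zero) simp_all
 then have "\<forall>\<^sub>F n in sequentially. x 0 * (1 / (1 + \<tau>)) ^ n < e" using order_tendstoD(2) e by fastforce
 then show ?thesis
 proof eventually_elim
  case (elim n)
  then show ?case using geometric_decay[of \<tau> x 0 n, OF t x] by simp
 qed
qed

text \<open>Repeated use of \<open>kb_comp\<close>: an application of f after i iterations
  contributes C (M i)^2, because the derivative of f^i is bounded by M i. One half of [a,b] is used
  at a time, so that every image stays within a single branch.\<close>

lemma (in lvl) kb_iter:
 assumes M: "\<And>i x. i < q ==> x \<in> {a..b} ==> \<bar>dpow f df i x\<bar> \<le> M i"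
  and open1: "\<And>i. 1 \<le> i ==> i < q ==> -1 < Lo i \<and> Hi i < 1"
  and S: "S = {a<..<c} \<or> S = {c<..<b}"
 shows "m \<le> q ==> kb (f ^^ m) (dpow f df m) S (C * (\<Sum>i<m. (M i)\<^sup>2)) \<and> inj_on (f ^^ m) S \<and>
  ((\<forall>x\<in>S. 0 \<le> dpow f df m x) \<or> (\<forall>x\<in>S. dpow f df m x \<le> 0))"
proof (induction m)
 case 0
 show ?case by (simp add: kb_def dpow_def)
next
 case (Suc m)
 then have IH: "kb (f ^^ m) (dpow f df m) S (C * (\<Sum>i<m. (M i)\<^sup>2))" "inj_on (f ^^ m) S"
  "(\<forall>x\<in>S. 0 \<le> dpow f df m x) \<or> (\<forall>x\<in>S. dpow f df m x \<le> 0)" and mq: "m < q" by simp_all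
 have Sab: "S \<subseteq> {a..b}" using S bd by auto
 have "(f ^^ m) ` S \<subseteq> {-1<..<c} \<or> (f ^^ m) ` S \<subseteq> {c<..<1}"
 proof (cases "m = 0")
  case True
  then show ?thesis using S bd by auto
 next
  case False
  have sub: "(f ^^ m) ` S \<subseteq> {Lo m..Hi m}" using image_mono[OF Sab, of "f ^^ m"] Iv(1)[of m] by simp
  have "{Lo m..Hi m} \<subseteq> {-1<..<c} \<or> {Lo m..Hi m} \<subseteq> {c<..<1}" using crit_av[of m] open1[of m] False mq by auto
  then show ?thesis using sub by blast
 qed
 then obtain T where T: "T = {-1<..<c} \<or> T = {c<..<1}" "(f ^^ m) ` S \<subseteq> T" by blast
 have kT: "kb f df T C" using T(1) kbl kbr by blast
 have injT: "inj_on f T"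
  using T(1)
 proof
  assume t: "T = {-1<..<c}"
  show ?thesis unfolding t
  proof (rule linorder_inj_onI')
   fix i j :: real assume "i \<in> {-1<..<c}" "j \<in> {-1<..<c}" "i < j"
   then show "f i \<noteq> f j" using inc[of i j] by simp
  qed
 next
  assume t: "T = {c<..<1}"
  show ?thesis unfolding t
  proof (rule linorder_inj_onI')
   fix i j :: real assume "i \<in> {c<..<1}" "j \<in> {c<..<1}" "i < j"
   then show "f i \<noteq> f j" using dec[of i j] by simp
  qed
 qed
 have sgT: "(\<forall>y\<in>T. 0 \<le> df y) \<or> (\<forall>y\<in>T. df y \<le> 0)"
  using T(1)
 proof
  assume t: "T = {-1<..<c}"
  have "0 \<le> df y" if "y \<in> T" for y using umapD(6)[OF u, of y] that unfolding t by simp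
  then show ?thesis by blast
 next
  assume t: "T = {c<..<1}"
  have "df y \<le> 0" if "y \<in> T" for y using umapD(7)[OF u, of y] that unfolding t by simp
  then show ?thesis by blast
 qed
 have ds: "dpow f df (Suc m) x = df ((f ^^ m) x) * dpow f df m x" for x unfolding dpow_def by (simp add: mult.commute)
 have "kb (\<lambda>x. f ((f ^^ m) x)) (\<lambda>x. df ((f ^^ m) x) * dpow f df m x) S (C * (\<Sum>i<m. (M i)\<^sup>2) + C * (M m)\<^sup>2)"
  by (rule kb_comp[OF kT IH(1) T(2) C0 IH(3) _ IH(2)]) (use M[OF mq] Sab in blast)
 moreover have "(\<lambda>x. f ((f ^^ m) x)) = f ^^ Suc m" by auto
 moreover have "C * (\<Sum>i<m. (M i)\<^sup>2) + C * (M m)\<^sup>2 = C * (\<Sum>i<Suc m. (M i)\<^sup>2)" by (simp add: distrib_left)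
 moreover have "(\<lambda>x. df ((f ^^ m) x) * dpow f df m x) = dpow f df (Suc m)" using ds by auto
 ultimately have 1: "kb (f ^^ Suc m) (dpow f df (Suc m)) S (C * (\<Sum>i<Suc m. (M i)\<^sup>2))" by metis
 have 2: "inj_on (f ^^ Suc m) S" using comp_inj_on[OF IH(2) inj_on_subset[OF injT T(2)]] by simp
 have 3: "(\<forall>x\<in>S. 0 \<le> dpow f df (Suc m) x) \<or> (\<forall>x\<in>S. dpow f df (Suc m) x \<le> 0)"
 proof -
  have im: "(f ^^ m) x \<in> T" if "x \<in> S" for x using T(2) that by blast
  show ?thesis using sgT IH(3) unfolding ds by (elim disjE) (simp_all add: im mult_nonneg_nonneg mult_nonneg_nonpos mult_nonpos_nonneg mult_nonpos_nonpos)
 qed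
 show ?case using 1 2 3 by blast
qed

text \<open>The kernel scales like an inverse squared length, so passing to the coordinate of level
  n multiplies the constant by the square of the half-length. A negative scale factor exchanges the
  two branches.\<close>

lemma kb_scale:
 assumes b: "inf_base \<alpha> f" and u: "umap \<alpha> f df (crit f)" and un: "umap \<alpha> ((renorm ^^ n) f) dg (crit ((renorm ^^ n) f))"
  and k1: "kb (f ^^ tper f n) (dpow f df (tper f n)) {lo f n<..<crit f} K"
  and k2: "kb (f ^^ tper f n) (dpow f df (tper f n)) {crit f<..<hi f n} K"
 shows "kb ((renorm ^^ n) f) dg {-1<..<crit ((renorm ^^ n) f)} (K * ((hi f n - lo f n) / 2)\<^sup>2)"
  "kb ((renorm ^^ n) f) dg {crit ((renorm ^^ n) f)<..<1} (K * ((hi f n - lo f n) / 2)\<^sup>2)"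
proof -
 define g where "g = (renorm ^^ n) f"
 define F where "F = f ^^ tper f n" define F' where "F' = dpow f df (tper f n)"
 obtain U W where UW: "W \<noteq> 0" "\<And>x. scale_map f n x = U + W * x" using scale_affine[OF b, of n] by blast
 have J: "(hi f n - lo f n)\<^sup>2 = (2 * W)\<^sup>2" unfolding hi_def lo_def UW(2) by (auto simp: max_def min_def power2_eq_square algebra_simps)
 then have J2: "((hi f n - lo f n) / 2)\<^sup>2 = W\<^sup>2" by (simp add: power_divide power_mult_distrib)
 have conj: "F (U + W * x) = U + W * g x" if "x \<in> {-1..1}" for x
  using scale_conj[OF b, of n x] unfolding F_def g_def UW(2) .
 have deriv: "F' (U + W * x) = dg x" if x: "x \<in> {-1<..<1}" for x
 proof -
  have "U + W * x \<in> {-1<..<1}" using scale_range_aux[OF b, of x n] x unfolding UW(2) by auto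
  then have "DERIV F (U + W * x) :> F' (U + W * x)"
   using dpow_deriv[OF u, of "U + W * x" "tper f n"] unfolding F_def F'_def by (simp add: at_within_Icc_at)
  then have "DERIV (\<lambda>x. F (U + W * x)) x :> F' (U + W * x) * W"
   by (rule DERIV_chain2) (auto intro!: derivative_eq_intros)
  moreover have "DERIV (\<lambda>x. F (U + W * x)) x :> W * dg x"
  proof (rule has_field_derivative_transform_within_open[where S = "{-1<..<1}"])
   have "DERIV g x :> dg x" using umap_deriv_in[OF un] x unfolding g_def by simp
   then show "DERIV (\<lambda>x. U + W * g x) x :> W * dg x" by (auto intro!: derivative_eq_intros)
  qed (use x conj in auto)
  ultimately have "F' (U + W * x) * W = W * dg x" by (rule DERIV_unique)
  then show ?thesis using UW(1) by simp
 qed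
 have main: "kb g dg S (K * W\<^sup>2)" if S: "S \<subseteq> {-1<..<1}" and kT: "kb F F' T K" and ST: "\<And>x. x \<in> S ==> U + W * x \<in> T" for S T
  unfolding kb_def
 proof (intro ballI)
  fix x y assume xy: "x \<in> S" "y \<in> S"
  define Lx where "Lx = U + W * x" define Ly where "Ly = U + W * y"
  have xI: "x \<in> {-1<..<1}" "y \<in> {-1<..<1}" using xy S by blast+
  have 1: "F' Lx * F' Ly * (Lx - Ly)\<^sup>2 \<le> (1 + K * (Lx - Ly)\<^sup>2) * (F Lx - F Ly)\<^sup>2"
   using kbD[OF kT ST[OF xy(1)] ST[OF xy(2)]] unfolding Lx_def Ly_def .
  have "Lx - Ly = W * (x - y)" unfolding Lx_def Ly_def by (simp add: algebra_simps)
  then have 2: "(Lx - Ly)\<^sup>2 = W\<^sup>2 * (x - y)\<^sup>2" by (simp add: power_mult_distrib)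
  have "F Lx - F Ly = W * (g x - g y)" using conj[of x] conj[of y] xI unfolding Lx_def Ly_def by (simp add: algebra_simps)
  then have 3: "(F Lx - F Ly)\<^sup>2 = W\<^sup>2 * (g x - g y)\<^sup>2" by (simp add: power_mult_distrib)
  have 4: "F' Lx = dg x" "F' Ly = dg y" using deriv xI unfolding Lx_def Ly_def by auto
  have "W\<^sup>2 * (dg x * dg y * (x - y)\<^sup>2) \<le> W\<^sup>2 * ((1 + K * W\<^sup>2 * (x - y)\<^sup>2) * (g x - g y)\<^sup>2)"
   using 1 unfolding 2 3 4 by (simp add: mult_ac)
  then show "dg x * dg y * (x - y)\<^sup>2 \<le> (1 + K * W\<^sup>2 * (x - y)\<^sup>2) * (g x - g y)\<^sup>2"
   using UW(1) mult_le_cancel_left_pos[of "W\<^sup>2"] by simp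
 qed
 have cb: "-1 < crit g" "crit g < 1" using umapD(9,10)[OF un] unfolding g_def by auto
 have cc: "crit f = U + W * crit g" using scale_crit[OF b, of n] unfolding UW(2) g_def by simp
 show "kb ((renorm ^^ n) f) dg {-1<..<crit ((renorm ^^ n) f)} (K * ((hi f n - lo f n) / 2)\<^sup>2)"
  unfolding J2 g_def[symmetric]
 proof (cases "W > 0")
  case True
  show "kb g dg {-1<..<crit g} (K * W\<^sup>2)"
  proof (rule main[OF _ k1[folded F_def F'_def]])
   fix x assume x: "x \<in> {-1<..<crit g}"
   then have "W * -1 < W * x" "W * x < W * crit g" using True by (simp_all only: greaterThanLessThan_iff mult_less_cancel_left_pos)
   then show "U + W * x \<in> {lo f n<..<crit f}" unfolding cc lo_def UW(2) by auto
  qed (use cb in auto)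
 next
  case False
  then have W: "W < 0" using UW(1) by simp
  show "kb g dg {-1<..<crit g} (K * W\<^sup>2)"
  proof (rule main[OF _ k2[folded F_def F'_def]])
   fix x assume x: "x \<in> {-1<..<crit g}"
   then have "W * x < W * -1" "W * crit g < W * x" using W by (simp_all only: greaterThanLessThan_iff mult_less_cancel_left_neg)
   then show "U + W * x \<in> {crit f<..<hi f n}" unfolding cc hi_def UW(2) by auto
  qed (use cb in auto)
 qed
 show "kb ((renorm ^^ n) f) dg {crit ((renorm ^^ n) f)<..<1} (K * ((hi f n - lo f n) / 2)\<^sup>2)"
  unfolding J2 g_def[symmetric]
 proof (cases "W > 0")
  case True
  show "kb g dg {crit g<..<1} (K * W\<^sup>2)"
  proof (rule main[OF _ k2[folded F_def F'_def]])
   fix x assume x: "x \<in> {crit g<..<1}"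
   then have "W * crit g < W * x" "W * x < W * 1" using True by (simp_all only: greaterThanLessThan_iff mult_less_cancel_left_pos)
   then show "U + W * x \<in> {crit f<..<hi f n}" unfolding cc hi_def UW(2) by auto
  qed (use cb in auto)
 next
  case False
  then have W: "W < 0" using UW(1) by simp
  show "kb g dg {crit g<..<1} (K * W\<^sup>2)"
  proof (rule main[OF _ k1[folded F_def F'_def]])
   fix x assume x: "x \<in> {crit g<..<1}"
   then have "W * x < W * crit g" "W * 1 < W * x" using W by (simp_all only: greaterThanLessThan_iff mult_less_cancel_left_neg)
   then show "U + W * x \<in> {lo f n<..<crit f}" unfolding cc lo_def UW(2) by auto
  qed (use cb in auto)
 qed
qed

lemma scale_add: "scale_map f (n + k) = scale_map f n \<circ> scale_map ((renorm ^^ n) f) k"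
proof (induction k)
 case (Suc k)
 have "(renorm ^^ (n + k)) f = (renorm ^^ k) ((renorm ^^ n) f)" using funpow_add[of k n renorm] by (simp add: add.commute)
 then show ?case using Suc by (simp add: scale_map.simps(2) comp_assoc)
qed simp

lemma level_length_add:
 assumes b: "inf_base \<alpha> f"
 shows "hi f (n + k) - lo f (n + k) = (hi f n - lo f n) / 2 * (hi ((renorm ^^ n) f) k - lo ((renorm ^^ n) f) k)"
proof -
 obtain U W where UW: "W \<noteq> 0" "\<And>x. scale_map f n x = U + W * x" using scale_affine[OF b, of n] by blast
 have d: "max x y - min x y = \<bar>x - y\<bar>" for x y :: real by auto
 have "hi f (n + k) - lo f (n + k) = \<bar>W\<bar> * \<bar>scale_map ((renorm ^^ n) f) k (-1) - scale_map ((renorm ^^ n) f) k 1\<bar>"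
  unfolding hi_def lo_def scale_add comp_def UW(2) d by (simp add: abs_mult[symmetric] right_diff_distrib)
 moreover have "hi f n - lo f n = 2 * \<bar>W\<bar>" unfolding hi_def lo_def UW(2) d by (auto simp: abs_if)
 moreover have "hi ((renorm ^^ n) f) k - lo ((renorm ^^ n) f) k = \<bar>scale_map ((renorm ^^ n) f) k (-1) - scale_map ((renorm ^^ n) f) k 1\<bar>"
  unfolding hi_def lo_def d ..
 ultimately show ?thesis by simp
qed

context rb
begin

text \<open>Write J for the level interval. The first step contributes at most K |J|^(\<alpha>-1)
  and \<open>koebe\<close> a multiple of |I_i| / |I_1|; as |I_1| is at least of order |J|^\<alpha>,
  the powers combine to |I_i| / |J|.\<close>

lemma dpow_bound:
 "\<exists>D>0. \<forall>k i x. 1 \<le> i \<longrightarrow> i < tper f (k + 2) \<longrightarrow> x \<in> {lo f (k + 2)..hi f (k + 2)} \<longrightarrow>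
   \<bar>dpow f df i x\<bar> * (hi f (k + 2) - lo f (k + 2)) \<le> D * (HI (k + 2) i - LO (k + 2) i)"
proof -
 obtain D where D: "0 < D" "\<And>k. \<exists>s t. lvl.chain f (crit f) (lo f (k + 2)) (hi f (k + 2)) 1 (tper f (k + 2)) s t \<and>
  card (lvl.meets f (tper f (k + 2)) (lo f (k + 2)) (hi f (k + 2)) (s (tper f (k + 2))) (t (tper f (k + 2)))) \<le> 3 \<and>
  (\<forall>i. 1 \<le> i \<longrightarrow> i \<le> tper f (k + 2) \<longrightarrow> s i < LO (k + 2) i \<and> HI (k + 2) i < t i \<and>
    HI (k + 2) i - LO (k + 2) i \<le> D * (LO (k + 2) i - s i) \<and> HI (k + 2) i - LO (k + 2) i \<le> D * (t i - HI (k + 2) i))"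
  using return_space by blast
 obtain k0 K where kK: "0 < k0" "0 < K" "\<And>x. x \<in> {-1..1} ==> \<bar>df x\<bar> \<le> K * \<bar>x - crit f\<bar> powr (\<alpha> - 1) \<and> k0 * \<bar>x - crit f\<bar> powr \<alpha> \<le> f (crit f) - f x"
  using umap_global(2)[OF u al] by blast
 define E where "E = 2 * exp (28 * C) * (1 + D)"
 have E0: "0 < E" unfolding E_def using D by simp
 define D' where "D' = K * E * 2 powr \<alpha> / k0"
 have D'0: "0 < D'" unfolding D'_def using kK E0 by simp
 have "\<bar>dpow f df i x\<bar> * (hi f (k + 2) - lo f (k + 2)) \<le> D' * (HI (k + 2) i - LO (k + 2) i)"
  if i: "1 \<le> i" "i < tper f (k + 2)" and x: "x \<in> {lo f (k + 2)..hi f (k + 2)}" for k i x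
 proof -
  interpret L: lvl \<alpha> f df "crit f" "tper f (k + 2)" "lo f (k + 2)" "hi f (k + 2)" C by (rule lvl_k)
  obtain s t where ch: "L.chain 1 (tper f (k + 2)) s t" and m: "card (L.meets (s (tper f (k + 2))) (t (tper f (k + 2)))) \<le> 3"
   and st: "\<And>i. 1 \<le> i ==> i \<le> tper f (k + 2) ==> s i < L.Lo i \<and> L.Hi i < t i \<and>
    L.Hi i - L.Lo i \<le> D * (L.Lo i - s i) \<and> L.Hi i - L.Lo i \<le> D * (t i - L.Hi i)"
   using D(2)[of k] by blast
  define n where "n = i - 1"
  have n: "i = Suc n" "1 + n = i" "1 + n \<le> tper f (k + 2)" using i unfolding n_def by auto
  define J where "J = hi f (k + 2) - lo f (k + 2)"
  have J: "0 < J" using L.bd unfolding J_def by simp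
  have sti: "L.Hi (1 + n) - L.Lo (1 + n) \<le> D * (L.Lo (1 + n) - s (1 + n))" "L.Hi (1 + n) - L.Lo (1 + n) \<le> D * (t (1 + n) - L.Hi (1 + n))"
   using st[of "1 + n"] n by simp_all
  have st1: "s 1 < L.Lo 1" "L.Hi 1 < t 1" using st[of 1] i by simp_all
  have fx: "L.Lo 1 \<le> f x" "f x \<le> L.Hi 1" using image_Icc_D[OF L.Iv(1)[of 1], of x] x by simp_all
  have ko: "\<bar>dpow f df n (f x)\<bar> * (L.Hi 1 - L.Lo 1) \<le> E * (L.Hi i - L.Lo i)"
   using L.koebe[OF ch m n(3) D(1) sti st1 fx] unfolding E_def n(2) .
  have I1: "k0 * (J / 2) powr \<alpha> \<le> L.Hi 1 - L.Lo 1"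
   unfolding L.Iv_1 J_def by (rule L.crit_gap[OF al kK(1)]) (use kK(3) in blast)
  have "\<bar>df x\<bar> \<le> K * \<bar>x - crit f\<bar> powr (\<alpha> - 1)" using kK(3)[of x] x L.bd by auto
  also have "\<dots> \<le> K * J powr (\<alpha> - 1)" using x L.bd al kK(2) unfolding J_def by (intro mult_left_mono powr_mono2) auto
  finally have dfx: "\<bar>df x\<bar> \<le> K * J powr (\<alpha> - 1)" .
  have "\<bar>dpow f df i x\<bar> * (k0 * (J / 2) powr \<alpha>) = \<bar>df x\<bar> * (\<bar>dpow f df n (f x)\<bar> * (k0 * (J / 2) powr \<alpha>))"
   unfolding n(1) dpow_Suc_shift by (simp add: abs_mult mult_ac)
  also have "\<dots> \<le> \<bar>df x\<bar> * (\<bar>dpow f df n (f x)\<bar> * (L.Hi 1 - L.Lo 1))" using I1 by (intro mult_left_mono) simp_all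
  also have "\<dots> \<le> (K * J powr (\<alpha> - 1)) * (E * (L.Hi i - L.Lo i))"
   by (rule mult_mono[OF dfx ko]) (use kK(2) L.Iv(2)[of 1] in simp_all)
  finally have "\<bar>dpow f df i x\<bar> * (k0 * (J / 2) powr \<alpha>) \<le> (K * J powr (\<alpha> - 1)) * (E * (L.Hi i - L.Lo i))" .
  moreover have "(J / 2) powr \<alpha> = J * J powr (\<alpha> - 1) / 2 powr \<alpha>" using J by (simp add: powr_divide powr_diff)
  ultimately have "(\<bar>dpow f df i x\<bar> * J * k0 / 2 powr \<alpha>) * J powr (\<alpha> - 1) \<le> (K * E * (L.Hi i - L.Lo i)) * J powr (\<alpha> - 1)"
   by (simp add: mult_ac)
  then have "\<bar>dpow f df i x\<bar> * J * k0 / 2 powr \<alpha> \<le> K * E * (L.Hi i - L.Lo i)" using J by (simp only: mult_le_cancel_right_pos powr_gt_zero)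
  then show ?thesis unfolding D'_def J_def using kK(1) by (simp add: field_simps)
 qed
 then show ?thesis using D'0 by blast
qed

text \<open>By \<open>kb_iter\<close>, \<open>dpow_bound\<close> and \<open>kb_scale\<close> the
  rescaled constant is at most C (|J|^2 + D^2 S) / 4, where S is the sum of the squares |I_i|^2 over
  1 \<le> i < q. As S is at most \<open>maxlen\<close> times the total length, hence at most 14
  \<open>maxlen\<close>, both terms become small.\<close>

lemma renorm_kb_small:
 assumes e: "0 < e"
 shows "\<exists>n dg. umap \<alpha> ((renorm ^^ n) f) dg (crit ((renorm ^^ n) f)) \<and>
  kb ((renorm ^^ n) f) dg {-1<..<crit ((renorm ^^ n) f)} e \<and> kb ((renorm ^^ n) f) dg {crit ((renorm ^^ n) f)<..<1} e"
proof -
 obtain D where D: "0 < D" "\<And>k i x. 1 \<le> i ==> i < tper f (k + 2) ==> x \<in> {lo f (k + 2)..hi f (k + 2)} ==>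
   \<bar>dpow f df i x\<bar> * (hi f (k + 2) - lo f (k + 2)) \<le> D * (HI (k + 2) i - LO (k + 2) i)"
  using dpow_bound by blast
 obtain \<tau>1 where t1: "0 < \<tau>1" "\<And>k. (1 + \<tau>1) * V (k + 2) \<le> V k" using V_decay by blast
 obtain \<tau>2 where t2: "0 < \<tau>2" "\<And>k. (1 + \<tau>2) * maxlen (k + 2) \<le> maxlen k" using maxlen_decay by blast
 obtain \<rho> where rho: "0 < \<rho>" "\<And>k i. 1 \<le> k ==> -1 + \<rho> \<le> LO k i \<and> HI k i \<le> 1 - \<rho>" using gap_exists by blast
 obtain k0 K where kK: "0 < k0" "0 < K" "\<And>x. x \<in> {-1..1} ==> \<bar>df x\<bar> \<le> K * \<bar>x - crit f\<bar> powr (\<alpha> - 1) \<and> k0 * \<bar>x - crit f\<bar> powr \<alpha> \<le> f (crit f) - f x"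
  using umap_global(2)[OF u al] by blast
 \<comment> \<open>Chosen so that |J| / 2 < \<eta> makes the term C |J|^2 / 4 at most e / 2.\<close>
 define \<eta> where "\<eta> = sqrt (e / (2 * (C + 1)))"
 have eta: "0 < \<eta>" "C * \<eta>\<^sup>2 \<le> e / 2" unfolding \<eta>_def using e C0 by (auto simp: field_simps)
 have "\<forall>\<^sub>F n in sequentially. V (2 * n) < k0 * \<eta> powr \<alpha>"
  by (rule geometric_decay_small[where x = V, OF t1]) (use kK eta in simp)
 moreover have "\<forall>\<^sub>F n in sequentially. maxlen (2 * n) < e / (C * D\<^sup>2 * 14 + 1)"
  by (rule geometric_decay_small[where x = maxlen, OF t2]) (use e C0 D in \<open>simp add: add_nonneg_pos\<close>)
 ultimately have "\<forall>\<^sub>F n in sequentially. 1 \<le> n \<and> V (2 * n) < k0 * \<eta> powr \<alpha> \<and> maxlen (2 * n) < e / (C * D\<^sup>2 * 14 + 1)"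
  using eventually_ge_at_top[of 1] by eventually_elim simp
 then obtain n' where n': "1 \<le> n'" "V (2 * n') < k0 * \<eta> powr \<alpha>" "maxlen (2 * n') < e / (C * D\<^sup>2 * 14 + 1)"
  using eventually_happens' by (metis (no_types, lifting) sequentially_bot)
 define k where "k = 2 * n' - 2"
 define n where "n = k + 2"
 have n: "n = 2 * n'" "1 \<le> n" unfolding n_def k_def using n'(1) by auto
 interpret L: lvl \<alpha> f df "crit f" "tper f n" "lo f n" "hi f n" C by (rule lvl_k)
 define J where "J = hi f n - lo f n"
 have J: "0 < J" using L.bd unfolding J_def by simp
 define M where "M i = (if i = 0 then 1 else D * (L.Hi i - L.Lo i) / J)" for i :: nat
 define q where "q = tper f n"
 have Mb: "\<bar>dpow f df i x\<bar> \<le> M i" if i: "i < q" and x: "x \<in> {lo f n..hi f n}" for i x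
 proof (cases "i = 0")
  case True then show ?thesis unfolding M_def dpow_def by simp
 next
  case False
  then have "\<bar>dpow f df i x\<bar> * J \<le> D * (L.Hi i - L.Lo i)" using D(2)[of i k x] i x unfolding q_def J_def n_def by simp
  then show ?thesis using False J unfolding M_def by (simp add: le_divide_eq)
 qed
 have op: "-1 < L.Lo i \<and> L.Hi i < 1" for i using rho(2)[OF n(2), of i] rho(1) by auto
 define Kq where "Kq = C * (\<Sum>i<q. (M i)\<^sup>2)"
 have k1: "kb (f ^^ tper f n) (dpow f df (tper f n)) {lo f n<..<crit f} Kq"
  unfolding Kq_def q_def by (rule L.kb_iter[THEN conjunct1]) (use Mb op in \<open>auto simp: q_def\<close>)
 have k2: "kb (f ^^ tper f n) (dpow f df (tper f n)) {crit f<..<hi f n} Kq"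
  unfolding Kq_def q_def by (rule L.kb_iter[THEN conjunct1]) (use Mb op in \<open>auto simp: q_def\<close>)
 obtain dg where dg: "umap \<alpha> ((renorm ^^ n) f) dg (crit ((renorm ^^ n) f))" using inf_base_umap(1)[OF inf_base_pow[OF base]] by blast
 have le: "Kq * (J / 2)\<^sup>2 \<le> e"
 proof -
  obtain s t where ch: "L.chain 1 q s t" and m: "card (L.meets (s q) (t q)) \<le> 3"
   using return_space unfolding n_def q_def by blast
  have "(\<Sum>i\<in>{1..<q}. L.Hi i - L.Lo i) \<le> (\<Sum>i\<in>{1..<q}. t i - s i)"
  proof (rule sum_mono)
   fix i assume "i \<in> {1..<q}"
   then have i: "1 \<le> i" "i \<le> q" by auto
   show "L.Hi i - L.Lo i \<le> t i - s i" using L.chainD(2,3)[OF ch i(1,2)] by simp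
  qed
  also have "\<dots> \<le> (\<Sum>i\<in>{1..q}. t i - s i)"
  proof (rule sum_mono2)
   fix i assume "i \<in> {1..q} - {1..<q}"
   then have i: "1 \<le> i" "i \<le> q" by auto
   show "0 \<le> t i - s i" using L.chainD(5)[OF ch i] by simp
  qed auto
  also have "\<dots> \<le> 14" using L.chain_sum[OF ch _ m] unfolding q_def by simp
  finally have s14: "(\<Sum>i\<in>{1..<q}. L.Hi i - L.Lo i) \<le> 14" .
  have ml: "L.Hi i - L.Lo i \<le> maxlen n" if "i \<in> {1..<q}" for i using maxlen_ge[of i n] that unfolding q_def by simp
  have Msum: "(\<Sum>i<q. (M i)\<^sup>2) * J\<^sup>2 = J\<^sup>2 + (\<Sum>i\<in>{1..<q}. D\<^sup>2 * (L.Hi i - L.Lo i)\<^sup>2)"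
  proof -
   have "{..<q} = insert 0 {1..<q}" using L.q0 unfolding q_def by auto
   then have "(\<Sum>i<q. (M i)\<^sup>2) * J\<^sup>2 = J\<^sup>2 + (\<Sum>i\<in>{1..<q}. (M i)\<^sup>2 * J\<^sup>2)"
    by (simp add: M_def distrib_right sum_distrib_right)
   also have "(\<Sum>i\<in>{1..<q}. (M i)\<^sup>2 * J\<^sup>2) = (\<Sum>i\<in>{1..<q}. D\<^sup>2 * (L.Hi i - L.Lo i)\<^sup>2)"
    using J by (intro sum.cong) (auto simp: M_def power_divide power_mult_distrib)
   finally show ?thesis .
  qed
  have "(\<Sum>i\<in>{1..<q}. D\<^sup>2 * (L.Hi i - L.Lo i)\<^sup>2) \<le> (\<Sum>i\<in>{1..<q}. D\<^sup>2 * maxlen n * (L.Hi i - L.Lo i))"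
  proof (rule sum_mono)
   fix i assume i: "i \<in> {1..<q}"
   have "(L.Hi i - L.Lo i) * (L.Hi i - L.Lo i) \<le> maxlen n * (L.Hi i - L.Lo i)" using ml[OF i] L.Iv(2)[of i] by (intro mult_right_mono) simp_all
   then have "D\<^sup>2 * ((L.Hi i - L.Lo i) * (L.Hi i - L.Lo i)) \<le> D\<^sup>2 * (maxlen n * (L.Hi i - L.Lo i))" by (intro mult_left_mono) simp_all
   then show "D\<^sup>2 * (L.Hi i - L.Lo i)\<^sup>2 \<le> D\<^sup>2 * maxlen n * (L.Hi i - L.Lo i)" by (simp add: power2_eq_square mult.assoc)
  qed
  also have "\<dots> \<le> D\<^sup>2 * maxlen n * 14"
   unfolding sum_distrib_left[symmetric] using s14 maxlen_pos[of n] by (intro mult_left_mono) simp_all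
  finally have "(\<Sum>i<q. (M i)\<^sup>2) * J\<^sup>2 \<le> J\<^sup>2 + D\<^sup>2 * maxlen n * 14" unfolding Msum by simp
  then have "C * ((\<Sum>i<q. (M i)\<^sup>2) * J\<^sup>2) \<le> C * (J\<^sup>2 + D\<^sup>2 * maxlen n * 14)" using C0 by (rule mult_left_mono)
  then have a: "Kq * J\<^sup>2 \<le> C * J\<^sup>2 + C * D\<^sup>2 * 14 * maxlen n" unfolding Kq_def by (simp add: algebra_simps)
  have "C * D\<^sup>2 * 14 * maxlen n \<le> (C * D\<^sup>2 * 14 + 1) * maxlen n" using maxlen_pos[of n] by (simp add: distrib_right)
  also have "\<dots> \<le> e" using n'(3) C0 unfolding n(1)[symmetric]
   by (simp add: less_divide_eq add_nonneg_pos mult.commute)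
  finally have b: "C * D\<^sup>2 * 14 * maxlen n \<le> e" .
  have "k0 * (J / 2) powr \<alpha> \<le> V n"
   unfolding V_def J_def by (rule L.crit_gap[OF al kK(1)]) (use kK(3) in blast)
  then have "k0 * (J / 2) powr \<alpha> < k0 * \<eta> powr \<alpha>" using n'(2) unfolding n(1) by simp
  then have "(J / 2) powr \<alpha> < \<eta> powr \<alpha>" using kK(1) by simp
  then have "J / 2 < \<eta>" using powr_mono2[of \<alpha> \<eta> "J / 2"] al eta(1) by (meson less_imp_le not_le order_trans zero_less_one)
  then have "(J / 2)\<^sup>2 \<le> \<eta>\<^sup>2" using J by (intro power_mono) simp_all
  then have "C * (J / 2)\<^sup>2 \<le> e / 2" using eta(2) C0 by (meson mult_left_mono order_trans)
  then have "C * J\<^sup>2 \<le> 2 * e" by (simp add: power_divide)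
  moreover have "Kq * (J / 2)\<^sup>2 = Kq * J\<^sup>2 / 4" by (simp add: power_divide)
  ultimately show ?thesis using a b e by linarith
 qed
 have "kb ((renorm ^^ n) f) dg {-1<..<crit ((renorm ^^ n) f)} e" "kb ((renorm ^^ n) f) dg {crit ((renorm ^^ n) f)<..<1} e"
  using kb_scale[OF base u dg k1 k2] le unfolding J_def by (auto intro: kb_mono)
 then show ?thesis using dg by blast
qed

end

text \<open>For a suitable deep renormalization g, \<open>phase1\<close> applies with \<theta> = 1
  at deep even levels. There \<open>crit_gap\<close> turns the decay of V into one of lengths by an
  \<alpha>-th root, and \<open>level_length_add\<close> transfers it from g to f; the dependence on
  f is confined to A.\<close>

theorem real_bounds:
 assumes al: "1 < \<alpha>" and base: "inf_base \<alpha> f"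
 shows "\<exists>A. \<forall>k. hi f k - lo f k \<le> A * ((6 / 7) powr (1 / (2 * \<alpha>))) ^ k"
proof -
 define lam where "lam = (6 / 7 :: real) powr (1 / (2 * \<alpha>))"
 have lam: "0 < lam" "lam < 1" unfolding lam_def using al powr_less_mono2[of "1 / (2 * \<alpha>)" "6 / 7" 1] by simp_all
 obtain df where u: "umap \<alpha> f df (crit f)" using inf_base_umap(1)[OF base] by blast
 obtain C where C: "0 \<le> C" "kb f df {-1<..<crit f} C" "kb f df {crit f<..<1} C" using umap_global(1)[OF u al] by blast
 interpret F: rb \<alpha> f df C by unfold_locales (use base al u C in auto)
 \<comment> \<open>With this constant a chain distorts cross ratios by a factor of at most
   2.\<close>
 define C1 where "C1 = ln 2 / (28 :: real)"
 have C1: "0 < C1" "exp (28 * C1) = 2" unfolding C1_def by simp_all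
 obtain n dg where dg: "umap \<alpha> ((renorm ^^ n) f) dg (crit ((renorm ^^ n) f))"
  "kb ((renorm ^^ n) f) dg {-1<..<crit ((renorm ^^ n) f)} C1" "kb ((renorm ^^ n) f) dg {crit ((renorm ^^ n) f)<..<1} C1"
  using F.renorm_kb_small[OF C1(1)] by blast
 define g where "g = (renorm ^^ n) f"
 have bg: "inf_base \<alpha> g" using inf_base_pow[OF base] unfolding g_def .
 interpret G: rb \<alpha> g dg C1 by unfold_locales (use bg al dg C1 in \<open>auto simp: g_def\<close>)
 obtain \<rho> where rho: "0 < \<rho>" "\<And>k i. 1 \<le> k ==> -1 + \<rho> \<le> G.LO k i \<and> G.HI k i \<le> 1 - \<rho>" using G.gap_exists by blast
 obtain \<tau>2 where t2: "0 < \<tau>2" "\<And>k. (1 + \<tau>2) * G.maxlen (k + 2) \<le> G.maxlen k" using G.maxlen_decay by blast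
 obtain k1 where k1: "\<And>j. k1 \<le> j ==> G.maxlen (2 * j) < \<rho>"
  using geometric_decay_small[where x = G.maxlen, OF t2 rho(1)] unfolding eventually_sequentially by blast
 \<comment> \<open>Only even levels are treated, because \<open>geometric_decay_small\<close>
   controls \<open>maxlen\<close> along them; nesting recovers the others at the end.\<close>
 have dec: "(1 + 1 / 6) * G.V (2 * k1 + (k + 2)) \<le> G.V (2 * k1 + k)" if ev: "even k" for k
 proof -
  define l where "l = 2 * k1 + k"
  obtain j where j: "k = 2 * j" using ev by (elim evenE)
  interpret L: lvl \<alpha> g dg "crit g" "tper g (l + 2)" "lo g (l + 2)" "hi g (l + 2)" C1 by (rule G.lvl_k)
  have "L.Hi 1 - L.Lo 1 \<le> G.maxlen (l + 2)" using L.q0 by (intro G.maxlen_ge) auto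
  moreover have "l + 2 = 2 * (k1 + j + 1)" unfolding l_def j by simp
  ultimately have "L.Hi 1 - L.Lo 1 \<le> 1 * \<rho>" using k1[of "k1 + j + 1"] by simp
  then have sm: "\<exists>i. 1 \<le> i \<and> i \<le> tper g (l + 2) \<and> L.Hi i - L.Lo i \<le> 1 * \<rho>" using L.q0 by (intro exI[of _ 1]) auto
  obtain s :: "nat \<Rightarrow> real" where s: "G.V (l + 2) \<le> exp (28 * C1) * (1\<^sup>2 + 2 * 1) * (g (lo g (l + 2)) - s 1)" "g (crit g) - s 1 \<le> G.V l"
   using G.phase1[OF rho order_refl sm] by blast
  then show ?thesis unfolding l_def[symmetric] C1(2) unfolding G.V_def l_def by (simp add: add.assoc)
 qed
 have V0: "G.V (2 * k1 + 2 * i) \<le> G.V (2 * k1) * (6 / 7) ^ i" for i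
 proof (induction i)
  case (Suc i)
  have "G.V (2 * k1 + 2 * Suc i) \<le> G.V (2 * k1 + 2 * i) * (6 / 7)" using dec[of "2 * i"] by simp
  then show ?case using Suc by simp
 qed simp
 obtain k0 K where kK: "0 < k0" "0 < K" "\<And>x. x \<in> {-1..1} ==> \<bar>dg x\<bar> \<le> K * \<bar>x - crit g\<bar> powr (\<alpha> - 1) \<and> k0 * \<bar>x - crit g\<bar> powr \<alpha> \<le> g (crit g) - g x"
  using umap_global(2)[OF G.u al] by blast
 define B where "B = 2 * (G.V (2 * k1) / k0) powr (1 / \<alpha>)"
 have B0: "0 \<le> B" unfolding B_def by simp
 have len: "hi g (2 * k1 + 2 * i) - lo g (2 * k1 + 2 * i) \<le> B * lam ^ (2 * i)" for i
 proof -
  interpret L: lvl \<alpha> g dg "crit g" "tper g (2 * k1 + 2 * i)" "lo g (2 * k1 + 2 * i)" "hi g (2 * k1 + 2 * i)" C1 by (rule G.lvl_k)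
  define J where "J = hi g (2 * k1 + 2 * i) - lo g (2 * k1 + 2 * i)"
  have J: "0 < J" using L.bd unfolding J_def by simp
  have "k0 * (J / 2) powr \<alpha> \<le> G.V (2 * k1 + 2 * i)"
   unfolding G.V_def J_def by (rule L.crit_gap[OF al kK(1)]) (use kK(3) in blast)
  then have "k0 * (J / 2) powr \<alpha> \<le> G.V (2 * k1) * (6 / 7) ^ i" using V0[of i] by (rule order_trans)
  then have "(J / 2) powr \<alpha> \<le> G.V (2 * k1) * (6 / 7) ^ i / k0" using kK(1) by (simp only: le_divide_eq if_True mult.commute[of k0])
  then have "(J / 2) powr \<alpha> \<le> G.V (2 * k1) / k0 * (6 / 7) ^ i" by simp
  then have "((J / 2) powr \<alpha>) powr (1 / \<alpha>) \<le> (G.V (2 * k1) / k0 * (6 / 7) ^ i) powr (1 / \<alpha>)"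
   using al by (intro powr_mono2) auto
  moreover have "((J / 2) powr \<alpha>) powr (1 / \<alpha>) = J / 2" using J al by (simp add: powr_powr)
  moreover have "((6 / 7 :: real) ^ i) powr (1 / \<alpha>) = lam ^ (2 * i)"
   unfolding lam_def using al by (simp add: powr_realpow[symmetric] powr_powr)
  moreover have "(G.V (2 * k1) / k0 * (6 / 7) ^ i) powr (1 / \<alpha>) = (G.V (2 * k1) / k0) powr (1 / \<alpha>) * ((6 / 7) ^ i) powr (1 / \<alpha>)"
   by (rule powr_mult)
  ultimately show ?thesis unfolding B_def J_def by simp
 qed
 define N where "N = n + 2 * k1"
 have sz: "hi f k - lo f k \<le> 2" for k
  using scale_range(1)[OF base, of "-1" k] scale_range(1)[OF base, of 1 k] unfolding hi_def lo_def by auto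
 \<comment> \<open>The denominator covers the levels below N, where lengths are at most 2, and the
   levels of the other parity, which are compared with their predecessors.\<close>
 have "hi f k - lo f k \<le> ((B + 2) / lam ^ (N + 1)) * lam ^ k" for k
 proof (cases "k < N")
  case True
  have "2 = 2 / lam ^ N * lam ^ N" using lam by simp
  also have "\<dots> \<le> (B + 2) / lam ^ (N + 1) * lam ^ k"
  proof (intro mult_mono frac_le)
   show "lam ^ N \<le> lam ^ k" using True lam by (intro power_decreasing) auto
   show "lam ^ (N + 1) \<le> lam ^ N" using lam by (intro power_decreasing) auto
  qed (use B0 lam in auto)
  finally show ?thesis using sz[of k] by simp
 next
  case False
  define i where "i = (k - N) div 2"
  have i: "N + 2 * i \<le> k" "k \<le> N + 1 + 2 * i" using False unfolding i_def by auto
  have "hi f k - lo f k \<le> hi f (N + 2 * i) - lo f (N + 2 * i)" using level_nested_le[OF base i(1)] by simp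
  also have "\<dots> = (hi f n - lo f n) / 2 * (hi g (2 * k1 + 2 * i) - lo g (2 * k1 + 2 * i))"
   using level_length_add[OF base, of n "2 * k1 + 2 * i"] unfolding N_def g_def by (simp add: add.assoc)
  also have "\<dots> \<le> 1 * (B * lam ^ (2 * i))"
  proof (rule mult_mono)
   have "lo g (2 * k1 + 2 * i) \<le> hi g (2 * k1 + 2 * i)" unfolding lo_def hi_def by simp
   then show "0 \<le> hi g (2 * k1 + 2 * i) - lo g (2 * k1 + 2 * i)" by simp
  qed (use sz[of n] len in auto)
  also have "\<dots> \<le> (B + 2) * (lam ^ k / lam ^ (N + 1))"
  proof -
   have "lam ^ (N + 1 + 2 * i) \<le> lam ^ k" using i(2) lam by (intro power_decreasing) auto
   then have "lam ^ (2 * i) \<le> lam ^ k / lam ^ (N + 1)" using lam by (simp add: le_divide_eq power_add mult_ac)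
   then have "B * lam ^ (2 * i) \<le> (B + 2) * (lam ^ k / lam ^ (N + 1))" using B0 lam by (intro mult_mono) simp_all
   then show ?thesis by simp
  qed
  finally show ?thesis by (simp add: mult.commute)
 qed
 then show ?thesis unfolding lam_def by blast
qed

section \<open>Real-symmetric holomorphic maps\<close>

lemma mem_nbhd: "z \<in> nbhd r K \<longleftrightarrow> (\<exists>x\<in>K. cmod (z - of_real x) < r)"
 unfolding nbhd_def by (auto simp: dist_norm norm_minus_commute)

lemma open_nbhd: "open (nbhd r K)"
 unfolding nbhd_def by auto

lemma of_real_nbhd: "x \<in> K ==> 0 < r ==> of_real x \<in> nbhd r K"
 unfolding mem_nbhd by force

lemma nbhd_mono: "r \<le> s ==> nbhd r K \<subseteq> nbhd s K"
 unfolding nbhd_def by force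

lemma closed_nbhd_compact:
 assumes K: "compact K" and rs: "r < s"
 shows "\<exists>L. compact L \<and> nbhd r K \<subseteq> L \<and> L \<subseteq> nbhd s K"
proof -
 define L where "L = {x + y |x y. x \<in> complex_of_real ` K \<and> y \<in> cball 0 r}"
 have "compact (complex_of_real ` K)" using K by (intro compact_continuous_image) (auto intro: continuous_intros)
 then have "compact L" unfolding L_def by (rule compact_sums) simp
 moreover have "nbhd r K \<subseteq> L"
 proof
  fix z assume "z \<in> nbhd r K"
  then obtain x where "x \<in> K" "cmod (z - of_real x) < r" unfolding mem_nbhd by blast
  then have "z = of_real x + (z - of_real x)" "of_real x \<in> complex_of_real ` K" "z - of_real x \<in> cball 0 r" by auto
  then show "z \<in> L" unfolding L_def by blast
 qed
 moreover have "L \<subseteq> nbhd s K"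
 proof
  fix z assume "z \<in> L"
  then obtain x y where "x \<in> K" "cmod y \<le> r" "z = of_real x + y" unfolding L_def by auto
  then show "z \<in> nbhd s K" unfolding mem_nbhd using rs by (intro bexI[of _ x]) auto
 qed
 ultimately show ?thesis by blast
qed

lemma closure_nbhd_subset: "compact K ==> r < s ==> closure (nbhd r K) \<subseteq> nbhd s K"
 by (meson closed_nbhd_compact closure_minimal compact_imp_closed order_trans)

lemma open_contains_nbhd:
 assumes "compact K" "open U" "complex_of_real ` K \<subseteq> U"
 shows "\<exists>e>0. nbhd e K \<subseteq> U"
proof -
 have "compact (complex_of_real ` K)" using assms(1) by (intro compact_continuous_image) (auto intro: continuous_intros)
 then obtain e where "0 < e" "(\<Union>x\<in>complex_of_real ` K. ball x e) \<subseteq> U"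
  using compact_subset_open_imp_ball_epsilon_subset[OF _ assms(2,3)] by blast
 then show ?thesis unfolding nbhd_def by (intro exI[of _ e]) auto
qed

lemma sym_real:
 assumes "F (cnj (of_real x)) = cnj (F (of_real x))"
 shows "F (of_real x) = of_real (real_trace F x)"
proof -
 have "cnj (F (of_real x)) = F (of_real x)" using assms by simp
 then have "Im (F (of_real x)) = 0" by (simp add: complex_eq_iff)
 then show ?thesis unfolding real_trace_def by (simp add: complex_eq_iff)
qed

lemma re_deriv:
 assumes "(F has_field_derivative D) (at (complex_of_real x))"
 shows "((\<lambda>t. Re (F (of_real t))) has_real_derivative Re D) (at x)"
proof -
 have "(complex_of_real has_vector_derivative 1) (at x)"
  using has_vector_derivative_of_real[OF DERIV_ident, where 'a = complex] by simp
 with assms have "((F \<circ> complex_of_real) has_vector_derivative 1 * D) (at x)"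
  by (intro field_vector_diff_chain_at) auto
 then have "((\<lambda>t. F (of_real t)) has_vector_derivative D) (at x)" by (simp add: o_def)
 from bounded_linear.has_vector_derivative[OF bounded_linear_Re this] show ?thesis
  by (simp add: has_real_derivative_iff_has_vector_derivative)
qed

text \<open>Im F vanishes along the real axis, and its derivative in the real direction is the
  imaginary part of F'.\<close>

lemma sym_deriv:
 assumes F: "F holomorphic_on \<Omega>" "open \<Omega>" and sym: "\<And>z. z \<in> \<Omega> ==> F (cnj z) = cnj (F z)" and x: "of_real x \<in> \<Omega>"
 shows "deriv F (of_real x) = of_real (Re (deriv F (of_real x)))"
  "(real_trace F has_real_derivative Re (deriv F (of_real x))) (at x)"
proof -
 define D where "D = deriv F (of_real x)"
 have "(F has_field_derivative D) (at (of_real x))" unfolding D_def by (rule holomorphic_derivI[OF F x])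
 note re = re_deriv[OF this] and im0 = re_deriv[OF DERIV_cmult[OF this, of "- \<i>"]]
 have im: "((\<lambda>t. Im (F (of_real t))) has_real_derivative Im D) (at x)" using im0 by simp
 obtain e where e: "0 < e" "ball (complex_of_real x) e \<subseteq> \<Omega>" using F(2) x open_contains_ball by blast
 have "((\<lambda>t. Im (F (of_real t))) has_real_derivative 0) (at x)"
 proof (rule has_field_derivative_transform_within_open[where S = "ball x e"])
  fix t assume "t \<in> ball x e"
  then have "of_real t \<in> ball (complex_of_real x) e" by (simp add: dist_norm) (metis norm_of_real of_real_diff)
  then have "F (cnj (of_real t)) = cnj (F (of_real t))" using sym e(2) by blast
  then have "F (of_real t) = of_real (real_trace F t)" by (rule sym_real)
  then show "0 = Im (F (of_real t))" by simp
 qed (use e in auto)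
 then have "Im D = 0" using im DERIV_unique by blast
 then show "deriv F (of_real x) = of_real (Re (deriv F (of_real x)))" unfolding D_def by (simp add: complex_eq_iff)
 show "(real_trace F has_real_derivative Re (deriv F (of_real x))) (at x)"
  using re unfolding D_def real_trace_def[abs_def] .
qed

text \<open>A continuous derivative without zeros has constant sign, and the growth from a to b
  decides which.\<close>

lemma deriv_pos:
 fixes u d :: "real \<Rightarrow> real"
 assumes ab: "a < b" and d: "\<And>x. x \<in> {a..b} ==> DERIV u x :> d x" and c: "continuous_on {a..b} d"
  and n: "\<And>x. x \<in> {a..b} ==> d x \<noteq> 0" and u: "u a < u b" and x: "x \<in> {a..b}"
 shows "0 < d x"
proof (rule ccontr)
 assume neg: "\<not> 0 < d x"
 obtain z where z: "a < z" "z < b" "u b - u a = (b - a) * d z" using MVT2[OF ab, of u d] d by auto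
 then have dz: "0 < d z" using ab u by (metis diff_gt_0_iff_gt zero_less_mult_pos)
 have "connected (d ` {a..b})" using c by (intro connected_continuous_image) auto
 moreover have "d x \<in> d ` {a..b}" "d z \<in> d ` {a..b}" using x z by auto
 ultimately have "0 \<in> d ` {a..b}" using neg dz by (meson connectedD_interval less_imp_le not_le)
 then show False using n by auto
qed

lemma deriv_real_cont:
 assumes F: "F holomorphic_on \<Omega>" "open \<Omega>" and x: "complex_of_real ` S \<subseteq> \<Omega>"
 shows "continuous_on S (\<lambda>x. Re (deriv F (of_real x)))"
proof -
 have "continuous_on \<Omega> (deriv F)" using F by (intro holomorphic_on_imp_continuous_on holomorphic_deriv)
 then have "continuous_on S (\<lambda>x. deriv F (of_real x))"
  by (rule continuous_on_compose2[where f = complex_of_real]) (use x in \<open>auto intro: continuous_on_of_real\<close>)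
 then show ?thesis by (rule continuous_on_Re)
qed

section \<open>Elements of \<open>Phi r\<close> on the real axis\<close>

lemma PhiD:
 assumes "\<phi> \<in> Phi r"
 shows "\<phi> holomorphic_on nbhd r {-1..1}" "z \<in> nbhd r {-1..1} ==> \<phi> (cnj z) = cnj (\<phi> z)"
  "\<phi> (-1) = -1" "\<phi> 1 = 1" "univalent_near (nbhd r {-1..1}) {-1..1} \<phi>"
 using assms unfolding Phi_def BR_def by blast+

context
 fixes \<phi> :: "complex \<Rightarrow> complex" and r :: real
 assumes phi: "\<phi> \<in> Phi r" and r: "0 < r"
begin

lemma phi_real: "x \<in> {-1..1} ==> \<phi> (of_real x) = of_real (real_trace \<phi> x)"
 by (intro sym_real PhiD(2)[OF phi] of_real_nbhd r)

lemma phi_trace_ends: "real_trace \<phi> (-1) = -1" "real_trace \<phi> 1 = 1"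
 using PhiD(3,4)[OF phi] unfolding real_trace_def by simp_all

text \<open>Univalence near the interval excludes zeros of the derivative; the values at -1 and 1
  make it positive.\<close>

lemma phi_deriv:
 assumes x: "x \<in> {-1..1}"
 shows "DERIV (real_trace \<phi>) x :> Re (deriv \<phi> (of_real x))" "0 < Re (deriv \<phi> (of_real x))"
proof -
 have in1: "of_real x \<in> nbhd r {-1..1}" if "x \<in> {-1..1}" for x by (rule of_real_nbhd[OF that r])
 have d: "DERIV (real_trace \<phi>) x :> Re (deriv \<phi> (of_real x))" if "x \<in> {-1..1}" for x
  by (rule sym_deriv(2)[OF PhiD(1)[OF phi] open_nbhd PhiD(2)[OF phi] in1[OF that]])
 have im: "deriv \<phi> (of_real x) = of_real (Re (deriv \<phi> (of_real x)))" if "x \<in> {-1..1}" for x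
  by (rule sym_deriv(1)[OF PhiD(1)[OF phi] open_nbhd PhiD(2)[OF phi] in1[OF that]])
 obtain U where U: "open U" "complex_of_real ` {-1..1} \<subseteq> U" "\<phi> holomorphic_on U" "inj_on \<phi> U"
  using PhiD(5)[OF phi] unfolding univalent_near_def by blast
 have nz: "Re (deriv \<phi> (of_real x)) \<noteq> 0" if "x \<in> {-1..1}" for x
 proof -
  have "of_real x \<in> U" using U(2) that by blast
  then have "deriv \<phi> (of_real x) \<noteq> 0" by (rule holomorphic_injective_imp_regular[OF U(3,1,4)])
  then show ?thesis using im[OF that] by (metis of_real_0)
 qed
 show "DERIV (real_trace \<phi>) x :> Re (deriv \<phi> (of_real x))" by (rule d[OF x])
 show "0 < Re (deriv \<phi> (of_real x))"
 proof (rule deriv_pos[where a = "-1" and b = 1 and u = "real_trace \<phi>" and d = "\<lambda>x. Re (deriv \<phi> (of_real x))"])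
  show "continuous_on {-1..1} (\<lambda>x. Re (deriv \<phi> (of_real x)))"
   by (rule deriv_real_cont[OF PhiD(1)[OF phi] open_nbhd]) (use in1 in auto)
 qed (use d nz phi_trace_ends x in auto)
qed

lemma phi_expand: "\<exists>\<mu>>0. \<forall>x\<in>{-1..1}. \<forall>y\<in>{-1..1}. x \<le> y \<longrightarrow> \<mu> * (y - x) \<le> real_trace \<phi> y - real_trace \<phi> x"
proof -
 define d where "d = (\<lambda>x::real. Re (deriv \<phi> (of_real x)))"
 have "continuous_on {-1..1} d" unfolding d_def
  by (rule deriv_real_cont[OF PhiD(1)[OF phi] open_nbhd]) (use of_real_nbhd[OF _ r] in auto)
 then obtain z where z: "z \<in> {-1..1}" "\<And>y. y \<in> {-1..1} ==> d z \<le> d y"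
  using continuous_attains_inf[of "{-1..1::real}" d] by auto
 have "d z * (y - x) \<le> real_trace \<phi> y - real_trace \<phi> x" if xy: "x \<in> {-1..1}" "y \<in> {-1..1}" "x \<le> y" for x y
 proof (cases "x = y")
  case False
  then have "x < y" using xy by simp
  then obtain w where "x < w" "w < y" "real_trace \<phi> y - real_trace \<phi> x = (y - x) * d w"
   using MVT2[of x y "real_trace \<phi>" d] phi_deriv(1) xy unfolding d_def by auto
  then show ?thesis using mult_right_mono[of "d z" "d w" "y - x"] z(2)[of w] xy by (simp add: mult.commute)
 qed simp
 then show ?thesis using phi_deriv(2)[OF z(1)] unfolding d_def by blast
qed

lemma phi_trace_mono: "x \<in> {-1..1} ==> y \<in> {-1..1} ==> x < y ==> real_trace \<phi> x < real_trace \<phi> y"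
proof -
 assume xy: "x \<in> {-1..1}" "y \<in> {-1..1}" "x < y"
 obtain \<mu> where \<mu>: "0 < \<mu>" "\<And>x y. x \<in> {-1..1} ==> y \<in> {-1..1} ==> x \<le> y ==> \<mu> * (y - x) \<le> real_trace \<phi> y - real_trace \<phi> x"
  using phi_expand by blast
 have "0 < \<mu> * (y - x)" using \<mu>(1) xy(3) by simp
 then show ?thesis using \<mu>(2)[of x y] xy by simp
qed

lemma phi_trace_inj: "inj_on (real_trace \<phi>) {-1..1}"
 by (rule linorder_inj_onI') (metis phi_trace_mono less_irrefl)

lemma phi_trace_cont: "continuous_on {-1..1} (real_trace \<phi>)"
 using phi_deriv(1) by (intro DERIV_continuous_on[where D = "\<lambda>x. Re (deriv \<phi> (of_real x))"]) (auto intro: has_field_derivative_at_within)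

lemma phi_trace_image: "real_trace \<phi> ` {-1..1} = {-1..1}"
proof
 show "real_trace \<phi> ` {-1..1} \<subseteq> {-1..1}"
 proof (rule image_subsetI)
  fix x :: real assume x: "x \<in> {-1..1}"
  have "real_trace \<phi> (-1) \<le> real_trace \<phi> x"
   using phi_trace_mono[of "-1" x] x by (cases "x = -1") auto
  moreover have "real_trace \<phi> x \<le> real_trace \<phi> 1"
   using phi_trace_mono[of x 1] x by (cases "x = 1") auto
  ultimately show "real_trace \<phi> x \<in> {-1..1}" unfolding phi_trace_ends by simp
 qed
 show "{-1..1} \<subseteq> real_trace \<phi> ` {-1..1}"
 proof
  fix y :: real assume "y \<in> {-1..1}"
  then obtain x where "-1 \<le> x" "x \<le> 1" "real_trace \<phi> x = y"
   using IVT'[of "real_trace \<phi>" "-1" y 1] phi_trace_cont phi_trace_ends by auto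
  then show "y \<in> real_trace \<phi> ` {-1..1}" by force
 qed
qed

lemma phi_inv: "y \<in> {-1..1} ==> real_inv \<phi> y \<in> {-1..1}" "y \<in> {-1..1} ==> real_trace \<phi> (real_inv \<phi> y) = y"
 "x \<in> {-1..1} ==> real_inv \<phi> (real_trace \<phi> x) = x"
 unfolding real_inv_def
 using inv_into_into[of y "real_trace \<phi>" "{-1..1}"] f_inv_into_f[of y "real_trace \<phi>" "{-1..1}"]
  inv_into_f_f[OF phi_trace_inj, of x] phi_trace_image by auto

text \<open>The second derivative is bounded on a compact set between the neighbourhoods of radius
  r/2 and r, which makes the remainder uniform in the base point a.\<close>

lemma phi_taylor:
 "\<exists>M\<ge>0. \<forall>a\<in>{-1..1}. \<forall>w. cmod (w - of_real a) < r / 2 \<longrightarrow>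
  cmod (\<phi> w - \<phi> (of_real a) - deriv \<phi> (of_real a) * (w - of_real a)) \<le> M * (cmod (w - of_real a))\<^sup>2"
proof -
 let ?N = "nbhd r {-1..1}"
 obtain L where L: "compact L" "nbhd (r / 2) {-1..1} \<subseteq> L" "L \<subseteq> ?N"
  using closed_nbhd_compact[of "{-1..1::real}" "r / 2" r] r by auto
 have "continuous_on ?N (deriv (deriv \<phi>))"
  by (intro holomorphic_on_imp_continuous_on holomorphic_deriv PhiD(1)[OF phi] open_nbhd)
 then have "compact (deriv (deriv \<phi>) ` L)" using L continuous_on_subset compact_continuous_image by blast
 then obtain M where M: "0 < M" "\<And>z. z \<in> L ==> cmod (deriv (deriv \<phi>) z) \<le> M"
  using compact_imp_bounded bounded_pos by (metis imageI)
 have "cmod (\<phi> w - \<phi> (of_real a) - deriv \<phi> (of_real a) * (w - of_real a)) \<le> M * (cmod (w - of_real a))\<^sup>2"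
  if a: "a \<in> {-1..1}" and w: "cmod (w - of_real a) < r / 2" for a w
 proof -
  define B where "B = ball (complex_of_real a) (r / 2)"
  have BN: "B \<subseteq> nbhd (r / 2) {-1..1}" using a unfolding B_def nbhd_def by blast
  have dd: "((deriv ^^ i) \<phi> has_field_derivative (deriv ^^ Suc i) \<phi> z) (at z within B)" if "z \<in> B" for z i
  proof -
   have "(deriv ^^ i) \<phi> holomorphic_on ?N" by (intro holomorphic_higher_deriv PhiD(1)[OF phi] open_nbhd)
   then have "((deriv ^^ i) \<phi> has_field_derivative deriv ((deriv ^^ i) \<phi>) z) (at z)"
    by (rule holomorphic_derivI[OF _ open_nbhd]) (use that BN L in blast)
   then show ?thesis by (simp add: has_field_derivative_at_within)
  qed
  have "cmod ((deriv ^^ 0) \<phi> w - (\<Sum>i\<le>1. (deriv ^^ i) \<phi> (of_real a) * (w - of_real a) ^ i / fact i))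
   \<le> M * cmod (w - of_real a) ^ Suc 1 / fact 1"
  proof (rule complex_Taylor[where S = B])
   show "convex B" unfolding B_def by simp
   show "cmod ((deriv ^^ Suc 1) \<phi> z) \<le> M" if "z \<in> B" for z using M(2)[of z] BN L(2) that by auto
  qed (use dd w r in \<open>auto simp: B_def dist_norm norm_minus_commute\<close>)
  then show ?thesis by (simp add: power2_eq_square algebra_simps)
 qed
 then show ?thesis using M(1) by (meson less_imp_le)
qed

end

section \<open>The skew product\<close>

lemma Rtilde_pow: "(Rtilde ^^ n) (f, \<phi>) = ((renorm ^^ n) f, Fiter n f \<phi>)"
proof (induction n)
 case (Suc n)
 have "(Rtilde ^^ Suc n) (f, \<phi>) = Rtilde ((renorm ^^ n) f, Fiter n f \<phi>)" using Suc by simp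
 then show ?case unfolding Fiter_def by (simp add: Rtilde_def)
qed (simp add: Fiter_def)

lemma Fiter_Suc: "Fiter (Suc n) f \<phi> = Fmap ((renorm ^^ n) f) (Fiter n f \<phi>)"
proof -
 have "(Rtilde ^^ Suc n) (f, \<phi>) = Rtilde ((renorm ^^ n) f, Fiter n f \<phi>)" using Rtilde_pow[of n f \<phi>] by simp
 then show ?thesis unfolding Fiter_def[of "Suc n"] by (simp only:) (simp add: Rtilde_def)
qed

lemma aff_of_real: "aff (of_real p) (of_real q) (of_real x) = complex_of_real (aff p q x)"
 unfolding aff_def by simp

lemma aff_between:
 fixes a b x :: real
 assumes "a \<noteq> b" "min a b \<le> x" "x \<le> max a b"
 shows "aff a b x \<in> {-1..1}"
 using assms unfolding aff_alt by (cases "a < b") (auto simp: field_simps)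

lemma aff_aff:
 fixes p q u v w :: complex
 assumes "v \<noteq> 0" "p \<noteq> q"
 shows "aff p q (aff (u - v) (u + v) w) = aff (u + v * p) (u + v * q) w"
 using assms unfolding aff_alt by (simp add: field_simps)

lemma inv_aff_aff:
 fixes a b a' b' z :: complex
 assumes "a \<noteq> b"
 shows "((b - a) * (((aff a b b' - aff a b a') * z + aff a b a' + aff a b b') / 2) + a + b) / 2 = ((b' - a') * z + a' + b') / 2"
proof -
 have ba: "(b - a) * aff a b x = 2 * x - a - b" for x using assms unfolding aff_alt by simp
 have "(b - a) * (((aff a b b' - aff a b a') * z + aff a b a' + aff a b b') / 2)
  = (((b - a) * aff a b b' - (b - a) * aff a b a') * z + (b - a) * aff a b a' + (b - a) * aff a b b') / 2"
  by (simp add: algebra_simps)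
 also have "\<dots> = (b' - a') * z + a' + b' - a - b" unfolding ba by (simp add: field_simps)
 finally have *: "(b - a) * (((aff a b b' - aff a b a') * z + aff a b a' + aff a b b') / 2) = (b' - a') * z + a' + b' - a - b" .
 show ?thesis unfolding * by (simp add: algebra_simps)
qed

lemma phi_inv_mono:
 assumes phi: "\<phi> \<in> Phi r" "0 < r" and xy: "x \<in> {-1..1}" "y \<in> {-1..1}" "x < y"
 shows "real_inv \<phi> x < real_inv \<phi> y"
proof (rule ccontr)
 assume n: "\<not> real_inv \<phi> x < real_inv \<phi> y"
 have "real_trace \<phi> (real_inv \<phi> y) \<le> real_trace \<phi> (real_inv \<phi> x)"
  using n phi_trace_mono[OF phi phi_inv(1)[OF phi xy(2)] phi_inv(1)[OF phi xy(1)]] by (cases "real_inv \<phi> x = real_inv \<phi> y") auto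
 then show False using phi_inv(2)[OF phi] xy by simp
qed

lemma phi_inv_between:
 assumes phi: "\<phi> \<in> Phi r" "0 < r" and xy: "x \<in> {-1..1}" "y \<in> {-1..1}" "z \<in> {-1..1}" "min x y \<le> z" "z \<le> max x y"
 shows "min (real_inv \<phi> x) (real_inv \<phi> y) \<le> real_inv \<phi> z" "real_inv \<phi> z \<le> max (real_inv \<phi> x) (real_inv \<phi> y)"
proof -
 have le: "real_inv \<phi> s \<le> real_inv \<phi> t" if "s \<in> {-1..1}" "t \<in> {-1..1}" "s \<le> t" for s t
  using phi_inv_mono[OF phi that(1,2)] that(3) by (cases "s = t") auto
 show "min (real_inv \<phi> x) (real_inv \<phi> y) \<le> real_inv \<phi> z" "real_inv \<phi> z \<le> max (real_inv \<phi> x) (real_inv \<phi> y)"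
  using le[of x z] le[of y z] le[of z x] le[of z y] xy by (auto simp: min_def max_def split: if_splits)
qed

text \<open>The affine changes of variable telescope: what remains is \<phi> on the interval from a
  k to b k, which it maps onto the level-k interval, rescaled in source and target.\<close>

lemma Fiter_eq:
 fixes \<phi> :: "complex \<Rightarrow> complex"
 assumes base: "inf_base \<alpha> f" and phi: "\<phi> \<in> Phi r" "0 < r"
 defines "a \<equiv> \<lambda>k. real_inv \<phi> (scale_map f k (-1))" and "b \<equiv> \<lambda>k. real_inv \<phi> (scale_map f k 1)"
 shows "Fiter k f \<phi> z = aff (of_real (scale_map f k (-1))) (of_real (scale_map f k 1))
  (\<phi> (((of_real (b k) - of_real (a k)) * z + of_real (a k) + of_real (b k)) / 2))"
proof (induction k arbitrary: z)
 case 0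
 have "a 0 = -1" "b 0 = 1"
  using phi_inv(3)[OF phi, of "-1"] phi_inv(3)[OF phi, of 1] phi_trace_ends[OF phi] unfolding a_def b_def by simp_all
 then show ?case by (simp add: Fiter_def aff_alt)
next
 case (Suc k)
 define P where "P = scale_map f k (-1)" define Q where "Q = scale_map f k 1"
 obtain u v where uv: "v \<noteq> 0" "\<And>x. scale_map f k x = u + v * x" using scale_affine[OF base] by blast
 have PQ: "P = u - v" "Q = u + v" unfolding P_def Q_def uv(2) by simp_all
 obtain p q where pq: "rescaling_points ((renorm ^^ k) f) = (p, q)" "p \<noteq> q" "-1 < min p q" "max p q < 1"
  using inf_base_structure[OF inf_base_pow[OF base, of k]] by metis
 have pq1: "p \<in> {-1..1}" "q \<in> {-1..1}" using pq(3,4) by auto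
 have S: "scale_map f (Suc k) (-1) = u + v * p" "scale_map f (Suc k) 1 = u + v * q"
  using pq by (simp_all add: uv(2) inv_aff scale_map.simps(2))
 have in1: "P \<in> {-1..1}" "Q \<in> {-1..1}" "u + v * p \<in> {-1..1}" "u + v * q \<in> {-1..1}"
  using scale_range(1)[OF base, of _ k] pq1 unfolding P_def Q_def uv(2)[symmetric] by auto
 have btw: "min P Q \<le> u + v * x \<and> u + v * x \<le> max P Q" if "x \<in> {-1..1}" for x
 proof -
  have "inv (aff P Q) x = u + v * x" using uv(1) by (subst inv_aff) (simp_all add: PQ algebra_simps)
  then show ?thesis using inv_aff_between[of P Q x] that uv(1) PQ by auto
 qed
 have PneQ: "P \<noteq> Q" using uv(1) PQ by simp
 have ab: "a k \<in> {-1..1}" "b k \<in> {-1..1}" "real_trace \<phi> (a k) = P" "real_trace \<phi> (b k) = Q"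
  using phi_inv(1,2)[OF phi in1(1)] phi_inv(1,2)[OF phi in1(2)] unfolding a_def b_def P_def Q_def by simp_all
 have aneb: "a k \<noteq> b k" using ab(3,4) PneQ by auto
 define ph where "ph = Fiter k f \<phi>"
 have ph: "ph z = aff (of_real P) (of_real Q) (\<phi> (((of_real (b k) - of_real (a k)) * z + of_real (a k) + of_real (b k)) / 2))" for z
  unfolding ph_def P_def Q_def by (rule Suc.IH)
 define y where "y x = ((b k - a k) * x + a k + b k) / 2" for x :: real
 have y1: "y x \<in> {-1..1}" if "x \<in> {-1..1}" for x
  using inv_aff_between[OF aneb that] ab(1,2) aneb unfolding y_def by (auto simp: inv_aff)
 have tr: "real_trace ph x = aff P Q (real_trace \<phi> (y x))" if "x \<in> {-1..1}" for x
 proof -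
  have "((of_real (b k) - of_real (a k)) * of_real x + of_real (a k) + of_real (b k)) / 2 = complex_of_real (y x)"
   unfolding y_def by simp
  then have "ph (of_real x) = of_real (aff P Q (real_trace \<phi> (y x)))"
   unfolding ph using phi_real[OF phi y1[OF that]] by (simp only: aff_of_real)
  then show ?thesis unfolding real_trace_def by simp
 qed
 have inj: "inj_on (real_trace ph) {-1..1}"
 proof (rule inj_onI)
  fix s t :: real assume st: "s \<in> {-1..1}" "t \<in> {-1..1}" "real_trace ph s = real_trace ph t"
  then have "real_trace \<phi> (y s) = real_trace \<phi> (y t)" using tr PneQ unfolding aff_alt by simp
  then have "y s = y t" using inj_onD[OF phi_trace_inj[OF phi]] y1 st by blast
  then show "s = t" using aneb unfolding y_def by simp
 qed
 \<comment> \<open>The real preimage under ph of a point s is the preimage under \<phi> of the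
   corresponding point of level k, read in the coordinate with ends a k and b k. This identifies the
   source interval of the next level.\<close>
 have inv: "real_inv ph s = aff (a k) (b k) (real_inv \<phi> (u + v * s))" if s: "s \<in> {-1..1}" for s
 proof -
  define w where "w = real_inv \<phi> (u + v * s)"
  have us: "u + v * s \<in> {-1..1}" using scale_range(1)[OF base s, of k] unfolding uv(2) .
  have "min (a k) (b k) \<le> w" "w \<le> max (a k) (b k)"
   using phi_inv_between[OF phi in1(1,2) us] btw[OF s] unfolding w_def a_def b_def P_def Q_def by blast+
  then have w1: "aff (a k) (b k) w \<in> {-1..1}" by (rule aff_between[OF aneb])
  have "y (aff (a k) (b k) w) = w" unfolding y_def aff_alt using aneb by (simp add: field_simps)
  then have "real_trace ph (aff (a k) (b k) w) = aff P Q (u + v * s)"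
   using tr[OF w1] phi_inv(2)[OF phi us] unfolding w_def by simp
  also have "\<dots> = s" unfolding aff_alt PQ using uv(1) by simp
  finally have "real_trace ph (aff (a k) (b k) w) = s" .
  then show ?thesis unfolding real_inv_def[of ph] w_def[symmetric] by (intro inv_into_f_eq[OF inj w1])
 qed
 have ab': "a (Suc k) = real_inv \<phi> (u + v * p)" "b (Suc k) = real_inv \<phi> (u + v * q)" unfolding a_def b_def S by simp_all
 have ab'ne: "real_inv ph p \<noteq> real_inv ph q"
 proof
  assume "real_inv ph p = real_inv ph q"
  then have "real_inv \<phi> (u + v * p) = real_inv \<phi> (u + v * q)" unfolding inv[OF pq1(1)] inv[OF pq1(2)] aff_alt using aneb by simp
  then have "u + v * p = u + v * q" using phi_inv(2)[OF phi in1(3)] phi_inv(2)[OF phi in1(4)] by metis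
  then show False using uv(1) pq(2) by simp
 qed
 let ?A = "complex_of_real (a k)" let ?B = "complex_of_real (b k)"
 let ?A' = "complex_of_real (a (Suc k))" let ?B' = "complex_of_real (b (Suc k))"
 have ri: "complex_of_real (real_inv ph p) = aff ?A ?B ?A'" "complex_of_real (real_inv ph q) = aff ?A ?B ?B'"
  unfolding inv[OF pq1(1)] inv[OF pq1(2)] ab' aff_of_real by simp_all
 have "Fiter (Suc k) f \<phi> z = aff (of_real p) (of_real q)
  (ph (((of_real (real_inv ph q) - of_real (real_inv ph p)) * z + of_real (real_inv ph p) + of_real (real_inv ph q)) / 2))"
  unfolding Fiter_Suc ph_def[symmetric] Fmap_def pq(1) using ab'ne by (simp add: inv_aff)
 also have "\<dots> = aff (of_real p) (of_real q) (aff (of_real P) (of_real Q) (\<phi> (((?B' - ?A') * z + ?A' + ?B') / 2)))"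
  unfolding ri ph by (subst inv_aff_aff) (use aneb in simp_all)
 also have "\<dots> = aff (of_real (u + v * p)) (of_real (u + v * q)) (\<phi> (((?B' - ?A') * z + ?A' + ?B') / 2))"
  using aff_aff[of "of_real v" "of_real p" "of_real q" "of_real u"] uv(1) pq(2) unfolding PQ by simp
 finally show ?case unfolding S .
qed

text \<open>On the scale d of the source interval \<phi> differs from its linearization by O(d^2).
  Rescaling divides by the length h of the image, which is at least \<mu> d, and leaves O(h); the
  affine part of \<phi> cancels against the rescaling.\<close>

lemma Fiter_close:
 assumes base: "inf_base \<alpha> f" and phi: "\<phi> \<in> Phi r" "0 < r"
 shows "\<exists>E \<delta>. 0 < \<delta> \<and> (\<forall>k. hi f k - lo f k < \<delta> \<longrightarrow>
  (\<forall>z\<in>nbhd r {-1..1}. cmod (Fiter k f \<phi> z - z) \<le> E * (hi f k - lo f k)))"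
proof -
 obtain \<mu> where \<mu>: "0 < \<mu>" "\<And>x y. x \<in> {-1..1} ==> y \<in> {-1..1} ==> x \<le> y ==> \<mu> * (y - x) \<le> real_trace \<phi> y - real_trace \<phi> x"
  using phi_expand[OF phi] by blast
 obtain M where M: "0 \<le> M" "\<And>a w. a \<in> {-1..1} ==> cmod (w - of_real a) < r / 2 ==>
  cmod (\<phi> w - \<phi> (of_real a) - deriv \<phi> (of_real a) * (w - of_real a)) \<le> M * (cmod (w - of_real a))\<^sup>2"
  using phi_taylor[OF phi] by blast
 \<comment> \<open>A bound for |z + 1| / 2 on the r-neighbourhood of [-1,1]. The choice of \<delta>
   below then keeps the rescaled point w within r/2 of a, where the Taylor estimate holds.\<close>
 define T where "T = (r + 2) / 2"
 have T: "1 \<le> T" unfolding T_def using phi(2) by simp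
 define \<delta> where "\<delta> = \<mu> * r / (2 * T)"
 have \<delta>: "0 < \<delta>" unfolding \<delta>_def using \<mu> phi(2) T by simp
 have "cmod (Fiter k f \<phi> z - z) \<le> 2 * M * (T\<^sup>2 + T) / \<mu>\<^sup>2 * (hi f k - lo f k)"
  if small: "hi f k - lo f k < \<delta>" and z: "z \<in> nbhd r {-1..1}" for k z
 proof -
  define P where "P = scale_map f k (-1)" define Q where "Q = scale_map f k 1"
  define a where "a = real_inv \<phi> P" define b where "b = real_inv \<phi> Q"
  have in1: "P \<in> {-1..1}" "Q \<in> {-1..1}" using scale_range(1)[OF base, of _ k] unfolding P_def Q_def by auto
  have ab: "a \<in> {-1..1}" "b \<in> {-1..1}" "real_trace \<phi> a = P" "real_trace \<phi> b = Q"
   using phi_inv(1,2)[OF phi in1(1)] phi_inv(1,2)[OF phi in1(2)] unfolding a_def b_def by simp_all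
  have PQ: "P \<noteq> Q" using scale_inj[OF base, of k "-1" 1] unfolding P_def Q_def by auto
  then have ne: "a \<noteq> b" using ab by auto
  define h where "h = hi f k - lo f k"
  have h: "h = \<bar>Q - P\<bar>" unfolding h_def hi_def lo_def P_def Q_def by auto
  define d where "d = \<bar>b - a\<bar>"
  have d0: "0 < d" unfolding d_def using ne by simp
  have dh: "\<mu> * d \<le> h"
   using \<mu>(2)[of a b] \<mu>(2)[of b a] ab unfolding d_def h by (cases "a \<le> b") auto
  have "\<mu> * d < \<mu> * r / (2 * T)" using dh small unfolding h_def[symmetric] \<delta>_def by simp
  then have "\<mu> * (2 * T * d) < \<mu> * r" using T by (simp add: less_divide_eq mult_ac)
  then have Td: "T * d < r / 2" using \<mu>(1) by simp
  have "1 * d \<le> T * d" using T d0 by (intro mult_right_mono) auto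
  then have d1: "d < r / 2" using Td by simp
  define t where "t = (z + 1) / 2"
  obtain x where x: "x \<in> {-1..1}" "cmod (z - of_real x) < r" using z unfolding mem_nbhd by blast
  have "cmod (z + 1) \<le> cmod (z - of_real x) + cmod (of_real (x + 1))"
   using norm_triangle_ineq[of "z - of_real x" "of_real (x + 1)"] by simp
  also have "cmod (of_real (x + 1)) \<le> 2" unfolding norm_of_real using x by simp
  finally have t: "cmod t \<le> T" unfolding t_def T_def using x by (simp add: norm_divide)
  let ?a = "complex_of_real a" let ?b = "complex_of_real b"
  define w where "w = ((?b - ?a) * z + ?a + ?b) / 2"
  have wa: "w - ?a = (?b - ?a) * t" unfolding w_def t_def by (simp add: field_simps)
  have nba: "cmod (?b - ?a) = d" unfolding d_def by (metis norm_of_real of_real_diff)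
  have nwa: "cmod (w - ?a) \<le> T * d" unfolding wa norm_mult nba using t d0 by (simp add: mult.commute)
  define D where "D = deriv \<phi> ?a"
  \<comment> \<open>Taylor remainders at w and at b, both based at a. In e1 - t e2 the terms with
    the derivative D cancel.\<close>
  define e1 where "e1 = \<phi> w - \<phi> ?a - D * (w - ?a)"
  define e2 where "e2 = \<phi> ?b - \<phi> ?a - D * (?b - ?a)"
  have "cmod e1 \<le> M * (cmod (w - ?a))\<^sup>2" unfolding e1_def D_def by (rule M(2)) (use ab nwa Td in auto)
  also have "\<dots> \<le> M * (T * d)\<^sup>2" using nwa M(1) by (intro mult_left_mono power_mono) auto
  finally have e1: "cmod e1 \<le> M * T\<^sup>2 * d\<^sup>2" by (simp add: power_mult_distrib mult_ac)
  have e2: "cmod e2 \<le> M * d\<^sup>2" unfolding e2_def D_def nba[symmetric] by (rule M(2)) (use ab d1 nba in auto)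
  have ph: "\<phi> ?a = of_real P" "\<phi> ?b = of_real Q" using phi_real[OF phi ab(1)] phi_real[OF phi ab(2)] ab by simp_all
  define q where "q = complex_of_real Q - of_real P"
  have q0: "q \<noteq> 0" "cmod q = h" unfolding q_def h using PQ by (simp, metis norm_of_real of_real_diff)
  have "Fiter k f \<phi> z - z = (2 * \<phi> w - of_real P - of_real Q) / q - z"
   unfolding Fiter_eq[OF base phi] aff_alt w_def a_def b_def P_def Q_def q_def by simp
  also have "\<dots> = (2 * \<phi> w - of_real P - of_real Q - q * z) / q" using q0(1) by (simp add: diff_divide_distrib)
  also have "2 * \<phi> w - of_real P - of_real Q - q * z = 2 * (e1 - t * e2)"
  proof -
   have 1: "e1 = \<phi> w - of_real P - D * ((?b - ?a) * t)" unfolding e1_def ph wa ..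
   have 2: "e2 = q - D * (?b - ?a)" unfolding e2_def ph q_def ..
   have "e1 - t * e2 = \<phi> w - of_real P - t * q" unfolding 1 2 by (simp add: algebra_simps)
   then show ?thesis unfolding t_def q_def by (simp add: field_simps)
  qed
  finally have "cmod (Fiter k f \<phi> z - z) = 2 * cmod (e1 - t * e2) / h" by (simp only: norm_divide norm_mult norm_numeral q0(2))
  moreover have "cmod (e1 - t * e2) \<le> M * T\<^sup>2 * d\<^sup>2 + T * (M * d\<^sup>2)"
  proof -
   have "cmod (e1 - t * e2) \<le> cmod e1 + cmod t * cmod e2" using norm_triangle_ineq4[of e1 "t * e2"] by (simp add: norm_mult)
   moreover have "cmod t * cmod e2 \<le> T * (M * d\<^sup>2)" using t e2 T by (intro mult_mono) auto
   ultimately show ?thesis using e1 by linarith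
  qed
  moreover have h0: "0 < h" unfolding h using PQ by simp
  ultimately have "cmod (Fiter k f \<phi> z - z) \<le> 2 * (M * T\<^sup>2 * d\<^sup>2 + T * (M * d\<^sup>2)) / h" by (simp add: divide_right_mono)
  also have "\<dots> = 2 * M * (T\<^sup>2 + T) * d\<^sup>2 / h" by (simp add: algebra_simps)
  also have "\<dots> \<le> 2 * M * (T\<^sup>2 + T) * (h / \<mu>)\<^sup>2 / h"
  proof -
   have "d \<le> h / \<mu>" using dh \<mu>(1) by (simp add: field_simps)
   then have "d\<^sup>2 \<le> (h / \<mu>)\<^sup>2" using d0 by (intro power_mono) auto
   then show ?thesis using h0 M(1) T by (intro divide_right_mono mult_left_mono) auto
  qed
  also have "\<dots> = 2 * M * (T\<^sup>2 + T) / \<mu>\<^sup>2 * h" using h0 by (simp add: power2_eq_square)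
  finally show ?thesis unfolding h_def .
 qed
 then show ?thesis using \<delta> by blast
qed

lemma A_unimodal_inf_base:
 assumes "f \<in> A_unimodal \<alpha>" "f \<in> inf_renormalizable_maps \<alpha>"
 shows "inf_base \<alpha> f"
proof -
 obtain r \<psi> where p: "\<psi> \<in> B_univ r" "\<And>x. x \<in> {-1..1} ==> f x = j_map \<alpha> \<psi> x"
  using assms(1) unfolding A_unimodal_def by blast
 have "\<psi> (-1) = -1" using p(1) unfolding B_univ_def Btilde_def by blast
 then have "f 1 = -1" "f (-1) = -1" using p(2)[of 1] p(2)[of "-1"] by (simp_all add: j_map_def real_trace_def)
 then show ?thesis using assms(2) unfolding inf_base_def by simp
qed

text \<open>Lengths are bounded by a constant times l^(2k). One factor l^k beats all constants that
  depend on f and \<phi>, so the other one is left with constant 1.\<close>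

theorem Fiter_converges:
 assumes al: "1 < \<alpha>" and base: "inf_base \<alpha> f" and phi: "\<phi> \<in> Phi r" "0 < r"
 shows "\<exists>K. \<forall>k\<ge>K. sup_norm (nbhd r {-1..1}) (\<lambda>z. Fiter k f \<phi> z - z) \<le> ((6 / 7) powr (1 / (4 * \<alpha>))) ^ k"
proof -
 define l where "l = (6 / 7 :: real) powr (1 / (4 * \<alpha>))"
 have l: "0 < l" "l < 1" unfolding l_def using al powr_less_mono2[of "1 / (4 * \<alpha>)" "6 / 7" 1] by simp_all
 have l2: "(6 / 7 :: real) powr (1 / (2 * \<alpha>)) = l * l" unfolding l_def by (simp add: powr_add[symmetric])
 obtain A where A: "\<And>k. hi f k - lo f k \<le> A * (l * l) ^ k" using real_bounds[OF al base] unfolding l2 by blast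
 obtain E \<delta> where E: "0 < \<delta>" "\<And>k z. hi f k - lo f k < \<delta> ==> z \<in> nbhd r {-1..1} ==> cmod (Fiter k f \<phi> z - z) \<le> E * (hi f k - lo f k)"
  using Fiter_close[OF base phi] by blast
 have l0: "(\<lambda>k. l ^ k) \<longlonglongrightarrow> 0" using l by (intro LIMSEQ_power_zero) simp
 have "(\<lambda>k. A * (l ^ k * l ^ k)) \<longlonglongrightarrow> A * (0 * 0)" by (intro tendsto_intros l0)
 then have 1: "\<forall>\<^sub>F k in sequentially. A * (l ^ k * l ^ k) < \<delta>" using E(1) by (intro order_tendstoD(2)) auto
 have "(\<lambda>k. \<bar>E\<bar> * \<bar>A\<bar> * l ^ k) \<longlonglongrightarrow> \<bar>E\<bar> * \<bar>A\<bar> * 0" by (intro tendsto_intros l0)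
 then have 2: "\<forall>\<^sub>F k in sequentially. \<bar>E\<bar> * \<bar>A\<bar> * l ^ k < 1" by (intro order_tendstoD(2)) auto
 have "\<forall>\<^sub>F k in sequentially. sup_norm (nbhd r {-1..1}) (\<lambda>z. Fiter k f \<phi> z - z) \<le> l ^ k"
  using 1 2
 proof eventually_elim
  case (elim k)
  have h: "hi f k - lo f k \<le> A * (l ^ k * l ^ k)" "0 \<le> hi f k - lo f k"
   using A[of k] unfolding lo_def hi_def by (simp_all add: power_mult_distrib)
  have "cmod (Fiter k f \<phi> z - z) \<le> l ^ k" if z: "z \<in> nbhd r {-1..1}" for z
  proof -
   have "cmod (Fiter k f \<phi> z - z) \<le> E * (hi f k - lo f k)" by (rule E(2)[OF _ z]) (use h elim in simp)
   also have "\<dots> \<le> \<bar>E\<bar> * (\<bar>A\<bar> * (l ^ k * l ^ k))"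
   proof (rule mult_mono)
    have "A * (l ^ k * l ^ k) \<le> \<bar>A\<bar> * (l ^ k * l ^ k)" using l by (intro mult_right_mono) auto
    then show "hi f k - lo f k \<le> \<bar>A\<bar> * (l ^ k * l ^ k)" using h by linarith
   qed (use h in auto)
   also have "\<dots> = \<bar>E\<bar> * \<bar>A\<bar> * l ^ k * l ^ k" by simp
   also have "\<dots> \<le> 1 * l ^ k" using elim(2) l by (intro mult_right_mono) auto
   finally show ?thesis by simp
  qed
  then show ?case unfolding sup_norm_def
   using of_real_nbhd[of "0::real" "{-1..1}" r] phi(2) by (intro cSUP_least) auto
 qed
 then show ?thesis unfolding l_def eventually_sequentially .
qed

section \<open>Real-analytic germs\<close>

text \<open>The set \<open>S\<close> need not be a neighbourhood of \<open>x\<close>: this covers the endpoints of \<open>[-1,1]\<close>.\<close>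

definition germ_ext :: "(real \<Rightarrow> real) \<Rightarrow> real set \<Rightarrow> real \<Rightarrow> (complex \<Rightarrow> complex) \<Rightarrow> real \<Rightarrow> bool" where
 "germ_ext u S x F e \<longleftrightarrow> 0 < e \<and> F holomorphic_on ball (of_real x) e \<and>
  (\<forall>z\<in>ball (of_real x) e. F (cnj z) = cnj (F z)) \<and> deriv F (of_real x) \<noteq> 0 \<and>
  (\<forall>y\<in>S. \<bar>y - x\<bar> < e \<longrightarrow> F (of_real y) = of_real (u y))"

definition germ :: "(real \<Rightarrow> real) \<Rightarrow> real set \<Rightarrow> real \<Rightarrow> bool" where
 "germ u S x \<longleftrightarrow> (\<exists>F e. germ_ext u S x F e)"

lemma germ_extD:
 assumes "germ_ext u S x F e"
 shows "0 < e" "F holomorphic_on ball (of_real x) e" "z \<in> ball (of_real x) e ==> F (cnj z) = cnj (F z)"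
  "deriv F (of_real x) \<noteq> 0" "y \<in> S ==> \<bar>y - x\<bar> < e ==> F (of_real y) = of_real (u y)"
 using assms unfolding germ_ext_def by blast+

lemma of_real_ball: "of_real y \<in> ball (complex_of_real x) e \<longleftrightarrow> \<bar>y - x\<bar> < e"
 by (simp only: mem_ball dist_of_real dist_real_def abs_minus_commute[of x])

lemma cnj_ball: "z \<in> ball (complex_of_real x) e ==> cnj z \<in> ball (complex_of_real x) e"
proof -
 have "cmod (cnj (complex_of_real x - z)) = cmod (complex_of_real x - z)" by (rule complex_mod_cnj)
 then show "z \<in> ball (complex_of_real x) e ==> cnj z \<in> ball (complex_of_real x) e" by (simp add: dist_norm)
qed

lemma germ_ext_shrink:
 assumes "germ_ext u S x F e" "0 < d" "d \<le> e" "\<And>y. y \<in> T ==> \<bar>y - x\<bar> < d ==> y \<in> S \<and> v y = u y"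
 shows "germ_ext v T x F d"
proof -
 have "ball (complex_of_real x) d \<subseteq> ball (of_real x) e" using assms(3) by (rule subset_ball)
 then have "F holomorphic_on ball (of_real x) d" "\<forall>z\<in>ball (of_real x) d. F (cnj z) = cnj (F z)"
  using germ_extD(2,3)[OF assms(1)] holomorphic_on_subset by blast+
 moreover have "F (of_real y) = of_real (v y)" if "y \<in> T" "\<bar>y - x\<bar> < d" for y
  using germ_extD(5)[OF assms(1), of y] assms(3) assms(4)[OF that] that(2) by simp
 ultimately show ?thesis using assms(2) germ_extD(4)[OF assms(1)] unfolding germ_ext_def by blast
qed

lemma germ_cong:
 assumes "germ u S x" "0 < d" "\<And>y. y \<in> T ==> \<bar>y - x\<bar> < d ==> y \<in> S \<and> v y = u y"
 shows "germ v T x"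
proof -
 obtain F e where F: "germ_ext u S x F e" using assms(1) unfolding germ_def by blast
 have "germ_ext v T x F (min d e)" by (rule germ_ext_shrink[OF F]) (use assms germ_extD(1)[OF F] in auto)
 then show ?thesis unfolding germ_def by blast
qed

lemma germ_compose:
 assumes u: "germ u S x" and v: "germ v T (u x)" and uS: "u ` S \<subseteq> T" and x: "x \<in> S"
 shows "germ (\<lambda>y. v (u y)) S x"
proof -
 obtain F e where F: "germ_ext u S x F e" using u unfolding germ_def by blast
 obtain G h where G: "germ_ext v T (u x) G h" using v unfolding germ_def by blast
 note F' = germ_extD[OF F] and G' = germ_extD[OF G]
 have Fx: "F (of_real x) = of_real (u x)" using F'(5)[OF x] F'(1) by simp
 let ?B = "ball (complex_of_real x) e" let ?C = "ball (complex_of_real (u x)) h"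
 have "continuous_on ?B F" using F'(2) by (rule holomorphic_on_imp_continuous_on)
 then have "open (?B \<inter> F -` ?C)" by (intro continuous_open_preimage) auto
 moreover have "complex_of_real x \<in> ?B \<inter> F -` ?C" using F'(1) G'(1) Fx by simp
 ultimately obtain d where d: "0 < d" "ball (complex_of_real x) d \<subseteq> ?B \<inter> F -` ?C" using open_contains_ball by blast
 have dsub: "F z \<in> ?C" "z \<in> ?B" if "z \<in> ball (complex_of_real x) d" for z using d(2) that by blast+
 have "germ_ext (\<lambda>y. v (u y)) S x (G \<circ> F) d"
  unfolding germ_ext_def
 proof (intro conjI ballI impI)
  show "(G \<circ> F) holomorphic_on ball (of_real x) d"
  proof (rule holomorphic_on_compose_gen[where t = ?C])
   show "F holomorphic_on ball (of_real x) d" using F'(2) dsub(2) by (meson holomorphic_on_subset subsetI)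
  qed (use G'(2) dsub in auto)
  show "(G \<circ> F) (cnj z) = cnj ((G \<circ> F) z)" if "z \<in> ball (of_real x) d" for z
   using F'(3)[OF dsub(2)[OF that]] G'(3)[OF dsub(1)[OF that]] by simp
  have dF: "(F has_field_derivative deriv F (of_real x)) (at (of_real x))"
   using F'(1) by (intro holomorphic_derivI[OF F'(2)]) auto
  have "(G has_field_derivative deriv G (of_real (u x))) (at (F (of_real x)))"
   unfolding Fx using G'(1) by (intro holomorphic_derivI[OF G'(2)]) auto
  from DERIV_chain[OF this dF] have "deriv (G \<circ> F) (of_real x) = deriv G (of_real (u x)) * deriv F (of_real x)" by (rule DERIV_imp_deriv)
  then show "deriv (G \<circ> F) (of_real x) \<noteq> 0" using F'(4) G'(4) by simp
  show "(G \<circ> F) (of_real y) = of_real (v (u y))" if y: "y \<in> S" "\<bar>y - x\<bar> < d" for y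
  proof -
   have yd: "of_real y \<in> ball (complex_of_real x) d" using y(2) of_real_ball by blast
   have "\<bar>y - x\<bar> < e" using dsub(2)[OF yd] of_real_ball by blast
   then have Fy: "F (of_real y) = of_real (u y)" using F'(5) y(1) by blast
   then have "\<bar>u y - u x\<bar> < h" using dsub(1)[OF yd] of_real_ball by metis
   then show ?thesis using G'(5)[of "u y"] uS y(1) Fy by auto
  qed
 qed (rule d(1))
 then show ?thesis unfolding germ_def by blast
qed

lemma germ_affine: "v \<noteq> 0 ==> germ (\<lambda>y. u + v * y) S x"
proof -
 assume v: "v \<noteq> 0"
 have "((\<lambda>z. complex_of_real u + of_real v * z) has_field_derivative of_real v) (at (of_real x))"
  by (auto intro!: derivative_eq_intros)
 then have "deriv (\<lambda>z. complex_of_real u + of_real v * z) (of_real x) = of_real v" by (rule DERIV_imp_deriv)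
 then have "germ_ext (\<lambda>y. u + v * y) S x (\<lambda>z. of_real u + of_real v * z) 1"
  unfolding germ_ext_def using v by (auto intro!: holomorphic_intros)
 then show ?thesis unfolding germ_def by blast
qed

text \<open>Composition of germs along the orbit, which has to avoid c, the point at which no germ
  of g is available.\<close>

lemma germ_pow:
 assumes g: "\<And>x. x \<in> S ==> x \<noteq> c ==> germ g S x" and S: "g ` S \<subseteq> S" and x: "x \<in> S"
  and av: "\<And>i. i < n ==> (g ^^ i) x \<noteq> c"
 shows "germ (g ^^ n) S x"
 using av
proof (induction n)
 case 0
 then show ?case using germ_affine[of 1 0 S x] by (simp add: id_def)
next
 case (Suc n)
 have im: "(g ^^ n) y \<in> S" if "y \<in> S" for y by (induction n) (use that S in auto)
 have "germ (\<lambda>y. g ((g ^^ n) y)) S x"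
  by (rule germ_compose[where T = S]) (use Suc g im x in auto)
 then show ?case by (simp add: comp_def)
qed

lemma holomorphic_power_series_real:
 assumes F: "F holomorphic_on ball (complex_of_real x) e" and Fu: "\<And>y. y \<in> S ==> \<bar>y - x\<bar> < e ==> F (of_real y) = of_real (u y)"
  and y: "y \<in> S" "\<bar>y - x\<bar> < e"
 shows "(\<lambda>n. Re ((deriv ^^ n) F (of_real x) / fact n) * (y - x) ^ n) sums u y"
proof -
 have "(\<lambda>n. (deriv ^^ n) F (of_real x) / fact n * (of_real y - of_real x) ^ n) sums F (of_real y)"
  by (rule holomorphic_power_series[OF F]) (use y of_real_ball in blast)
 then have "(\<lambda>n. Re ((deriv ^^ n) F (of_real x) / fact n * (of_real y - of_real x) ^ n)) sums Re (F (of_real y))"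
  by (rule sums_Re)
 then have s: "(\<lambda>n. Re ((deriv ^^ n) F (of_real x) / fact n * (of_real y - of_real x) ^ n)) sums u y"
  unfolding Fu[OF y] Re_complex_of_real .
 have "Re (w * (of_real y - of_real x) ^ n) = Re w * (y - x) ^ n" for w n
 proof -
  have "(of_real y - of_real x) ^ n = complex_of_real ((y - x) ^ n)" by simp
  then show ?thesis by (simp only:) simp
 qed
 then show ?thesis using s by (simp only:)
qed

lemma germ_real_analytic:
 assumes "\<And>x. x \<in> S ==> germ u S x"
 shows "real_analytic_on u S"
 unfolding real_analytic_on_def
proof
 fix x assume "x \<in> S"
 then obtain F e where F: "germ_ext u S x F e" using assms unfolding germ_def by blast
 show "\<exists>a e. 0 < e \<and> (\<forall>y\<in>S. \<bar>y - x\<bar> < e \<longrightarrow> (\<lambda>n. a n * (y - x) ^ n) sums u y)"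
  by (intro exI[of _ "\<lambda>n. Re ((deriv ^^ n) F (of_real x) / fact n)"] exI[of _ e] conjI ballI impI
    holomorphic_power_series_real[OF germ_extD(2,5)[OF F]] germ_extD(1)[OF F])
qed

text \<open>Convergence of the power series at a single point y0 of S other than x already gives a
  complex disc of convergence, by Abel's lemma; so x may be an endpoint of S. The nonzero derivative
  of u passes to the extension.\<close>

lemma real_analytic_germ:
 assumes u: "real_analytic_on u S" and x: "x \<in> S" "x islimpt S"
  and D: "(u has_real_derivative D) (at x within S)" "D \<noteq> 0"
 shows "germ u S x"
proof -
 obtain a e where e: "0 < e" "\<And>y. y \<in> S ==> \<bar>y - x\<bar> < e ==> (\<lambda>n. a n * (y - x) ^ n) sums u y"
  using u x(1) unfolding real_analytic_on_def by metis
 obtain y0 where y0: "y0 \<in> S" "y0 \<noteq> x" "dist y0 x < e" using x(2) e(1) unfolding islimpt_approachable by blast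
 define d where "d = \<bar>y0 - x\<bar>"
 have d: "0 < d" "d < e" using y0 unfolding d_def dist_real_def by auto
 define F where "F z = (\<Sum>n. complex_of_real (a n) * (z - of_real x) ^ n)" for z
 have "summable (\<lambda>n. a n * (y0 - x) ^ n)" using e(2)[OF y0(1)] d unfolding d_def by (auto intro: sums_summable)
 then have "summable (\<lambda>n. complex_of_real (a n * (y0 - x) ^ n))" by (rule summable_of_real)
 then have s0: "summable (\<lambda>n. complex_of_real (a n) * (of_real (y0 - x)) ^ n)" by simp
 have sF: "(\<lambda>n. complex_of_real (a n) * (z - of_real x) ^ n) sums F z" if z: "z \<in> ball (of_real x) d" for z
  unfolding F_def
 proof (rule summable_sums, rule powser_inside[OF s0])
  show "cmod (z - of_real x) < cmod (of_real (y0 - x))"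
   using z unfolding d_def norm_of_real by (simp add: dist_norm norm_minus_commute)
 qed
 have hol: "F holomorphic_on ball (of_real x) d" by (rule power_series_holomorphic[OF sF])
 have sym: "F (cnj z) = cnj (F z)" if z: "z \<in> ball (of_real x) d" for z
 proof -
  have "(\<lambda>n. cnj (complex_of_real (a n) * (z - of_real x) ^ n)) sums cnj (F z)"
   by (rule iffD2[OF sums_cnj sF[OF z]])
  moreover have "(\<lambda>n. cnj (complex_of_real (a n) * (z - of_real x) ^ n)) = (\<lambda>n. complex_of_real (a n) * (cnj z - of_real x) ^ n)"
   by (rule ext) simp
  ultimately have "(\<lambda>n. complex_of_real (a n) * (cnj z - of_real x) ^ n) sums cnj (F z)" by (simp only:)
  with sF[OF cnj_ball[OF z]] show ?thesis by (rule sums_unique2)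
 qed
 have Fu: "F (of_real y) = of_real (u y)" if y: "y \<in> S" "\<bar>y - x\<bar> < d" for y
 proof -
  have "(\<lambda>n. complex_of_real (a n * (y - x) ^ n)) sums of_real (u y)" using e(2)[of y] y d by (intro sums_of_real) auto
  then have "(\<lambda>n. complex_of_real (a n) * (of_real y - of_real x) ^ n) sums of_real (u y)" by simp
  moreover have "complex_of_real y \<in> ball (of_real x) d" unfolding of_real_ball by (rule y(2))
  note sF[OF this]
  ultimately show ?thesis by (rule sums_unique2[rotated])
 qed
 have "(F has_field_derivative deriv F (of_real x)) (at (of_real x))" using d by (intro holomorphic_derivI[OF hol]) auto
 then have "((\<lambda>t. Re (F (of_real t))) has_real_derivative Re (deriv F (of_real x))) (at x)" by (rule re_deriv)
 then have "((\<lambda>t. Re (F (of_real t))) has_real_derivative Re (deriv F (of_real x))) (at x within S)" by (rule has_field_derivative_at_within)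
 then have "(u has_real_derivative Re (deriv F (of_real x))) (at x within S)"
  by (rule has_field_derivative_transform_within[OF _ d(1) x(1)]) (use Fu in \<open>simp add: dist_real_def\<close>)
 moreover have "at x within S \<noteq> bot" using x(2) trivial_limit_within[of x S] by simp
 ultimately have "D = Re (deriv F (of_real x))"
  using D(1) unfolding has_field_derivative_iff by (blast intro: tendsto_unique)
 then have "deriv F (of_real x) \<noteq> 0" using D(2) by auto
 then have "germ_ext u S x F d" unfolding germ_ext_def using d hol sym Fu by blast
 then show ?thesis unfolding germ_def by blast
qed

text \<open>The Noshiro-Warschawski criterion: with d = z - w, the derivative of cnj d F along the
  segment from w to z has real part |d|^2 Re F' > 0.\<close>

lemma inj_on_Re_deriv_pos:
 assumes F: "F holomorphic_on S" "open S" "convex S" and pos: "\<And>z. z \<in> S ==> 0 < Re (deriv F z)"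
 shows "inj_on F S"
proof (rule inj_onI, rule ccontr)
 fix z w assume zw: "z \<in> S" "w \<in> S" "F z = F w" "z \<noteq> w"
 define d where "d = z - w"
 define G where "G = (\<lambda>\<zeta>. cnj d * F (w + \<zeta> * d))"
 have inS: "w + of_real t * d \<in> S" if t: "t \<in> {0..1}" for t
 proof -
  have "(1 - t) *\<^sub>R w + t *\<^sub>R z \<in> S" using convexD_alt[OF F(3) zw(2,1), of t] t by simp
  moreover have "(1 - t) *\<^sub>R w + t *\<^sub>R z = w + of_real t * d" unfolding d_def by (simp add: scaleR_conv_of_real algebra_simps)
  ultimately show ?thesis by simp
 qed
 have "(G has_field_derivative cnj d * (deriv F (w + of_real t * d) * d)) (at (of_real t))" if t: "t \<in> {0..1}" for t
 proof -
  have 1: "(F has_field_derivative deriv F (w + of_real t * d)) (at (w + of_real t * d))"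
   by (rule holomorphic_derivI[OF F(1,2) inS[OF t]])
  have "((\<lambda>\<zeta>. w + \<zeta> * d) has_field_derivative d) (at (of_real t))" by (auto intro!: derivative_eq_intros)
  from DERIV_chain2[OF 1 this] show ?thesis unfolding G_def by (rule DERIV_cmult)
 qed
 from re_deriv[OF this] have dG: "((\<lambda>t. Re (G (of_real t))) has_real_derivative Re (cnj d * (deriv F (w + of_real t * d) * d))) (at t)"
  if "t \<in> {0..1}" for t using that by blast
 obtain t where t: "0 < t" "t < 1" "Re (G (of_real 1)) - Re (G (of_real 0)) = (1 - 0) * Re (cnj d * (deriv F (w + of_real t * d) * d))"
  using MVT2[of 0 1 "\<lambda>t. Re (G (of_real t))" "\<lambda>t. Re (cnj d * (deriv F (w + of_real t * d) * d))"] dG by auto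
 have "cnj d * (deriv F (w + of_real t * d) * d) = (d * cnj d) * deriv F (w + of_real t * d)" by (simp only: mult_ac)
 also have "\<dots> = of_real ((cmod d)\<^sup>2) * deriv F (w + of_real t * d)" unfolding complex_norm_square ..
 finally have nsq: "cnj d * (deriv F (w + of_real t * d) * d) = of_real ((cmod d)\<^sup>2) * deriv F (w + of_real t * d)" .
 have "Re (cnj d * (deriv F (w + of_real t * d) * d)) = (cmod d)\<^sup>2 * Re (deriv F (w + of_real t * d))"
  unfolding nsq by (simp only: Re_complex_of_real times_complex.sel Im_complex_of_real)
 moreover have "0 < \<dots>" using pos[OF inS[of t]] t zw(4) unfolding d_def by (intro mult_pos_pos) auto
 moreover have "G (of_real 1) = G (of_real 0)" unfolding G_def d_def using zw(3) by simp
 ultimately show False using t(3) by (metis diff_self diff_zero mult_1 less_irrefl)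
qed

text \<open>Two overlapping discs centred in [a,b] share a real segment between their centres, on
  which both extensions equal u. The identity theorem makes them agree on the whole lens, and
  compactness of [a,b] provides a uniform radius.\<close>

lemma germ_glue:
 assumes g: "\<And>x. x \<in> {a..b} ==> germ u {a..b} x"
 shows "\<exists>r>0. \<exists>F. F holomorphic_on nbhd r {a..b} \<and> (\<forall>z\<in>nbhd r {a..b}. F (cnj z) = cnj (F z)) \<and>
  (\<forall>x\<in>{a..b}. F (of_real x) = of_real (u x) \<and> deriv F (of_real x) \<noteq> 0)"
proof -
 have "\<forall>x\<in>{a..b}. \<exists>F e. germ_ext u {a..b} x F e" using g unfolding germ_def by blast
 then obtain F e where Fe: "\<And>x. x \<in> {a..b} ==> germ_ext u {a..b} x (F x) (e x)" by metis
 define B where "B x = ball (complex_of_real x) (e x)" for x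
 have agree: "F x z = F x' z" if x: "x \<in> {a..b}" "x' \<in> {a..b}" "x < x'" and z: "z \<in> B x" "z \<in> B x'" for x x' z
 proof -
  note X = germ_extD[OF Fe[OF x(1)]] and X' = germ_extD[OF Fe[OF x(2)]]
  let ?S = "B x \<inter> B x'"
  have "cmod (of_real x' - of_real x) \<le> cmod (of_real x' - z) + cmod (z - of_real x)"
   using norm_triangle_ineq[of "of_real x' - z" "z - of_real x"] by simp
  also have "\<dots> < e x' + e x" using z unfolding B_def by (simp add: dist_norm norm_minus_commute)
  finally have "x' - x < e x' + e x" using x(3) by (metis abs_of_pos diff_gt_0_iff_gt norm_of_real of_real_diff)
  then have lt: "max x (x' - e x') < min x' (x + e x)" using x(3) X(1) X'(1) by auto
  \<comment> \<open>The segment is kept between the two centres, hence inside [a,b], where u is the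
    common value.\<close>
  define T where "T = {max x (x' - e x')<..<min x' (x + e x)}"
  obtain t where t: "t \<in> T" unfolding T_def using dense[OF lt] by auto
  have TS: "complex_of_real s \<in> ?S" if "s \<in> T" for s
   using that x(3) unfolding T_def B_def Int_iff of_real_ball by auto
  have "F x z - F x' z = 0"
  proof (rule analytic_continuation[where f = "\<lambda>z. F x z - F x' z" and w = z and S = ?S and U = "complex_of_real ` T" and \<xi> = "complex_of_real t"])
   show "(\<lambda>z. F x z - F x' z) holomorphic_on ?S"
    using X(2) X'(2) unfolding B_def[symmetric] by (intro holomorphic_intros; meson holomorphic_on_subset inf_le1 inf_le2)
   show "open ?S" unfolding B_def by auto
   show "connected ?S" unfolding B_def by (intro convex_connected convex_Int) auto
   show "complex_of_real ` T \<subseteq> ?S" using TS by blast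
   show "complex_of_real t \<in> ?S" using TS t by blast
   show "complex_of_real t islimpt complex_of_real ` T"
    unfolding islimpt_approachable
   proof (intro allI impI)
    fix h :: real assume h: "0 < h"
    have tT: "max x (x' - e x') < t" "t < min x' (x + e x)" using t unfolding T_def by auto
    have "t < min (t + h) (min x' (x + e x))" using h tT by simp
    then obtain s where "t < s" "s < min (t + h) (min x' (x + e x))" using dense by blast
    then have s: "t < s" "s < min x' (x + e x)" "s - t < h" by simp_all
    have "s \<in> T" unfolding T_def using s tT by auto
    moreover have "dist (complex_of_real s) (of_real t) < h" using s unfolding dist_of_real dist_real_def by simp
    ultimately show "\<exists>w\<in>complex_of_real ` T. w \<noteq> of_real t \<and> dist w (of_real t) < h" using s(1) by force
   qed
   show "F x z - F x' z = 0" if zT: "z \<in> complex_of_real ` T" for z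
   proof -
    obtain s where s: "z = of_real s" "s \<in> T" using zT by blast
    have "s \<in> {a..b}" "\<bar>s - x\<bar> < e x" "\<bar>s - x'\<bar> < e x'" using s(2) x unfolding T_def by auto
    then have "F x (of_real s) = of_real (u s)" "F x' (of_real s) = of_real (u s)" using X(5) X'(5) by blast+
    then show ?thesis unfolding s(1) by simp
   qed
  qed (use z in auto)
  then show ?thesis by simp
 qed
 have agree': "F x z = F x' z" if x: "x \<in> {a..b}" "x' \<in> {a..b}" and z: "z \<in> B x" "z \<in> B x'" for x x' z
  using agree[of x x' z] agree[of x' x z] x z by (cases x x' rule: linorder_cases) auto
 define \<Omega> where "\<Omega> = (\<Union>x\<in>{a..b}. B x)"
 define sel where "sel z = (SOME x. x \<in> {a..b} \<and> z \<in> B x)" for z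
 define H where "H z = F (sel z) z" for z
 have H: "H z = F x z" if "x \<in> {a..b}" "z \<in> B x" for x z
 proof -
  have "sel z \<in> {a..b} \<and> z \<in> B (sel z)" unfolding sel_def by (rule someI[of _ x]) (use that in blast)
  then show ?thesis unfolding H_def using agree' that by blast
 qed
 have oO: "open \<Omega>" unfolding \<Omega>_def B_def by auto
 have KO: "complex_of_real ` {a..b} \<subseteq> \<Omega>" using germ_extD(1)[OF Fe] unfolding \<Omega>_def B_def by force
 obtain r where r: "0 < r" "nbhd r {a..b} \<subseteq> \<Omega>" using open_contains_nbhd[OF _ oO KO] by auto
 have Hd: "(H has_field_derivative deriv (F x) z) (at z)" if x: "x \<in> {a..b}" and z: "z \<in> B x" for x z
 proof (rule has_field_derivative_transform_within_open[where S = "B x" and f = "F x"])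
  show "(F x has_field_derivative deriv (F x) z) (at z)"
   using z germ_extD(2)[OF Fe[OF x]] unfolding B_def by (intro holomorphic_derivI) auto
 qed (use x z H in \<open>auto simp: B_def\<close>)
 have inO: "\<exists>x\<in>{a..b}. z \<in> B x" if "z \<in> nbhd r {a..b}" for z using r(2) that unfolding \<Omega>_def by blast
 have "H holomorphic_on nbhd r {a..b}"
  unfolding holomorphic_on_def field_differentiable_def
  using Hd inO by (meson has_field_derivative_at_within)
 moreover have "H (cnj z) = cnj (H z)" if z: "z \<in> nbhd r {a..b}" for z
 proof -
  obtain x where x: "x \<in> {a..b}" "z \<in> B x" using inO[OF z] by blast
  then have "cnj z \<in> B x" using cnj_ball unfolding B_def by blast
  then show ?thesis using H[OF x(1)] x germ_extD(3)[OF Fe[OF x(1)], of z] unfolding B_def by simp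
 qed
 moreover have "H (of_real x) = of_real (u x) \<and> deriv H (of_real x) \<noteq> 0" if x: "x \<in> {a..b}" for x
 proof -
  note X = germ_extD[OF Fe[OF x]]
  have xB: "of_real x \<in> B x" unfolding B_def using X(1) by simp
  have "deriv H (of_real x) = deriv (F x) (of_real x)" using Hd[OF x xB] by (rule DERIV_imp_deriv)
  then show ?thesis using H[OF x xB] X(4) X(5)[OF x] X(1) by simp
 qed
 ultimately show ?thesis using r(1) by blast
qed

lemma local_pos:
 assumes F: "F holomorphic_on ball (complex_of_real x) e" and e: "0 < e"
  and sym: "\<And>z. z \<in> ball (complex_of_real x) e ==> F (cnj z) = cnj (F z)" and pos: "0 < Re (deriv F (of_real x))"
 obtains d where "0 < d" "d \<le> e" "inj_on F (ball (of_real x) d)" "\<And>z. z \<in> ball (of_real x) d ==> 0 < Re (deriv F z)"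
  "strict_mono_on {x - d<..<x + d} (real_trace F)"
proof -
 let ?B = "ball (complex_of_real x)"
 have "continuous_on (?B e) (\<lambda>z. Re (deriv F z))"
  by (intro continuous_on_Re holomorphic_on_imp_continuous_on holomorphic_deriv F open_ball)
 then have "open (?B e \<inter> (\<lambda>z. Re (deriv F z)) -` {0<..})" by (intro continuous_open_preimage) auto
 moreover have "complex_of_real x \<in> ?B e \<inter> (\<lambda>z. Re (deriv F z)) -` {0<..}" using e pos by simp
 ultimately obtain d' where d': "0 < d'" "?B d' \<subseteq> ?B e \<inter> (\<lambda>z. Re (deriv F z)) -` {0<..}" using open_contains_ball by blast
 define d where "d = min d' e"
 have d: "0 < d" "d \<le> e" "?B d \<subseteq> ?B d'" unfolding d_def using d'(1) e by (auto intro: subset_ball)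
 have Fd: "F holomorphic_on ?B d" using F d(2) by (meson holomorphic_on_subset subset_ball)
 have posd: "0 < Re (deriv F z)" if "z \<in> ?B d" for z using d(3) d'(2) that by auto
 have injF: "inj_on F (?B d)" by (rule inj_on_Re_deriv_pos[OF Fd]) (use posd in auto)
 have mono: "strict_mono_on {x - d<..<x + d} (real_trace F)"
 proof (rule strict_mono_onI)
  fix s t assume st: "s \<in> {x - d<..<x + d}" "t \<in> {x - d<..<x + d}" "s < t"
  show "real_trace F s < real_trace F t"
  proof (rule DERIV_pos_imp_increasing[OF st(3)])
   fix y assume "s \<le> y" "y \<le> t"
   then have y: "of_real y \<in> ?B d" using st unfolding of_real_ball by auto
   have "DERIV (real_trace F) y :> Re (deriv F (of_real y))"
    using re_deriv[OF holomorphic_derivI[OF Fd open_ball y]] unfolding real_trace_def[abs_def] .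
   then show "\<exists>D. DERIV (real_trace F) y :> D \<and> 0 < D" using posd[OF y] by blast
  qed
 qed
 show ?thesis by (rule that[OF d(1,2) injF posd mono])
qed

text \<open>The derivatives of all orders of the trace and of its inverse are real parts of complex
  derivatives of F and of its holomorphic local inverse.\<close>

lemma holomorphic_local_diffeo:
 assumes F: "F holomorphic_on ball (complex_of_real x) e" and e: "0 < e"
  and sym: "\<And>z. z \<in> ball (complex_of_real x) e ==> F (cnj z) = cnj (F z)" and pos: "0 < Re (deriv F (of_real x))"
 shows "local_diffeo (real_trace F) x" "real_analytic_near (real_trace F) x"
proof -
 let ?B = "ball (complex_of_real x)"
 obtain d where d: "0 < d" "d \<le> e" and injF: "inj_on F (?B d)" and posd: "\<And>z. z \<in> ?B d ==> 0 < Re (deriv F z)"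
  and mono0: "strict_mono_on {x - d<..<x + d} (real_trace F)"
  using local_pos[OF F e sym pos] by metis
 have Fd: "F holomorphic_on ?B d" using F d(2) by (meson holomorphic_on_subset subset_ball)
 have symd: "F (cnj z) = cnj (F z)" if "z \<in> ?B d" for z using d(2) that by (intro sym) auto
 define h where "h = real_trace F"
 define U where "U = {x - d<..<x + d}"
 have UB: "of_real t \<in> ?B d" if "t \<in> U" for t using that unfolding U_def of_real_ball by auto
 have Fh: "F (of_real t) = of_real (h t)" if "t \<in> U" for t unfolding h_def by (rule sym_real[OF symd[OF UB[OF that]]])
 have dh: "DERIV h t :> Re (deriv F (of_real t))" if "t \<in> U" for t
  using re_deriv[OF holomorphic_derivI[OF Fd open_ball UB[OF that]]] unfolding h_def real_trace_def[abs_def] .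
 have mono: "strict_mono_on U h" using mono0 unfolding U_def h_def .
 have injh: "inj_on h U" using mono by (rule strict_mono_on_imp_inj_on)
 have oU: "open U" unfolding U_def by simp
 have conth: "continuous_on U h" using dh by (intro DERIV_continuous_on) (auto intro: has_field_derivative_at_within)
 have ohU: "open (h ` U)" by (rule invariance_of_domain[OF conth oU injh])
 have smooth: "smooth_on v S" if S: "open S" "\<And>t. t \<in> S ==> of_real t \<in> \<Omega>" and G: "G holomorphic_on \<Omega>" "open \<Omega>"
   and Gv: "\<And>t. t \<in> S ==> G (of_real t) = of_real (v t)" for v S \<Omega> and G :: "complex \<Rightarrow> complex"
  unfolding smooth_on_def
 proof (intro exI[of _ "\<lambda>n t. Re ((deriv ^^ n) G (of_real t))"] conjI ballI allI)
  fix n t assume t: "t \<in> S"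
  have "((deriv ^^ n) G has_field_derivative deriv ((deriv ^^ n) G) (of_real t)) (at (of_real t))"
   by (rule holomorphic_derivI[OF holomorphic_higher_deriv[OF G] G(2) S(2)[OF t]])
  from re_deriv[OF this] show "((\<lambda>t. Re ((deriv ^^ n) G (of_real t))) has_real_derivative Re ((deriv ^^ Suc n) G (of_real t))) (at t within S)"
   by (simp add: has_field_derivative_at_within)
 qed (use Gv in simp)
 obtain H where H: "H holomorphic_on (F ` ?B d)" "\<And>z. z \<in> ?B d ==> H (F z) = z"
  using holomorphic_has_inverse[OF Fd open_ball injF] by metis
 have oFB: "open (F ` ?B d)" by (rule open_mapping_thm3[OF Fd open_ball injF])
 have "smooth_on h U" by (rule smooth[OF oU UB Fd open_ball Fh])
 moreover have "smooth_on (inv_into U h) (h ` U)"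
 proof (rule smooth[OF ohU _ H(1) oFB])
  fix s assume s: "s \<in> h ` U"
  define t where "t = inv_into U h s"
  have t: "t \<in> U" "h t = s" unfolding t_def using s by (auto simp: inv_into_into f_inv_into_f)
  show "of_real s \<in> F ` ?B d" using Fh[OF t(1)] UB[OF t(1)] t(2) by (metis imageI)
  show "H (of_real s) = of_real (inv_into U h s)" using H(2)[OF UB[OF t(1)]] Fh[OF t(1)] t(2) unfolding t_def by simp
 qed
 ultimately show "local_diffeo (real_trace F) x"
  unfolding local_diffeo_def Let_def h_def[symmetric] using mono ohU d(1) unfolding U_def by blast
 have "real_analytic_on h U"
 proof (rule germ_real_analytic)
  fix t assume t: "t \<in> U"
  obtain k where k: "0 < k" "ball (complex_of_real t) k \<subseteq> ?B d" using UB[OF t] open_contains_ball[of "?B d"] by blast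
  have "F (of_real s) = of_real (h s)" if "s \<in> U" for s using Fh that .
  moreover have "deriv F (of_real t) \<noteq> 0" using posd[OF UB[OF t]] by auto
  ultimately have "germ_ext h U t F k"
   unfolding germ_ext_def using k Fd symd by (meson holomorphic_on_subset subsetD)
  then show "germ h U t" unfolding germ_def by blast
 qed
 then show "real_analytic_near (real_trace F) x"
  unfolding real_analytic_near_def h_def[symmetric] U_def using d(1) by blast
qed

section \<open>Renormalizations of analytic maps\<close>

lemma inf_renorm_base:
 assumes g: "g \<in> inf_renormalizable_maps \<alpha>"
 shows "inf_base \<alpha> ((renorm ^^ 2) g)"
proof -
 have "(renorm ^^ n) ((renorm ^^ 2) g) \<in> renormalizable_maps \<alpha>" for n
 proof -
  have "(renorm ^^ (n + 2)) g \<in> renormalizable_maps \<alpha>" using g unfolding inf_renormalizable_maps_def by blast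
  then show ?thesis by (simp only: funpow_add comp_apply)
 qed
 moreover obtain d0 where u0: "umap \<alpha> g d0 (crit g)" using inf_renormD(3)[OF g, of 0] by auto
 have r0: "renormalizable g" using inf_renormD(2)[OF g, of 0] by simp
 obtain d1 where u1: "umap \<alpha> (renorm g) d1 (crit (renorm g))" using inf_renormD(3)[OF g, of 1] by auto
 have r1: "renormalizable (renorm g)" using inf_renormD(2)[OF g, of 1] by simp
 have "renorm (renorm g) (-1) = -1" "renorm (renorm g) 1 = -1"
  using renorm_boundary(1)[OF u0 r0] renorm_boundary[OF u1 r1] by simp_all
 ultimately show ?thesis unfolding inf_base_def inf_renormalizable_maps_def by (simp add: numeral_2_eq_2)
qed

text \<open>The decay theorem is applied to the second renormalization, which has the required
  boundary values; the coordinates of g are obtained from its coordinates by one fixed affine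
  map.\<close>

lemma scale_small:
 assumes al: "1 < \<alpha>" and g: "g \<in> inf_renormalizable_maps \<alpha>" and e: "0 < e"
 shows "\<exists>K. \<forall>k\<ge>K. \<bar>scale_map g k 1 - scale_map g k (-1)\<bar> < e"
proof -
 define h where "h = (renorm ^^ 2) g"
 have bh: "inf_base \<alpha> h" unfolding h_def by (rule inf_renorm_base[OF g])
 obtain A where A: "\<And>k. hi h k - lo h k \<le> A * ((6 / 7) powr (1 / (2 * \<alpha>))) ^ k" using real_bounds[OF al bh] by blast
 define l where "l = (6 / 7 :: real) powr (1 / (2 * \<alpha>))"
 have l: "0 < l" "l < 1" unfolding l_def using al powr_less_mono2[of "1 / (2 * \<alpha>)" "6 / 7" 1] by simp_all
 obtain u v where uv: "v \<noteq> 0" "\<And>x. scale_map g 2 x = u + v * x" using inf_scale[OF g, of 2] by blast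
 have "(\<lambda>k. l ^ k) \<longlonglongrightarrow> 0" using l by (intro LIMSEQ_power_zero) simp
 then have "(\<lambda>k. \<bar>v\<bar> * A * l ^ k) \<longlonglongrightarrow> \<bar>v\<bar> * A * 0" by (rule tendsto_mult_left)
 then have "\<forall>\<^sub>F k in sequentially. \<bar>v\<bar> * A * l ^ k < e" using e by (intro order_tendstoD(2)) auto
 then obtain K where K: "\<And>k. K \<le> k ==> \<bar>v\<bar> * A * l ^ k < e" unfolding eventually_sequentially by blast
 have "\<bar>scale_map g k 1 - scale_map g k (-1)\<bar> < e" if k: "2 + K \<le> k" for k
 proof -
  define j where "j = k - 2"
  have kj: "k = 2 + j" "K \<le> j" unfolding j_def using k by simp_all
  have "\<bar>scale_map g k 1 - scale_map g k (-1)\<bar> = \<bar>v\<bar> * \<bar>scale_map h j 1 - scale_map h j (-1)\<bar>"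
   unfolding kj(1) scale_add h_def[symmetric] comp_apply uv(2) by (simp add: abs_mult[symmetric] right_diff_distrib)
  also have "\<bar>scale_map h j 1 - scale_map h j (-1)\<bar> = hi h j - lo h j" unfolding hi_def lo_def by auto
  also have "\<bar>v\<bar> * (hi h j - lo h j) \<le> \<bar>v\<bar> * (A * l ^ j)" using A[of j] unfolding l_def by (intro mult_left_mono) auto
  also have "\<dots> < e" using K[OF kj(2)] by (simp add: mult.assoc)
  finally show ?thesis .
 qed
 then show ?thesis by blast
qed

lemma renorm_tail_boundary:
 assumes g: "g \<in> inf_renormalizable_maps \<alpha>" and k: "2 \<le> k"
 defines "f \<equiv> (renorm ^^ k) g"
 shows "f (-1) = -1" "f 1 = -1" "crit f < f (crit f)" "f (crit f) < 1"
proof -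
 have "f = (renorm ^^ (k - 2)) ((renorm ^^ 2) g)" unfolding f_def using k by (metis comp_apply funpow_add le_add_diff_inverse2)
 then have b: "inf_base \<alpha> f" using inf_base_pow[OF inf_renorm_base[OF g]] by simp
 then show f1: "f (-1) = -1" "f 1 = -1" unfolding inf_base_def by simp_all
 obtain df where u: "umap \<alpha> f df (crit f)" using inf_base_umap(1)[OF b] by blast
 show "crit f < f (crit f)" "f (crit f) < 1" using cyc_not_beyond[OF u inf_base_umap(2)[OF b] f1] by simp_all
qed

text \<open>Analyticity is given on two half-open intervals; near any point other than the critical
  one, one of them describes g on all of [-1,1].\<close>

lemma analytic_unimodal_germ:
 assumes g: "g \<in> analytic_unimodal \<alpha>" and x: "x \<in> {-1..1}" "x \<noteq> crit g"
 shows "germ g {-1..1} x"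
proof -
 have gu: "g \<in> unimodal \<alpha>" and ra: "real_analytic_on g {-1..<crit g}" "real_analytic_on g {crit g<..1}"
  using g unfolding analytic_unimodal_def by simp_all
 obtain df where u: "umap \<alpha> g df (crit g)" using unimodal_umap[OF gu] by blast
 have cb: "-1 < crit g" "crit g < 1" using umapD(9,10)[OF u] by simp_all
 have d: "(g has_real_derivative df x) (at x within {-1..1})" by (rule umapD(5)[OF u x(1)])
 show ?thesis
 proof (cases "x < crit g")
  case True
  have xi: "x islimpt {-1..<crit g}"
  proof -
   have "x islimpt {x<..<crit g}" using True by (intro islimpt_greaterThanLessThan1)
   then show ?thesis by (rule islimpt_subset) (use x in auto)
  qed
  have "(g has_real_derivative df x) (at x within {-1..<crit g})" by (rule DERIV_subset[OF d]) (use cb in auto)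
  moreover have "df x \<noteq> 0" using umapD(6)[OF u, of x] x True by simp
  ultimately have "germ g {-1..<crit g} x" using x True xi by (intro real_analytic_germ[OF ra(1)]) auto
  then show ?thesis by (rule germ_cong[where d = "crit g - x"]) (use True x in auto)
 next
  case False
  then have cx: "crit g < x" using x by simp
  have xi: "x islimpt {crit g<..1}"
  proof -
   have "x islimpt {crit g<..<x}" using cx by (intro islimpt_greaterThanLessThan2)
   then show ?thesis by (rule islimpt_subset) (use x in auto)
  qed
  have "(g has_real_derivative df x) (at x within {crit g<..1})" by (rule DERIV_subset[OF d]) (use cb in auto)
  moreover have "df x \<noteq> 0" using umapD(7)[OF u, of x] x cx by simp
  ultimately have "germ g {crit g<..1} x" using x cx xi by (intro real_analytic_germ[OF ra(2)]) auto
  then show ?thesis by (rule germ_cong[where d = "x - crit g"]) (use cx x in auto)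
 qed
qed

lemma diffeo_germ:
 assumes ld: "local_diffeo h x" and ra: "real_analytic_near h x"
 obtains F e where "0 < e" "F holomorphic_on ball (complex_of_real x) e" "\<And>z. z \<in> ball (of_real x) e ==> F (cnj z) = cnj (F z)"
  "inj_on F (ball (of_real x) e)" "strict_mono_on {x - e<..<x + e} (real_trace F)"
  "\<And>y. \<bar>y - x\<bar> < e ==> F (of_real y) = of_real (h y)"
proof -
 obtain d where d: "0 < d" "real_analytic_on h {x - d<..<x + d}" using ra unfolding real_analytic_near_def by blast
 obtain D where D: "DERIV h x :> D" "0 < D"
 proof -
  obtain e' \<mu> M h1 h2 h3 where "0 < e'" "0 < \<mu>" "\<And>y. \<bar>y - x\<bar> \<le> e' ==> DERIV h y :> h1 y" "\<And>y. \<bar>y - x\<bar> \<le> e' ==> \<mu> \<le> (h1 y :: real)"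
   using local_diffeo_derivs[OF ld] by metis
  then have "DERIV h x :> h1 x" "0 < h1 x" by (simp, metis abs_zero diff_self less_imp_le less_le_trans)
  then show ?thesis using that by blast
 qed
 have xi: "x islimpt {x - d<..<x + d}"
  by (rule islimpt_subset[OF islimpt_greaterThanLessThan1[of x "x + d"]]) (use d in auto)
 have "germ h {x - d<..<x + d} x"
  by (rule real_analytic_germ[OF d(2) _ xi has_field_derivative_at_within[OF D(1)]]) (use d D in auto)
 then obtain F e0 where F0: "germ_ext h {x - d<..<x + d} x F e0" unfolding germ_def by blast
 have F: "germ_ext h UNIV x F (min d e0)"
  by (rule germ_ext_shrink[OF F0]) (use d germ_extD(1)[OF F0] in auto)
 define e1 where "e1 = min d e0"
 note X = germ_extD[OF F, folded e1_def]
 have "(real_trace F has_real_derivative D) (at x)"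
 proof (rule has_field_derivative_transform_within_open[OF D(1), where S = "ball x e1"])
  show "h y = real_trace F y" if "y \<in> ball x e1" for y
   using X(5)[of y] that unfolding real_trace_def by (simp add: dist_real_def abs_minus_commute)
 qed (use X(1) in auto)
 moreover have "(real_trace F has_real_derivative Re (deriv F (of_real x))) (at x)"
  using re_deriv[OF holomorphic_derivI[OF X(2) open_ball]] X(1) unfolding real_trace_def[abs_def] by simp
 ultimately have pos: "0 < Re (deriv F (of_real x))" using D(2) DERIV_unique by blast
 obtain e where e: "0 < e" "e \<le> e1" "inj_on F (ball (of_real x) e)" "strict_mono_on {x - e<..<x + e} (real_trace F)"
  using local_pos[OF X(2,1,3) pos] by metis
 have sub: "ball (complex_of_real x) e \<subseteq> ball (of_real x) e1" using e(2) by (rule subset_ball)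
 show ?thesis
 proof (rule that[OF e(1) holomorphic_on_subset[OF X(2) sub] _ e(3,4)])
  show "F (cnj z) = cnj (F z)" if "z \<in> ball (complex_of_real x) e" for z using X(3) sub that by blast
  show "F (of_real y) = of_real (h y)" if "\<bar>y - x\<bar> < e" for y using X(5)[of y] that e(2) by simp
 qed
qed

text \<open>The data of one deep renormalization f of g: x -> u + v x is its coordinate, M + 1 its
  total period, and \<Phi>, \<Psi> extend the normal form of g at c. The bound \<open>small\<close>
  sends the (r + 1)-neighbourhood of [-1,1], whose points are within r + 3 of crit f, into the
  domain of \<Phi>.\<close>

locale germ_rep =
 fixes \<alpha> r :: real and g f dg df :: "real \<Rightarrow> real" and \<Phi> \<Psi> :: "complex \<Rightarrow> complex" and c e1 e2 u v :: real and M :: nat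
 assumes al: "1 < \<alpha>" and r: "0 < r"
  and germs: "\<And>x. x \<in> {-1..1} ==> x \<noteq> c ==> germ g {-1..1} x"
  and ug: "umap \<alpha> g dg c" and uf: "umap \<alpha> f df (crit f)" and f_unim: "f \<in> unimodal \<alpha>"
  and v: "v \<noteq> 0" and Lc: "u + v * crit f = c" and L_range: "\<And>x. x \<in> {-1..1} ==> u + v * x \<in> {-1..1}"
  and conj: "\<And>x. (g ^^ Suc M) (u + v * x) = u + v * f x"
  and av: "\<And>x i. x \<in> {-1..1} ==> 0 < i ==> i < Suc M ==> (g ^^ i) (u + v * x) \<noteq> c"
  and f_ends: "f (-1) = -1" "f 1 = -1" and f_crit: "crit f < f (crit f)" "f (crit f) < 1"
  and Phi0: "0 < e1" "\<Phi> holomorphic_on ball (of_real c) e1" "\<And>z. z \<in> ball (of_real c) e1 ==> \<Phi> (cnj z) = cnj (\<Phi> z)"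
   "inj_on \<Phi> (ball (of_real c) e1)" "strict_mono_on {c - e1<..<c + e1} (real_trace \<Phi>)" "\<Phi> (of_real c) = 0"
  and Psi0: "0 < e2" "\<Psi> holomorphic_on ball 0 e2" "\<And>z. z \<in> ball 0 e2 ==> \<Psi> (cnj z) = cnj (\<Psi> z)" "inj_on \<Psi> (ball 0 e2)"
  and nf: "\<And>y. \<bar>y - c\<bar> < e1 ==> g y = real_trace \<Psi> (- (\<bar>real_trace \<Phi> y\<bar> powr \<alpha>)) \<and> \<bar>real_trace \<Phi> y\<bar> powr \<alpha> < e2"
  and small: "\<bar>v\<bar> * (r + 3) < e1"
begin

definition Lam :: "complex \<Rightarrow> complex" where "Lam z = of_real u + of_real v * z"
definition tq :: real where "tq = real_trace \<Phi> (u + v)"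
text \<open>\<Phi> in the coordinate of f, normalized at 1. It will serve as the conjugacy; its
  normalization at -1 is then automatic by \<open>tp\<close>.\<close>

definition ph :: "complex \<Rightarrow> complex" where "ph z = \<Phi> (Lam z) / of_real tq"

lemma crit_f: "-1 < crit f" "crit f < 1" using umapD(9,10)[OF uf] by simp_all

lemma Lam_ball: "z \<in> nbhd (r + 1) {-1..1} ==> Lam z \<in> ball (of_real c) e1"
proof -
 assume "z \<in> nbhd (r + 1) {-1..1}"
 then obtain x where x: "x \<in> {-1..1}" "cmod (z - of_real x) < r + 1" unfolding mem_nbhd by blast
 have "cmod (z - of_real (crit f)) \<le> cmod (z - of_real x) + cmod (of_real (x - crit f))"
  using norm_triangle_ineq[of "z - of_real x" "of_real (x - crit f)"] by simp
 also have "cmod (of_real (x - crit f)) \<le> 2" unfolding norm_of_real using x(1) crit_f by auto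
 finally have 1: "cmod (z - of_real (crit f)) \<le> r + 3" using x(2) by simp
 have "Lam z - of_real c = of_real v * (z - of_real (crit f))" unfolding Lam_def Lc[symmetric] by (simp add: algebra_simps)
 then have "cmod (Lam z - of_real c) \<le> \<bar>v\<bar> * (r + 3)" using mult_left_mono[OF 1, of "\<bar>v\<bar>"] by (simp add: norm_mult)
 then show ?thesis using small by (simp add: dist_norm norm_minus_commute)
qed

lemma L_near: "x \<in> {-1..1} ==> \<bar>u + v * x - c\<bar> < e1"
proof -
 assume "x \<in> {-1..1}"
 then have "of_real x \<in> nbhd (r + 1) {-1..1}" using r by (intro of_real_nbhd) auto
 then have "Lam (of_real x) \<in> ball (of_real c) e1" by (rule Lam_ball)
 moreover have "Lam (of_real x) = of_real (u + v * x)" unfolding Lam_def by simp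
 ultimately show ?thesis using of_real_ball by metis
qed

lemma tau_inj: "\<bar>x - c\<bar> < e1 ==> \<bar>y - c\<bar> < e1 ==> x < y ==> real_trace \<Phi> x < real_trace \<Phi> y"
 by (rule strict_mono_onD[OF Phi0(5)]) auto

lemma tau_c: "real_trace \<Phi> c = 0" using Phi0(6) unfolding real_trace_def by simp

lemma tau_real: "\<bar>y - c\<bar> < e1 ==> \<Phi> (of_real y) = of_real (real_trace \<Phi> y)"
 by (intro sym_real Phi0(3)) (simp only: of_real_ball)

text \<open>f takes the same value at -1 and 1, and the later iterates of g identify no points,
  because the orbit of the interval avoids c.\<close>

lemma g_pq: "g (u - v) = g (u + v)"
proof (rule pow_eq_imp_eq[OF umapD(1)[OF ug], where n = "Suc M"])
 let ?a = "min (u - v) (u + v)" let ?b = "max (u - v) (u + v)"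
 show "-1 \<le> ?a" "?b \<le> 1" using L_range[of "-1"] L_range[of 1] by simp_all
 show "c \<notin> (g ^^ i) ` {?a..?b}" if i: "0 < i" "i < Suc M" for i
 proof
  assume "c \<in> (g ^^ i) ` {?a..?b}"
  then obtain x where x: "x \<in> {?a..?b}" "c = (g ^^ i) x" by blast
  have "\<bar>x - u\<bar> \<le> \<bar>v\<bar>" using x(1) by (auto simp: abs_if min_def max_def split: if_splits)
  then have "\<bar>(x - u) / v\<bar> \<le> 1" unfolding abs_divide using v by simp
  then have "(x - u) / v \<in> {-1..1}" unfolding abs_le_iff atLeastAtMost_iff by linarith
  then show False using av[OF _ i] x(2) v by force
 qed
 show "(g ^^ Suc M) (u - v) = (g ^^ Suc M) (u + v)" using conj[of "-1"] conj[of 1] f_ends by simp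
qed (use v in auto)

text \<open>By \<open>g_pq\<close> and the injectivity of \<Psi> and of the power, |\<Phi>| agrees
  at the two endpoints; these lie on different sides of c, where \<Phi> changes sign.\<close>

lemma tq_nz: "tq \<noteq> 0" and tp: "real_trace \<Phi> (u - v) = - tq"
proof -
 have n1: "\<bar>u + v - c\<bar> < e1" "\<bar>u - v - c\<bar> < e1" using L_near[of 1] L_near[of "-1"] by simp_all
 have cc: "\<bar>c - c\<bar> < e1" using Phi0(1) by simp
 have eq: "g (u - v) = real_trace \<Psi> (- (\<bar>real_trace \<Phi> (u - v)\<bar> powr \<alpha>))" "\<bar>real_trace \<Phi> (u - v)\<bar> powr \<alpha> < e2"
  "g (u + v) = real_trace \<Psi> (- (\<bar>tq\<bar> powr \<alpha>))" "\<bar>tq\<bar> powr \<alpha> < e2" unfolding tq_def using nf[OF n1(1)] nf[OF n1(2)] by simp_all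
 have root: "(\<bar>s\<bar> powr \<alpha>) powr (1 / \<alpha>) = \<bar>s\<bar>" for s :: real using al by (simp add: powr_powr)
 have b: "complex_of_real (- (s powr \<alpha>)) \<in> ball 0 e2" if "s powr \<alpha> < e2" for s
  using that by simp
 have "\<Psi> (of_real (- (\<bar>real_trace \<Phi> (u - v)\<bar> powr \<alpha>))) = \<Psi> (of_real (- (\<bar>tq\<bar> powr \<alpha>)))"
  using sym_real[OF Psi0(3)[OF b[OF eq(2)]]] sym_real[OF Psi0(3)[OF b[OF eq(4)]]] eq(1,3) g_pq by simp
 then have "\<bar>real_trace \<Phi> (u - v)\<bar> powr \<alpha> = \<bar>tq\<bar> powr \<alpha>"
  using inj_onD[OF Psi0(4) _ b[OF eq(2)] b[OF eq(4)]] by (metis neg_equal_iff_equal of_real_eq_iff)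
 then have ab: "\<bar>real_trace \<Phi> (u - v)\<bar> = \<bar>tq\<bar>" by (metis root)
 have vs: "v * (1 - crit f) = u + v - c" "v * (1 + crit f) = c - (u - v)" unfolding Lc[symmetric] by (simp_all add: algebra_simps)
 have "tq \<noteq> 0 \<and> real_trace \<Phi> (u - v) = - tq"
 proof (cases "0 < v")
  case True
  then have "0 < u + v - c" "0 < c - (u - v)" unfolding vs[symmetric] using crit_f by (simp_all)
  then have "c < u + v" "u - v < c" by simp_all
  then have "0 < tq" "real_trace \<Phi> (u - v) < 0" unfolding tq_def
   using tau_inj[OF cc n1(1)] tau_inj[OF n1(2) cc] tau_c by simp_all
  then show ?thesis using ab by simp
 next
  case False
  then have "v < 0" using v by simp
  then have "u + v - c < 0" "c - (u - v) < 0" unfolding vs[symmetric] using crit_f by (simp_all add: mult_less_0_iff)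
  then have "u + v < c" "c < u - v" by simp_all
  then have "tq < 0" "0 < real_trace \<Phi> (u - v)" unfolding tq_def
   using tau_inj[OF n1(1) cc] tau_inj[OF cc n1(2)] tau_c by simp_all
  then show ?thesis using ab by simp
 qed
 then show "tq \<noteq> 0" "real_trace \<Phi> (u - v) = - tq" by simp_all
qed

lemma ph_real: "x \<in> {-1..1} ==> ph (of_real x) = of_real (real_trace \<Phi> (u + v * x) / tq)"
proof -
 assume x: "x \<in> {-1..1}"
 have "Lam (of_real x) = of_real (u + v * x)" unfolding Lam_def by simp
 then show ?thesis unfolding ph_def using tau_real[OF L_near[OF x]] by simp
qed

lemma ph_trace: "x \<in> {-1..1} ==> real_trace ph x = real_trace \<Phi> (u + v * x) / tq"
 unfolding real_trace_def[of ph] using ph_real by simp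

text \<open>The extra margin 1 later yields continuity on the closure of the
  r-neighbourhood.\<close>

lemma ph_holo: "ph holomorphic_on nbhd (r + 1) {-1..1}"
proof -
 have "(\<Phi> \<circ> Lam) holomorphic_on nbhd (r + 1) {-1..1}"
 proof (rule holomorphic_on_compose_gen[OF _ Phi0(2)])
  show "Lam holomorphic_on nbhd (r + 1) {-1..1}" unfolding Lam_def[abs_def] by (intro holomorphic_intros)
 qed (use Lam_ball in blast)
 then have "(\<lambda>z. (\<Phi> \<circ> Lam) z / of_real tq) holomorphic_on nbhd (r + 1) {-1..1}"
  by (rule holomorphic_on_divide[OF _ holomorphic_on_const]) (use tq_nz in simp)
 then show ?thesis unfolding ph_def[abs_def] by simp
qed

lemma ph_Phi: "ph \<in> Phi r"
proof -
 have sub: "nbhd r {-1..1} \<subseteq> nbhd (r + 1) {-1..1}" by (rule nbhd_mono) simp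
 have h: "ph holomorphic_on nbhd r {-1..1}" by (rule holomorphic_on_subset[OF ph_holo sub])
 have ct: "continuous_on (closure (nbhd r {-1..1})) ph"
  by (rule continuous_on_subset[OF holomorphic_on_imp_continuous_on[OF ph_holo] closure_nbhd_subset]) auto
 have sy: "ph (cnj z) = cnj (ph z)" if "z \<in> nbhd r {-1..1}" for z
 proof -
  have "Lam (cnj z) = cnj (Lam z)" unfolding Lam_def by simp
  then show ?thesis unfolding ph_def using Phi0(3)[OF Lam_ball] sub that by auto
 qed
 have inj: "inj_on ph (nbhd r {-1..1})"
 proof (rule inj_onI)
  fix z w assume zw: "z \<in> nbhd r {-1..1}" "w \<in> nbhd r {-1..1}" "ph z = ph w"
  then have "\<Phi> (Lam z) = \<Phi> (Lam w)" unfolding ph_def using tq_nz by simp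
  then have "Lam z = Lam w" by (rule inj_onD[OF Phi0(4)]) (use Lam_ball sub zw in blast)+
  then show "z = w" unfolding Lam_def using v by simp
 qed
 have "univalent_near (nbhd r {-1..1}) {-1..1} ph"
  unfolding univalent_near_def using h inj open_nbhd of_real_nbhd[OF _ r] by blast
 moreover have "ph (-1) = -1" "ph 1 = 1" using ph_real[of "-1"] ph_real[of 1] tp tq_nz unfolding tq_def by simp_all
 ultimately show ?thesis unfolding Phi_def BR_def using h ct sy by blast
qed

lemmas phD = phi_real[OF ph_Phi r] phi_deriv[OF ph_Phi r] phi_trace_mono[OF ph_Phi r] phi_inv[OF ph_Phi r]

text \<open>On [-1,1] f is \<open>vm\<close> applied to -|ph|^\<alpha>: \<open>vm\<close> consists
  of \<Psi>, the remaining iterate g^M and the inverse coordinate, and \<open>rho\<close> undoes the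
  normalization of \<open>ph\<close>.\<close>

definition rho :: real where "rho = \<bar>tq\<bar> powr \<alpha>"
definition vm :: "real \<Rightarrow> real" where "vm w = ((g ^^ M) (real_trace \<Psi> (rho * w)) - u) / v"

lemma rho: "0 < rho" "rho < e2"
 unfolding rho_def using tq_nz nf[OF L_near[of 1]] unfolding tq_def by simp_all

lemma vm_eq:
 assumes x: "x \<in> {-1..1}"
 shows "real_trace \<Psi> (rho * - (\<bar>real_trace ph x\<bar> powr \<alpha>)) = g (u + v * x)" "vm (- (\<bar>real_trace ph x\<bar> powr \<alpha>)) = f x"
proof -
 have "rho * - (\<bar>real_trace ph x\<bar> powr \<alpha>) = - (\<bar>real_trace \<Phi> (u + v * x)\<bar> powr \<alpha>)"
  unfolding rho_def ph_trace[OF x] using tq_nz by (simp add: powr_divide)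
 then show 1: "real_trace \<Psi> (rho * - (\<bar>real_trace ph x\<bar> powr \<alpha>)) = g (u + v * x)" using nf[OF L_near[OF x]] by simp
 have "(g ^^ M) (g (u + v * x)) = u + v * f x" using conj[of x] by (simp add: funpow_swap1)
 then show "vm (- (\<bar>real_trace ph x\<bar> powr \<alpha>)) = f x" unfolding vm_def 1 using v by simp
qed

lemma w_ex:
 assumes w: "w \<in> {-1..0}"
 shows "\<exists>x\<in>{-1..1}. w = - (\<bar>real_trace ph x\<bar> powr \<alpha>)"
proof -
 define t where "t = (- w) powr (1 / \<alpha>)"
 have t: "0 \<le> t" "t \<le> 1" unfolding t_def using w al by (auto intro!: powr_le1)
 then have "real_inv ph t \<in> {-1..1}" "real_trace ph (real_inv ph t) = t" using phD(5,6)[of t] by simp_all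
 moreover have "t powr \<alpha> = - w" unfolding t_def using w al by (simp add: powr_powr)
 ultimately show ?thesis using t by (intro bexI[of _ "real_inv ph t"]) simp_all
qed

lemma ph_w: "x \<in> {-1..1} ==> - (\<bar>real_trace ph x\<bar> powr \<alpha>) \<in> {-1..0}"
proof -
 assume "x \<in> {-1..1}"
 then have "real_trace ph x \<in> {-1..1}" using phi_trace_image[OF ph_Phi r] by blast
 then have "\<bar>real_trace ph x\<bar> powr \<alpha> \<le> 1" using al by (intro powr_le1) auto
 then show ?thesis by simp
qed

text \<open>Each w in [-1,0] is -|ph x|^\<alpha> for some x in [-1,1], and the orbit of length M of
  g (u + v x) avoids c; so every factor of \<open>vm\<close> has a germ there.\<close>

lemma vm_germ:
 assumes w: "w \<in> {-1..0}"
 shows "germ vm {-1..0} w"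
proof -
 obtain x where x: "x \<in> {-1..1}" "w = - (\<bar>real_trace ph x\<bar> powr \<alpha>)" using w_ex[OF w] by blast
 have g1: "germ (\<lambda>w. 0 + rho * w) {-1..0} w" by (rule germ_affine) (use rho in simp)
 have rw: "\<bar>rho * w\<bar> < e2"
 proof -
  have "\<bar>rho * w\<bar> \<le> rho * 1" unfolding abs_mult using rho w by (intro mult_mono) auto
  then show ?thesis using rho by simp
 qed
 define d where "d = e2 - \<bar>rho * w\<bar>"
 have dsub: "ball (complex_of_real (rho * w)) d \<subseteq> ball 0 e2"
 proof
  fix z assume z: "z \<in> ball (complex_of_real (rho * w)) d"
  have "cmod z \<le> cmod (z - of_real (rho * w)) + cmod (of_real (rho * w))"
   using norm_triangle_ineq[of "z - of_real (rho * w)" "of_real (rho * w)"] by simp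
  also have "\<dots> < d + \<bar>rho * w\<bar>" using z unfolding norm_of_real by (simp only: mem_ball dist_norm norm_minus_commute add_less_cancel_right)
  finally show "z \<in> ball 0 e2" unfolding d_def by simp
 qed
 have "germ_ext (real_trace \<Psi>) {-rho..0} (rho * w) \<Psi> d"
  unfolding germ_ext_def
 proof (intro conjI ballI impI)
  show "0 < d" using rw unfolding d_def by simp
  then have "of_real (rho * w) \<in> ball (complex_of_real (rho * w)) d" by (simp only: centre_in_ball)
  then have "of_real (rho * w) \<in> ball (0::complex) e2" by (rule subsetD[OF dsub])
  then show "deriv \<Psi> (of_real (rho * w)) \<noteq> 0" by (rule holomorphic_injective_imp_regular[OF Psi0(2) open_ball Psi0(4)])
  show "\<Psi> holomorphic_on ball (of_real (rho * w)) d" by (rule holomorphic_on_subset[OF Psi0(2) dsub])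
  show "\<Psi> (cnj z) = cnj (\<Psi> z)" if "z \<in> ball (of_real (rho * w)) d" for z using Psi0(3) dsub that by blast
  show "\<Psi> (of_real y) = of_real (real_trace \<Psi> y)" if "y \<in> {-rho..0}" for y
   by (rule sym_real, rule Psi0(3)) (use that rho in simp)
 qed
 then have g2: "germ (real_trace \<Psi>) {-rho..0} (0 + rho * w)" unfolding germ_def by auto
 have sub1: "(\<lambda>w. 0 + rho * w) ` {-1..0} \<subseteq> {-rho..0}"
 proof (rule image_subsetI)
  fix y :: real assume "y \<in> {-1..0}"
  then have "rho * -1 \<le> rho * y" "rho * y \<le> rho * 0" using rho by (intro mult_left_mono; simp)+
  then show "0 + rho * y \<in> {-rho..0}" by simp
 qed
 have g3: "germ (\<lambda>w. real_trace \<Psi> (0 + rho * w)) {-1..0} w" by (rule germ_compose[OF g1 g2 sub1 w])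
 have Pw: "real_trace \<Psi> (0 + rho * y) \<in> {-1..1}" if y: "y \<in> {-1..0}" for y
 proof -
  obtain x' where x': "x' \<in> {-1..1}" "y = - (\<bar>real_trace ph x'\<bar> powr \<alpha>)" using w_ex[OF y] by blast
  then show ?thesis using vm_eq(1)[OF x'(1)] unim_pow_maps[OF umapD(1)[OF ug] L_range[OF x'(1)], of 1] by simp
 qed
 have "germ (g ^^ M) {-1..1} (real_trace \<Psi> (0 + rho * w))"
 proof (rule germ_pow[OF germs _ Pw[OF w]])
  show "g ` {-1..1} \<subseteq> {-1..1}" using unim_pow_image[OF umapD(1)[OF ug] order_refl, of 1] by simp
  fix i assume i: "i < M"
  have "(g ^^ i) (real_trace \<Psi> (0 + rho * w)) = (g ^^ Suc i) (u + v * x)"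
   using vm_eq(1)[OF x(1)] x(2) by (simp add: funpow_swap1)
  then show "(g ^^ i) (real_trace \<Psi> (0 + rho * w)) \<noteq> c" using av[OF x(1), of "Suc i"] i by simp
 qed simp_all
 then have g4: "germ (\<lambda>w. (g ^^ M) (real_trace \<Psi> (0 + rho * w))) {-1..0} w"
  by (rule germ_compose[OF g3 _ _ w]) (use Pw in blast)
 have "germ (\<lambda>y. - u / v + (1 / v) * y) UNIV ((g ^^ M) (real_trace \<Psi> (0 + rho * w)))" by (rule germ_affine) (use v in simp)
 then have "germ (\<lambda>w. - u / v + (1 / v) * ((g ^^ M) (real_trace \<Psi> (0 + rho * w)))) {-1..0} w"
  by (rule germ_compose[OF g4 _ _ w]) simp
 moreover have "(\<lambda>w. - u / v + (1 / v) * ((g ^^ M) (real_trace \<Psi> (0 + rho * w)))) = vm"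
  unfolding vm_def by (rule ext) (simp add: diff_divide_distrib)
 ultimately show ?thesis by simp
qed

lemma f_analytic:
 assumes x: "x \<in> {-1..1}" "x \<noteq> crit f"
 shows "germ f {-1..1} x"
proof -
 have g1: "germ (\<lambda>x. u + v * x) {-1..1} x" by (rule germ_affine[OF v])
 have "germ (g ^^ Suc M) {-1..1} (u + v * x)"
 proof (rule germ_pow[OF germs _ L_range[OF x(1)]])
  show "g ` {-1..1} \<subseteq> {-1..1}" using unim_pow_image[OF umapD(1)[OF ug] order_refl, of 1] by simp
  show "(g ^^ i) (u + v * x) \<noteq> c" if "i < Suc M" for i
   using av[OF x(1), of i] that x(2) v Lc by (cases "i = 0") auto
 qed simp_all
 then have g2: "germ (\<lambda>x. (g ^^ Suc M) (u + v * x)) {-1..1} x" by (rule germ_compose[OF g1 _ _ x(1)]) (use L_range in blast)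
 have "germ (\<lambda>y. - u / v + (1 / v) * y) UNIV ((g ^^ Suc M) (u + v * x))" by (rule germ_affine) (use v in simp)
 then have "germ (\<lambda>x. - u / v + (1 / v) * ((g ^^ Suc M) (u + v * x))) {-1..1} x" by (rule germ_compose[OF g2 _ _ x(1)]) simp
 moreover have "(\<lambda>x. - u / v + (1 / v) * ((g ^^ Suc M) (u + v * x))) = f"
  unfolding conj by (rule ext) (use v in \<open>simp add: add_divide_distrib\<close>)
 ultimately show ?thesis by simp
qed

text \<open>Conjugating f by \<open>ph\<close> gives the map sending x to ph (vm (-|x|^\<alpha>)).
  Hence W = ph o V, with V a holomorphic extension of \<open>vm\<close>, is the element of
  \<open>B_univ\<close> sought.\<close>

theorem f_A_Phi: "f \<in> A_Phi \<alpha> r"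
proof -
 obtain r1 V where r1: "0 < r1" and V: "V holomorphic_on nbhd r1 {-1..0}" "\<And>z. z \<in> nbhd r1 {-1..0} ==> V (cnj z) = cnj (V z)"
  "\<And>w. w \<in> {-1..0} ==> V (of_real w) = of_real (vm w)" "\<And>w. w \<in> {-1..0} ==> deriv V (of_real w) \<noteq> 0"
  using germ_glue[of "-1" 0 vm] vm_germ by blast
 let ?K = "{-1..0::real}" let ?N1 = "nbhd r1 ?K" let ?P = "nbhd r {-1..1}"
 have Kin: "of_real w \<in> ?N1" if "w \<in> ?K" for w by (rule of_real_nbhd[OF that r1])
 have tV: "real_trace V w = vm w" if "w \<in> ?K" for w unfolding real_trace_def V(3)[OF that] by simp
 have ph1: "real_trace ph 1 = 1" "real_trace ph (-1) = -1" using phi_trace_ends[OF ph_Phi r] by simp_all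
 have phc: "real_trace ph (crit f) = 0" using ph_trace[of "crit f"] crit_f Lc tau_c by simp
 have vm1: "vm (-1) = -1" using vm_eq(2)[of 1] ph1 f_ends by simp
 have vm0: "vm 0 = f (crit f)" using vm_eq(2)[of "crit f"] crit_f phc by simp
 have vm_range: "vm w \<in> {-1..1}" if w: "w \<in> ?K" for w
 proof -
  obtain x where x: "x \<in> {-1..1}" "w = - (\<bar>real_trace ph x\<bar> powr \<alpha>)" using w_ex[OF w] by blast
  then show ?thesis using vm_eq(2)[OF x(1)] unim_pow_maps[OF umapD(1)[OF uf] x(1), of 1] by simp
 qed
 have Vreal: "deriv V (of_real w) = of_real (Re (deriv V (of_real w)))" "(real_trace V has_real_derivative Re (deriv V (of_real w))) (at w)"
  if "w \<in> ?K" for w using sym_deriv[OF V(1) open_nbhd V(2) Kin[OF that]] by blast+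
 have Vpos: "0 < Re (deriv V (of_real w))" if w: "w \<in> ?K" for w
 proof (rule deriv_pos[where a = "-1" and b = 0 and u = "real_trace V" and d = "\<lambda>w. Re (deriv V (of_real w))"])
  show "continuous_on ?K (\<lambda>w. Re (deriv V (of_real w)))" by (rule deriv_real_cont[OF V(1) open_nbhd]) (use Kin in blast)
  show "Re (deriv V (of_real w)) \<noteq> 0" if "w \<in> ?K" for w using V(4)[OF that] Vreal(1)[OF that] by (metis of_real_0)
  show "real_trace V (-1) < real_trace V 0" using tV[of "-1"] tV[of 0] vm1 vm0 f_crit crit_f by simp
 qed (use Vreal w in auto)
 define W where "W = ph \<circ> V"
 \<comment> \<open>The set on which V takes values in the domain of \<open>ph\<close>. It is then
   reduced to where Re W' > 0, for univalence, and once more to leave room for continuity on the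
   closure.\<close>
 define O1 where "O1 = ?N1 \<inter> V -` ?P"
 have oO1: "open O1" unfolding O1_def
  by (intro continuous_open_preimage holomorphic_on_imp_continuous_on V(1) open_nbhd)
 have W1: "W holomorphic_on O1" unfolding W_def
 proof (rule holomorphic_on_compose_gen[OF _ PhiD(1)[OF ph_Phi]])
  show "V holomorphic_on O1" by (rule holomorphic_on_subset[OF V(1)]) (simp add: O1_def)
 qed (auto simp: O1_def)
 have KO1: "of_real w \<in> O1" if w: "w \<in> ?K" for w
  unfolding O1_def using Kin[OF w] V(3)[OF w] of_real_nbhd[OF vm_range[OF w] r] by simp
 have Wpos: "0 < Re (deriv W (of_real w))" if w: "w \<in> ?K" for w
 proof -
  have "(V has_field_derivative deriv V (of_real w)) (at (of_real w))" by (rule holomorphic_derivI[OF V(1) open_nbhd Kin[OF w]])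
  moreover have "(ph has_field_derivative deriv ph (of_real (vm w))) (at (V (of_real w)))"
   unfolding V(3)[OF w] by (rule holomorphic_derivI[OF PhiD(1)[OF ph_Phi] open_nbhd of_real_nbhd[OF vm_range[OF w] r]])
  ultimately have "deriv W (of_real w) = deriv ph (of_real (vm w)) * deriv V (of_real w)"
   unfolding W_def by (intro DERIV_imp_deriv DERIV_chain)
  also have "\<dots> = deriv ph (of_real (vm w)) * of_real (Re (deriv V (of_real w)))" using Vreal(1)[OF w] by simp
  finally have "Re (deriv W (of_real w)) = Re (deriv ph (of_real (vm w))) * Re (deriv V (of_real w))" by simp
  then show ?thesis using phD(3)[OF vm_range[OF w]] Vpos[OF w] by simp
 qed
 define O2 where "O2 = O1 \<inter> (\<lambda>z. Re (deriv W z)) -` {0<..}"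
 have "open O2" unfolding O2_def
  by (intro continuous_open_preimage continuous_on_Re holomorphic_on_imp_continuous_on holomorphic_deriv W1 oO1) auto
 moreover have "complex_of_real ` ?K \<subseteq> O2" unfolding O2_def using KO1 Wpos by auto
 ultimately obtain r2 where r2: "0 < r2" "nbhd r2 ?K \<subseteq> O2" using open_contains_nbhd[of ?K O2] by auto
 define r3 where "r3 = r2 / 2"
 have r3: "0 < r3" "r3 < r2" unfolding r3_def using r2(1) by simp_all
 have sub3: "nbhd r3 ?K \<subseteq> nbhd r2 ?K" using r3 by (intro nbhd_mono) simp
 have hol2: "W holomorphic_on nbhd r2 ?K" by (rule holomorphic_on_subset[OF W1]) (use r2 O2_def in blast)
 have hol3: "W holomorphic_on nbhd r3 ?K" by (rule holomorphic_on_subset[OF hol2 sub3])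
 have ct: "continuous_on (closure (nbhd r3 ?K)) W"
  by (rule continuous_on_subset[OF holomorphic_on_imp_continuous_on[OF hol2] closure_nbhd_subset]) (use r3 in auto)
 have sy: "W (cnj z) = cnj (W z)" if "z \<in> nbhd r3 ?K" for z
 proof -
  have "z \<in> O1" using that sub3 r2(2) unfolding O2_def by blast
  then show ?thesis unfolding W_def O1_def using V(2) PhiD(2)[OF ph_Phi] by simp
 qed
 \<comment> \<open>As a Minkowski sum of a segment and a disc the neighbourhood is convex, as
   \<open>inj_on_Re_deriv_pos\<close> requires.\<close>
 have cv: "convex (nbhd r3 ?K)"
 proof -
  have "nbhd r3 ?K = (\<Union>x\<in>complex_of_real ` ?K. \<Union>y\<in>ball 0 r3. {x + y})"
  proof (rule set_eqI)
   fix z :: complex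
   have "z \<in> nbhd r3 ?K \<longleftrightarrow> (\<exists>x\<in>?K. \<exists>y\<in>ball 0 r3. z = of_real x + y)" unfolding mem_nbhd
   proof (rule bex_cong[OF refl])
    fix x :: real
    show "cmod (z - of_real x) < r3 \<longleftrightarrow> (\<exists>y\<in>ball 0 r3. z = of_real x + y)"
     by (auto intro!: bexI[of _ "z - of_real x"])
   qed
   then show "z \<in> nbhd r3 ?K \<longleftrightarrow> z \<in> (\<Union>x\<in>complex_of_real ` ?K. \<Union>y\<in>ball 0 r3. {x + y})" by simp
  qed
  moreover have "convex (complex_of_real ` ?K)" by (rule convex_linear_image) (auto intro: bounded_linear.linear bounded_linear_of_real)
  ultimately show ?thesis using convex_sums[of "complex_of_real ` ?K" "ball 0 r3"] by simp
 qed
 have inj: "inj_on W (nbhd r3 ?K)"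
  by (rule inj_on_Re_deriv_pos[OF hol3 open_nbhd cv]) (use sub3 r2(2) in \<open>auto simp: O2_def\<close>)
 have un: "univalent_near (nbhd r3 ?K) ?K W"
  unfolding univalent_near_def using hol3 inj open_nbhd of_real_nbhd[OF _ r3(1)] by blast
 have Ww: "W (of_real w) = of_real (real_trace ph (vm w))" if w: "w \<in> ?K" for w
  unfolding W_def comp_apply V(3)[OF w] by (rule phD(1)[OF vm_range[OF w]])
 have Wm1: "W (-1) = -1" using Ww[of "-1"] vm1 ph1 by simp
 have fc: "f (crit f) \<in> {-1..1}" "-1 < f (crit f)" using f_crit crit_f by simp_all
 have W0: "Re (W 0) = real_trace ph (f (crit f))" using Ww[of 0] vm0 by simp
 \<comment> \<open>The strict inequality f (crit f) < 1 is what separates \<open>B_univ\<close> from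
   \<open>Btilde\<close>.\<close>
 have W01: "-1 < Re (W 0)" "Re (W 0) < 1"
  unfolding W0 using phD(4)[of "-1" "f (crit f)"] phD(4)[of "f (crit f)" 1] fc f_crit ph1 by simp_all
 have B: "W \<in> B_univ r3" unfolding B_univ_def Btilde_def BR_def using hol3 ct sy un Wm1 W01 by simp
 have A: "j_map \<alpha> W \<in> A_unimodal \<alpha>" unfolding A_unimodal_def using r3(1) B by blast
 have rep: "f x = (real_inv ph \<circ> j_map \<alpha> W \<circ> real_trace ph) x" if x: "x \<in> {-1..1}" for x
 proof -
  have "j_map \<alpha> W (real_trace ph x) = real_trace ph (f x)"
   unfolding j_map_def real_trace_def[of W] Ww[OF ph_w[OF x]] vm_eq(2)[OF x] by simp
  moreover have "f x \<in> {-1..1}" using unim_pow_maps[OF umapD(1)[OF uf] x, of 1] by simp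
  ultimately show ?thesis using phD(7) by simp
 qed
 have "real_analytic_on f {-1..<crit f}"
 proof (rule germ_real_analytic)
  fix x assume x: "x \<in> {-1..<crit f}"
  then have "germ f {-1..1} x" using crit_f by (intro f_analytic) auto
  then show "germ f {-1..<crit f} x" by (rule germ_cong[where d = 1]) (use crit_f in auto)
 qed
 moreover have "real_analytic_on f {crit f<..1}"
 proof (rule germ_real_analytic)
  fix x assume x: "x \<in> {crit f<..1}"
  then have "germ f {-1..1} x" using crit_f by (intro f_analytic) auto
  then show "germ f {crit f<..1} x" by (rule germ_cong[where d = 1]) (use crit_f in auto)
 qed
 moreover have "local_diffeo (real_trace ph) (crit f)" "real_analytic_near (real_trace ph) (crit f)"
 proof -
  have sub: "ball (complex_of_real (crit f)) r \<subseteq> ?P" unfolding nbhd_def using crit_f by force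
  have "0 < Re (deriv ph (of_real (crit f)))" using phD(3)[of "crit f"] crit_f by simp
  moreover have "ph holomorphic_on ball (of_real (crit f)) r" by (rule holomorphic_on_subset[OF PhiD(1)[OF ph_Phi] sub])
  moreover have "ph (cnj z) = cnj (ph z)" if "z \<in> ball (of_real (crit f)) r" for z using PhiD(2)[OF ph_Phi] sub that by blast
  ultimately show "local_diffeo (real_trace ph) (crit f)" "real_analytic_near (real_trace ph) (crit f)"
   using holomorphic_local_diffeo[of ph "crit f" r] r by blast+
 qed
 moreover have "local_diffeo (real_trace V) 0" "real_analytic_near (real_trace V) 0"
 proof -
  have sub: "ball (complex_of_real 0) r1 \<subseteq> ?N1" unfolding nbhd_def by (rule UN_upper) simp
  have "0 < Re (deriv V (of_real 0))" by (rule Vpos) simp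
  moreover have "V holomorphic_on ball (of_real 0) r1" by (rule holomorphic_on_subset[OF V(1) sub])
  moreover have "V (cnj z) = cnj (V z)" if "z \<in> ball (of_real 0) r1" for z using V(2) sub that by blast
  ultimately show "local_diffeo (real_trace V) 0" "real_analytic_near (real_trace V) 0"
   using holomorphic_local_diffeo[of V 0 r1] r1 by blast+
 qed
 moreover have "\<forall>\<^sub>F x in nhds (crit f). f x = real_trace V (- (\<bar>real_trace ph x\<bar> powr \<alpha>))"
 proof -
  have "\<forall>\<^sub>F x in nhds (crit f). x \<in> {-1<..<1}" using crit_f by (intro eventually_nhds_in_open) auto
  then show ?thesis
  proof eventually_elim
   case (elim x)
   then have x: "x \<in> {-1..1}" by simp
   show ?case using tV[OF ph_w[OF x]] vm_eq(2)[OF x] by simp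
  qed
 qed
 ultimately have "f \<in> analytic_unimodal \<alpha>"
  unfolding analytic_unimodal_def normal_form_def using f_unim phc by blast
 then have "f \<in> A_conj \<alpha> ph" unfolding A_conj_def using A rep by blast
 then show ?thesis unfolding A_Phi_def using ph_Phi by blast
qed

end

text \<open>The radius e1 depends on g only: it makes the extended normal form valid around c. Every
  level k \<ge> 2 whose coordinate satisfies |v| (r + 3) < e1 is then an instance of
  \<open>germ_rep\<close>.\<close>

theorem renorm_in_A_Phi:
 assumes al: "1 < \<alpha>" and ga: "g \<in> analytic_unimodal \<alpha>" and gi: "g \<in> inf_renormalizable_maps \<alpha>" and r: "0 < r"
 shows "\<exists>K. \<forall>k\<ge>K. (renorm ^^ k) g \<in> A_Phi \<alpha> r"
proof -
 define c where "c = crit g"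
 have gu: "g \<in> unimodal \<alpha>" using ga unfolding analytic_unimodal_def by simp
 obtain dg where ug: "umap \<alpha> g dg c" using unimodal_umap[OF gu] unfolding c_def by blast
 obtain \<phi> \<psi> where nf: "\<phi> c = 0" "local_diffeo \<phi> c" "local_diffeo \<psi> 0" "\<forall>\<^sub>F x in nhds c. g x = \<psi> (- (\<bar>\<phi> x\<bar> powr \<alpha>))"
  "real_analytic_near \<phi> c" "real_analytic_near \<psi> 0"
  using ga unfolding analytic_unimodal_def normal_form_def c_def by blast
 obtain \<Phi> a where P: "0 < a" "\<Phi> holomorphic_on ball (of_real c) a" "\<And>z. z \<in> ball (of_real c) a ==> \<Phi> (cnj z) = cnj (\<Phi> z)"
  "inj_on \<Phi> (ball (of_real c) a)" "strict_mono_on {c - a<..<c + a} (real_trace \<Phi>)"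
  "\<And>y. \<bar>y - c\<bar> < a ==> \<Phi> (of_real y) = of_real (\<phi> y)"
  using diffeo_germ[OF nf(2,5)] by metis
 obtain \<Psi> e2 where Q: "0 < e2" "\<Psi> holomorphic_on ball (of_real 0) e2" "\<And>z. z \<in> ball (of_real 0) e2 ==> \<Psi> (cnj z) = cnj (\<Psi> z)"
  "inj_on \<Psi> (ball (of_real 0) e2)" "\<And>y. \<bar>y - 0\<bar> < e2 ==> \<Psi> (of_real y) = of_real (\<psi> y)"
  using diffeo_germ[OF nf(3,6)] by metis
 obtain b where b: "0 < b" "\<And>y. \<bar>y - c\<bar> < b ==> g y = \<psi> (- (\<bar>\<phi> y\<bar> powr \<alpha>))"
  using nf(4) unfolding eventually_nhds_metric dist_real_def by blast
 have P0: "\<Phi> (of_real c) = 0" using P(6)[of c] P(1) nf(1) by simp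
 \<comment> \<open>Keeps |\<Phi>|^\<alpha> below e2, so that \<Psi> can be applied.\<close>
 obtain d where d: "0 < d" "\<And>y. \<bar>y - c\<bar> < d ==> \<bar>real_trace \<Phi> y\<bar> < e2 powr (1 / \<alpha>)"
 proof -
  have "continuous_on (ball (of_real c) a) \<Phi>" by (rule holomorphic_on_imp_continuous_on[OF P(2)])
  then have "open (ball (of_real c) a \<inter> \<Phi> -` ball 0 (e2 powr (1 / \<alpha>)))" by (intro continuous_open_preimage) auto
  moreover have "of_real c \<in> ball (of_real c) a \<inter> \<Phi> -` ball 0 (e2 powr (1 / \<alpha>))" using P(1) P0 Q(1) by simp
  ultimately obtain d where d: "0 < d" "ball (of_real c) d \<subseteq> ball (of_real c) a \<inter> \<Phi> -` ball 0 (e2 powr (1 / \<alpha>))"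
   using open_contains_ball by blast
  have "\<bar>real_trace \<Phi> y\<bar> < e2 powr (1 / \<alpha>)" if "\<bar>y - c\<bar> < d" for y
  proof -
   have "complex_of_real y \<in> ball (of_real c) d" unfolding of_real_ball by (rule that)
   from subsetD[OF d(2) this] have "cmod (\<Phi> (of_real y)) < e2 powr (1 / \<alpha>)" by simp
   then show ?thesis unfolding real_trace_def using abs_Re_le_cmod le_less_trans by blast
  qed
  then show ?thesis using that d(1) by blast
 qed
 define e1 where "e1 = min a (min b d)"
 have e1: "0 < e1" "e1 \<le> a" "e1 \<le> b" "e1 \<le> d" unfolding e1_def using P(1) b(1) d(1) by simp_all
 have sub: "ball (complex_of_real c) e1 \<subseteq> ball (of_real c) a" using e1(2) by (rule subset_ball)
 have nf': "g y = real_trace \<Psi> (- (\<bar>real_trace \<Phi> y\<bar> powr \<alpha>)) \<and> \<bar>real_trace \<Phi> y\<bar> powr \<alpha> < e2" if y: "\<bar>y - c\<bar> < e1" for y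
 proof -
  have ph: "real_trace \<Phi> y = \<phi> y" using P(6)[of y] y e1 unfolding real_trace_def by simp
  have "\<bar>\<phi> y\<bar> < e2 powr (1 / \<alpha>)" using d(2)[of y] y e1 ph by simp
  then have "\<bar>\<phi> y\<bar> powr \<alpha> < (e2 powr (1 / \<alpha>)) powr \<alpha>" using al by (intro powr_less_mono2) auto
  then have lt: "\<bar>\<phi> y\<bar> powr \<alpha> < e2" using al Q(1) by (simp add: powr_powr)
  then have "real_trace \<Psi> (- (\<bar>\<phi> y\<bar> powr \<alpha>)) = \<psi> (- (\<bar>\<phi> y\<bar> powr \<alpha>))" using Q(5)[of "- (\<bar>\<phi> y\<bar> powr \<alpha>)"] unfolding real_trace_def by simp
  then show ?thesis using b(2)[of y] y e1 ph lt by simp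
 qed
 obtain K where K: "\<And>k. K \<le> k ==> \<bar>scale_map g k 1 - scale_map g k (-1)\<bar> < e1 / (r + 3)"
  using scale_small[OF al gi, of "e1 / (r + 3)"] e1 r by auto
 have "(renorm ^^ k) g \<in> A_Phi \<alpha> r" if k: "max 2 K \<le> k" for k
 proof -
  define f where "f = (renorm ^^ k) g"
  have k2: "2 \<le> k" "K \<le> k" using k by simp_all
  obtain df where uf: "umap \<alpha> f df (crit f)" using inf_renormD(3)[OF gi, of k] unfolding f_def by blast
  note sc = inf_scale[OF gi, of k]
  obtain u v where uv: "v \<noteq> 0" "\<And>x. scale_map g k x = u + v * x" using sc by blast
  obtain M where M: "tper g k = Suc M" using sc by (cases "tper g k") auto
  have sc': "(g ^^ Suc M) (u + v * x) = u + v * f x" "u + v * crit f = c" "x \<in> {-1..1} ==> u + v * x \<in> {-1..1}"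
   "x \<in> {-1..1} ==> 0 < i ==> i < Suc M ==> (g ^^ i) (u + v * x) \<noteq> c" for x i
   using sc unfolding M uv(2) f_def c_def by blast+
  note tb = renorm_tail_boundary[OF gi k2(1), folded f_def]
  have "\<bar>v\<bar> \<le> \<bar>scale_map g k 1 - scale_map g k (-1)\<bar>" unfolding uv(2) by simp
  then have "\<bar>v\<bar> < e1 / (r + 3)" using K[OF k2(2)] by simp
  then have small: "\<bar>v\<bar> * (r + 3) < e1" using r by (simp add: less_divide_eq)
  interpret R: germ_rep \<alpha> r g f dg df \<Phi> \<Psi> c e1 e2 u v M
  proof
   show "germ g {-1..1} x" if "x \<in> {-1..1}" "x \<noteq> c" for x using analytic_unimodal_germ[OF ga] that unfolding c_def by blast
   show "f \<in> unimodal \<alpha>" unfolding f_def by (rule inf_renormD(1)[OF gi])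
   show "\<Phi> holomorphic_on ball (of_real c) e1" by (rule holomorphic_on_subset[OF P(2) sub])
   show "\<Phi> (cnj z) = cnj (\<Phi> z)" if "z \<in> ball (of_real c) e1" for z using P(3) sub that by blast
   show "inj_on \<Phi> (ball (of_real c) e1)" by (rule inj_on_subset[OF P(4) sub])
   show "strict_mono_on {c - e1<..<c + e1} (real_trace \<Phi>)"
    by (rule monotone_on_subset[OF P(5)]) (use e1(2) in auto)
   show "\<Psi> holomorphic_on ball 0 e2" "inj_on \<Psi> (ball 0 e2)" using Q(2,4) by simp_all
   show "\<Psi> (cnj z) = cnj (\<Psi> z)" if "z \<in> ball 0 e2" for z using Q(3) that by simp
  qed (use al r ug uf uv(1) sc' tb e1(1) P0 Q(1) nf' small in \<open>blast+\<close>)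
  show ?thesis using R.f_A_Phi unfolding f_def .
 qed
 then show ?thesis by blast
qed

theorem theorem1p10:
  shows "(\<forall>\<alpha>::real. \<alpha> > 1 \<longrightarrow>
            (\<forall>g \<in> analytic_unimodal \<alpha> \<inter> inf_renormalizable_maps \<alpha>. \<forall>r::real. r > 0 \<longrightarrow>
               (\<exists>K1::nat. \<forall>k\<ge>K1. (renorm ^^ k) g \<in> A_Phi \<alpha> r)))
       \<and> (\<forall>\<alpha>::real. \<alpha> > 1 \<longrightarrow>
            (\<exists>C::real. \<exists>lam::real. C > 0 \<and> 0 < lam \<and> lam < 1 \<and>
               (\<forall>r::real. r > 0 \<longrightarrow>
                 (\<forall>f \<in> A_unimodal \<alpha> \<inter> inf_renormalizable_maps \<alpha>. \<forall>\<phi> \<in> Phi r.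
                    \<exists>K2::nat. \<forall>k\<ge>K2.
                      sup_norm (nbhd r {-1..1}) (\<lambda>z. Fiter k f \<phi> z - z) \<le> C * lam ^ k))))"
proof (intro conjI allI impI)
  fix \<alpha> :: real assume al: "\<alpha> > 1"
  show "\<forall>g \<in> analytic_unimodal \<alpha> \<inter> inf_renormalizable_maps \<alpha>. \<forall>r::real. r > 0 \<longrightarrow>
    (\<exists>K1::nat. \<forall>k\<ge>K1. (renorm ^^ k) g \<in> A_Phi \<alpha> r)"
    using renorm_in_A_Phi[OF al] by blast
  \<comment> \<open>Half the exponent of \<open>real_bounds\<close>, as in
    \<open>Fiter_converges\<close>; with this rate C = 1 serves for all r, f and \<phi>.\<close>
  define lam where "lam = (6 / 7 :: real) powr (1 / (4 * \<alpha>))"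
  have "0 < lam" "lam < 1" unfolding lam_def using al powr_less_mono2[of "1 / (4 * \<alpha>)" "6 / 7" 1] by simp_all
  moreover have "\<exists>K. \<forall>k\<ge>K. sup_norm (nbhd r {-1..1}) (\<lambda>z. Fiter k f \<phi> z - z) \<le> 1 * lam ^ k"
    if "r > 0" "f \<in> A_unimodal \<alpha> \<inter> inf_renormalizable_maps \<alpha>" "\<phi> \<in> Phi r" for r f \<phi>
  proof -
    have "inf_base \<alpha> f" using A_unimodal_inf_base that(2) by blast
    from Fiter_converges[OF al this that(3,1)] show ?thesis unfolding lam_def by simp
  qed
  ultimately show "\<exists>C::real. \<exists>lam::real. C > 0 \<and> 0 < lam \<and> lam < 1 \<and> (\<forall>r::real. r > 0 \<longrightarrow>
      (\<forall>f \<in> A_unimodal \<alpha> \<inter> inf_renormalizable_maps \<alpha>. \<forall>\<phi> \<in> Phi r. \<exists>K2::nat. \<forall>k\<ge>K2.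
        sup_norm (nbhd r {-1..1}) (\<lambda>z. Fiter k f \<phi> z - z) \<le> C * lam ^ k))"
    by (intro exI[of _ 1] exI[of _ lam]) simp
qed

end
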